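(* Let $n\ge 3$ be odd, $W=D_n$, $A=S*W$, and let $\precsim$ be a preorder on $\mathrm{Irr}(W)$ with associated modules $\{\widetilde K_\lambda, K_\lambda\}_{\lambda\in\mathrm{Irr}(W)}$. Suppose that $P_\mu$ (for each $\mu\in\mathrm{Irr}(W)$) admits a finite filtration by graded shifts of $\{\widetilde K_\lambda\}_{\lambda\in\mathrm{Irr}(W)}$, and let $(P_\mu:\widetilde K_\lambda)_q$ be the graded multiplicity of $\widetilde K_\lambda$ in the filtration pieces of $P_\mu$. Then the collection of modules $\{\widetilde K_\lambda,K_\lambda\}_{\lambda\in\mathrm{Irr}(W)}$ satisfies the orthogonality relation $$\mathrm{Ext}^i_{A}(\widetilde K_\lambda,K_\mu^* )_d=\begin{cases}\mathbb C & (\lambda=\mu \text{ and } i=d=0),\\ 0&(\text{otherwise})\end{cases}$$ (for all $\lambda,\mu\in\mathrm{Irr}(W)$, $i\ge 0$, $d\in\mathbb Z$) if and only if $(P_\mu:\widetilde K_\lambda)_q=[K_\lambda:L_\mu]_q$ holds for all $\lambda,\mu\in\mathrm{Irr}(W)$.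
   Context: Dihedral setting: $D_n=\langle r,s\mid r^n=s^2=e,\ srs^{-1}=r^{-1}\rangle$ (order $2n$), $\zeta$ a primitive $n$-th root of unity. $S=\mathbb C[X,Y]$ with $\deg X=\deg Y=1$ and $W=D_n$ acting by algebra automorphisms with $rX=\zeta X$, $rY=\zeta^{-1}Y$, $sX=Y$, $sY=X$. The skew group algebra $A=S*W$ is $S\otimes_{\mathbb C}\mathbb CW$ with $(s\otimes w)(s'\otimes w')=s\,w(s')\otimes ww'$, graded with $\mathbb CW$ in degree $0$. $\mathrm{Irr}(W)$ is the set of isomorphism classes of irreducible complex representations of $W$. Graded modules: all modules are finitely generated; $A$-gmod is the category of finitely generated $\mathbb Z$-graded left $A$-modules with degree-$0$ homomorphisms; $(M\langle d\rangle)_i=M_{i-d}$; $\mathrm{Hom}_A(M,N)_d$ is the space of homomorphisms with $f(M_i)\subset N_{i+d}$ for all $i$, and $\mathrm{Hom}_A(M,N)_{>0}=\bigoplus_{d>0}\mathrm{Hom}_A(M,N)_d$; $\mathrm{Ext}^i_A(M,N)_d=\mathrm{Ext}^i_{A\text{-gmod}}(M,N\langle -d\rangle)$, the degree $d$ part of the Ext group $\mathrm{Ext}^i_A(M,N)$ of ungraded modules. For $\lambda\in\mathrm{Irr}(W)$, $L_\lambda$ is the simple graded module given by $\lambda$ placed in degree $0$ with $S_{>0}$ acting by $0$, and $P_\lambda=S\otimes_{\mathbb C}\lambda$ with $(P_\lambda)_i=S_i\otimes\lambda$ is its graded projective cover. $[M:L_\lambda]_q=\sum_{i}q^i[M_i:\lambda]$,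 where $[M_i:\lambda]$ is the multiplicity of $\lambda$ in the $W$-representation $M_i$. For a finite dimensional graded $A$-module $M$, $M^*=\mathrm{Hom}_{\mathbb C}(M,\mathbb C)$ with $(M^* )_i=\mathrm{Hom}_{\mathbb C}(M_{-i},\mathbb C)$ and left action $((s\otimes w)f)(m)=f((w^{-1}(s)\otimes w^{-1})m)$. Filtrations: a finite filtration of $M$ by graded shifts of a family $\{F_\alpha\}$ of graded modules is a decreasing sequence of graded submodules $M=M^0\supseteq M^1\supseteq\cdots\supseteq M^m=0$ such that each factor $M^{i-1}/M^i$ is zero or isomorphic to some $F_\alpha\langle d\rangle$. The graded multiplicity of $F_\alpha$ in it is $\sum_d m_dq^d$, where $m_d$ is the number of factors isomorphic to $F_\alpha\langle d\rangle$. Trace quotients: for a preorder (reflexive transitive relation) $\precsim$ on $\mathrm{Irr}(W)$, write $\lambda\sim\mu$ if $\lambda\precsim\mu$ and $\mu\precsim\lambda$, and $\lambda\prec\mu$ if $\lambda\precsim\mu$ and $\lambda\not\sim\mu$. Put $$\widetilde K_\lambda=P_\lambda\Big/\sum_{\lambda\prec\mu,\ f\in\mathrm{Hom}_A(P_\mu,P_\lambda)_{>0}}\mathrm{Im} f,\qquad K_\lambda=P_\lambda\Big/\sum_{\lambda\precsim\mu,\ f\in\mathrm{Hom}_A(P_\mu,P_\lambda)_{>0}}\mathrm{Im} f .$$ Each $K_\lambda$ is finite dimensional. *)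

theory Defs
  imports
    Complex_Main
    "HOL-Library.FuncSet"
    "HOL-Library.Poly_Mapping"
    "HOL-Library.Product_Plus"
    "HOL-Algebra.AbelCoset"
    "HOL-Algebra.Module"
    "HOL-Algebra.Generated_Groups"
    "Jordan_Normal_Form.Matrix"
begin

section \<open>The dihedral group and its irreducible representations\<close>

text \<open>The pair \<open>(k, b)\<close> stands for \<open>r\<^sup>k s\<^sup>b\<close>.\<close>

type_synonym dih = "int \<times> bool"

definition dihedral :: "nat \<Rightarrow> dih monoid" where
  "dihedral n =
    \<lparr> carrier = {0..<int n} \<times> UNIV,
      monoid.mult = (\<lambda>(k, b) (l, c). ((if b then k - l else k + l) mod int n, b \<noteq> c)),
      one = (0, False) \<rparr>"

type_synonym mrep = "dih \<Rightarrow> complex mat"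

definition rep_deg :: "mrep \<Rightarrow> nat" where
  "rep_deg \<rho> = dim_row (\<rho> (0, False))"

definition is_rep :: "nat \<Rightarrow> mrep \<Rightarrow> bool" where
  "is_rep n \<rho> \<longleftrightarrow>
     (\<forall>w \<in> carrier (dihedral n). \<rho> w \<in> carrier_mat (rep_deg \<rho>) (rep_deg \<rho>)) \<and>
     \<rho> \<one>\<^bsub>dihedral n\<^esub> = 1\<^sub>m (rep_deg \<rho>) \<and>
     (\<forall>v \<in> carrier (dihedral n). \<forall>w \<in> carrier (dihedral n).
        \<rho> (v \<otimes>\<^bsub>dihedral n\<^esub> w) = \<rho> v * \<rho> w)"

definition invariant_subspace :: "nat \<Rightarrow> mrep \<Rightarrow> complex vec set \<Rightarrow> bool" where
  "invariant_subspace n \<rho> U \<longleftrightarrow>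
     U \<subseteq> carrier_vec (rep_deg \<rho>) \<and> 0\<^sub>v (rep_deg \<rho>) \<in> U \<and>
     (\<forall>u \<in> U. \<forall>v \<in> U. u + v \<in> U) \<and> (\<forall>c. \<forall>u \<in> U. c \<cdot>\<^sub>v u \<in> U) \<and>
     (\<forall>w \<in> carrier (dihedral n). \<forall>u \<in> U. \<rho> w *\<^sub>v u \<in> U)"

definition irreducible_rep :: "nat \<Rightarrow> mrep \<Rightarrow> bool" where
  "irreducible_rep n \<rho> \<longleftrightarrow> is_rep n \<rho> \<and> 0 < rep_deg \<rho> \<and>
     (\<forall>U. invariant_subspace n \<rho> U \<longrightarrow> U = {0\<^sub>v (rep_deg \<rho>)} \<or> U = carrier_vec (rep_deg \<rho>))"

definition rep_iso :: "nat \<Rightarrow> mrep \<Rightarrow> mrep \<Rightarrow> bool" where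
  "rep_iso n \<rho> \<sigma> \<longleftrightarrow> rep_deg \<rho> = rep_deg \<sigma> \<and>
     (\<exists>T \<in> carrier_mat (rep_deg \<rho>) (rep_deg \<rho>). invertible_mat T \<and>
        (\<forall>w \<in> carrier (dihedral n). T * \<rho> w = \<sigma> w * T))"

type_synonym irr = "mrep set"

text \<open>Every finite dimensional representation is isomorphic to one on some \<open>\<complex>\<^sup>m\<close>, so the
  isomorphism classes are formed among matrix representations.\<close>

definition Irr :: "nat \<Rightarrow> irr set" where
  "Irr n = {\<rho>. irreducible_rep n \<rho>} //
     {(\<rho>, \<sigma>). irreducible_rep n \<rho> \<and> irreducible_rep n \<sigma> \<and> rep_iso n \<rho> \<sigma>}"

definition rep_of :: "irr \<Rightarrow> mrep" where
  "rep_of \<nu> = (SOME \<rho>. \<rho> \<in> \<nu>)"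


section \<open>The graded algebra \<open>S * W\<close>\<close>

text \<open>\<open>S = \<complex>[X, Y]\<close>; the key \<open>(a, b)\<close> is the exponent of \<open>X\<^sup>a Y\<^sup>b\<close>.\<close>

type_synonym S = "(nat \<times> nat) \<Rightarrow>\<^sub>0 complex"

definition constS :: "complex \<Rightarrow> S" where
  "constS c = Poly_Mapping.single (0, 0) c"

definition polyX :: S where "polyX = Poly_Mapping.single (1, 0) 1"
definition polyY :: S where "polyY = Poly_Mapping.single (0, 1) 1"

definition poly_subst :: "S \<Rightarrow> S \<Rightarrow> S \<Rightarrow> S" where
  "poly_subst u v p = (\<Sum>(a, b) \<in> Poly_Mapping.keys p. constS (Poly_Mapping.lookup p (a, b)) * u ^ a * v ^ b)"

text \<open>\<open>r\<^sup>k\<close> maps \<open>X, Y\<close> to \<open>\<zeta>\<^sup>k X, \<zeta>\<^sup>-\<^sup>k Y\<close>, hence \<open>r\<^sup>k s\<close> maps \<open>X, Y\<close> to \<open>\<zeta>\<^sup>-\<^sup>k Y, \<zeta>\<^sup>k X\<close>.\<close>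

definition act :: "complex \<Rightarrow> dih \<Rightarrow> S \<Rightarrow> S" where
  "act \<zeta> = (\<lambda>(k, b).
     if b then poly_subst (constS (\<zeta> powi (- k)) * polyY) (constS (\<zeta> powi k) * polyX)
     else poly_subst (constS (\<zeta> powi k) * polyX) (constS (\<zeta> powi (- k)) * polyY))"

definition S_gr :: "int \<Rightarrow> S set" where
  "S_gr i = {p. \<forall>(a, b) \<in> Poly_Mapping.keys p. int (a + b) = i}"

text \<open>The function \<open>a\<close> stands for \<open>\<Sum>\<^sub>w a(w) \<otimes> w\<close>.\<close>

type_synonym A = "dih \<Rightarrow> S"

definition tensor :: "S \<Rightarrow> dih \<Rightarrow> A" where
  "tensor p w = (\<lambda>v. if v = w then p else 0)"

definition skew :: "nat \<Rightarrow> complex \<Rightarrow> A ring" where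
  "skew n \<zeta> =
    \<lparr> carrier = {a. \<forall>w. w \<notin> carrier (dihedral n) \<longrightarrow> a w = 0},
      monoid.mult = (\<lambda>a b w. if w \<in> carrier (dihedral n)
        then \<Sum>u \<in> carrier (dihedral n).
               a u * act \<zeta> u (b (inv\<^bsub>dihedral n\<^esub> u \<otimes>\<^bsub>dihedral n\<^esub> w))
        else 0),
      one = tensor 1 \<one>\<^bsub>dihedral n\<^esub>,
      zero = (\<lambda>w. 0),
      add = (\<lambda>a b w. a w + b w) \<rparr>"

definition skew_gr :: "nat \<Rightarrow> int \<Rightarrow> A set" where
  "skew_gr n i = {a. (\<forall>w. w \<notin> carrier (dihedral n) \<longrightarrow> a w = 0) \<and> (\<forall>w. a w \<in> S_gr i)}"


section \<open>Graded left modules\<close>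

text \<open>The library's record of modules is reused for left modules over a noncommutative ring; as
  usual, its fields \<open>mult\<close> and \<open>one\<close> are meaningless.  The field \<open>gr\<close> gives the homogeneous
  components.\<close>

record ('a, 'b) gmodule = "('a, 'b) module" +
  gr :: "int \<Rightarrow> 'b set"

definition shift :: "int \<Rightarrow> ('a, 'b) gmodule \<Rightarrow> ('a, 'b) gmodule" where
  "shift d M = M\<lparr>gr := \<lambda>i. gr M (i - d)\<rparr>"

definition ghom :: "('a, 'r) ring_scheme \<Rightarrow> ('a, 'b) gmodule \<Rightarrow> ('a, 'c) gmodule \<Rightarrow> int \<Rightarrow> ('b \<Rightarrow> 'c) set"
  where
  "ghom R M N d = {f \<in> carrier M \<rightarrow>\<^sub>E carrier N.
     (\<forall>x \<in> carrier M. \<forall>y \<in> carrier M. f (x \<oplus>\<^bsub>M\<^esub> y) = f x \<oplus>\<^bsub>N\<^esub> f y) \<and>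
     (\<forall>a \<in> carrier R. \<forall>x \<in> carrier M. f (a \<odot>\<^bsub>M\<^esub> x) = a \<odot>\<^bsub>N\<^esub> f x) \<and>
     (\<forall>i. f ` gr M i \<subseteq> gr N (i + d))}"

text \<open>\<open>Hom\<^sub>R(M, N)\<^sub>>\<^sub>0\<close>, the direct sum of the spaces \<open>Hom\<^sub>R(M, N)\<^sub>d\<close> for \<open>d > 0\<close>.\<close>

definition ghom_pos :: "('a, 'r) ring_scheme \<Rightarrow> ('a, 'b) gmodule \<Rightarrow> ('a, 'c) gmodule \<Rightarrow> ('b \<Rightarrow> 'c) set"
  where
  "ghom_pos R M N = {restrict (\<lambda>x. \<Oplus>\<^bsub>N\<^esub>d \<in> D. g d x) (carrier M) | D g.
     finite D \<and> D \<subseteq> {0<..} \<and> (\<forall>d \<in> D. g d \<in> ghom R M N d)}"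

definition giso :: "('a, 'r) ring_scheme \<Rightarrow> ('a, 'b) gmodule \<Rightarrow> ('a, 'c) gmodule \<Rightarrow> bool" where
  "giso R M N \<longleftrightarrow> (\<exists>f \<in> ghom R M N 0. bij_betw f (carrier M) (carrier N))"

definition graded_submodule :: "('a, 'r) ring_scheme \<Rightarrow> ('a, 'b) gmodule \<Rightarrow> 'b set \<Rightarrow> bool" where
  "graded_submodule R M N \<longleftrightarrow> submodule N R M \<and>
     (\<forall>x \<in> N. \<exists>I c. finite I \<and> (\<forall>i \<in> I. c i \<in> N \<inter> gr M i) \<and> x = (\<Oplus>\<^bsub>M\<^esub>i \<in> I. c i))"

definition gsub :: "('a, 'b) gmodule \<Rightarrow> 'b set \<Rightarrow> ('a, 'b) gmodule" where
  "gsub M N = M\<lparr>carrier := N, gr := \<lambda>i. N \<inter> gr M i\<rparr>"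

definition quot :: "('a, 'b, 'm) module_scheme \<Rightarrow> 'b set \<Rightarrow> ('a, 'b set) module" where
  "quot M N =
    \<lparr> carrier = a_rcosets\<^bsub>M\<^esub> N, monoid.mult = undefined, one = undefined,
      zero = N, add = set_add M,
      smult = (\<lambda>a C. \<Union>x \<in> C. N +>\<^bsub>M\<^esub> (a \<odot>\<^bsub>M\<^esub> x)) \<rparr>"

definition gquot :: "('a, 'b) gmodule \<Rightarrow> 'b set \<Rightarrow> ('a, 'b set) gmodule" where
  "gquot M N = module.extend (quot M N) \<lparr>gr = \<lambda>i. (\<lambda>x. N +>\<^bsub>M\<^esub> x) ` gr M i\<rparr>"


section \<open>Filtrations\<close>

definition factor :: "('a, 'b) gmodule \<Rightarrow> (nat \<Rightarrow> 'b set) \<Rightarrow> nat \<Rightarrow> ('a, 'b set) gmodule" where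
  "factor M Fil i = gquot (gsub M (Fil (i - 1))) (Fil i)"

definition shift_filtration ::
  "('a, 'r) ring_scheme \<Rightarrow> ('a, 'b) gmodule \<Rightarrow> 'l set \<Rightarrow> ('l \<Rightarrow> ('a, 'c) gmodule) \<Rightarrow> nat \<Rightarrow> (nat \<Rightarrow> 'b set) \<Rightarrow> bool"
  where
  "shift_filtration R M I F m Fil \<longleftrightarrow>
     Fil 0 = carrier M \<and> Fil m = {\<zero>\<^bsub>M\<^esub>} \<and>
     (\<forall>i \<le> m. graded_submodule R M (Fil i)) \<and>
     (\<forall>i \<in> {1..m}. Fil i \<subseteq> Fil (i - 1)) \<and>
     (\<forall>i \<in> {1..m}. carrier (factor M Fil i) = {\<zero>\<^bsub>factor M Fil i\<^esub>} \<or>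
        (\<exists>\<alpha> \<in> I. \<exists>d. giso R (factor M Fil i) (shift d (F \<alpha>))))"

text \<open>Here and below, a Laurent polynomial in \<open>q\<close> is given by its coefficient function
  \<open>int \<Rightarrow> nat\<close>.\<close>

definition filtration_mult ::
  "('a, 'r) ring_scheme \<Rightarrow> ('a, 'b) gmodule \<Rightarrow> nat \<Rightarrow> (nat \<Rightarrow> 'b set) \<Rightarrow> ('a, 'c) gmodule \<Rightarrow> int \<Rightarrow> nat"
  where
  "filtration_mult R M m Fil N d = card {i \<in> {1..m}. giso R (factor M Fil i) (shift d N)}"


section \<open>Multiplicities, duals and Ext over \<open>S * W\<close>\<close>

definition cscale :: "(A, 'b, 'm) module_scheme \<Rightarrow> complex \<Rightarrow> 'b \<Rightarrow> 'b" where
  "cscale M c x = tensor (constS c) (0, False) \<odot>\<^bsub>M\<^esub> x"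

text \<open>\<open>M\<^sub>i\<close> is isomorphic, as a representation of \<open>W\<close>, to the direct sum of the \<open>\<rho>\<close> in the list;
  the direct sum is given by block diagonal matrices.\<close>

definition decomposition :: "nat \<Rightarrow> (A, 'b) gmodule \<Rightarrow> int \<Rightarrow> mrep list \<Rightarrow> bool" where
  "decomposition n M i \<rho>s \<longleftrightarrow> (\<exists>\<phi>.
     bij_betw \<phi> (carrier_vec (sum_list (map rep_deg \<rho>s))) (gr M i) \<and>
     (\<forall>u \<in> carrier_vec (sum_list (map rep_deg \<rho>s)).
        (\<forall>v \<in> carrier_vec (sum_list (map rep_deg \<rho>s)). \<phi> (u + v) = \<phi> u \<oplus>\<^bsub>M\<^esub> \<phi> v) \<and>
        (\<forall>c. \<phi> (c \<cdot>\<^sub>v u) = cscale M c (\<phi> u)) \<and>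
        (\<forall>w \<in> carrier (dihedral n).
           \<phi> (diag_block_mat (map (\<lambda>\<rho>. \<rho> w) \<rho>s) *\<^sub>v u) = tensor 1 w \<odot>\<^bsub>M\<^esub> \<phi> u)))"

text \<open>The coefficient \<open>[M\<^sub>i : \<nu>]\<close> of \<open>q\<^sup>i\<close> in \<open>[M : L\<^sub>\<nu>]\<^sub>q\<close>.\<close>

definition graded_mult :: "nat \<Rightarrow> (A, 'b) gmodule \<Rightarrow> irr \<Rightarrow> int \<Rightarrow> nat" where
  "graded_mult n M \<nu> i = (THE k. \<exists>\<rho>s. (\<forall>\<rho> \<in> set \<rho>s. irreducible_rep n \<rho>) \<and>
     decomposition n M i \<rho>s \<and> k = length (filter (\<lambda>\<rho>. \<rho> \<in> \<nu>) \<rho>s))"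

text \<open>The dual of a finite dimensional graded module; \<open>Hom\<^sub>\<complex>(M\<^sub>-\<^sub>i, \<complex>)\<close> is identified with the
  functionals on \<open>M\<close> that vanish on \<open>M\<^sub>j\<close> for \<open>j \<noteq> -i\<close>.\<close>

definition dual_carrier :: "(A, 'b) gmodule \<Rightarrow> ('b \<Rightarrow> complex) set" where
  "dual_carrier M = {f \<in> extensional (carrier M).
     (\<forall>x \<in> carrier M. \<forall>y \<in> carrier M. f (x \<oplus>\<^bsub>M\<^esub> y) = f x + f y) \<and>
     (\<forall>c. \<forall>x \<in> carrier M. f (cscale M c x) = c * f x)}"

definition dual :: "nat \<Rightarrow> complex \<Rightarrow> (A, 'b) gmodule \<Rightarrow> (A, 'b \<Rightarrow> complex) gmodule" where
  "dual n \<zeta> M =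
    \<lparr> carrier = dual_carrier M,
      monoid.mult = undefined, one = undefined,
      zero = (\<lambda>x \<in> carrier M. 0),
      add = (\<lambda>f g. \<lambda>x \<in> carrier M. f x + g x),
      smult = (\<lambda>a f. \<lambda>x \<in> carrier M. \<Sum>w \<in> carrier (dihedral n).
        f (tensor (act \<zeta> (inv\<^bsub>dihedral n\<^esub> w) (a w)) (inv\<^bsub>dihedral n\<^esub> w) \<odot>\<^bsub>M\<^esub> x)),
      gr = (\<lambda>i. {f \<in> dual_carrier M. \<forall>j. j \<noteq> - i \<longrightarrow> (\<forall>x \<in> gr M j. f x = 0)}) \<rparr>"

text \<open>The graded free module \<open>\<Oplus>\<^sub>j A\<langle>d\<^sub>j\<rangle>\<close> of finite rank, for the list of the \<open>d\<^sub>j\<close>.\<close>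

definition gfree :: "nat \<Rightarrow> complex \<Rightarrow> int list \<Rightarrow> (A, nat \<Rightarrow> A) gmodule" where
  "gfree n \<zeta> ds =
    \<lparr> carrier = {x. (\<forall>j < length ds. x j \<in> carrier (skew n \<zeta>)) \<and>
                     (\<forall>j \<ge> length ds. x j = \<zero>\<^bsub>skew n \<zeta>\<^esub>)},
      monoid.mult = undefined, one = undefined,
      zero = (\<lambda>j. \<zero>\<^bsub>skew n \<zeta>\<^esub>),
      add = (\<lambda>x y j. x j \<oplus>\<^bsub>skew n \<zeta>\<^esub> y j),
      smult = (\<lambda>a x j. a \<otimes>\<^bsub>skew n \<zeta>\<^esub> x j),
      gr = (\<lambda>i. {x. (\<forall>j < length ds. x j \<in> skew_gr n (i - ds ! j)) \<and>
                     (\<forall>j \<ge> length ds. x j = \<zero>\<^bsub>skew n \<zeta>\<^esub>)}) \<rparr>"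

text \<open>A resolution \<open>\<dots> \<rightarrow> F\<^sub>1 \<rightarrow> F\<^sub>0 \<rightarrow> M \<rightarrow> 0\<close> of \<open>M\<close> in the category of finitely generated graded
  modules, where \<open>F\<^sub>i\<close> is free with generators in the degrees \<open>ds i\<close>, \<open>\<delta> i\<close> is the map
  \<open>F\<^sub>i\<^sub>+\<^sub>1 \<rightarrow> F\<^sub>i\<close> and \<open>\<epsilon>\<close> is the augmentation.\<close>

type_synonym 'b resolution =
  "(nat \<Rightarrow> int list) \<times> (nat \<Rightarrow> (nat \<Rightarrow> A) \<Rightarrow> nat \<Rightarrow> A) \<times> ((nat \<Rightarrow> A) \<Rightarrow> 'b)"

definition free_resolution :: "nat \<Rightarrow> complex \<Rightarrow> (A, 'b) gmodule \<Rightarrow> 'b resolution \<Rightarrow> bool" where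
  "free_resolution n \<zeta> M = (\<lambda>(ds, \<delta>, \<epsilon>). let R = skew n \<zeta>; F = (\<lambda>i. gfree n \<zeta> (ds i)) in
     \<epsilon> \<in> ghom R (F 0) M 0 \<and> (\<forall>i. \<delta> i \<in> ghom R (F (Suc i)) (F i) 0) \<and>
     \<epsilon> ` carrier (F 0) = carrier M \<and>
     \<delta> 0 ` carrier (F 1) = {x \<in> carrier (F 0). \<epsilon> x = \<zero>\<^bsub>M\<^esub>} \<and>
     (\<forall>i. \<delta> (Suc i) ` carrier (F (Suc (Suc i))) =
            {x \<in> carrier (F (Suc i)). \<delta> i x = \<zero>\<^bsub>F i\<^esub>}))"

definition some_resolution :: "nat \<Rightarrow> complex \<Rightarrow> (A, 'b) gmodule \<Rightarrow> 'b resolution" where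
  "some_resolution n \<zeta> M = (SOME r. free_resolution n \<zeta> M r)"

text \<open>The complex vector space of degree \<open>0\<close> homomorphisms.\<close>

definition hom_space :: "nat \<Rightarrow> complex \<Rightarrow> (A, 'b) gmodule \<Rightarrow> (A, 'c) gmodule \<Rightarrow> (complex, 'b \<Rightarrow> 'c) module"
  where
  "hom_space n \<zeta> M N =
    \<lparr> carrier = ghom (skew n \<zeta>) M N 0,
      monoid.mult = undefined, one = undefined,
      zero = (\<lambda>x \<in> carrier M. \<zero>\<^bsub>N\<^esub>),
      add = (\<lambda>f g. \<lambda>x \<in> carrier M. f x \<oplus>\<^bsub>N\<^esub> g x),
      smult = (\<lambda>c f. \<lambda>x \<in> carrier M. cscale N c (f x)) \<rparr>"

text \<open>\<open>Ext\<^sup>i\<close> in the graded category: the cohomology at \<open>i\<close> of \<open>Hom(F\<^sub>0, N) \<rightarrow> Hom(F\<^sub>1, N) \<rightarrow> \<dots>\<close>,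
  where \<open>Hom\<close> means homomorphisms of degree \<open>0\<close>.\<close>

definition Ext_gmod ::
  "nat \<Rightarrow> complex \<Rightarrow> nat \<Rightarrow> (A, 'b) gmodule \<Rightarrow> (A, 'c) gmodule \<Rightarrow> (complex, ((nat \<Rightarrow> A) \<Rightarrow> 'c) set) module"
  where
  "Ext_gmod n \<zeta> i M N =
     (let (ds, \<delta>, \<epsilon>) = some_resolution n \<zeta> M;
          F = (\<lambda>i. gfree n \<zeta> (ds i));
          H = (\<lambda>i. hom_space n \<zeta> (F i) N);
          Z = {f \<in> carrier (H i). \<forall>x \<in> carrier (F (Suc i)). f (\<delta> i x) = \<zero>\<^bsub>N\<^esub>};
          B = (case i of 0 \<Rightarrow> {\<zero>\<^bsub>H 0\<^esub>}
               | Suc j \<Rightarrow> (\<lambda>f. compose (carrier (F (Suc j))) f (\<delta> j)) ` carrier (H j))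
      in quot ((H i)\<lparr>carrier := Z\<rparr>) B)"

definition Ext ::
  "nat \<Rightarrow> complex \<Rightarrow> nat \<Rightarrow> (A, 'b) gmodule \<Rightarrow> (A, 'c) gmodule \<Rightarrow> int \<Rightarrow> (complex, ((nat \<Rightarrow> A) \<Rightarrow> 'c) set) module"
  where
  "Ext n \<zeta> i M N d = Ext_gmod n \<zeta> i M (shift (- d) N)"

definition iso_complex_line :: "(complex, 'v) module \<Rightarrow> bool" where
  "iso_complex_line V \<longleftrightarrow> (\<exists>\<phi>. bij_betw \<phi> (carrier V) (UNIV :: complex set) \<and>
     (\<forall>x \<in> carrier V. \<forall>y \<in> carrier V. \<phi> (x \<oplus>\<^bsub>V\<^esub> y) = \<phi> x + \<phi> y) \<and>
     (\<forall>c. \<forall>x \<in> carrier V. \<phi> (c \<odot>\<^bsub>V\<^esub> x) = c * \<phi> x))"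

definition zero_space :: "(complex, 'v) module \<Rightarrow> bool" where
  "zero_space V \<longleftrightarrow> carrier V = {\<zero>\<^bsub>V\<^esub>}"


section \<open>The projective modules and their trace quotients\<close>

text \<open>\<open>P\<^sub>\<nu> = S \<otimes> \<nu>\<close> is written as \<open>S\<^sup>m\<close>, where \<open>\<nu>\<close> is given by matrices on \<open>\<complex>\<^sup>m\<close>; the element
  \<open>a \<otimes> w\<close> maps \<open>p \<otimes> v\<close> to \<open>a w(p) \<otimes> w v\<close>.\<close>

definition Pmod :: "nat \<Rightarrow> complex \<Rightarrow> irr \<Rightarrow> (A, S vec) gmodule" where
  "Pmod n \<zeta> \<nu> = (let \<rho> = rep_of \<nu>; m = rep_deg \<rho> in
    \<lparr> carrier = carrier_vec m,
      monoid.mult = undefined, one = undefined,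
      zero = 0\<^sub>v m, add = (+),
      smult = (\<lambda>a x. vec m (\<lambda>i. \<Sum>w \<in> carrier (dihedral n).
        a w * (\<Sum>j < m. constS (\<rho> w $$ (i, j)) * act \<zeta> w (x $ j)))),
      gr = (\<lambda>i. {x \<in> carrier_vec m. \<forall>j < m. x $ j \<in> S_gr i}) \<rparr>)"

definition equiv_in :: "irr rel \<Rightarrow> irr \<Rightarrow> irr \<Rightarrow> bool" where
  "equiv_in R \<nu> \<mu> \<longleftrightarrow> (\<nu>, \<mu>) \<in> R \<and> (\<mu>, \<nu>) \<in> R"

definition strict_in :: "irr rel \<Rightarrow> irr \<Rightarrow> irr \<Rightarrow> bool" where
  "strict_in R \<nu> \<mu> \<longleftrightarrow> (\<nu>, \<mu>) \<in> R \<and> \<not> equiv_in R \<nu> \<mu>"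

text \<open>The sum of the images of all \<open>f \<in> Hom(P\<^sub>\<mu>, P\<^sub>\<nu>)\<^sub>>\<^sub>0\<close> with \<open>\<mu> \<in> J\<close>.\<close>

definition trace_sum :: "nat \<Rightarrow> complex \<Rightarrow> irr set \<Rightarrow> irr \<Rightarrow> S vec set" where
  "trace_sum n \<zeta> J \<nu> = generate (add_monoid (Pmod n \<zeta> \<nu>))
     (\<Union>\<mu> \<in> J. \<Union>f \<in> ghom_pos (skew n \<zeta>) (Pmod n \<zeta> \<mu>) (Pmod n \<zeta> \<nu>). f ` carrier (Pmod n \<zeta> \<mu>))"

definition Ktilde :: "nat \<Rightarrow> complex \<Rightarrow> irr rel \<Rightarrow> irr \<Rightarrow> (A, S vec set) gmodule" where
  "Ktilde n \<zeta> R \<nu> = gquot (Pmod n \<zeta> \<nu>) (trace_sum n \<zeta> {\<mu> \<in> Irr n. strict_in R \<nu> \<mu>} \<nu>)"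

definition Kmod :: "nat \<Rightarrow> complex \<Rightarrow> irr rel \<Rightarrow> irr \<Rightarrow> (A, S vec set) gmodule" where
  "Kmod n \<zeta> R \<nu> = gquot (Pmod n \<zeta> \<nu>) (trace_sum n \<zeta> {\<mu> \<in> Irr n. (\<nu>, \<mu>) \<in> R} \<nu>)"

definition primitive_root_of_unity :: "nat \<Rightarrow> complex \<Rightarrow> bool" where
  "primitive_root_of_unity n \<zeta> \<longleftrightarrow> \<zeta> ^ n = 1 \<and> (\<forall>k. 0 < k \<and> k < n \<longrightarrow> \<zeta> ^ k \<noteq> 1)"

end

theory Submission
 imports Defs "Jordan_Normal_Form.Spectral_Radius"
begin

text \<open>Let \<open>T\<^sub>\<alpha>\<close> be the submodule of \<open>P\<^sub>\<alpha>\<close> with quotient \<open>K\<close>-tilde of \<open>\<alpha>\<close>, and \<open>N\<close> the dual of \<open>K\<^sub>\<nu>\<close>, so that \<open>Hom(P\<^sub>\<mu>, N)\<close> counts \<open>[K\<^sub>\<nu> : L\<^sub>\<mu>]\<close>.  Each step of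
  a filtration is presented by some \<open>P\<^sub>\<alpha>\<close> with kernel \<open>T\<^sub>\<alpha>\<close>, and the first one by \<open>P\<^sub>\<mu>\<close> itself.  If the maps \<open>P\<^sub>\<alpha> \<rightarrow> N\<close> killing \<open>T\<^sub>\<alpha>\<close> form a line for
  \<open>\<alpha> = \<nu>\<close> in degree \<open>0\<close> and vanish otherwise, then counting dimensions along the filtration bounds \<open>[K\<^sub>\<nu> : L\<^sub>\<mu>]\<close> by the
  filtration multiplicity, with equality iff all maps to \<open>N\<close> extend up the filtration; at the first step this is the
  vanishing of \<open>Ext\<^sup>1\<close>.  The higher Ext groups vanish since \<open>T\<^sub>\<alpha>\<close> is filtered too.  Conversely, a nonzero map
  \<open>P\<^sub>\<alpha> \<rightarrow> N\<close> of nonzero degree makes \<open>\<nu>\<close> a label in \<open>P\<^sub>\<alpha>\<close>, hence \<open>\<nu>\<close> lies strictly above \<open>\<alpha>\<close>, which the self-duality of the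
  irreducible representations of \<open>W\<close> excludes.\<close>

text \<open>\<open>Ext\<close> is computed from a free resolution picked by choice, while the
  modules \<open>P_mu\<close> are only retracts of free ones. Everything is therefore expressed by a
  property that fits any resolution: \<open>ext M Z N\<close>, every homomorphism
  \<open>Z -> N\<close> extends to \<open>M\<close>. For the syzygies of a free resolution it says
  that a higher Ext group vanishes, and it passes along any map inducing an isomorphism of
  \<open>M1/Z1\<close> with \<open>M2/Z2\<close>, because \<open>M2\<close> is then the pushout of
  \<open>M1\<close> and \<open>Z2\<close> over \<open>Z1\<close>. Finitely generated resolutions
  exist because \<open>T_alpha\<close>, being a step of a filtration, is again filtered and so has a
  finitely generated cover; the syzygies of an arbitrary free resolution are compared with such
  filtered ones up to homotopy. Self-duality enters through pairings: a nonzero map from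
  \<open>P_alpha\<close> to the dual of a quotient of \<open>P_nu\<close> pairs the two modules, and
  in nonzero degree the invariant form on nu converts the pairing into a map
  \<open>P_nu -> P_alpha\<close> of positive degree on whose image the given map does not vanish. If
  nu were strictly above alpha, that image would lie in \<open>T_alpha\<close>.\<close>

abbreviation smx ("_ *[_] _" [70, 0, 71] 70) where "smx a M x == module.smult M a x"
abbreviation plx ("_ +[_] _" [65, 0, 66] 65) where "plx x M y == add M x y"
abbreviation mnx ("_ -[_] _" [65, 0, 66] 65) where "mnx x M y == a_minus M x y"
abbreviation ngx ("-[_] _" [0, 81] 80) where "ngx M x == a_inv M x"
abbreviation tmx ("_ \<otimes>[_] _" [70, 0, 71] 70) where "tmx x M y == monoid.mult M x y"
abbreviation zrx ("0[_]") where "zrx M == zero M"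
abbreviation onx ("1[_]") where "onx M == one M"
abbreviation acx ("_ +>[_] _" [60, 0, 61] 60) where "acx Z M x == a_r_coset M Z x"
abbreviation iffx (infixr "<->" 25) where "iffx (p :: bool) q == p = q"
abbreviation "fs M A f == finsum M f A"
abbreviation "cr == carrier"
abbreviation "cV == carrier_vec"
abbreviation "cM == carrier_mat"
abbreviation mvx (infixl "*v" 70) where "mvx == mult_mat_vec"
abbreviation svx (infixl "*s" 70) where "svx == smult_vec"
abbreviation smm (infixl "*sm" 70) where "smm == smult_mat"
abbreviation "zv == zero_vec"
abbreviation "zm == zero_mat"
abbreviation "om == one_mat"

section \<open>Linear algebra\<close>

definition minj :: "complex mat => bool" where
 "minj B <-> (ALL x : cV (dim_col B). B *v x = zv (dim_row B) --> x = zv (dim_col B))"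

lemma minj_D:
 assumes "minj B" "B : cM k l" "x : cV l" "B *v x = zv k"
 shows "x = zv l"
 using assms unfolding minj_def by auto

lemma minj_I:
 assumes "B : cM k l"
  and "!!x. x : cV l ==> B *v x = zv k ==> x = zv l"
 shows "minj B"
 using assms unfolding minj_def by auto

lemma vec_minus_eq_zero:
 fixes x y :: "complex vec"
 assumes "x : cV l" "y : cV l" "x - y = zv l"
 shows "x = y"
proof (rule eq_vecI)
 show "dim_vec x = dim_vec y" using assms by auto
 fix i assume i: "i < dim_vec y"
 have "x $ i - y $ i = (x - y) $ i" using assms(1,2) i by simp
 also have "... = 0" using assms(2,3) i by simp
 finally show "x $ i = y $ i" by simp
qed

lemma minj_inj:
 assumes "minj B" "B : cM k l" "x : cV l" "y : cV l" "B *v x = B *v y"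
 shows "x = y"
proof -
 have "B *v (x - y) = zv k"
  using assms(2-5) by (subst mult_minus_distrib_mat_vec[OF assms(2-4)]) auto
 then have "x - y = zv l" using minj_D[OF assms(1,2)] assms(3,4) by auto
 then show ?thesis using vec_minus_eq_zero assms by blast
qed

text \<open>Padding with zero rows gives a square matrix with a zero row. Its determinant vanishes,
  and a kernel vector of it lies in the kernel of \<open>B\<close>.\<close>

lemma wide_mat_kernel:
 assumes B: "B : cM l k" and lk: "l < k"
 obtains x :: "complex vec" where "x : cV k" "x ~= zv k" "B *v x = zv l"
proof -
 define C where "C = mat k k (%(i,j). if i < l then B $$ (i,j) else 0)"
 have C: "C : cM k k" unfolding C_def by auto
 have row: "row C l = zv k" unfolding C_def using lk by (intro eq_vecI) auto
 have "(C\<^sup>T) *v unit_vec k l = zv k"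
 proof (rule eq_vecI)
  fix i assume i: "i < dim_vec (zv k :: complex vec)"
  then have i: "i < k" by simp
  have "(C\<^sup>T *v unit_vec k l) $ i = col C i \<bullet> unit_vec k l" using C i by auto
  also have "... = col C i $ l" using C lk i by (intro scalar_prod_right_unit) auto
  also have "... = 0" using i lk unfolding C_def by auto
  finally show "(C\<^sup>T *v unit_vec k l) $ i = (zv k) $ i" using i by simp
 qed (use C in auto)
 then have "det (C\<^sup>T) = 0"
  using det_0_iff_vec_prod_zero[of "C\<^sup>T" k] C lk unit_vec_nonzero[OF lk]
  by (metis transpose_carrier_mat unit_vec_carrier)
 then have "det C = 0" using det_transpose[OF C] by simp
 then obtain x where x: "x : cV k" "x ~= zv k" "C *v x = zv k"
  using det_0_iff_vec_prod_zero[OF C] by auto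
 have "B *v x = zv l"
 proof (rule eq_vecI)
  fix i assume "i < dim_vec (zv l :: complex vec)"
  then have i: "i < l" by simp
  have "row B i = row C i" using i lk B unfolding C_def by (intro eq_vecI) auto
  then have "(B *v x) $ i = (C *v x) $ i" using i lk B C by auto
  then show "(B *v x) $ i = (zv l) $ i" using x i lk by simp
 qed (use B in auto)
 with x show ?thesis using that by blast
qed

lemma minj_le:
 assumes "minj B" "B : cM l k" shows "k <= l"
proof (rule ccontr)
 assume "~ k <= l"
 then obtain x where "x : cV k" "x ~= zv k" "B *v x = zv l"
  using wide_mat_kernel[OF assms(2)] by auto
 then show False using minj_D[OF assms] by auto
qed

lemma det_nonzero_inverse:
 fixes B :: "complex mat"
 assumes B: "B : cM k k" and d: "det B ~= 0"
 obtains C where "C : cM k k" "B * C = om k" "C * B = om k"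
 using det_non_zero_imp_unit[OF B d, of "()"] unfolding Units_def ring_mat_def by auto

lemma minj_det:
 assumes B: "B : cM k k" shows "minj B <-> det B ~= 0"
 using det_0_iff_vec_prod_zero[OF B] B unfolding minj_def by auto

lemma minj_square_surj:
 assumes B: "B : cM k k" and "minj B" and y: "y : cV k"
 obtains x where "x : cV k" "B *v x = y"
proof -
 obtain C where C: "C : cM k k" "B * C = om k"
  using det_nonzero_inverse[OF B] minj_det[OF B] assms(2) by blast
 have "B *v (C *v y) = y" using B C y by (metis assoc_mult_mat_vec one_mult_mat_vec)
 then show ?thesis using that C y by (metis mult_mat_vec_carrier)
qed

definition vsub :: "nat => complex vec set => bool" where
 "vsub l U <-> U <= cV l & zv l : U & (ALL u : U. ALL v : U. u + v : U) & (ALL c. ALL u : U. c *s u : U)"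

definition add_col :: "complex mat => complex vec => complex mat" where
 "add_col B u = mat (dim_row B) (Suc (dim_col B)) (%(i,j). if j < dim_col B then B $$ (i,j) else u $ i)"

lemma add_col_carrier: "B : cM l k ==> add_col B u : cM l (Suc k)"
 unfolding add_col_def by auto

lemma add_col_mult:
 assumes B: "B : cM l k" and u: "u : cV l" and x: "x : cV (Suc k)"
 shows "add_col B u *v x = B *v vec k (%i. x $ i) + (x $ k) *s u"
proof (rule eq_vecI)
 fix i assume i: "i < dim_vec (B *v vec k (%i. x $ i) + (x $ k) *s u)"
 then have i: "i < l" using u by auto
 show "(add_col B u *v x) $ i = (B *v vec k (%i. x $ i) + (x $ k) *s u) $ i"
  using B u x i unfolding add_col_def by (auto simp: scalar_prod_def)
qed (use B u in \<open>auto simp: add_col_def\<close>)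

lemma mult_mat_vec_diff_in:
 assumes U: "vsub l U" and "a + c *s u = zv l" "c ~= 0" "a : U" "u : cV l"
 shows "u : U"
proof -
 have a: "a : cV l" using U assms unfolding vsub_def by auto
 have "u = (- inverse c) *s a"
 proof (rule eq_vecI)
  fix i assume i: "i < dim_vec ((- inverse c) *s a)"
  have "(a + c *s u) $ i = 0" using assms(2) i a by simp
  then have "a $ i = - (c * u $ i)" using i a assms(5) by (simp add: add_eq_0_iff2)
  then show "u $ i = ((- inverse c) *s a) $ i" using i assms(3) by simp
 qed (use a assms in auto)
 then show ?thesis using U assms unfolding vsub_def by auto
qed

lemma vsub_image:
 assumes B: "B : cM l k"
 shows "vsub l ((*v) B ` cV k)"
 unfolding vsub_def
proof (intro conjI ballI allI)
 show "(*v) B ` cV k <= cV l" using B by auto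
 have "B *v zv k = zv l" using B by auto
 then show "zv l : (*v) B ` cV k" by (metis image_eqI zero_carrier_vec)
 fix u assume "u : (*v) B ` cV k"
 then obtain x where x: "x : cV k" "u = B *v x" by auto
 { fix v assume "v : (*v) B ` cV k"
  then obtain y where y: "y : cV k" "v = B *v y" by auto
  have "u + v = B *v (x + y)" using B x y by (simp add: mult_add_distrib_mat_vec)
  then show "u + v : (*v) B ` cV k" using x y by auto }
 fix c
 have "c *s u = B *v (c *s x)" using B x by (simp add: mult_mat_vec)
 then show "c *s u : (*v) B ` cV k" using x by auto
qed

lemma add_col_minj:
 assumes B: "B : cM l k" "minj B" and u: "u : cV l" "u ~: (*v) B ` cV k"
 shows "minj (add_col B u)"
proof (rule minj_I[OF add_col_carrier[OF B(1)]])
 fix x assume x: "x : cV (Suc k)" and z: "add_col B u *v x = zv l"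
 let ?x = "vec k (%i. x $ i)"
 have e: "B *v ?x + (x $ k) *s u = zv l" using z add_col_mult[OF B(1) u(1) x] by simp
 have k0: "x $ k = 0"
 proof (rule ccontr)
  assume "x $ k ~= 0"
  from mult_mat_vec_diff_in[OF vsub_image[OF B(1)] e this _ u(1)] u(2) show False by auto
 qed
 have "0 *s u = zv l" using u(1) by (intro eq_vecI) auto
 then have "B *v ?x = zv l" using e k0 B(1) by auto
 then have "?x = zv k" using minj_D[OF B(2,1)] by auto
 then have "x $ i = 0" if "i < k" for i using that by (metis index_vec index_zero_vec(1))
 with k0 show "x = zv (Suc k)" using x by (intro eq_vecI) (auto simp: less_Suc_eq)
qed

lemma vsub_mult_in:
 assumes U: "vsub l U" and B: "B : cM l k" and c: "!!j. j < k ==> col B j : U" and x: "x : cV k"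
 shows "B *v x : U"
 using B c x
proof (induction k arbitrary: B x)
 case 0
 then have "B *v x = zv l" by (intro eq_vecI) (auto simp: scalar_prod_def)
 then show ?case using U unfolding vsub_def by auto
next
 case (Suc k)
 define B' where "B' = mat l k (%(i,j). B $$ (i,j))"
 have B': "B' : cM l k" unfolding B'_def by auto
 have eq: "B = add_col B' (col B k)"
  unfolding add_col_def B'_def using Suc(2) by (intro eq_matI) (auto simp: less_Suc_eq)
 have "col B' j = col B j" if "j < k" for j
  using that Suc(2) unfolding B'_def by (intro eq_vecI) auto
 then have "B' *v vec k (%i. x $ i) : U" using Suc(1)[OF B'] Suc(3) by auto
 moreover have "(x $ k) *s col B k : U" using U Suc(3) unfolding vsub_def by auto
 moreover have "B *v x = B' *v vec k (%i. x $ i) + (x $ k) *s col B k"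
  using add_col_mult[OF B', of "col B k" x] eq Suc(2,4) by (metis carrier_matD(1) carrier_vec_dim_vec dim_col)
 ultimately show ?case using U unfolding vsub_def by auto
qed

text \<open>Preimages of the unit vectors are the columns of a right inverse \<open>M\<close> of
  \<open>B\<close>. Such an \<open>M\<close> is injective, so \<open>minj_le\<close> applies to
  it.\<close>

lemma surj_mat_ge:
 fixes B :: "complex mat"
 assumes B: "B : cM l k" and surj: "cV l <= (*v) B ` cV k"
 shows "l <= k"
proof -
 have "EX C. ALL j<l. C j : cV k & B *v C j = unit_vec l j"
 proof (intro choice allI)
  fix j
  have "unit_vec l j : (*v) B ` cV k" using surj by auto
  then show "EX y. j < l --> y : cV k & B *v y = unit_vec l j" by (metis imageE)
 qed
 then obtain C where C: "!!j. j < l ==> C j : cV k" "!!j. j < l ==> B *v C j = unit_vec l j" by blast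
 define M where "M = mat k l (%(i,j). C j $ i)"
 have M: "M : cM k l" unfolding M_def by auto
 have cM: "col M j = C j" if "j < l" for j using C(1)[OF that] that unfolding M_def by (intro eq_vecI) auto
 have BM: "B * M = om l"
 proof (rule eq_matI)
  fix i j assume ij: "i < dim_row (om l :: complex mat)" "j < dim_col (om l :: complex mat)"
  have "(B * M) $$ (i,j) = (B *v C j) $ i" using ij B M cM by auto
  then show "(B * M) $$ (i,j) = om l $$ (i,j)" using C(2)[of j] ij by auto
 qed (use B M in auto)
 have "minj M"
 proof (rule minj_I[OF M])
  fix x assume x: "x : cV l" "M *v x = zv k"
  have "x = (B * M) *v x" using BM x by simp
  also have "... = B *v (M *v x)" using B M x by simp
  also have "... = zv l" using x(2) B by auto
  finally show "x = zv l" .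
 qed
 then show ?thesis using minj_le[OF _ M] by auto
qed

text \<open>A basis is an injective matrix of largest width with columns in \<open>U\<close>:
  \<open>minj_le\<close> bounds the width, and by \<open>add_col_minj\<close> a vector of
  \<open>U\<close> outside the span would give a wider one.\<close>

lemma subspace_basis:
 assumes U: "vsub l U"
 obtains k B where "k <= l" "B : cM l k" "minj B" "U = (*v) B ` cV k"
  "k = l <-> U = cV l"
proof -
 let ?P = "%k. EX B : cM l k. minj B & (ALL j < k. col B j : U)"
 have 0: "?P 0" by (intro bexI[of _ "zm l 0"]) (auto simp: minj_def)
 have bd: "ALL k. ?P k --> k <= l" using minj_le by blast
 define k where "k = (GREATEST k. ?P k)"
 have Pk: "?P k" unfolding k_def using GreatestI_nat[of ?P, OF 0] bd by blast
 have mx: "k' <= k" if "?P k'" for k' unfolding k_def using Greatest_le_nat[of ?P k', OF that] bd by blast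
 obtain B where B: "B : cM l k" "minj B" "ALL j < k. col B j : U" using Pk by auto
 have sub: "(*v) B ` cV k <= U" using vsub_mult_in[OF U B(1)] B(3) by auto
 have eq: "U = (*v) B ` cV k"
 proof (rule ccontr)
  assume "U ~= (*v) B ` cV k"
  then obtain u where u: "u : U" "u ~: (*v) B ` cV k" using sub by auto
  have ul: "u : cV l" using u U unfolding vsub_def by auto
  have mi: "minj (add_col B u)" by (rule add_col_minj[OF B(1,2) ul u(2)])
  have cl: "col (add_col B u) j : U" if "j < Suc k" for j
  proof (cases "j < k")
  case True
  have "col (add_col B u) j = col B j" using True B(1) unfolding add_col_def by (intro eq_vecI) auto
  then show ?thesis using B(3) True by auto
  next
  case False
  then have "j = k" using that by auto
  then have "col (add_col B u) j = u" using B(1) ul unfolding add_col_def by (intro eq_vecI) auto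
  then show ?thesis using u by auto
  qed
  have "Suc k <= k" by (rule mx, rule bexI[OF _ add_col_carrier[OF B(1)]]) (use mi cl in blast)
  then show False by simp
 qed
 have kl: "k <= l" using bd Pk by blast
 have "U = cV l" if "k = l"
  using eq minj_square_surj[of B l] B that U unfolding vsub_def by blast
 moreover have "k = l" if "U = cV l"
  using surj_mat_ge[OF B(1)] that eq kl by auto
 ultimately show ?thesis using that[OF kl B(1,2) eq] by blast
qed

lemma linear_mat:
 fixes f :: "complex vec => complex vec"
 assumes f: "!!x. x : cV l ==> f x : cV k"
  and add: "!!x y. x : cV l ==> y : cV l ==> f (x + y) = f x + f y"
  and sm: "!!c x. x : cV l ==> f (c *s x) = c *s f x"
 obtains M where "M : cM k l" "!!x. x : cV l ==> f x = M *v x"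
proof -
 define M where "M = mat k l (%(i,j). f (unit_vec l j) $ i)"
 have M: "M : cM k l" unfolding M_def by auto
 have cM: "M *v unit_vec l j = f (unit_vec l j)" if "j < l" for j
 proof (rule eq_vecI)
  show "dim_vec (M *v unit_vec l j) = dim_vec (f (unit_vec l j))" using f[OF unit_vec_carrier, of j] M by auto
  fix i assume "i < dim_vec (f (unit_vec l j))"
  then have i: "i < k" using f[OF unit_vec_carrier, of j] by auto
  have "(M *v unit_vec l j) $ i = row M i \<bullet> unit_vec l j" using M i by auto
  also have "... = row M i $ j" using M that by (intro scalar_prod_right_unit) auto
  finally show "(M *v unit_vec l j) $ i = f (unit_vec l j) $ i" using i that unfolding M_def by auto
 qed
 \<comment> \<open>Induction on the support: only the coordinates below \<open>t\<close> may be
   nonzero.\<close>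
 have "f x = M *v x" if "x : cV l" "ALL i<l. t <= i --> x $ i = 0" "t <= l" for x t
  using that
 proof (induction t arbitrary: x)
  case 0
  then have x: "x = zv l" by (intro eq_vecI) auto
  have "f (0 *s zv l) = 0 *s f (zv l)" by (rule sm) auto
  moreover have "0 *s f (zv l) = zv k" using f[of "zv l"] by (intro eq_vecI) auto
  moreover have "0 *s zv l = (zv l :: complex vec)" "M *v zv l = zv k" using M by (auto intro!: eq_vecI)
  ultimately show ?case using x by auto
 next
  case (Suc t)
  define y where "y = vec l (%i. if i = t then 0 else x $ i)"
  have x: "x = y + (x $ t) *s unit_vec l t" using Suc(2,4) unfolding y_def by (intro eq_vecI) auto
  have y: "y : cV l" unfolding y_def by auto
  have "f y = M *v y" using Suc by (intro Suc(1)) (auto simp: y_def)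
  then have "f x = M *v y + (x $ t) *s (M *v unit_vec l t)"
  using add[OF y, of "(x $ t) *s unit_vec l t"] sm[of "unit_vec l t" "x $ t"] x cM[of t] Suc(4) by auto
  also have "... = M *v (y + (x $ t) *s unit_vec l t)"
  using M y by (simp add: mult_add_distrib_mat_vec mult_mat_vec)
  also have "... = M *v x" using x by simp
  finally show ?case .
 qed
 then have "f x = M *v x" if "x : cV l" for x using that by (metis le_refl not_le)
 then show ?thesis using that M by blast
qed

section \<open>Left modules and finite dimensional complex vector spaces\<close>

lemma (in abelian_group) add_lcancel:
 assumes "x : cr G" "y : cr G" "z : cr G"
 shows "x \<oplus> y = x \<oplus> z <-> y = z"
proof
 assume "x \<oplus> y = x \<oplus> z"
 then have "\<ominus> x \<oplus> (x \<oplus> y) = \<ominus> x \<oplus> (x \<oplus> z)" by simp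
 then show "y = z" using assms by (simp add: a_assoc[symmetric] l_neg)
qed simp

text \<open>\<open>R\<close> may be noncommutative, and the fields \<open>mult\<close> and
  \<open>one\<close> of the module record stay unconstrained.\<close>

locale lmod = R?: ring R + M?: abelian_group M
 for R :: "('a, 'r) ring_scheme" (structure) and M :: "('a, 'b, 'm) module_scheme" (structure) +
 assumes smult_closed [simp, intro]: "[|a : cr R; x : cr M|] ==> a *[M] x : cr M"
  and smult_l_distr: "[|a : cr R; b : cr R; x : cr M|] ==>
  (a \<oplus> b) *[M] x = a *[M] x +[M] b *[M] x"
  and smult_r_distr: "[|a : cr R; x : cr M; y : cr M|] ==>
  a *[M] (x +[M] y) = a *[M] x +[M] a *[M] y"
  and smult_assoc1: "[|a : cr R; b : cr R; x : cr M|] ==>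
  (a \<otimes> b) *[M] x = a *[M] (b *[M] x)"
  and smult_one [simp]: "x : cr M ==> \<one> *[M] x = x"
begin

lemma smult_l_null [simp]:
 assumes "x : cr M" shows "\<zero> *[M] x = 0[M]"
proof -
 have "\<zero> *[M] x +[M] \<zero> *[M] x = \<zero> *[M] x +[M] 0[M]"
  using smult_l_distr[of \<zero> \<zero> x] assms by simp
 then show ?thesis using assms by (metis M.add_lcancel M.zero_closed R.zero_closed smult_closed)
qed

lemma smult_r_null [simp]:
 assumes "a : cr R" shows "a *[M] 0[M] = 0[M]"
proof -
 have "a *[M] 0[M] +[M] a *[M] 0[M] = a *[M] 0[M] +[M] 0[M]"
  using smult_r_distr[of a "0[M]" "0[M]"] assms by simp
 then show ?thesis using assms by (metis M.add_lcancel M.zero_closed smult_closed)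
qed

lemma smult_l_minus:
 assumes "a : cr R" "x : cr M" shows "(\<ominus> a) *[M] x = -[M] (a *[M] x)"
proof -
 have "(\<ominus> a) *[M] x +[M] a *[M] x = 0[M]"
  using smult_l_distr[of "\<ominus> a" a x] assms by (simp add: R.l_neg)
 then show ?thesis using assms by (metis M.minus_equality R.a_inv_closed smult_closed)
qed

lemma smult_r_minus:
 assumes "a : cr R" "x : cr M" shows "a *[M] (-[M] x) = -[M] (a *[M] x)"
proof -
 have "a *[M] (-[M] x) +[M] a *[M] x = 0[M]"
  using smult_r_distr[of a "-[M] x" x] assms by (simp add: M.l_neg)
 then show ?thesis using assms by (metis M.minus_equality M.a_inv_closed smult_closed)
qed

lemma smult_finsum:
 assumes "finite I" "a : cr R" "f : I \<rightarrow> cr M"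
 shows "a *[M] (fs M I (%i. f i)) = (fs M I (%i. a *[M] f i))"
 using assms
proof (induction I rule: finite_induct)
 case (insert x F)
 then show ?case
  by (subst M.finsum_insert, simp, simp, blast, blast)
  (subst M.finsum_insert, auto simp: smult_r_distr Pi_iff)
qed auto

lemma finsum_smult:
 assumes "finite I" "x : cr M" "f : I \<rightarrow> cr R"
 shows "(\<Oplus>i\<in>I. f i) *[M] x = (fs M I (%i. f i *[M] x))"
 using assms
proof (induction I rule: finite_induct)
 case (insert y F)
 then show ?case
  by (subst R.finsum_insert, simp, simp, blast, blast)
  (subst M.finsum_insert, auto simp: smult_l_distr Pi_iff)
qed auto

end

lemma (in abelian_monoid) finsum_swap:
 assumes "finite I" "finite J" "!!i j. i : I ==> j : J ==> f i j : cr G"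
 shows "(\<Oplus>i\<in>I. \<Oplus>j\<in>J. f i j) = (\<Oplus>j\<in>J. \<Oplus>i\<in>I. f i j)"
 using assms(1,3)
proof (induction I rule: finite_induct)
 case empty
 then show ?case by simp
next
 case (insert x F)
 have "(\<Oplus>i\<in>insert x F. \<Oplus>j\<in>J. f i j) = (\<Oplus>j\<in>J. f x j) \<oplus> (\<Oplus>i\<in>F. \<Oplus>j\<in>J. f i j)"
  using insert by (intro finsum_insert) (auto intro!: finsum_closed)
 also have "... = (\<Oplus>j\<in>J. f x j) \<oplus> (\<Oplus>j\<in>J. \<Oplus>i\<in>F. f i j)" using insert by auto
 also have "... = (\<Oplus>j\<in>J. f x j \<oplus> (\<Oplus>i\<in>F. f i j))"
  using insert by (intro finsum_addf[symmetric]) (auto intro!: finsum_closed)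
 also have "... = (\<Oplus>j\<in>J. \<Oplus>i\<in>insert x F. f i j)"
  using insert by (intro finsum_cong' refl) (auto intro!: finsum_closed finsum_insert[symmetric])
 finally show ?case .
qed

text \<open>With scalars from this ring, complex vector spaces become instances of
  \<open>lmod\<close>, so one set of lemmas serves the modules and the spaces of homomorphisms
  between them.\<close>

definition complex_ring :: "complex ring" where
 "complex_ring = (|carrier = UNIV, monoid.mult = (*), one = 1, zero = 0, add = (+)|)"

lemma complex_ring_simps [simp]:
 "cr complex_ring = UNIV" "x \<otimes>[complex_ring] y = x * y" "x +[complex_ring] y = x + y"
 "1[complex_ring] = 1" "0[complex_ring] = 0"
 by (auto simp: complex_ring_def)

lemma ring_complex: "ring complex_ring"
proof (rule ringI)
 show "abelian_group complex_ring"
  by (rule abelian_groupI) (auto intro: exI[of _ "- x" for x] simp: add_eq_0_iff)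
 show "Group.monoid complex_ring" by (rule monoidI) auto
qed (auto simp: algebra_simps)

abbreviation cvs :: "(complex, 'v, 'm) module_scheme => bool" where
 "cvs V == lmod complex_ring V"

lemma cvsI:
 fixes V :: "(complex, 'v, 'm) module_scheme" (structure)
 assumes "abelian_group V"
  and "!!a x. x : cr V ==> a \<odot> x : cr V"
  and "!!a b x. x : cr V ==> (a + b) \<odot> x = a \<odot> x \<oplus> b \<odot> x"
  and "!!a x y. x : cr V ==> y : cr V ==> a \<odot> (x \<oplus> y) = a \<odot> x \<oplus> a \<odot> y"
  and "!!a b x. x : cr V ==> (a * b) \<odot> x = a \<odot> (b \<odot> x)"
  and "!!x. x : cr V ==> 1 \<odot> x = x"
 shows "cvs V"
 unfolding lmod_def lmod_axioms_def using ring_complex assms by auto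

definition clin :: "(complex, 'v, 'm) module_scheme => (complex, 'w, 'k) module_scheme => ('v => 'w) => bool" where
 "clin V W r <-> (ALL x : cr V. r x : cr W & (ALL y : cr V. r (x +[V] y) = r x +[W] r y) &
  (ALL c. r (c *[V] x) = c *[W] r x))"

lemma clin_closed: "clin V W r ==> x : cr V ==> r x : cr W"
 and clin_add: "clin V W r ==> x : cr V ==> y : cr V ==> r (x +[V] y) = r x +[W] r y"
 and clin_smult: "clin V W r ==> x : cr V ==> r (c *[V] x) = c *[W] r x"
 unfolding clin_def by auto

definition vecs :: "nat => (complex, complex vec) module" where
 "vecs k = (|carrier = cV k, monoid.mult = undefined, one = undefined, zero = zv k, add = (+), module.smult = (*s)|)"

lemma vecs_simps [simp]:
 "cr (vecs k) = cV k" "x +[vecs k] y = x + y" "0[vecs k] = zv k" "c *[vecs k] x = c *s x"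
 by (auto simp: vecs_def)

lemma cvs_vecs: "cvs (vecs k)"
proof (rule cvsI)
 show "abelian_group (vecs k)"
 proof (rule abelian_groupI)
  fix x assume "x : cr (vecs k)"
  then show "EX y:cr (vecs k). y +[vecs k] x = 0[vecs k]" by (intro bexI[of _ "- x"]) auto
 qed (auto intro: comm_add_vec)
qed (auto simp: add_smult_distrib_vec smult_add_distrib_vec smult_smult_assoc)

text \<open>A relation instead of a function: \<open>vdim V k\<close> also asserts that
  \<open>V\<close> is finite dimensional.\<close>

definition vdim :: "(complex, 'v, 'm) module_scheme => nat => bool" where
 "vdim V k <-> (EX fy. clin (vecs k) V fy & bij_betw fy (cV k) (cr V))"

lemma clin_zero:
 assumes "clin V W r" "cvs V" "cvs W" shows "r 0[V] = 0[W]"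
proof -
 interpret V: lmod complex_ring V by fact
 interpret W: lmod complex_ring W by fact
 have "r (0 *[V] 0[V]) = 0 *[W] r 0[V]" "r 0[V] : cr W"
  using assms(1) V.zero_closed unfolding clin_def by blast+
 then show ?thesis using V.smult_l_null[OF V.zero_closed] W.smult_l_null[of "r 0[V]"] by simp
qed

lemma clin_ext:
 assumes f: "clin (vecs k) W f" and g: "clin (vecs k) W g"
  and eq: "!!j. j < k ==> f (unit_vec k j) = g (unit_vec k j)" and W: "cvs W"
  and x: "x : cV k"
 shows "f x = g x"
proof -
 have "f x = g x" if "x : cV k" "ALL i<k. t <= i --> x $ i = 0" "t <= k" for x t
  using that
 proof (induction t arbitrary: x)
  case 0
  then have "x = zv k" by (intro eq_vecI) auto
  then show ?case using clin_zero[OF f cvs_vecs W] clin_zero[OF g cvs_vecs W] by simp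
 next
  case (Suc t)
  define y where "y = vec k (%i. if i = t then 0 else x $ i)"
  have x: "x = y + (x $ t) *s unit_vec k t" using Suc(2,4) unfolding y_def by (intro eq_vecI) auto
  have y: "y : cV k" unfolding y_def by auto
  have "f y = g y" using Suc by (intro Suc(1)) (auto simp: y_def)
  have "h x = h y +[W] (x $ t) *[W] h (unit_vec k t)" if h: "clin (vecs k) W h" for h
  proof -
  have "h (y + (x $ t) *s unit_vec k t) = h y +[W] (x $ t) *[W] h (unit_vec k t)"
  using h y unfolding clin_def by auto
  then show ?thesis using x by simp
  qed
  from this[OF f] this[OF g] \<open>f y = g y\<close> show ?case using eq[of t] Suc(4) by simp
 qed
 from this[of x k] x show ?thesis by auto
qed

lemma clin_section:
 assumes W: "cvs W" and v: "!!j. j < k ==> v j : cr W"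
 obtains s where "clin (vecs k) W s" "!!j. j < k ==> s (unit_vec k j) = v j"
proof -
 interpret W: lmod complex_ring W by fact
 define s where "s x = (fs W {..<k} (%j. (x $ j) *[W] v j))" for x
 have 1: "(%j. (x $ j) *[W] v j) : {..<k} \<rightarrow> cr W" for x using v by auto
 have "clin (vecs k) W s"
  unfolding clin_def
 proof (intro ballI conjI allI)
  fix x c assume x: "x : cr (vecs k)"
  show "s x : cr W" unfolding s_def using 1 by auto
  have "s (c *[vecs k] x) = (fs W {..<k} (%j. c *[W] ((x $ j) *[W] v j)))"
  unfolding s_def using x v by (intro W.finsum_cong') (auto simp flip: W.smult_assoc1)
  also have "... = c *[W] s x" unfolding s_def using 1 by (subst W.smult_finsum) auto
  finally show "s (c *[vecs k] x) = c *[W] s x" .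
 next
  fix x y assume x: "x : cr (vecs k)" and y: "y : cr (vecs k)"
  have "s (x +[vecs k] y) = (fs W {..<k} (%j. (x $ j) *[W] v j +[W] (y $ j) *[W] v j))"
  unfolding s_def using x y v by (intro W.finsum_cong') (auto simp flip: W.smult_l_distr)
  also have "... = s x +[W] s y" unfolding s_def using 1 by (subst W.finsum_addf) auto
  finally show "s (x +[vecs k] y) = s x +[W] s y" .
 qed
 moreover have "s (unit_vec k j) = v j" if j: "j < k" for j
 proof -
  have "s (unit_vec k j) = (fs W {..<k} (%i. if j = i then v i else 0[W]))"
  unfolding s_def using j v W.smult_one W.smult_l_null by (intro W.finsum_cong') (auto simp: unit_vec_def)
  also have "... = v j" using j v by (intro W.finsum_singleton) auto
  finally show ?thesis .
 qed
 ultimately show ?thesis using that by blast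
qed

lemma vdim_le:
 assumes V: "cvs V" and f: "clin (vecs k) V f" "inj_on f (cV k)" and l: "vdim V l"
 shows "k <= l"
proof -
 interpret V: lmod complex_ring V by fact
 obtain fy where fy: "clin (vecs l) V fy" "bij_betw fy (cV l) (cr V)" using l unfolding vdim_def by auto
 define si where "si = inv_into (cV l) fy"
 have si: "si y : cV l" "fy (si y) = y" if "y : cr V" for y
  using that fy(2) unfolding si_def bij_betw_def by (auto intro: inv_into_into f_inv_into_f)
 have inj: "x = y" if "fy x = fy y" "x : cV l" "y : cV l" for x y
  using that fy(2) unfolding bij_betw_def inj_on_def by auto
 have fc: "f x : cr V" if "x : cV k" for x using f that unfolding clin_def by auto
 have a: "si (f (x + y)) = si (f x) + si (f y)" if "x : cV k" "y : cV k" for x y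
 proof (rule inj)
  have "f (x + y) = f x +[V] f y" using f that unfolding clin_def by auto
  moreover have "fy (si (f x) + si (f y)) = f x +[V] f y" using fy(1) si fc that unfolding clin_def by auto
  ultimately show "fy (si (f (x + y))) = fy (si (f x) + si (f y))" using si fc that by simp
 qed (use si fc that in auto)
 have b: "si (f (c *s x)) = c *s si (f x)" if "x : cV k" for x c
 proof (rule inj)
  have "f (c *s x) = c *[V] f x" using f that unfolding clin_def by auto
  moreover have "fy (c *s si (f x)) = c *[V] f x" using fy(1) si fc that unfolding clin_def by auto
  ultimately show "fy (si (f (c *s x))) = fy (c *s si (f x))" using si fc that by simp
 qed (use si fc that in auto)
 obtain M where M: "M : cM l k" "!!x. x : cV k ==> si (f x) = M *v x"
  by (rule linear_mat[of k "%x. si (f x)" l, OF si(1)[OF fc] a b]) blast+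
 have "minj M"
 proof (rule minj_I[OF M(1)])
  fix x assume x: "x : cV k" "M *v x = zv l"
  have "f x = fy (zv l)" using M(2)[OF x(1)] x si(2)[OF fc[OF x(1)]] by simp
  also have "... = f (zv k)" using clin_zero[OF fy(1) cvs_vecs V] clin_zero[OF f(1) cvs_vecs V] by simp
  finally show "x = zv k" using f(2) x(1) unfolding inj_on_def by auto
 qed
 then show ?thesis using minj_le M by blast
qed

lemma vdim_unique: "cvs V ==> vdim V k ==> vdim V l ==> k = l"
 by (meson vdim_def vdim_le bij_betw_def le_antisym)

lemma vdim_iso:
 assumes "vdim V k" "clin V W r" "bij_betw r (cr V) (cr W)"
 shows "vdim W k"
proof -
 obtain fy where fy: "clin (vecs k) V fy" "bij_betw fy (cV k) (cr V)" using assms unfolding vdim_def by auto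
 have "clin (vecs k) W (r \<circ> fy)" using fy(1) assms(2) unfolding clin_def by auto
 moreover have "bij_betw (r \<circ> fy) (cV k) (cr W)" using fy(2) assms(3) by (rule bij_betw_trans)
 ultimately show ?thesis unfolding vdim_def by blast
qed

lemma vdim_zero:
 assumes "cvs V" shows "vdim V 0 <-> cr V = {0[V]}"
proof -
 interpret V: lmod complex_ring V by fact
 have c0: "cV 0 = {zv 0 :: complex vec}" by auto
 show ?thesis
 proof
  assume "vdim V 0"
  then obtain fy where fy: "clin (vecs 0) V fy" "bij_betw fy (cV 0) (cr V)" unfolding vdim_def by auto
  then show "cr V = {0[V]}" using clin_zero[OF fy(1) cvs_vecs assms] c0 unfolding bij_betw_def by auto
 next
  assume "cr V = {0[V]}"
  then show "vdim V 0" unfolding vdim_def c0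
  by (intro exI[of _ "%_. 0[V]"]) (auto simp: clin_def bij_betw_def c0)
 qed
qed

text \<open>Rank-nullity, in the form used for counting along a filtration. The target dimension
  \<open>w\<close> only bounds the rank, and equality in the bound detects surjectivity of
  \<open>r\<close>.\<close>

lemma vdim_extension:
 assumes V: "cvs V" and W: "cvs W" and r: "clin V W r" and w: "vdim W w"
  and ka: "vdim (V(|carrier := {x : cr V. r x = 0[W]}|)) ka"
 obtains v where "vdim V v" "v <= w + ka" "v = w + ka <-> r ` cr V = cr W"
proof -
 interpret V: lmod complex_ring V by fact
 interpret W: lmod complex_ring W by fact
 define K where "K = {x : cr V. r x = 0[W]}"
 obtain fy where fy: "clin (vecs w) W fy" "bij_betw fy (cV w) (cr W)" using w unfolding vdim_def by auto
 have inj: "x = y" if "fy x = fy y" "x : cV w" "y : cV w" for x y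
  using that fy(2) unfolding bij_betw_def inj_on_def by auto
 obtain si where si: "clin (vecs ka) (V(|carrier := K|)) si" "bij_betw si (cV ka) K"
  using ka unfolding vdim_def K_def by auto
 have siK: "si x : cr V" "r (si x) = 0[W]" if "x : cV ka" for x
  using si(1) that unfolding clin_def K_def by auto
 note rl = clin_closed[OF r] clin_add[OF r] clin_smult[OF r]
 note fyl = clin_closed[OF fy(1), simplified] clin_add[OF fy(1), simplified] clin_smult[OF fy(1), simplified]
 \<comment> \<open>\<open>U\<close> is the image of \<open>r\<close> in coordinates. Its basis
   \<open>B\<close> gives the rank \<open>u\<close>, and \<open>u = w\<close> exactly when
   \<open>r\<close> is onto.\<close>
 define U where "U = {x : cV w. fy x : r ` cr V}"
 have "vsub w U"
  unfolding vsub_def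
 proof (intro conjI ballI allI)
  show "U <= cV w" unfolding U_def by auto
  have "fy (zv w) = r 0[V]" using clin_zero[OF fy(1) cvs_vecs W] clin_zero[OF r V W] by simp
  then show "zv w : U" unfolding U_def by auto
  fix x assume "x : U"
  then obtain a where a: "x : cV w" "a : cr V" "fy x = r a" unfolding U_def by auto
  { fix y assume "y : U"
  then obtain b where b: "y : cV w" "b : cr V" "fy y = r b" unfolding U_def by auto
  have "fy (x + y) = r (a +[V] b)" using a b rl fyl by simp
  then show "x + y : U" unfolding U_def using a b by auto }
  fix c
  have "fy (c *s x) = r (c *[V] a)" using a rl fyl by simp
  then show "c *s x : U" unfolding U_def using a by auto
 qed
 then obtain u B where B: "u <= w" "B : cM w u" "minj B" "U = (*v) B ` cV u"
  "u = w <-> U = cV w" by (rule subspace_basis)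
 have "EX v. ALL j<u. v j : cr V & fy (B *v unit_vec u j) = r (v j)"
 proof (intro choice allI)
  fix j
  have "B *v unit_vec u j : U" using B(4) by auto
  then show "EX y. j < u --> y : cr V & fy (B *v unit_vec u j) = r y" unfolding U_def by auto
 qed
 then obtain v where v: "!!j. j < u ==> v j : cr V" "!!j. j < u ==> fy (B *v unit_vec u j) = r (v j)" by blast
 obtain s where s: "clin (vecs u) V s" "!!j. j < u ==> s (unit_vec u j) = v j"
  by (rule clin_section[OF V v(1)]) blast+
 note sl = clin_closed[OF s(1), simplified] clin_add[OF s(1), simplified] clin_smult[OF s(1), simplified]
 have rs: "r (s x) = fy (B *v x)" if x: "x : cV u" for x
 proof (rule clin_ext[where f = "%x. r (s x)" and g = "%x. fy (B *v x)", OF _ _ _ W x])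
  show "clin (vecs u) W (%x. r (s x))" unfolding clin_def using sl rl by auto
  show "clin (vecs u) W (%x. fy (B *v x))"
  unfolding clin_def using B(2) fyl by (auto simp: mult_add_distrib_mat_vec mult_mat_vec)
  show "r (s (unit_vec u j)) = fy (B *v unit_vec u j)" if "j < u" for j using s v that by auto
 qed
 define p1 where "p1 x = vec u (%i. x $ i)" for x :: "complex vec"
 define p2 where "p2 x = vec ka (%i. x $ (u + i))" for x :: "complex vec"
 have p: "p1 x : cV u" "p2 x : cV ka" for x unfolding p1_def p2_def by auto
 have pa: "p1 (x + y) = p1 x + p1 y" "p2 (x + y) = p2 x + p2 y" "p1 (c *s x) = c *s p1 x" "p2 (c *s x) = c *s p2 x"
  if "x : cV (u + ka)" "y : cV (u + ka)" for x y c
  using that unfolding p1_def p2_def by (auto intro!: eq_vecI)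
 \<comment> \<open>A lift \<open>s\<close> of the basis of the image and a parametrization
   \<open>si\<close> of the kernel together give \<open>u + ka\<close> coordinates on
   \<open>V\<close>; \<open>p1\<close> and \<open>p2\<close> cut a vector into these two
   parts.\<close>
 define Ph where "Ph x = s (p1 x) +[V] si (p2 x)" for x
 note sil = clin_add[OF si(1), simplified] clin_smult[OF si(1), simplified]
 have "clin (vecs (u + ka)) V Ph"
  unfolding clin_def
 proof (intro ballI conjI allI)
  fix x c assume x: "x : cr (vecs (u + ka))"
  show "Ph x : cr V" unfolding Ph_def using sl siK p by auto
  show "Ph (c *[vecs (u + ka)] x) = c *[V] Ph x"
  unfolding Ph_def using x pa sl siK sil p by (simp add: V.smult_r_distr)
 next
  fix x y assume x: "x : cr (vecs (u + ka))" and y: "y : cr (vecs (u + ka))"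
  show "Ph (x +[vecs (u + ka)] y) = Ph x +[V] Ph y"
  unfolding Ph_def using x y pa sl siK sil p by (simp add: V.a_ac)
 qed
 moreover have "inj_on Ph (cV (u + ka))"
 proof (rule inj_onI)
  fix x y assume x: "x : cV (u + ka)" and y: "y : cV (u + ka)" and e: "Ph x = Ph y"
  have "r (Ph z) = fy (B *v p1 z)" for z
  unfolding Ph_def using rl sl siK p rs fyl B(2) by simp
  then have "fy (B *v p1 x) = fy (B *v p1 y)" using e by metis
  then have "B *v p1 x = B *v p1 y" using B(2) p inj by (metis mult_mat_vec_carrier)
  then have 1: "p1 x = p1 y" using minj_inj[OF B(3,2)] p by blast
  then have "si (p2 x) = si (p2 y)" using e sl siK p unfolding Ph_def by (metis V.add_lcancel)
  then have 2: "p2 x = p2 y" using si(2) p unfolding bij_betw_def inj_on_def by auto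
  show "x = y"
  proof (rule eq_vecI)
  fix i assume "i < dim_vec y"
  then have i: "i < u + ka" using y by auto
  show "x $ i = y $ i"
  proof (cases "i < u")
  case True
  then have "x $ i = p1 x $ i" "y $ i = p1 y $ i" unfolding p1_def by auto
  then show ?thesis using 1 by simp
  next
  case False
  then have "x $ i = p2 x $ (i - u)" "y $ i = p2 y $ (i - u)" using i unfolding p2_def by auto
  then show ?thesis using 2 by simp
  qed
  qed (use x y in auto)
 qed
 moreover have "z : Ph ` cV (u + ka)" if z: "z : cr V" for z
 proof -
  obtain y where y: "y : cV w" "fy y = r z"
  using fy(2) rl(1)[OF z] unfolding bij_betw_def by (metis imageE)
  then have "y : U" unfolding U_def using z by auto
  then obtain x1 where x1: "x1 : cV u" "y = B *v x1" using B(4) by auto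
  have zz: "z -[V] s x1 : K"
  proof -
  have "z -[V] s x1 = z +[V] (-1) *[V] s x1"
  proof -
  have "(-1) *[V] s x1 +[V] s x1 = 0[V]"
  using V.smult_l_distr[of "-1" 1 "s x1"] sl x1 V.smult_one[of "s x1"] V.smult_l_null[of "s x1"] by simp
  then have "-[V] s x1 = (-1) *[V] s x1" using sl x1 V.minus_equality V.smult_closed by simp
  then show ?thesis by (simp add: a_minus_def)
  qed
  moreover have "r z +[W] (-1) *[W] r z = 0[W]"
  using W.smult_l_distr[of 1 "-1" "r z"] rl(1)[OF z] W.smult_one[of "r z"] W.smult_l_null[of "r z"] by simp
  ultimately show ?thesis using z sl x1 rl rs y unfolding K_def by simp
  qed
  then obtain x2 where x2: "x2 : cV ka" "si x2 = z -[V] s x1"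
  using si(2) unfolding bij_betw_def by (metis imageE)
  define x where "x = x1 @\<^sub>v x2"
  have "p1 x = x1" "p2 x = x2" using x1 x2 unfolding x_def p1_def p2_def by (auto intro!: eq_vecI)
  then have "Ph x = s x1 +[V] (z -[V] s x1)" unfolding Ph_def using x2 by simp
  also have "... = z" using z sl x1 by (simp add: a_minus_def V.a_lcomm V.r_neg)
  finally show ?thesis unfolding x_def using x1 x2 by (metis append_carrier_vec image_eqI)
 qed
 moreover have "Ph ` cV (u + ka) <= cr V" unfolding Ph_def using sl siK p by auto
 ultimately have d: "vdim V (u + ka)" unfolding vdim_def bij_betw_def by blast
 have "U = cV w <-> r ` cr V = cr W"
 proof
  assume "U = cV w"
  then have "fy ` cV w <= r ` cr V" unfolding U_def by auto
  then show "r ` cr V = cr W" using fy(2) rl unfolding bij_betw_def by auto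
 next
  assume "r ` cr V = cr W"
  then show "U = cV w" unfolding U_def using fyl by auto
 qed
 then show ?thesis using that[OF d] B(1,5) by auto
qed

section \<open>Representations of the dihedral group\<close>

text \<open>Induction on \<open>k - l\<close>: as long as \<open>B\<close> is not square, a column
  outside its image can be added. Dropping the last row of a left inverse of the wider matrix leaves
  a left inverse of \<open>B\<close>.\<close>

lemma minj_left_inverse:
 assumes "B : cM k l" "minj B"
 obtains C where "C : cM l k" "C * B = om l"
proof -
 have "EX C : cM l k. C * B = om l"
  using assms
 proof (induction "k - l" arbitrary: l B)
  case 0
  then have kl: "k = l" using minj_le by fastforce
  then obtain C where "C : cM k k" "C * B = om k"
  using det_nonzero_inverse minj_det 0 by metis
  then show ?case using kl by auto
 next
  case (Suc d)
  then have "~ k <= l" by auto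
  then have "~ cV k <= (*v) B ` cV l" using surj_mat_ge[OF Suc(3)] by auto
  then obtain u where u: "u : cV k" "u ~: (*v) B ` cV l" by auto
  have Bu: "add_col B u : cM k (Suc l)" by (rule add_col_carrier[OF Suc(3)])
  have "EX C : cM (Suc l) k. C * add_col B u = om (Suc l)"
  using Suc(2) by (intro Suc(1)[OF _ Bu add_col_minj[OF Suc(3,4) u]]) auto
  then obtain C where C: "C : cM (Suc l) k" "C * add_col B u = om (Suc l)" by auto
  define C' where "C' = mat l k (%(i,j). C $$ (i,j))"
  have "C' * B = om l"
  proof (rule eq_matI)
  fix i j assume ij: "i < dim_row (om l :: complex mat)" "j < dim_col (om l :: complex mat)"
  have "row C' i = row C i" unfolding C'_def using ij C by (intro eq_vecI) auto
  moreover have "col B j = col (add_col B u) j" unfolding add_col_def using ij Suc(3) by (intro eq_vecI) auto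
  ultimately have "(C' * B) $$ (i,j) = (C * add_col B u) $$ (i,j)"
  using ij C(1) Bu Suc(3) unfolding C'_def by auto
  then show "(C' * B) $$ (i,j) = om l $$ (i,j)" using C(2) ij by auto
  qed (use Suc(3) C in \<open>auto simp: C'_def\<close>)
  then show ?case by (intro bexI[of _ C']) (auto simp: C'_def)
 qed
 then show ?thesis using that by blast
qed

lemma minj_cancel:
 assumes "B : cM k l" "minj B" "X : cM l m" "Y : cM l m" "B * X = B * Y"
 shows "X = Y"
proof -
 obtain C where C: "C : cM l k" "C * B = om l" using minj_left_inverse[OF assms(1,2)] .
 have "X = C * B * X" unfolding C(2) using assms by simp
 also have "... = C * (B * X)" using C(1) assms by simp
 also have "... = C * B * Y" using assoc_mult_mat[OF C(1) assms(1,4)] assms(5) by simp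
 also have "... = Y" unfolding C(2) using assms by simp
 finally show ?thesis .
qed

lemma mat_image_factor:
 assumes B: "B : cM k l" and M: "M : cM k m"
  and "!!j. j < m ==> col M j : (*v) B ` cV l"
 obtains T where "T : cM l m" "M = B * T"
proof -
 have "EX c. ALL j<m. c j : cV l & col M j = B *v c j"
  by (intro choice allI) (use assms(3) in blast)
 then obtain c where c: "!!j. j < m ==> c j : cV l" "!!j. j < m ==> col M j = B *v c j" by blast
 define T where "T = mat l m (%(i,j). c j $ i)"
 have cT: "col T j = c j" if "j < m" for j using c(1)[OF that] that unfolding T_def by (intro eq_vecI) auto
 have "M = B * T"
 proof (rule eq_matI)
  fix i j assume ij: "i < dim_row (B * T)" "j < dim_col (B * T)"
  then have j: "j < m" unfolding T_def by auto
  have "M $$ (i,j) = col M j $ i" using ij j M B by auto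
  also have "... = (B *v col T j) $ i" using c(2)[OF j] cT[OF j] by simp
  also have "... = (B * T) $$ (i,j)" using ij by auto
  finally show "M $$ (i,j) = (B * T) $$ (i,j)" .
 qed (use B M in \<open>auto simp: T_def\<close>)
 then show ?thesis using that[of T] unfolding T_def by auto
qed

locale dih =
 fixes n :: nat
 assumes n3: "n >= 3"
begin

abbreviation "D == dihedral n"
abbreviation "W == cr (dihedral n)"
abbreviation dmul :: "dih => dih => dih" (infixl "**" 70) where "u ** v == u \<otimes>[dihedral n] v"
abbreviation dinv :: "dih => dih" where "dinv w == inv\<^bsub>dihedral n\<^esub> w"
abbreviation e0 :: dih where "e0 == (0, False)"

lemma W_eq: "W = {0..<int n} \<times> UNIV" by (simp add: dihedral_def)
lemma D_mult: "(k, b) ** (l, c) = ((if b then k - l else k + l) mod int n, b ~= c)"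
 by (simp add: dihedral_def)
lemma D_one: "1[dihedral n] = e0" by (simp add: dihedral_def)
lemma finite_W [simp]: "finite W" by (simp add: W_eq)
lemma e0_W [simp]: "e0 : W" using n3 by (simp add: W_eq)

lemma group_D: "group D"
proof (rule groupI)
 fix x y assume "x : W" "y : W"
 then show "x ** y : W" using n3 by (cases x; cases y) (auto simp: W_eq D_mult)
next
 show "1[D] : W" by (simp add: D_one)
next
 fix x y z assume "x : W" "y : W" "z : W"
 then show "x ** y ** z = x ** (y ** z)"
  by (cases x; cases y; cases z) (auto simp: D_mult mod_simps algebra_simps)
next
 fix x assume x: "x : W"
 then show "1[D] ** x = x" by (cases x) (auto simp: D_mult D_one W_eq)
 show "EX y:W. y ** x = 1[D]"
 proof (cases x)
  case (Pair k b)
  show ?thesis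
  proof (cases b)
  case True
  then show ?thesis using Pair x by (intro bexI[of _ x]) (auto simp: D_mult D_one)
  next
  case False
  then show ?thesis using Pair x n3
  by (intro bexI[of _ "((- k) mod int n, False)"]) (auto simp: D_mult D_one W_eq mod_simps)
  qed
 qed
qed

text \<open>The rewrite lets the group lemmas speak of \<open>e0\<close>, the form in which the
  identity occurs in \<open>cscale\<close>.\<close>

sublocale D: group "dihedral n" rewrites "1[dihedral n] = e0" 
 by (rule group_D) (rule D_one)

lemma card_W_pos: "card W > 0" using e0_W finite_W card_gt_0_iff by blast

lemma sum_W_shift: "u : W ==> (SUM w:W. f (u ** w)) = (SUM w:W. f w)"
 by (rule sum.reindex_bij_witness[of _ "%w. dinv u ** w" "%w. u ** w"]) (auto simp: D.m_assoc[symmetric])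

definition rep :: "nat => mrep => bool" where
 "rep k rx <-> (ALL w:W. rx w : cM k k) & rx e0 = om k & (ALL v:W. ALL w:W. rx (v ** w) = rx v * rx w)"

lemma rep_rep_deg: "rep k rx ==> rep_deg rx = k"
 unfolding rep_def rep_deg_def using e0_W by auto

lemma is_rep_iff: "is_rep n rx <-> rep (rep_deg rx) rx"
 unfolding is_rep_def rep_def D_one by auto

lemma rep_carrier: "rep k rx ==> w : W ==> rx w : cM k k"
 and rep_one: "rep k rx ==> rx e0 = om k"
 and rep_mult: "rep k rx ==> v : W ==> w : W ==> rx (v ** w) = rx v * rx w"
 unfolding rep_def by auto

lemma rep_inv:
 assumes "rep k rx" "w : W"
 shows "rx (dinv w) * rx w = om k" "rx w * rx (dinv w) = om k"
 using rep_mult[OF assms(1), of "dinv w" w] rep_mult[OF assms(1), of w "dinv w"] rep_one[OF assms(1)] assms(2) by auto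

definition minv :: "nat => mrep => complex vec set => bool" where
 "minv k rx U <-> vsub k U & (ALL w:W. ALL u:U. rx w *v u : U)"

definition irr_rep :: "nat => mrep => bool" where
 "irr_rep k rx <-> rep k rx & 0 < k & (ALL U. minv k rx U --> U = {zv k} | U = cV k)"

lemma irreducible_iff: "irreducible_rep n rx <-> irr_rep (rep_deg rx) rx"
 unfolding irreducible_rep_def irr_rep_def is_rep_iff minv_def invariant_subspace_def vsub_def by auto

text \<open>The matrix of a bilinear pairing with \<open>b(rx(w) x, so(w) y) = b(x, y)\<close>.
  Pairings take the place of intertwiners because a homomorphism into a dual module is a
  pairing.\<close>

definition inv_pair :: "nat => nat => mrep => mrep => complex mat => bool" where
 "inv_pair k l rx so b <-> b : cM k l & (ALL w:W. (rx w)\<^sup>T * b * so w = b)"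

lemma inv_pair_transpose:
 assumes "rep k rx" "rep l so" "inv_pair k l rx so b"
 shows "inv_pair l k so rx b\<^sup>T"
 unfolding inv_pair_def
proof (intro conjI ballI)
 have b: "b : cM k l" using assms unfolding inv_pair_def by auto
 then show "b\<^sup>T : cM l k" by auto
 fix w assume w: "w : W"
 have "((rx w)\<^sup>T * b * so w)\<^sup>T = (so w)\<^sup>T * (b\<^sup>T * rx w)"
  using b rep_carrier[OF assms(1) w] rep_carrier[OF assms(2) w]
  by (simp add: transpose_mult[of _ k l _ l] transpose_mult[of _ k k _ l])
 also have "... = (so w)\<^sup>T * b\<^sup>T * rx w"
  using b rep_carrier[OF assms(1) w] rep_carrier[OF assms(2) w] by (simp add: assoc_mult_mat[of _ l l _ k _ k])
 finally show "(so w)\<^sup>T * b\<^sup>T * rx w = b\<^sup>T" using assms(3) w unfolding inv_pair_def by auto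
qed

text \<open>The right kernel of an invariant pairing is stable under \<open>so\<close>, so
  irreducibility leaves only zero or everything, and the latter makes the pairing zero.\<close>

lemma inv_pair_kernel:
 assumes rx: "rep k rx" and so: "irr_rep l so" and b: "inv_pair k l rx so b" "b ~= zm k l"
 shows "minj b"
proof -
 have bc: "b : cM k l" using b unfolding inv_pair_def by auto
 have so': "rep l so" using so unfolding irr_rep_def by auto
 define U where "U = {x : cV l. b *v x = zv k}"
 have "minv l so U"
  unfolding minv_def vsub_def
 proof (intro conjI ballI allI)
  show "U <= cV l" "zv l : U" unfolding U_def using bc by auto
  fix x assume x: "x : U"
  show "x + y : U" if "y : U" for y
  using x that bc unfolding U_def by (auto simp: mult_add_distrib_mat_vec)
  show "c *s x : U" for c using x bc unfolding U_def by (auto simp: mult_mat_vec)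
 next
  fix w x assume w: "w : W" and x: "x : U"
  have rxw: "rx w : cM k k" "rx (dinv w) : cM k k" and sow: "so w : cM l l"
  using rep_carrier[OF rx] rep_carrier[OF so'] w by auto
  have xc: "x : cV l" and bx: "b *v x = zv k" using x unfolding U_def by auto
  have sx: "so w *v x : cV l" using sow xc by auto
  have "(rx w)\<^sup>T *v (b *v (so w *v x)) = ((rx w)\<^sup>T * b * so w) *v x"
  using rxw sow bc xc sx by (simp add: assoc_mult_mat_vec[of _ k l _ l] assoc_mult_mat_vec[of _ k k _ l])
  also have "... = zv k" using b(1) w bx unfolding inv_pair_def by auto
  finally have z: "(rx w)\<^sup>T *v (b *v (so w *v x)) = zv k" .
  have bs: "b *v (so w *v x) : cV k" using bc sx by auto
  have "(rx (dinv w))\<^sup>T * (rx w)\<^sup>T = (rx w * rx (dinv w))\<^sup>T" using rxw by (simp add: transpose_mult[of _ k k _ k])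
  also have "... = om k" using rep_inv[OF rx w] by simp
  finally have "b *v (so w *v x) = (rx (dinv w))\<^sup>T *v ((rx w)\<^sup>T *v (b *v (so w *v x)))"
  using bs rxw by (simp flip: assoc_mult_mat_vec[of _ k k _ k])
  also have "... = zv k" using z rxw by auto
  finally show "so w *v x : U" using sx unfolding U_def by auto
 qed
 then have "U = {zv l} | U = cV l" using so unfolding irr_rep_def by auto
 moreover have "b = zm k l" if "U = cV l"
 proof (rule eq_matI)
  fix i j assume ij: "i < dim_row (zm k l :: complex mat)" "j < dim_col (zm k l :: complex mat)"
  have "unit_vec l j : U" using that by auto
  then have "b *v unit_vec l j = zv k" unfolding U_def by auto
  moreover have "(b *v unit_vec l j) $ i = b $$ (i,j)"
  using ij bc by (auto simp: scalar_prod_right_unit[of _ l])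
  ultimately show "b $$ (i,j) = zm k l $$ (i,j)" using ij by auto
 qed (use bc in auto)
 ultimately have "U = {zv l}" using b by auto
 then show ?thesis by (intro minj_I[OF bc]) (auto simp: U_def)
qed

text \<open>Both kernels vanish: \<open>inv_pair_kernel\<close> applies to \<open>b\<close> and,
  with the two representations exchanged, to its transpose.\<close>

lemma schur_nondeg:
 assumes rx: "irr_rep k rx" and so: "irr_rep l so" and b: "inv_pair k l rx so b" "b ~= zm k l"
 shows "k = l" "det b ~= 0"
proof -
 have r: "rep k rx" "rep l so" using rx so unfolding irr_rep_def by auto
 have bc: "b : cM k l" using b unfolding inv_pair_def by auto
 have m: "minj b" by (rule inv_pair_kernel[OF r(1) so b])
 have "b\<^sup>T ~= zm l k"
 proof
  assume "b\<^sup>T = zm l k"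
  then have "b = (zm l k)\<^sup>T" by (metis transpose_transpose)
  then show False using b(2) by (auto simp: transpose_mat_def)
 qed
 then have m2: "minj b\<^sup>T" by (intro inv_pair_kernel[OF r(2) rx inv_pair_transpose[OF r b(1)]])
 show "k = l" using minj_le[OF m bc] minj_le[OF m2, of l k] bc by auto
 then show "det b ~= 0" using minj_det m bc by auto
qed

lemma inv_pair_lin:
 assumes "inv_pair k l rx so b" "inv_pair k l rx so c" "rep k rx" "rep l so"
 shows "inv_pair k l rx so (b - z *sm c)"
 unfolding inv_pair_def
proof (intro conjI ballI)
 have bc: "b : cM k l" "c : cM k l" using assms unfolding inv_pair_def by auto
 then show "b - z *sm c : cM k l" by auto
 fix w assume w: "w : W"
 note [simp] = rep_carrier[OF assms(3) w] rep_carrier[OF assms(4) w]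
 have "(rx w)\<^sup>T * (b - z *sm c) * so w = ((rx w)\<^sup>T * b - z *sm ((rx w)\<^sup>T * c)) * so w"
  using bc by (simp add: mult_minus_distrib_mat[of _ k k _ l] mult_smult_distrib[of _ k k _ l])
 also have "... = (rx w)\<^sup>T * b * so w - z *sm ((rx w)\<^sup>T * c * so w)"
 proof -
  have c: "(rx w)\<^sup>T * b : cM k l" "(rx w)\<^sup>T * c : cM k l" "z *sm ((rx w)\<^sup>T * c) : cM k l"
  using bc rep_carrier[OF assms(3) w] by (auto intro!: mult_carrier_mat[of _ k k] smult_carrier_mat)
  show ?thesis using minus_mult_distrib_mat[OF c(1,3) rep_carrier[OF assms(4) w]]
  mult_smult_assoc_mat[OF c(2) rep_carrier[OF assms(4) w]] by simp
 qed
 finally show "(rx w)\<^sup>T * (b - z *sm c) * so w = b - z *sm c" using assms w unfolding inv_pair_def by auto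
qed

text \<open>Schur's argument: the product of the inverse of \<open>b\<close> with \<open>c\<close>
  has an eigenvalue \<open>z\<close>. Then \<open>c - z b\<close> is an invariant pairing with a
  nonzero kernel vector, hence zero.\<close>

lemma schur_scalar:
 assumes rx: "irr_rep k rx" and so: "irr_rep l so" and b: "inv_pair k l rx so b" "b ~= zm k l"
  and c: "inv_pair k l rx so c"
 shows "EX z. c = z *sm b"
proof -
 have r: "rep k rx" "rep l so" and k0: "0 < k" using rx so unfolding irr_rep_def by auto
 have kl: "l = k" "det b ~= 0" using schur_nondeg[OF rx so b] by auto
 have bc: "b : cM k k" "c : cM k k" using b c kl unfolding inv_pair_def by auto
 obtain b' where b': "b' : cM k k" "b * b' = om k" "b' * b = om k" using det_nonzero_inverse[OF bc(1) kl(2)] .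
 have bcc: "b' * c : cM k k" using b' bc by auto
 obtain z where "z : spectrum (b' * c)" using spectrum_non_empty[OF bcc k0] by auto
 then obtain v where v: "v : cV k" "v ~= zv k" "(b' * c) *v v = z *s v"
  unfolding spectrum_def eigenvalue_def eigenvector_def using bcc b' by auto
 have "c *v v = b *v ((b' * c) *v v)"
 proof -
  have "b *v ((b' * c) *v v) = (b * (b' * c)) *v v" using bc bcc v by simp
  also have "b * (b' * c) = b * b' * c" using bc b'(1) by simp
  also have "... = c" unfolding b'(2) using bc by simp
  finally show ?thesis by simp
 qed
 also have "... = z *s (b *v v)" using v bc by (simp add: mult_mat_vec)
 finally have cv: "c *v v = z *s (b *v v)" .
 have "(c - z *sm b) *v v = c *v v - (z *sm b) *v v"
  using bc v by (simp add: minus_mult_distrib_mat_vec[of _ k k])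
 also have "(z *sm b) *v v = z *s (b *v v)" using bc v
  by (intro eq_vecI) (auto simp: scalar_prod_def sum_distrib_left mult.assoc)
 finally have 0: "(c - z *sm b) *v v = zv k" using cv bc v by auto
 have ip: "inv_pair k l rx so (c - z *sm b)" by (rule inv_pair_lin[OF c b(1) r])
 have "c - z *sm b = zm k k"
 proof (rule ccontr)
  assume "c - z *sm b ~= zm k k"
  then have "minj (c - z *sm b)" using inv_pair_kernel[OF r(1) so ip] kl by simp
  moreover have "c - z *sm b : cM k k" using bc by (intro minus_carrier_mat smult_carrier_mat)
  ultimately show False using minj_D[of "c - z *sm b" k k v] 0 v by auto
 qed
 then have e: "(c - z *sm b) $$ (i,j) = 0" if "i < k" "j < k" for i j using that by simp
 have "c = z *sm b"
 proof (rule eq_matI)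
  fix i j assume "i < dim_row (z *sm b)" "j < dim_col (z *sm b)"
  then show "c $$ (i,j) = (z *sm b) $$ (i,j)" using e[of i j] bc by auto
 qed (use bc in auto)
 then show ?thesis by auto
qed

lemma rep_transpose_power:
 assumes rx: "rep k rx" and v: "v : cV k" "(rx (1, False))\<^sup>T *v v = ow *s v" and "j < n"
 shows "(rx (int j, False))\<^sup>T *v v = (ow ^ j) *s v"
 using \<open>j < n\<close>
proof (induction j)
 case 0
 then show ?case using rep_one[OF rx] v by simp
next
 case (Suc j)
 have W: "(int j, False) : W" "(1, False) : W" using Suc n3 by (auto simp: W_eq)
 have "(int (Suc j), False) = (int j, False) ** (1, False)" using Suc by (simp add: D_mult)
 then have "rx (int (Suc j), False) = rx (int j, False) * rx (1, False)" using rep_mult[OF rx W] by simp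
 then have "(rx (int (Suc j), False))\<^sup>T = (rx (1, False))\<^sup>T * (rx (int j, False))\<^sup>T"
  using rep_carrier[OF rx] W by (simp add: transpose_mult[of _ k k _ k])
 then have "(rx (int (Suc j), False))\<^sup>T *v v = (rx (1, False))\<^sup>T *v ((rx (int j, False))\<^sup>T *v v)"
  using rep_carrier[OF rx] W v by (simp add: assoc_mult_mat_vec[of _ k k _ k])
 also have "... = (rx (1, False))\<^sup>T *v (ow ^ j *s v)" using Suc by simp
 also have "... = ow ^ j *s (ow *s v)" using v rep_carrier[OF rx W(2)] by (simp add: mult_mat_vec[of _ k k])
 finally show ?case by (simp add: smult_smult_assoc mult.commute)
qed

definition outer :: "nat => complex vec => complex vec => complex mat" where
 "outer k a b = mat k k (%(i,j). a $ i * b $ j)"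

lemma outer_conj:
 assumes M: "M : cM k k" and a: "a : cV k" and b: "b : cV k"
 shows "M\<^sup>T * outer k a b * M = outer k (M\<^sup>T *v a) (M\<^sup>T *v b)"
proof (rule eq_matI)
 fix i j assume ij: "i < dim_row (outer k (M\<^sup>T *v a) (M\<^sup>T *v b))" "j < dim_col (outer k (M\<^sup>T *v a) (M\<^sup>T *v b))"
 then have ij: "i < k" "j < k" unfolding outer_def by auto
 have "(M\<^sup>T * outer k a b * M) $$ (i,j) = (SUM q<k. (SUM p<k. M $$ (p,i) * (a $ p * b $ q)) * M $$ (q,j))"
  using ij M unfolding outer_def by (simp add: scalar_prod_def lessThan_atLeast0)
 also have "... = (SUM q<k. (SUM p<k. M $$ (p,i) * a $ p) * (M $$ (q,j) * b $ q))"
  by (intro sum.cong refl) (simp add: sum_distrib_left sum_distrib_right algebra_simps)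
 also have "... = (SUM p<k. M $$ (p,i) * a $ p) * (SUM q<k. M $$ (q,j) * b $ q)"
  by (simp add: sum_distrib_left)
 also have "... = outer k (M\<^sup>T *v a) (M\<^sup>T *v b) $$ (i,j)"
  using ij M a b unfolding outer_def by (simp add: scalar_prod_def lessThan_atLeast0)
 finally show "(M\<^sup>T * outer k a b * M) $$ (i,j) = outer k (M\<^sup>T *v a) (M\<^sup>T *v b) $$ (i,j)" .
qed (use M in \<open>auto simp: outer_def\<close>)

lemma outer_smult: "outer k (x *s a) (y *s b) = (x * y) *sm outer k a b"
 if "a : cV k" "b : cV k"
 using that unfolding outer_def by (intro eq_matI) auto

text \<open>If \<open>l\<close> is a left eigenvector of \<open>r\<close> then \<open>l \<circ> s\<close> is one for the inverse eigenvalue, so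
  \<open>B(x, y) = l(x) l(s y) + l(s x) l(y)\<close> is an invariant form.\<close>

lemma self_dual:
 assumes rx: "irr_rep k rx"
 obtains b where "inv_pair k k rx rx b" "b ~= zm k k"
proof -
 have r: "rep k rx" and k0: "0 < k" using rx unfolding irr_rep_def by auto
 have Ws: "(0, True) : W" "(1, False) : W" using n3 by (auto simp: W_eq)
 let ?s = "rx (0, True)"
 have sc: "?s : cM k k" and rc: "rx (1, False) : cM k k" using rep_carrier[OF r] Ws by auto
 have ss: "?s * ?s = om k" using rep_mult[OF r Ws(1) Ws(1)] rep_one[OF r] by (simp add: D_mult)
 obtain ow where "ow : spectrum (rx (1, False))\<^sup>T"
  using spectrum_non_empty[of "(rx (1, False))\<^sup>T" k] rc k0 by auto
 then obtain v where v: "v : cV k" "v ~= zv k" "(rx (1, False))\<^sup>T *v v = ow *s v"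
  unfolding spectrum_def eigenvalue_def eigenvector_def using rc by auto
 note pw = rep_transpose_power[OF r v(1,3)]
 have own: "ow ^ n = 1"
 proof -
  have W: "(int (n - 1), False) : W" using n3 by (auto simp: W_eq)
  have "(1, False) ** (int (n - 1), False) = e0" using n3 by (simp add: D_mult of_nat_diff)
  then have "rx (1, False) * rx (int (n - 1), False) = om k" using rep_mult[OF r Ws(2) W] rep_one[OF r] by simp
  then have "(rx (int (n - 1), False))\<^sup>T * (rx (1, False))\<^sup>T = om k"
  using transpose_mult[OF rc rep_carrier[OF r W]] by simp
  then have "v = (rx (int (n - 1), False))\<^sup>T *v ((rx (1, False))\<^sup>T *v v)"
  using v(1) rc rep_carrier[OF r W] by (simp flip: assoc_mult_mat_vec[of _ k k _ k])
  also have "... = (rx (int (n - 1), False))\<^sup>T *v (ow *s v)" using v by simp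
  also have "... = ow *s ((rx (int (n - 1), False))\<^sup>T *v v)" using v(1) rep_carrier[OF r W] by (simp add: mult_mat_vec[of _ k k])
  also have "... = ow ^ n *s v" using pw[of "n - 1"] n3 by (simp add: smult_smult_assoc flip: power_Suc)
  finally have e: "v = ow ^ n *s v" .
  obtain i where i: "i < k" "v $ i ~= 0" using v(1,2) by (metis carrier_vecD eq_vecI index_zero_vec)
  have "v $ i = ow ^ n * v $ i" using e i v(1) by (metis carrier_vecD index_smult_vec(1))
  then show ?thesis using i by auto
 qed
 \<comment> \<open>\<open>v\<close> and \<open>u\<close> are the functionals \<open>l\<close> and
   \<open>l\<close> after \<open>s\<close>, written as column vectors.\<close>
 define u where "u = ?s\<^sup>T *v v"
 have u: "u : cV k" unfolding u_def using sc v by auto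
 have su: "?s\<^sup>T *v u = v"
 proof -
  have "?s\<^sup>T *v u = (?s\<^sup>T * ?s\<^sup>T) *v v" unfolding u_def using sc v by (simp add: assoc_mult_mat_vec[of _ k k _ k])
  also have "?s\<^sup>T * ?s\<^sup>T = om k" using ss transpose_mult[OF sc sc] by simp
  finally show ?thesis using v by simp
 qed
 \<comment> \<open>Conjugation by \<open>s\<close> inverts rotations. The exponent
   \<open>(n - j) mod n\<close> is \<open>-j\<close> reduced to a natural number below
   \<open>n\<close>; the \<open>mod\<close> only acts for \<open>j = 0\<close>.\<close>
 have pu: "(rx (int j, False))\<^sup>T *v u = (ow ^ ((n - j) mod n)) *s u" if j: "j < n" for j
 proof -
  define j' where "j' = (n - j) mod n"
  have j': "j' < n" unfolding j'_def using n3 by auto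
  have W: "(int j, False) : W" "(int j', False) : W" using j j' by (auto simp: W_eq)
  have jj: "int j' = (- int j) mod int n"
  proof (cases "j = 0")
  case False
  then have "j' = n - j" unfolding j'_def using j by simp
  then show ?thesis using False j by (simp add: of_nat_diff zmod_zminus1_eq_if)
  qed (simp add: j'_def)
  have "(0, True) ** (int j, False) = (int j', False) ** (0, True)" using jj by (simp add: D_mult)
  then have "?s * rx (int j, False) = rx (int j', False) * ?s"
  using rep_mult[OF r Ws(1) W(1)] rep_mult[OF r W(2) Ws(1)] by simp
  then have "(rx (int j, False))\<^sup>T * ?s\<^sup>T = ?s\<^sup>T * (rx (int j', False))\<^sup>T"
  using transpose_mult[OF sc rep_carrier[OF r W(1)]] transpose_mult[OF rep_carrier[OF r W(2)] sc] by simp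
  then have "(rx (int j, False))\<^sup>T *v u = ?s\<^sup>T *v ((rx (int j', False))\<^sup>T *v v)"
  unfolding u_def using sc v rep_carrier[OF r] W by (simp flip: assoc_mult_mat_vec[of _ k k _ k])
  also have "... = ow ^ j' *s u" unfolding u_def using pw[OF j'] sc v by (simp add: mult_mat_vec[of _ k k])
  finally show ?thesis unfolding j'_def .
 qed
 define b where "b = outer k v u + outer k u v"
 have oc: "outer k x y : cM k k" for x y unfolding outer_def by auto
 have bc: "b : cM k k" unfolding b_def using oc by auto
 have cj: "M\<^sup>T * b * M = outer k (M\<^sup>T *v v) (M\<^sup>T *v u) + outer k (M\<^sup>T *v u) (M\<^sup>T *v v)" if M: "M : cM k k" for M
 proof -
  have "M\<^sup>T * b * M = M\<^sup>T * outer k v u * M + M\<^sup>T * outer k u v * M" unfolding b_def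
  using M oc by (simp add: mult_add_distrib_mat[of _ k k _ k] add_mult_distrib_mat[of _ k k _ _ k])
  then show ?thesis using outer_conj[OF M] u v by simp
 qed
 have bs: "?s\<^sup>T * b * ?s = b" using cj[OF sc] su unfolding b_def u_def[symmetric] using oc by (simp add: comm_add_mat[of _ k k])
 have br: "(rx (int j, False))\<^sup>T * b * rx (int j, False) = b" if j: "j < n" for j
 proof -
  have W: "(int j, False) : W" using j by (auto simp: W_eq)
  have 1: "ow ^ j * ow ^ ((n - j) mod n) = 1"
  by (cases "j = 0") (use j own in \<open>auto simp flip: power_add\<close>)
  have "(rx (int j, False))\<^sup>T * b * rx (int j, False)
  = outer k (ow ^ j *s v) (ow ^ ((n - j) mod n) *s u) + outer k (ow ^ ((n - j) mod n) *s u) (ow ^ j *s v)"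
  using cj[OF rep_carrier[OF r W]] pw[OF j] pu[OF j] by simp
  also have "... = 1 *sm outer k v u + 1 *sm outer k u v"
  unfolding outer_smult[OF v(1) u] outer_smult[OF u v(1)] using 1 by (simp add: mult.commute)
  also have "... = b" unfolding b_def by (intro eq_matI) (auto simp: outer_def)
  finally show ?thesis .
 qed
 have "inv_pair k k rx rx b"
  unfolding inv_pair_def
 proof (intro conjI ballI)
  fix w assume w: "w : W"
  obtain i c where wi: "w = (i, c)" by (cases w)
  define j where "j = nat i"
  have j: "j < n" "i = int j" unfolding j_def using w wi by (auto simp: W_eq)
  have Wj: "(int j, False) : W" using j by (auto simp: W_eq)
  show "(rx w)\<^sup>T * b * rx w = b"
  proof (cases c)
  case False
  then show ?thesis using br[OF j(1)] wi j by simp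
  next
  case True
  let ?r = "rx (int j, False)"
  have rc: "?r : cM k k" using rep_carrier[OF r Wj] .
  have "w = (int j, False) ** (0, True)" using True wi j by (simp add: D_mult)
  then have e: "rx w = ?r * ?s" using rep_mult[OF r Wj Ws(1)] by simp
  have "(?r * ?s)\<^sup>T * b * (?r * ?s) = ?s\<^sup>T * (?r\<^sup>T * b * ?r) * ?s"
  using rc sc bc by (simp add: transpose_mult[of _ k k _ k] assoc_mult_mat[of _ k k _ k _ k])
  then show ?thesis using e br[OF j(1)] bs by simp
  qed
 qed (rule bc)
 moreover have "b ~= zm k k"
 proof
  assume b0: "b = zm k k"
  have bij: "v $ i * u $ j + u $ i * v $ j = 0" if "i < k" "j < k" for i j
  using arg_cong[OF b0, of "%b. b $$ (i,j)"] that unfolding b_def outer_def by simp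
  obtain i where i: "i < k" "v $ i ~= 0" using v(1,2) by (metis carrier_vecD eq_vecI index_zero_vec)
  have "u ~= zv k" using su v sc by auto
  then obtain j where j: "j < k" "u $ j ~= 0" using u by (metis carrier_vecD eq_vecI index_zero_vec)
  \<comment> \<open>The diagonal entry of \<open>b\<close> is
    \<open>2 * v $ i * u $ i\<close>.\<close>
  have "u $ i = 0" using bij[OF i(1) i(1)] i(2) by simp
  then show False using bij[OF i(1) j(1)] i j by simp
 qed
 ultimately show ?thesis using that by blast
qed

end

section \<open>Complete reducibility\<close>

context dih
begin

definition blocks :: "mrep list => dih => complex mat" where
 "blocks rxs w = diag_block_mat (map (%rx. rx w) rxs)"

definition tdeg :: "mrep list => nat" where "tdeg rxs = sum_list (map rep_deg rxs)"

definition irreps :: "mrep list => bool" where "irreps rxs <-> (ALL rx:set rxs. irr_rep (rep_deg rx) rx)"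

lemma tdeg_simps [simp]: "tdeg [] = 0" "tdeg (rx # rxs) = rep_deg rx + tdeg rxs"
 by (auto simp: tdeg_def)

lemma irreps_simps [simp]: "irreps []" "irreps (rx # rxs) <-> irr_rep (rep_deg rx) rx & irreps rxs"
 by (auto simp: irreps_def)

lemma irr_rep_rep: "irr_rep k rx ==> rep k rx" unfolding irr_rep_def by auto

lemma blocks_carrier: "irreps rxs ==> w : W ==> blocks rxs w : cM (tdeg rxs) (tdeg rxs)"
proof (induction rxs)
 case (Cons rx rxs)
 have "rx w : cM (rep_deg rx) (rep_deg rx)" using Cons rep_carrier irr_rep_rep by auto
 then show ?case using Cons unfolding blocks_def by (auto simp: Let_def)
qed (auto simp: blocks_def)

lemma blocks_Cons:
 assumes "irreps (rx # rxs)" "w : W"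
 shows "blocks (rx # rxs) w =
  four_block_mat (rx w) (zm (rep_deg rx) (tdeg rxs)) (zm (tdeg rxs) (rep_deg rx)) (blocks rxs w)"
proof -
 have "rx w : cM (rep_deg rx) (rep_deg rx)" using assms rep_carrier irr_rep_rep by auto
 moreover have "blocks rxs w : cM (tdeg rxs) (tdeg rxs)" using blocks_carrier assms by auto
 ultimately show ?thesis unfolding blocks_def by (auto simp: Let_def)
qed

lemma blocks_rep: "irreps rxs ==> rep (tdeg rxs) (blocks rxs)"
proof (induction rxs)
 case Nil
 then show ?case unfolding rep_def blocks_def by (auto intro!: eq_matI)
next
 case (Cons rx rxs)
 have rx: "rep (rep_deg rx) rx" and r: "rep (tdeg rxs) (blocks rxs)" using Cons irr_rep_rep by auto
 show ?case
  unfolding rep_def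
 proof (intro conjI ballI)
  show "blocks (rx # rxs) w : cM (tdeg (rx # rxs)) (tdeg (rx # rxs))" if "w : W" for w
  using blocks_carrier[OF Cons(2) that] .
  show "blocks (rx # rxs) e0 = om (tdeg (rx # rxs))"
  using blocks_Cons[OF Cons(2) e0_W] rep_one[OF rx] rep_one[OF r] by simp
  fix v w assume v: "v : W" and w: "w : W"
  have vw: "v ** w : W" using v w by simp
  note c = rep_carrier[OF rx v] rep_carrier[OF rx w] rep_carrier[OF r v] rep_carrier[OF r w]
  have "blocks (rx # rxs) v * blocks (rx # rxs) w = four_block_mat (rx v * rx w) (zm (rep_deg rx) (tdeg rxs)) (zm (tdeg rxs) (rep_deg rx)) (blocks rxs v * blocks rxs w)"
  unfolding blocks_Cons[OF Cons(2) v] blocks_Cons[OF Cons(2) w]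
  by (subst mult_four_block_mat[OF c(1) _ _ c(3) c(2) _ _ c(4)]) (use c in auto)
  then show "blocks (rx # rxs) (v ** w) = blocks (rx # rxs) v * blocks (rx # rxs) w"
  using blocks_Cons[OF Cons(2) vw] rep_mult[OF rx v w] rep_mult[OF r v w] by simp
 qed
qed

definition msum :: "nat => nat => (dih => complex mat) => complex mat" where
 "msum k l M = mat k l (%(i,j). SUM w:W. M w $$ (i,j))"

lemma msum_carrier [simp]: "msum k l M : cM k l" unfolding msum_def by auto

lemma msum_cong: "(!!w. w : W ==> M w = N w) ==> msum k l M = msum k l N"
 unfolding msum_def by (intro eq_matI) (auto intro: sum.cong)

lemma mult_msum:
 assumes "C : cM a k" "!!w. w : W ==> M w : cM k l"
 shows "C * msum k l M = msum a l (%w. C * M w)"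
proof (rule eq_matI)
 fix i j assume "i < dim_row (msum a l (%w. C * M w))" "j < dim_col (msum a l (%w. C * M w))"
 then have ij: "i < a" "j < l" unfolding msum_def by auto
 have "(C * msum k l M) $$ (i,j) = (SUM p<k. C $$ (i,p) * (SUM w:W. M w $$ (p,j)))"
  using ij assms(1) unfolding msum_def by (simp add: scalar_prod_def lessThan_atLeast0)
 also have "... = (SUM w:W. SUM p<k. C $$ (i,p) * M w $$ (p,j))"
  unfolding sum_distrib_left by (rule sum.swap)
 also have "... = (SUM w:W. (C * M w) $$ (i,j))"
 proof (intro sum.cong refl)
  fix w assume "w : W"
  then show "(SUM p<k. C $$ (i,p) * M w $$ (p,j)) = (C * M w) $$ (i,j)"
  using ij assms(1) assms(2)[of w] by (simp add: scalar_prod_def lessThan_atLeast0)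
 qed
 finally show "(C * msum k l M) $$ (i,j) = msum a l (%w. C * M w) $$ (i,j)" using ij unfolding msum_def by simp
qed (use assms in \<open>auto simp: msum_def\<close>)

lemma msum_mult:
 assumes "C : cM l a" "!!w. w : W ==> M w : cM k l"
 shows "msum k l M * C = msum k a (%w. M w * C)"
proof (rule eq_matI)
 fix i j assume "i < dim_row (msum k a (%w. M w * C))" "j < dim_col (msum k a (%w. M w * C))"
 then have ij: "i < k" "j < a" unfolding msum_def by auto
 have "(msum k l M * C) $$ (i,j) = (SUM p<l. (SUM w:W. M w $$ (i,p)) * C $$ (p,j))"
  using ij assms(1) unfolding msum_def by (simp add: scalar_prod_def lessThan_atLeast0)
 also have "... = (SUM w:W. SUM p<l. M w $$ (i,p) * C $$ (p,j))"
  unfolding sum_distrib_right by (rule sum.swap)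
 also have "... = (SUM w:W. (M w * C) $$ (i,j))"
 proof (intro sum.cong refl)
  fix w assume "w : W"
  then show "(SUM p<l. M w $$ (i,p) * C $$ (p,j)) = (M w * C) $$ (i,j)"
  using ij assms(1) assms(2)[of w] by (simp add: scalar_prod_def lessThan_atLeast0)
 qed
 finally show "(msum k l M * C) $$ (i,j) = msum k a (%w. M w * C) $$ (i,j)" using ij unfolding msum_def by simp
qed (use assms in \<open>auto simp: msum_def\<close>)

text \<open>Maschke's averaging: the conjugates of an arbitrary left inverse are again left
  inverses, and their mean over the group is equivariant.\<close>

lemma equivariant_left_inverse:
 assumes so: "rep K so" and ta: "rep l ta" and Ph: "Ph : cM K l" "minj Ph"
  and eq: "!!w. w : W ==> so w * Ph = Ph * ta w"
 obtains Ps where "Ps : cM l K" "Ps * Ph = om l" "ALL w:W. ta w * Ps = Ps * so w"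
proof -
 obtain C where C: "C : cM l K" "C * Ph = om l" using minj_left_inverse[OF Ph] .
 define N where "N = msum l K (%w. ta w * C * so (dinv w))"
 define c where "c = inverse (of_nat (card W) :: complex)"
 have c: "c * of_nat (card W) = 1" unfolding c_def using card_W_pos by (metis left_inverse less_irrefl of_nat_eq_0_iff)
 note rc = rep_carrier[OF so] rep_carrier[OF ta]
 have tc: "ta w * C * so (dinv w) : cM l K" if "w : W" for w
  by (rule mult_carrier_mat[OF mult_carrier_mat[OF rc(2)[OF that] C(1)] rc(1)]) (use that in simp)
 have N: "N : cM l K" unfolding N_def by simp
 have 1: "N * Ph = of_nat (card W) *sm om l"
 proof -
  have "N * Ph = msum l l (%w. ta w * C * so (dinv w) * Ph)"
  unfolding N_def by (rule msum_mult[OF Ph(1) tc])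
  also have "... = msum l l (%w. om l)"
  proof (rule msum_cong)
  fix w assume w: "w : W"
  then have w': "dinv w : W" by simp
  have "ta w * C * so (dinv w) * Ph = ta w * C * (so (dinv w) * Ph)"
  using rc(1)[OF w'] rc(2)[OF w] C(1) Ph by (intro assoc_mult_mat[of _ l K _ K _ l]) auto
  also have "... = ta w * C * (Ph * ta (dinv w))" using eq[OF w'] by simp
  also have "... = ta w * (C * (Ph * ta (dinv w)))"
  using rc(2)[OF w'] rc(2)[OF w] C(1) Ph by (intro assoc_mult_mat[of _ l l _ K _ l]) auto
  also have "C * (Ph * ta (dinv w)) = C * Ph * ta (dinv w)"
  using rc(2)[OF w'] C(1) Ph by (intro assoc_mult_mat[symmetric, of _ l K _ l _ l]) auto
  also have "... = ta (dinv w)" unfolding C(2) using rc(2)[OF w'] by simp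
  finally show "ta w * C * so (dinv w) * Ph = om l" using rep_inv[OF ta w] by simp
  qed
  also have "... = of_nat (card W) *sm om l" unfolding msum_def by (intro eq_matI) auto
  finally show ?thesis .
 qed
 have 2: "ta u * N = N * so u" if u: "u : W" for u
 proof -
  have "ta u * N = msum l K (%w. ta u * (ta w * C * so (dinv w)))"
  unfolding N_def by (rule mult_msum[OF rc(2)[OF u] tc])
  \<comment> \<open>In terms of \<open>u ** w\<close> the summand is that of \<open>N\<close>
    followed by \<open>so u\<close>, and translation invariance of the sum removes
    \<open>u\<close>.\<close>
  also have "... = msum l K (%w. ta (u ** w) * C * so (dinv (u ** w)) * so u)"
  proof (rule msum_cong)
  fix w assume w: "w : W"
  then have w': "dinv w : W" "dinv (u ** w) : W" "u ** w : W" using u by auto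
  have iv: "dinv (u ** w) ** u = dinv w" using u w by (simp add: D.inv_mult_group D.m_assoc)
  have x: "ta (u ** w) * C : cM l K" using rc(2)[OF w'(3)] C(1) by auto
  have "ta u * (ta w * C * so (dinv w)) = ta u * (ta w * C) * so (dinv w)"
  using rc(1)[OF w'(1)] rc(2)[OF w] rc(2)[OF u] C(1) by (intro assoc_mult_mat[symmetric, of _ l l _ K _ K]) auto
  also have "ta u * (ta w * C) = ta (u ** w) * C"
  unfolding rep_mult[OF ta u w] using rc(2)[OF w] rc(2)[OF u] C(1) by (intro assoc_mult_mat[symmetric, of _ l l _ l _ K]) auto
  also have "ta (u ** w) * C * so (dinv w) = ta (u ** w) * C * (so (dinv (u ** w)) * so u)"
  using rep_mult[OF so w'(2) u] iv by simp
  also have "... = ta (u ** w) * C * so (dinv (u ** w)) * so u"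
  by (rule assoc_mult_mat[symmetric, OF x rc(1)[OF w'(2)] rc(1)[OF u]])
  finally show "ta u * (ta w * C * so (dinv w)) = ta (u ** w) * C * so (dinv (u ** w)) * so u" .
  qed
  also have "... = msum l K (%w. ta w * C * so (dinv w) * so u)"
  unfolding msum_def by (intro eq_matI) (auto intro!: sum_W_shift[OF u, of "%w. (ta w * C * so (dinv w) * so u) $$ _"])
  also have "... = N * so u"
  unfolding N_def by (rule msum_mult[symmetric, OF rc(1)[OF u] tc])
  finally show ?thesis .
 qed
 show ?thesis
 proof (rule that[of "c *sm N"])
  show "c *sm N : cM l K" using N by auto
  have "(c *sm N) * Ph = c *sm (N * Ph)" by (rule mult_smult_assoc_mat[OF N Ph(1)])
  also have "... = om l" unfolding 1 using c by (intro eq_matI) auto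
  finally show "(c *sm N) * Ph = om l" .
  show "ALL w:W. ta w * (c *sm N) = (c *sm N) * so w"
  proof
  fix w assume w: "w : W"
  show "ta w * (c *sm N) = (c *sm N) * so w"
  using mult_smult_distrib[OF rc(2)[OF w] N, of c] mult_smult_assoc_mat[OF N rc(1)[OF w], of c] 2[OF w] by simp
  qed
 qed
qed

text \<open>A nonzero stable subspace of \<open>U\<close> of least dimension is irreducible;
  \<open>ta\<close> is the action on it in the basis \<open>B\<close>.\<close>

lemma irreducible_sub:
 assumes so: "rep K so" and U: "minv K so U" and ne: "U ~= {zv K}"
 obtains l B ta where "irr_rep l ta" "B : cM K l" "minj B" "(*v) B ` cV l <= U"
  "ALL w:W. so w * B = B * ta w"
proof -
 let ?P = "%l. 0 < l & (EX B ta. B : cM K l & minj B & (*v) B ` cV l <= U &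
  (ALL w:W. ta w : cM l l & so w * B = B * ta w))"
 \<comment> \<open>In a basis \<open>B\<close> of a stable subspace each group element acts by some
   matrix. That these matrices multiply correctly is recovered later from the injectivity of
   \<open>B\<close>.\<close>
 have sub: "EX ta. ALL w:W. ta w : cM l l & rx w * B = B * ta w"
  if B: "B : cM k l" "V = (*v) B ` cV l" and V: "minv k rx V" and rx: "rep k rx" for k l B V rx
 proof (intro bchoice ballI)
  fix w assume w: "w : W"
  have c: "rx w * B : cM k l" using B rep_carrier[OF rx w] by auto
  have "col (rx w * B) j : (*v) B ` cV l" if j: "j < l" for j
  proof -
  have "col B j = B *v unit_vec l j" using B j by (intro eq_vecI) (auto simp: scalar_prod_right_unit[of _ l])
  then have "col B j : V" using B by auto
  then have "rx w *v col B j : V" using V w unfolding minv_def by auto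
  moreover have "col (rx w * B) j = rx w *v col B j" using B j rep_carrier[OF rx w] by (intro eq_vecI) auto
  ultimately show ?thesis using B by simp
  qed
  from mat_image_factor[OF B(1) c this] show "EX T. T : cM l l & rx w * B = B * T" by metis
 qed
 have Us: "vsub K U" using U unfolding minv_def by auto
 obtain k B where B: "B : cM K k" "minj B" "U = (*v) B ` cV k" using subspace_basis[OF Us] by metis
 have "k ~= 0"
 proof
  assume "k = 0"
  then have "cV k = {zv k :: complex vec}" by auto
  then have "U = {B *v zv k}" using B(3) by auto
  then show False using ne B(1) by auto
 qed
 then have Pk: "?P k" using B sub[OF B(1,3) U so] by blast
 define l where "l = (LEAST l. ?P l)"
 have Pl: "?P l" unfolding l_def using LeastI[of ?P, OF Pk] .
 have least: "l <= l'" if "?P l'" for l' unfolding l_def using Least_le[of ?P, OF that] .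
 obtain B ta where l0: "0 < l" and B: "B : cM K l" "minj B" "(*v) B ` cV l <= U"
  and ta: "!!w. w : W ==> ta w : cM l l" "!!w. w : W ==> so w * B = B * ta w" using Pl by blast
 note sc = rep_carrier[OF so]
 have r: "rep l ta"
  unfolding rep_def
 proof (intro conjI ballI ta(1))
  have "B * ta e0 = B * om l" using ta(2)[OF e0_W] rep_one[OF so] B by simp
  then show "ta e0 = om l" using minj_cancel[OF B(1,2) ta(1)[OF e0_W]] by auto
  fix v w assume v: "v : W" and w: "w : W"
  have vw: "v ** w : W" using v w by simp
  have "B * ta (v ** w) = so v * so w * B" using ta(2)[OF vw] rep_mult[OF so v w] by simp
  also have "... = so v * (so w * B)" using assoc_mult_mat[OF sc[OF v] sc[OF w] B(1)] .
  also have "... = so v * B * ta w" using ta(2)[OF w] assoc_mult_mat[OF sc[OF v] B(1) ta(1)[OF w]] by simp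
  also have "... = B * (ta v * ta w)" using ta(2)[OF v] assoc_mult_mat[OF B(1) ta(1)[OF v] ta(1)[OF w]] by simp
  finally show "ta (v ** w) = ta v * ta w"
  using minj_cancel[OF B(1,2) ta(1)[OF vw]] ta(1)[OF v] ta(1)[OF w] by auto
 qed
 have "irr_rep l ta"
  unfolding irr_rep_def
 proof (intro conjI allI impI r l0)
  fix V assume V: "minv l ta V"
  then have Vs: "vsub l V" unfolding minv_def by auto
  obtain k C where C: "k <= l" "C : cM l k" "minj C" "V = (*v) C ` cV k" "k = l <-> V = cV l"
  using subspace_basis[OF Vs] .
  obtain ta' where ta': "ALL w:W. ta' w : cM k k & ta w * C = C * ta' w" using sub[OF C(2,4) V r] by auto
  show "V = {zv l} | V = cV l"
  proof (cases "k = 0")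
  case True
  then have "cV k = {zv k :: complex vec}" by auto
  then have "V = {C *v zv k}" using C(4) by auto
  then show ?thesis using C(2) by auto
  next
  case False
  \<comment> \<open>A nonzero stable subspace of \<open>ta\<close>, pushed into \<open>U\<close> by
    \<open>B\<close>, competes with \<open>l\<close> for the minimum, so it cannot be
    proper.\<close>
  have BC: "B * C : cM K k" using B C by auto
  have "?P k"
  proof (intro conjI exI[of _ "B * C"] exI[of _ ta'] ballI)
  show "minj (B * C)"
  proof (rule minj_I[OF BC])
  fix x assume x: "x : cV k" "(B * C) *v x = zv K"
  then have "B *v (C *v x) = zv K" using B C by (simp add: assoc_mult_mat_vec[OF B(1) C(2)])
  then have "C *v x = zv l" using minj_D[OF B(2,1)] x C by auto
  then show "x = zv k" using minj_D[OF C(3,2)] x by auto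
  qed
  show "(*v) (B * C) ` cV k <= U"
  proof
  fix y assume "y : (*v) (B * C) ` cV k"
  then obtain x where x: "x : cV k" "y = (B * C) *v x" by auto
  then have "y = B *v (C *v x)" by (simp add: assoc_mult_mat_vec[OF B(1) C(2)])
  then show "y : U" using B(3) C(2) x by auto
  qed
  fix w assume w: "w : W"
  have t: "ta' w : cM k k" "ta w * C = C * ta' w" using ta' w by auto
  show "ta' w : cM k k" by fact
  have "so w * (B * C) = so w * B * C" using assoc_mult_mat[OF sc[OF w] B(1) C(2)] by simp
  also have "... = B * (ta w * C)" using ta(2)[OF w] assoc_mult_mat[OF B(1) ta(1)[OF w] C(2)] by simp
  also have "... = B * C * ta' w" using t assoc_mult_mat[OF B(1) C(2) t(1)] by simp
  finally show "so w * (B * C) = B * C * ta' w" .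
  qed (use False BC in auto)
  then have "l <= k" by (rule least)
  then show ?thesis using C(1,5) by auto
  qed
 qed
 then show ?thesis using that B ta(2) by blast
qed

text \<open>Take the largest sum of irreducible representations that embeds equivariantly. If it is
  not everything, the kernel of an equivariant retraction onto it is nonzero and stable and contains
  one more irreducible representation.\<close>

lemma complete_reducibility:
 assumes so: "rep K so"
 obtains rxs Ph where "irreps rxs" "tdeg rxs = K" "Ph : cM K K" "minj Ph"
  "ALL w:W. so w * Ph = Ph * blocks rxs w"
proof -
 let ?P = "%k. EX rxs Ph. irreps rxs & tdeg rxs = k & Ph : cM K k & minj Ph &
  (ALL w:W. so w * Ph = Ph * blocks rxs w)"
 note sc = rep_carrier[OF so]
 have bl0: "blocks [] w = zm 0 0" for w unfolding blocks_def by simp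
 have 0: "?P 0"
  by (intro exI[of _ "[]"] exI[of _ "zm K 0"]) (auto simp: minj_def bl0 carrier_matD(1)[OF sc] intro!: eq_matI)
 have bd: "ALL k. ?P k --> k <= K" using minj_le by blast
 define k where "k = (GREATEST k. ?P k)"
 have Pk: "?P k" unfolding k_def using GreatestI_nat[of ?P, OF 0] bd by blast
 have mx: "k' <= k" if "?P k'" for k' unfolding k_def using Greatest_le_nat[of ?P k', OF that] bd by blast
 obtain rxs Ph where rxs: "irreps rxs" "tdeg rxs = k" and Ph: "Ph : cM K k" "minj Ph"
  and eq: "!!w. w : W ==> so w * Ph = Ph * blocks rxs w" using Pk by blast
 have br: "rep k (blocks rxs)" using blocks_rep rxs by auto
 have "k = K"
 proof (rule ccontr)
  assume "k ~= K"
  then have kK: "k < K" using minj_le[OF Ph(2,1)] by simp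
  obtain Ps where Ps: "Ps : cM k K" "Ps * Ph = om k" "ALL w:W. blocks rxs w * Ps = Ps * so w"
  using equivariant_left_inverse[OF so br Ph eq] .
  \<comment> \<open>\<open>U\<close> is the complement of the image of \<open>Ph\<close> cut out by
    the retraction \<open>Ps\<close>.\<close>
  define U where "U = {x : cV K. Ps *v x = zv k}"
  have "minv K so U"
  unfolding minv_def vsub_def
  proof (intro conjI ballI allI)
  show "U <= cV K" "zv K : U" unfolding U_def using Ps(1) by auto
  fix x assume x: "x : U"
  show "x + y : U" if "y : U" for y
  using x that Ps(1) unfolding U_def by (auto simp: mult_add_distrib_mat_vec)
  show "c *s x : U" for c using x Ps(1) unfolding U_def by (auto simp: mult_mat_vec)
  next
  fix w x assume w: "w : W" and x: "x : U"
  have xc: "x : cV K" "Ps *v x = zv k" using x unfolding U_def by auto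
  have "Ps *v (so w *v x) = (Ps * so w) *v x" using assoc_mult_mat_vec[OF Ps(1) sc[OF w] xc(1)] by simp
  also have "... = blocks rxs w *v (Ps *v x)"
  using bspec[OF Ps(3) w] assoc_mult_mat_vec[OF rep_carrier[OF br w] Ps(1) xc(1)] by simp
  also have "... = zv k" using xc rep_carrier[OF br w] by auto
  finally show "so w *v x : U" unfolding U_def using sc[OF w] xc by auto
  qed
  then have Ui: "minv K so U" .
  obtain x where x: "x : cV K" "x ~= zv K" "Ps *v x = zv k"
  using wide_mat_kernel[OF Ps(1) kK] .
  then have Une: "U ~= {zv K}" unfolding U_def by auto
  obtain l B ta where ta: "irr_rep l ta" and B: "B : cM K l" "minj B" "(*v) B ` cV l <= U"
  and eqB: "ALL w:W. so w * B = B * ta w" by (rule irreducible_sub[OF so Ui Une])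
  have l: "rep_deg ta = l" using rep_rep_deg irr_rep_rep ta by auto
  have tr: "rep l ta" using ta irr_rep_rep by auto
  have irr: "irreps (ta # rxs)" using ta l rxs by simp
  \<comment> \<open>\<open>E\<close> places the new embedding \<open>B\<close> beside
    \<open>Ph\<close>; the two zero blocks have no rows.\<close>
  define E where "E = four_block_mat B Ph (zm 0 l) (zm 0 k)"
  have E: "E : cM K (l + k)" unfolding E_def using B(1) Ph(1) by auto
  have Ev: "E *v x = B *v vec_first x l + Ph *v vec_last x k" if x: "x : cV (l + k)" for x
  proof -
  have "E *v (vec_first x l @\<^sub>v vec_last x k) = (B *v vec_first x l + Ph *v vec_last x k) @\<^sub>v (zm 0 l *v vec_first x l + zm 0 k *v vec_last x k)"
  unfolding E_def using B(1) Ph(1) by (intro four_block_mat_mult_vec) auto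
  also have "... = B *v vec_first x l + Ph *v vec_last x k" using B(1) Ph(1) by (intro eq_vecI) auto
  finally show ?thesis using vec_first_last_append[OF x] by simp
  qed
  have "minj E"
  proof (rule minj_I[OF E])
  fix x assume x: "x : cV (l + k)" "E *v x = zv K"
  let ?a = "vec_first x l" and ?b = "vec_last x k"
  have ab: "?a : cV l" "?b : cV k" by auto
  have s: "B *v ?a + Ph *v ?b = zv K" using Ev[OF x(1)] x(2) by simp
  have "B *v ?a : U" by (rule subsetD[OF B(3) imageI[OF ab(1)]])
  then have "Ps *v (B *v ?a) = zv k" unfolding U_def by auto
  moreover have "Ps *v (Ph *v ?b) = ?b" using assoc_mult_mat_vec[OF Ps(1) Ph(1) ab(2)] Ps(2) ab by simp
  moreover have "Ps *v (B *v ?a + Ph *v ?b) = Ps *v (B *v ?a) + Ps *v (Ph *v ?b)"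
  using Ps(1) B(1) Ph(1) ab by (intro mult_add_distrib_mat_vec) auto
  moreover have "Ps *v zv K = zv k" using Ps(1) by auto
  ultimately have b: "?b = zv k" using s ab by simp
  have "Ph *v zv k = zv K" using Ph(1) by auto
  moreover have "B *v ?a + zv K = B *v ?a" using B(1) ab by (intro right_zero_vec) auto
  ultimately have "B *v ?a = zv K" using s b by simp
  then have a: "?a = zv l" using minj_D[OF B(2,1)] by auto
  have "x = zv l @\<^sub>v zv k" using vec_first_last_append[OF x(1)] a b by simp
  then show "x = zv (l + k)" by (auto intro!: eq_vecI)
  qed
  moreover have "so w * E = E * blocks (ta # rxs) w" if w: "w : W" for w
  proof -
  note tc = rep_carrier[OF tr w] and bc = rep_carrier[OF br w]
  have "E * blocks (ta # rxs) w = four_block_mat (B * ta w) (Ph * blocks rxs w) (zm 0 l) (zm 0 k)"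
  unfolding E_def blocks_Cons[OF irr w] l rxs(2)
  by (subst mult_four_block_mat[OF B(1) Ph(1) _ _ tc _ _ bc]) (use B(1) Ph(1) tc bc in auto)
  also have "... = four_block_mat (so w * B) (so w * Ph) (zm 0 l) (zm 0 k)" using eq[OF w] bspec[OF eqB w] by simp
  also have "... = so w * E"
  proof (rule eq_matI)
  fix i j assume ij: "i < dim_row (so w * E)" "j < dim_col (so w * E)"
  then have i: "i < K" "j < l + k" using sc[OF w] E by auto
  have cE: "col E j = (if j < l then col B j else col Ph (j - l))"
  unfolding E_def using i B(1) Ph(1) by (intro eq_vecI) auto
  show "four_block_mat (so w * B) (so w * Ph) (zm 0 l) (zm 0 k) $$ (i,j) = (so w * E) $$ (i,j)"
  using i ij sc[OF w] B(1) Ph(1) cE by auto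
  qed (use sc[OF w] B(1) Ph(1) E in auto)
  finally show ?thesis by simp
  qed
  ultimately have "?P (l + k)" using irr E l rxs(2)
  by (intro exI[of _ "ta # rxs"] exI[of _ E]) auto
  then have "l + k <= k" by (rule mx)
  then show False using ta unfolding irr_rep_def by auto
 qed
 then show ?thesis using that rxs Ph eq by blast
qed

end

section \<open>Isomorphism classes, invariant pairings and multiplicities\<close>

lemma invertible_matE:
 assumes "invertible_mat T" "T : cM k k"
 obtains S where "S : cM k k" "T * S = om k" "S * T = om k"
proof -
 obtain S where S: "T * S = om (dim_row T)" "S * T = om (dim_row S)"
  using assms unfolding invertible_mat_def inverts_mat_def by auto
 have "dim_col (T * S) = k" "dim_col (S * T) = dim_row S" using S assms by auto
 then have "S : cM k k" using assms by auto
 then show ?thesis using that S assms by auto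
qed

lemma invertible_matI:
 assumes "T : cM k k" "S : cM k k" "T * S = om k" "S * T = om k"
 shows "invertible_mat T"
 using assms unfolding invertible_mat_def inverts_mat_def by (intro conjI exI[of _ S]) auto

definition hcat :: "complex mat => complex mat => complex mat" where
 "hcat A B = four_block_mat A B (zm 0 (dim_col A)) (zm 0 (dim_col B))"

lemma hcat_carrier: "A : cM k l ==> B : cM k t ==> hcat A B : cM k (l + t)"
 unfolding hcat_def by auto

lemma hcat_index:
 assumes "A : cM k l" "B : cM k t" "i < k" "j < l + t"
 shows "hcat A B $$ (i,j) = (if j < l then A $$ (i,j) else B $$ (i,j - l))"
 using assms unfolding hcat_def by auto

lemma hcat_inject:
 assumes c: "A : cM k l" "B : cM k t" "A' : cM k l" "B' : cM k t"
 shows "hcat A B = hcat A' B' <-> A = A' & B = B'"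
proof
 assume e: "hcat A B = hcat A' B'"
 have "A $$ (i,j) = A' $$ (i,j)" if "i < k" "j < l" for i j
  using hcat_index[OF c(1,2) that(1), of j] hcat_index[OF c(3,4) that(1), of j] that e by auto
 moreover have "B $$ (i,j) = B' $$ (i,j)" if "i < k" "j < t" for i j
  using hcat_index[OF c(1,2) that(1), of "l + j"] hcat_index[OF c(3,4) that(1), of "l + j"] that e by auto
 ultimately show "A = A' & B = B'" using c by (auto intro!: eq_matI)
qed simp

lemma hcat_split:
 assumes C: "C : cM k (l + t)"
 obtains A B where "A : cM k l" "B : cM k t" "C = hcat A B"
proof
 let ?A = "mat k l (%(i,j). C $$ (i,j))" and ?B = "mat k t (%(i,j). C $$ (i,l + j))"
 show c: "?A : cM k l" "?B : cM k t" by auto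
 show "C = hcat ?A ?B"
  by (rule eq_matI) (use C hcat_index[OF c] hcat_carrier[OF c] in auto)
qed

lemma mult_hcat:
 assumes c: "A : cM k l" "B : cM k t" and M: "M : cM m k"
 shows "M * hcat A B = hcat (M * A) (M * B)"
proof (rule eq_matI)
 have MA: "M * A : cM m l" "M * B : cM m t" using assms by auto
 fix i j assume "i < dim_row (hcat (M * A) (M * B))" "j < dim_col (hcat (M * A) (M * B))"
 then have ij: "i < m" "j < l + t" using hcat_carrier[OF MA] by auto
 have "col (hcat A B) j = (if j < l then col A j else col B (j - l))"
  unfolding hcat_def using ij c by (intro eq_vecI) auto
 then show "(M * hcat A B) $$ (i,j) = hcat (M * A) (M * B) $$ (i,j)"
  using ij c M hcat_index[OF MA ij] hcat_carrier[OF c] by auto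
qed (use assms in \<open>auto simp: hcat_def\<close>)

lemma hcat_mult_diag:
 assumes c: "A : cM k l" "B : cM k t" and M: "M : cM l l" "N : cM t t"
 shows "hcat A B * four_block_mat M (zm l t) (zm t l) N = hcat (A * M) (B * N)"
proof -
 have "hcat A B * four_block_mat M (zm l t) (zm t l) N = four_block_mat (A * M + B * zm t l) (A * zm l t + B * N)
  (zm 0 l * M + zm 0 t * zm t l) (zm 0 l * zm l t + zm 0 t * N)"
  unfolding hcat_def using c by (subst mult_four_block_mat[OF c _ _ M(1) _ _ M(2)]) auto
 also have "... = hcat (A * M) (B * N)"
  unfolding hcat_def using c M by (intro cong_four_block_mat) auto
 finally show ?thesis .
qed

definition mat_space :: "nat => nat => complex mat set => (complex, complex mat) module" where
 "mat_space k l C = (|carrier = C, monoid.mult = undefined, one = undefined, zero = zm k l, add = (+), module.smult = (*sm)|)"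

lemma mat_space_simps [simp]:
 "cr (mat_space k l C) = C" "x +[mat_space k l C] y = x + y" "0[mat_space k l C] = zm k l" "c *[mat_space k l C] x = c *sm x"
 by (auto simp: mat_space_def)

lemma cvs_mat_space:
 assumes C: "C <= cM k l" "zm k l : C" "!!x y. x : C ==> y : C ==> x + y : C" "!!c x. x : C ==> c *sm x : C"
 shows "cvs (mat_space k l C)"
proof (rule cvsI)
 show "abelian_group (mat_space k l C)"
 proof (rule abelian_groupI)
  fix x assume x: "x : cr (mat_space k l C)"
  show "EX y:cr (mat_space k l C). y +[mat_space k l C] x = 0[mat_space k l C]"
  using x C(1,4) by (intro bexI[of _ "(-1) *sm x"]) (auto intro!: eq_matI)
 qed (use C in \<open>auto intro!: comm_add_mat[of _ k l] assoc_add_mat[of _ k l] left_add_zero_mat[of _ k l]\<close>)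
qed (use C(3,4) in \<open>auto intro!: eq_matI simp: algebra_simps carrier_matD[OF subsetD[OF C(1)]]\<close>)

context dih
begin

lemma rep_isoE:
 assumes "rep_iso n rx so" "rep_deg rx = k"
 obtains T S where "rep_deg so = k" "T : cM k k" "S : cM k k" "T * S = om k" "S * T = om k"
  "ALL w:W. T * rx w = so w * T"
proof -
 obtain T where T: "T : cM k k" "invertible_mat T" "!!w. w : W ==> T * rx w = so w * T" "rep_deg so = k"
  using assms unfolding rep_iso_def by auto
 show ?thesis by (rule invertible_matE[OF T(2,1)]) (use T that in simp)
qed

lemma rep_isoI:
 assumes "rep_deg rx = k" "rep_deg so = k" "T : cM k k" "S : cM k k" "T * S = om k" "S * T = om k"
  "!!w. w : W ==> T * rx w = so w * T"
 shows "rep_iso n rx so"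
 unfolding rep_iso_def
proof (intro conjI bexI[of _ T] ballI)
 show "invertible_mat T" by (rule invertible_matI[OF assms(3-6)])
qed (use assms in simp_all)

lemma rep_iso_refl: "rep k rx ==> rep_iso n rx rx"
 by (rule rep_isoI[of _ k _ "om k" "om k"]) (simp_all add: rep_rep_deg left_mult_one_mat[OF rep_carrier] right_mult_one_mat[OF rep_carrier])

lemma rep_iso_sym:
 assumes "rep k rx" "rep l so" "rep_iso n rx so" shows "rep_iso n so rx"
proof -
 have k: "rep_deg rx = k" "rep_deg so = l" using assms rep_rep_deg by auto
 obtain T S where T: "rep_deg so = k" "T : cM k k" "S : cM k k" "T * S = om k" "S * T = om k"
  "ALL w:W. T * rx w = so w * T" by (rule rep_isoE[OF assms(3) k(1)])
 have "S * so w = rx w * S" if w: "w : W" for w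
 proof -
  have c: "rx w : cM k k" "so w : cM k k" using assms rep_carrier w k T(1) by auto
  have "S * so w = S * (so w * (T * S))" using T(4) c T by simp
  also have "... = S * (so w * T) * S" using c T(2,3) by (simp add: assoc_mult_mat[of _ k k _ k _ k])
  also have "... = S * (T * rx w) * S" using bspec[OF T(6) w] by simp
  also have "... = S * T * rx w * S" using c T(2,3) by (simp add: assoc_mult_mat[of _ k k _ k _ k])
  also have "... = rx w * S" unfolding T(5) using c by simp
  finally show ?thesis .
 qed
 then show ?thesis using T k by (intro rep_isoI[of _ k _ S T]) auto
qed

lemma rep_iso_trans:
 assumes "rep k rx" "rep l so" "rep m ta" "rep_iso n rx so" "rep_iso n so ta" shows "rep_iso n rx ta"
proof -
 have k: "rep_deg rx = k" "rep_deg so = l" "rep_deg ta = m" using assms rep_rep_deg by auto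
 obtain T S where T: "rep_deg so = k" "T : cM k k" "S : cM k k" "T * S = om k" "S * T = om k"
  "ALL w:W. T * rx w = so w * T" by (rule rep_isoE[OF assms(4) k(1)])
 obtain T' S' where T': "rep_deg ta = k" "T' : cM k k" "S' : cM k k" "T' * S' = om k" "S' * T' = om k"
  "ALL w:W. T' * so w = ta w * T'" by (rule rep_isoE[OF assms(5) T(1)])
 show ?thesis
 proof (rule rep_isoI[of _ k _ "T' * T" "S * S'"])
  show "T' * T : cM k k" "S * S' : cM k k" using T T' by auto
  have "T' * T * (S * S') = T' * (T * S * S')" using T(2,3) T'(2,3) by (simp add: assoc_mult_mat[of _ k k _ k _ k])
  also have "... = om k" unfolding T(4) using T' by simp
  finally show "T' * T * (S * S') = om k" .
  have "S * S' * (T' * T) = S * (S' * T' * T)" using T(2,3) T'(2,3) by (simp add: assoc_mult_mat[of _ k k _ k _ k])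
  also have "... = om k" unfolding T'(5) using T by simp
  finally show "S * S' * (T' * T) = om k" .
  fix w assume w: "w : W"
  have c: "rx w : cM k k" "so w : cM k k" "ta w : cM k k"
  using assms rep_carrier w k T(1) T'(1) by auto
  have "T' * T * rx w = T' * (T * rx w)" using c T(2) T'(2) by (simp add: assoc_mult_mat[of _ k k _ k _ k])
  also have "... = T' * so w * T" using c T(2) T'(2) bspec[OF T(6) w] by (simp add: assoc_mult_mat[of _ k k _ k _ k])
  also have "... = ta w * (T' * T)" using c T(2) T'(2) bspec[OF T'(6) w] by (simp add: assoc_mult_mat[of _ k k _ k _ k])
  finally show "T' * T * rx w = ta w * (T' * T)" .
 qed (use k T'(1) in auto)
qed

text \<open>The invariant form \<open>bq\<close> on \<open>so\<close> identifies this representation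
  with its dual, and thereby intertwiners from \<open>rx\<close> to \<open>so\<close> with invariant
  pairings of the two.\<close>

lemma rep_iso_pairing:
 assumes rx: "irr_rep k rx" and so: "irr_rep l so"
 shows "rep_iso n rx so <-> (EX b. inv_pair k l rx so b & b ~= zm k l)"
proof
 have r: "rep k rx" "rep l so" using rx so irr_rep_rep by auto
 then have k: "rep_deg rx = k" "rep_deg so = l" using rep_rep_deg by auto
 obtain bq where bq: "inv_pair l l so so bq" "bq ~= zm l l" using self_dual[OF so] .
 have bqc: "bq : cM l l" and bqd: "det bq ~= 0" using bq schur_nondeg[OF so so bq] unfolding inv_pair_def by auto
 obtain bq' where bq': "bq' : cM l l" "bq * bq' = om l" "bq' * bq = om l" using det_nonzero_inverse[OF bqc bqd] .
 { assume "rep_iso n rx so"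
  then obtain T S where T: "rep_deg so = k" "T : cM k k" "S : cM k k" "T * S = om k" "S * T = om k"
  "ALL w:W. T * rx w = so w * T" using k(1) by (metis rep_isoE)
  have kl: "l = k" using T(1) k by simp
  \<comment> \<open>This is the pairing \<open>b(x, y) = bq(T x, y)\<close>.\<close>
  have ip: "inv_pair k l rx so (T\<^sup>T * bq)"
  unfolding inv_pair_def
  proof (intro conjI ballI)
  show "T\<^sup>T * bq : cM k l" using T bqc kl by auto
  fix w assume w: "w : W"
  have c: "rx w : cM k k" "so w : cM k k" using r rep_carrier w kl by auto
  have "(rx w)\<^sup>T * (T\<^sup>T * bq) * so w = (T * rx w)\<^sup>T * bq * so w"
  using c T(2) bqc kl by (simp add: transpose_mult[of _ k k _ k] assoc_mult_mat[of _ k k _ k _ k])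
  also have "... = T\<^sup>T * ((so w)\<^sup>T * bq * so w)" unfolding bspec[OF T(6) w]
  using c T(2) bqc kl by (simp add: transpose_mult[of _ k k _ k] assoc_mult_mat[of _ k k _ k _ k])
  also have "... = T\<^sup>T * bq" using bq(1) w unfolding inv_pair_def by simp
  finally show "(rx w)\<^sup>T * (T\<^sup>T * bq) * so w = T\<^sup>T * bq" .
  qed
  have "T\<^sup>T * bq ~= zm k l"
  proof
  assume z: "T\<^sup>T * bq = zm k l"
  have "S\<^sup>T * (T\<^sup>T * bq) = S\<^sup>T * T\<^sup>T * bq" using T bqc kl by (simp add: assoc_mult_mat[of _ k k _ k _ k])
  also have "S\<^sup>T * T\<^sup>T = om k" using T transpose_mult[OF T(2,3)] by simp
  finally have "bq = zm k k" using z T(3) bqc kl by simp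
  then show False using bq(2) kl by simp
  qed
  with ip show "EX b. inv_pair k l rx so b & b ~= zm k l" by auto }
 { assume "EX b. inv_pair k l rx so b & b ~= zm k l"
  then obtain b where b: "inv_pair k l rx so b" "b ~= zm k l" by auto
  have kl: "l = k" and bd: "det b ~= 0" using schur_nondeg[OF rx so b] by auto
  have bc: "b : cM k k" using b kl unfolding inv_pair_def by auto
  have bqc: "bq : cM k k" and bq': "bq' : cM k k" "bq * bq' = om k" "bq' * bq = om k"
  using bqc bq' kl by auto
  have bt: "det b\<^sup>T ~= 0" using bd det_transpose[OF bc] by simp
  obtain c where c: "c : cM k k" "b\<^sup>T * c = om k" "c * b\<^sup>T = om k"
  using det_nonzero_inverse[OF _ bt, of k] bc by auto
  have btc: "b\<^sup>T : cM k k" using bc by simp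
  show "rep_iso n rx so"
  \<comment> \<open>The candidate is the matrix \<open>T\<close> defined by
    \<open>bq(y, T x) = b(x, y)\<close>; the second matrix is its inverse.\<close>
  proof (rule rep_isoI[of _ k _ "bq' * b\<^sup>T" "c * bq"])
  show "bq' * b\<^sup>T : cM k k" "c * bq : cM k k" using btc c bq' bqc by auto
  have "bq' * b\<^sup>T * (c * bq) = bq' * (b\<^sup>T * c * bq)" using btc c(1) bq'(1) bqc by (simp add: assoc_mult_mat[of _ k k _ k _ k])
  also have "... = om k" unfolding c(2) using bq' bqc by simp
  finally show "bq' * b\<^sup>T * (c * bq) = om k" .
  have "c * bq * (bq' * b\<^sup>T) = c * (bq * bq' * b\<^sup>T)" using btc c(1) bq'(1) bqc by (simp add: assoc_mult_mat[of _ k k _ k _ k])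
  also have "... = om k" unfolding bq'(2) using btc c by simp
  finally show "c * bq * (bq' * b\<^sup>T) = om k" .
  fix w assume w: "w : W"
  have cc: "rx w : cM k k" "so w : cM k k" "so (dinv w) : cM k k" using r rep_carrier w kl by auto
  have 1: "(so w)\<^sup>T * b\<^sup>T * rx w = b\<^sup>T" using inv_pair_transpose[OF r b(1)] w unfolding inv_pair_def by auto
  have 2: "(so w)\<^sup>T * bq * so w = bq" using bq(1) w unfolding inv_pair_def by auto
  have 3: "(so (dinv w))\<^sup>T * (so w)\<^sup>T = om k"
  using transpose_mult[OF cc(2,3)] rep_inv[OF r(2) w] kl by simp
  have e: "X = (so (dinv w))\<^sup>T * Y" if "(so w)\<^sup>T * X = Y" "X : cM k k" for X Y
  proof -
  have "(so (dinv w))\<^sup>T * ((so w)\<^sup>T * X) = (so (dinv w))\<^sup>T * (so w)\<^sup>T * X"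
  using that(2) cc by (simp add: assoc_mult_mat[of _ k k _ k _ k])
  also have "... = X" unfolding 3 using that by simp
  finally show ?thesis using that(1) by simp
  qed
  have "b\<^sup>T * rx w = (so (dinv w))\<^sup>T * b\<^sup>T"
  by (rule e) (use 1 cc btc in \<open>auto simp: assoc_mult_mat[of _ k k _ k _ k]\<close>)
  moreover have "bq * so w = (so (dinv w))\<^sup>T * bq"
  by (rule e) (use 2 cc bqc in \<open>auto simp: assoc_mult_mat[of _ k k _ k _ k]\<close>)
  moreover have "so w = bq' * (bq * so w)"
  proof -
  have "bq' * (bq * so w) = bq' * bq * so w" using bq'(1) bqc cc by (simp add: assoc_mult_mat[of _ k k _ k _ k])
  then show ?thesis unfolding bq'(3) using cc by simp
  qed
  ultimately have "so w * (bq' * b\<^sup>T) = bq' * ((so (dinv w))\<^sup>T * bq) * (bq' * b\<^sup>T)" by metis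
  also have "... = bq' * (so (dinv w))\<^sup>T * (bq * bq' * b\<^sup>T)"
  using bq'(1) bqc cc btc by (simp add: assoc_mult_mat[of _ k k _ k _ k])
  also have "... = bq' * ((so (dinv w))\<^sup>T * b\<^sup>T)" unfolding bq'(2)
  using bq'(1) cc btc by (simp add: assoc_mult_mat[of _ k k _ k _ k])
  also have "... = bq' * b\<^sup>T * rx w" using \<open>b\<^sup>T * rx w = _\<close> bq'(1) cc btc by (simp add: assoc_mult_mat[of _ k k _ k _ k])
  finally show "bq' * b\<^sup>T * rx w = so w * (bq' * b\<^sup>T)" by simp
  qed (use k kl in auto) }
qed

abbreviation irr_rel :: "(mrep \<times> mrep) set" where
 "irr_rel == {(rx, so). irreducible_rep n rx & irreducible_rep n so & rep_iso n rx so}"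

lemma irreducible_rep_rep: "irreducible_rep n rx ==> rep (rep_deg rx) rx"
 using irreducible_iff irr_rep_rep by blast

lemma equiv_irr: "equiv {rx. irreducible_rep n rx} irr_rel"
proof (rule equivI)
 show "irr_rel <= {rx. irreducible_rep n rx} \<times> {rx. irreducible_rep n rx}" by auto
 show "refl_on {rx. irreducible_rep n rx} irr_rel"
  by (rule refl_onI) (use irreducible_rep_rep rep_iso_refl in auto)
 show "sym irr_rel" by (rule symI) (use irreducible_rep_rep rep_iso_sym in blast)
 show "trans irr_rel" by (rule transI) (use irreducible_rep_rep rep_iso_trans in blast)
qed

lemma rep_of_in: "nu : Irr n ==> rep_of nu : nu"
 using in_quotient_imp_non_empty[OF equiv_irr, of nu] some_in_eq[of nu] unfolding rep_of_def Irr_def by blast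

lemma in_Irr_iff:
 assumes "nu : Irr n"
 shows "rx : nu <-> irreducible_rep n rx & rep_iso n (rep_of nu) rx"
proof -
 have q: "nu : {rx. irreducible_rep n rx} // irr_rel" using assms unfolding Irr_def .
 have 1: "(rep_of nu, rx) : irr_rel" if "rx : nu"
  using quotient_eq_iff[OF equiv_irr q q rep_of_in[OF assms] that] by simp
 have 2: "rx : nu" if "(rep_of nu, rx) : irr_rel"
  using in_quotient_imp_closed[OF equiv_irr q rep_of_in[OF assms] that] .
 have 3: "irreducible_rep n (rep_of nu)"
  using subsetD[OF in_quotient_imp_subset[OF equiv_irr q] rep_of_in[OF assms]] by (rule CollectD)
 show ?thesis using 1 2 3 by blast
qed

lemma rep_of_irr: "nu : Irr n ==> irreducible_rep n (rep_of nu)"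
 using in_Irr_iff rep_of_in by blast

lemma Irr_eqI:
 assumes "nu : Irr n" "mu : Irr n" "rep_iso n (rep_of nu) (rep_of mu)"
 shows "nu = mu"
proof -
 have "rep_of mu : nu" using in_Irr_iff[OF assms(1)] rep_of_irr[OF assms(2)] assms(3) by blast
 then have "nu \<inter> mu ~= {}" using rep_of_in[OF assms(2)] by auto
 then show ?thesis using quotient_disj[OF equiv_irr, of nu mu] assms unfolding Irr_def by auto
qed

abbreviation "pairs k l rx so == mat_space k l {b. inv_pair k l rx so b}"

lemma inv_pair_zero:
 assumes "rep k rx" "rep l so" shows "inv_pair k l rx so (zm k l)"
 unfolding inv_pair_def
proof (intro conjI ballI)
 fix w assume w: "w : W"
 show "(rx w)\<^sup>T * zm k l * so w = zm k l" using rep_carrier[OF assms(1) w] rep_carrier[OF assms(2) w] by simp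
qed simp

lemma cvs_pairs:
 assumes "rep k rx" "rep l so" shows "cvs (pairs k l rx so)"
proof (rule cvs_mat_space)
 show "{b. inv_pair k l rx so b} <= cM k l" unfolding inv_pair_def by auto
 have 0: "inv_pair k l rx so (zm k l)" by (rule inv_pair_zero[OF assms])
 then show "zm k l : {b. inv_pair k l rx so b}" by simp
 fix x y assume "x : {b. inv_pair k l rx so b}" "y : {b. inv_pair k l rx so b}"
 then have xy: "inv_pair k l rx so x" "inv_pair k l rx so y" by auto
 then have c: "x : cM k l" "y : cM k l" unfolding inv_pair_def by auto
 have "x - (-1) *sm y = x + y" using c by (intro eq_matI) auto
 then show "x + y : {b. inv_pair k l rx so b}" using inv_pair_lin[OF xy assms, of "-1"] by simp
next
 fix c x assume "x : {b. inv_pair k l rx so b}"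
 then have x: "inv_pair k l rx so x" by auto
 have 0: "inv_pair k l rx so (zm k l)" by (rule inv_pair_zero[OF assms])
 have "x : cM k l" using x unfolding inv_pair_def by auto
 then have "zm k l - (-c) *sm x = c *sm x" by (intro eq_matI) auto
 then show "c *sm x : {b. inv_pair k l rx so b}" using inv_pair_lin[OF 0 x assms, of "-c"] by simp
qed

lemma vdim_pairs_irr:
 assumes rx: "irr_rep k rx" and so: "irr_rep l so"
 shows "vdim (pairs k l rx so) (if rep_iso n rx so then 1 else 0)"
proof (cases "rep_iso n rx so")
 case True
 then obtain b where b: "inv_pair k l rx so b" "b ~= zm k l" using rep_iso_pairing[OF assms] by auto
 have r: "rep k rx" "rep l so" using rx so irr_rep_rep by auto
 interpret V: lmod complex_ring "pairs k l rx so" by (rule cvs_pairs[OF r])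
 have bc: "b : cM k l" using b unfolding inv_pair_def by auto
 define fy where "fy x = (x $ 0) *sm b" for x :: "complex vec"
 have "clin (vecs 1) (pairs k l rx so) fy"
  unfolding clin_def
 proof (intro ballI conjI allI)
  fix x c assume x: "x : cr (vecs 1)"
  show "fy x : cr (pairs k l rx so)" unfolding fy_def using V.smult_closed[of "x $ 0" b] b by simp
  show "fy (c *[vecs 1] x) = c *[pairs k l rx so] fy x" unfolding fy_def using x bc by (intro eq_matI) auto
  fix y assume y: "y : cr (vecs 1)"
  show "fy (x +[vecs 1] y) = fy x +[pairs k l rx so] fy y"
  unfolding fy_def using x y bc by (intro eq_matI) (auto simp: algebra_simps)
 qed
 moreover have "inj_on fy (cV 1)"
 proof (rule inj_onI)
  fix x y assume x: "x : cV 1" and y: "y : cV 1" and e: "fy x = fy y"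
  obtain i j where ij: "i < k" "j < l" "b $$ (i,j) ~= 0"
  using b(2) bc by (metis (no_types, lifting) carrier_matD eq_matI index_zero_mat)
  have "fy x $$ (i,j) = fy y $$ (i,j)" using e by simp
  then have "x $ 0 = y $ 0" unfolding fy_def using ij bc by simp
  then show "x = y" using x y by (intro eq_vecI) auto
 qed
 moreover have "fy ` cV 1 = {b. inv_pair k l rx so b}"
 proof
  show "fy ` cV 1 <= {b. inv_pair k l rx so b}" using calculation(1) unfolding clin_def by auto
  show "{b. inv_pair k l rx so b} <= fy ` cV 1"
  proof
  fix c assume "c : {b. inv_pair k l rx so b}"
  then obtain z where z: "c = z *sm b" using schur_scalar[OF rx so b] by auto
  then have "c = fy (vec 1 (%_. z))" unfolding fy_def by simp
  then show "c : fy ` cV 1" by (metis image_eqI vec_carrier)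
  qed
 qed
 ultimately show ?thesis using True unfolding vdim_def bij_betw_def by auto
next
 case False
 have r: "rep k rx" "rep l so" using rx so irr_rep_rep by auto
 interpret V: lmod complex_ring "pairs k l rx so" by (rule cvs_pairs[OF r])
 have "{b. inv_pair k l rx so b} = {zm k l}" using False rep_iso_pairing[OF assms] inv_pair_zero[OF r] by blast
 then show ?thesis using False vdim_zero[OF cvs_pairs[OF r]] by simp
qed

lemma inv_pair_blocks_Cons:
 assumes rx: "rep k rx" and irr: "irreps (so # rxs)" and A: "A : cM k (rep_deg so)" and B: "B : cM k (tdeg rxs)"
 shows "inv_pair k (tdeg (so # rxs)) rx (blocks (so # rxs)) (hcat A B) <->
  inv_pair k (rep_deg so) rx so A & inv_pair k (tdeg rxs) rx (blocks rxs) B"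
proof -
 have "(rx w)\<^sup>T * hcat A B * blocks (so # rxs) w = hcat A B <-> (rx w)\<^sup>T * A * so w = A & (rx w)\<^sup>T * B * blocks rxs w = B"
  if w: "w : W" for w
 proof -
  have rxw: "(rx w)\<^sup>T : cM k k" using rep_carrier[OF rx w] by simp
  have sow: "so w : cM (rep_deg so) (rep_deg so)" using irr w rep_carrier irr_rep_rep by auto
  have bw: "blocks rxs w : cM (tdeg rxs) (tdeg rxs)" using blocks_carrier irr w by auto
  have c: "(rx w)\<^sup>T * A : cM k (rep_deg so)" "(rx w)\<^sup>T * B : cM k (tdeg rxs)" using rxw A B by auto
  have "(rx w)\<^sup>T * hcat A B * blocks (so # rxs) w = hcat ((rx w)\<^sup>T * A * so w) ((rx w)\<^sup>T * B * blocks rxs w)"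
  unfolding mult_hcat[OF A B rxw] blocks_Cons[OF irr w] by (rule hcat_mult_diag[OF c sow bw])
  then show ?thesis using c sow bw A B by (simp add: hcat_inject[of _ k "rep_deg so" _ "tdeg rxs"])
 qed
 then show ?thesis unfolding inv_pair_def using A B hcat_carrier[OF A B] by auto
qed

text \<open>This turns a multiplicity read off a decomposition into the dimension of a space that
  does not mention individual summands.\<close>

lemma vdim_pairs_blocks:
 assumes rx: "irr_rep k rx"
 shows "irreps rxs ==> vdim (pairs k (tdeg rxs) rx (blocks rxs)) (length (filter (rep_iso n rx) rxs))"
proof (induction rxs)
 case Nil
 have "inv_pair k 0 rx (blocks []) b <-> b = zm k 0" for b
 proof
  assume "b = zm k 0"
  then show "inv_pair k 0 rx (blocks []) b" using inv_pair_zero[OF irr_rep_rep[OF rx] blocks_rep[of "[]"]] by simp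
 qed (auto simp: inv_pair_def intro!: eq_matI)
 then have "cr (pairs k 0 rx (blocks [])) = {0[pairs k 0 rx (blocks [])]}" by auto
 then show ?case using vdim_zero[OF cvs_pairs[OF irr_rep_rep[OF rx], of 0 "blocks []"]] blocks_rep[of "[]"] by simp
next
 case (Cons so rxs)
 let ?l = "rep_deg so" and ?t = "tdeg rxs" and ?T = "tdeg (so # rxs)"
 let ?V = "pairs k ?T rx (blocks (so # rxs))" and ?W = "pairs k ?t rx (blocks rxs)" and ?U = "pairs k ?l rx so"
 have r: "rep k rx" using rx irr_rep_rep by auto
 have so: "irr_rep ?l so" using Cons by auto
 have V: "cvs ?V" by (rule cvs_pairs[OF r blocks_rep[OF Cons(2)]])
 have W: "cvs ?W" using Cons by (intro cvs_pairs[OF r blocks_rep]) auto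
 have U: "cvs ?U" using so irr_rep_rep by (intro cvs_pairs[OF r]) auto
 interpret U: lmod complex_ring ?U by (rule U)
 interpret W: lmod complex_ring ?W by (rule W)
 \<comment> \<open>Restriction of a pairing to the tail of the list is onto, and its kernel consists
   of the pairings with \<open>so\<close> alone; rank-nullity adds the two counts.\<close>
 define p where "p C = mat k ?t (%(i,j). C $$ (i,?l + j))" for C :: "complex mat"
 have ph: "p (hcat A B) = B" if "A : cM k ?l" "B : cM k ?t" for A B
  unfolding p_def using that by (intro eq_matI) (auto simp: hcat_index[of _ k ?l _ ?t])
 have split: "EX A B. A : cM k ?l & B : cM k ?t & C = hcat A B & inv_pair k ?l rx so A & inv_pair k ?t rx (blocks rxs) B"
  if "inv_pair k ?T rx (blocks (so # rxs)) C" for C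
 proof -
  have "C : cM k (?l + ?t)" using that unfolding inv_pair_def by simp
  then obtain A B where "A : cM k ?l" "B : cM k ?t" "C = hcat A B" by (rule hcat_split)
  then show ?thesis using inv_pair_blocks_Cons[OF r Cons(2)] that by blast
 qed
 have pc: "clin ?V ?W p"
  unfolding clin_def
 proof (intro ballI conjI allI)
  fix x c assume "x : cr ?V"
  then have x: "inv_pair k ?T rx (blocks (so # rxs)) x" by simp
  then have xc: "x : cM k (?l + ?t)" unfolding inv_pair_def by simp
  show "p x : cr ?W" using split[OF x] ph by auto
  show "p (c *[?V] x) = c *[?W] p x" unfolding p_def using xc by (intro eq_matI) auto
  fix y assume "y : cr ?V"
  then have "y : cM k (?l + ?t)" unfolding inv_pair_def by simp
  then show "p (x +[?V] y) = p x +[?W] p y" unfolding p_def using xc by (intro eq_matI) auto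
 qed
 have w: "vdim ?W (length (filter (rep_iso n rx) rxs))" using Cons by auto
 have Ac: "A : cM k ?l" if "inv_pair k ?l rx so A" for A using that unfolding inv_pair_def by auto
 have Bc: "B : cM k ?t" if "inv_pair k ?t rx (blocks rxs) B" for B using that unfolding inv_pair_def by auto
 have Bz: "inv_pair k ?t rx (blocks rxs) (zm k ?t)" using W.zero_closed by simp
 have Az: "inv_pair k ?l rx so (zm k ?l)" using U.zero_closed by simp
 let ?K = "{x : cr ?V. p x = 0[?W]}"
 have hc: "clin ?U (?V(|carrier := ?K|)) (%A. hcat A (zm k ?t))"
  unfolding clin_def
 proof (intro ballI conjI allI)
  fix x c assume "x : cr ?U"
  then have x: "inv_pair k ?l rx so x" by simp
  note xc = Ac[OF x]
  show "hcat x (zm k ?t) : cr (?V(|carrier := ?K|))"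
  using inv_pair_blocks_Cons[OF r Cons(2) xc, of "zm k ?t"] x Bz ph[OF xc, of "zm k ?t"] by simp
  show "hcat (c *[?U] x) (zm k ?t) = c *[?V(|carrier := ?K|)] hcat x (zm k ?t)"
  using xc by (intro eq_matI) (auto simp: hcat_def)
  fix y assume "y : cr ?U"
  then have "y : cM k ?l" using Ac by simp
  then show "hcat (x +[?U] y) (zm k ?t) = hcat x (zm k ?t) +[?V(|carrier := ?K|)] hcat y (zm k ?t)"
  using xc by (intro eq_matI) (auto simp: hcat_def)
 qed
 have hb: "bij_betw (%A. hcat A (zm k ?t)) (cr ?U) (cr (?V(|carrier := ?K|)))"
  unfolding bij_betw_def
 proof
  show "inj_on (%A. hcat A (zm k ?t)) (cr ?U)"
  by (rule inj_onI) (use Ac hcat_inject[of _ k ?l _ ?t] in auto)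
  have "x : (%A. hcat A (zm k ?t)) ` cr ?U" if x: "x : ?K" for x
  proof -
  obtain A B where AB: "A : cM k ?l" "B : cM k ?t" "x = hcat A B" "inv_pair k ?l rx so A"
  using split[of x] x by auto
  then show ?thesis using ph[OF AB(1,2)] x by auto
  qed
  moreover have "hcat A (zm k ?t) : ?K" if "A : cr ?U" for A using clin_closed[OF hc that] by simp
  ultimately show "(%A. hcat A (zm k ?t)) ` cr ?U = cr (?V(|carrier := ?K|))" by auto
 qed
 have ka: "vdim (?V(|carrier := ?K|)) (if rep_iso n rx so then 1 else 0)"
  by (rule vdim_iso[OF vdim_pairs_irr[OF rx so] hc hb])
 have "p ` cr ?V = cr ?W"
 proof
  show "p ` cr ?V <= cr ?W" using pc unfolding clin_def by auto
  show "cr ?W <= p ` cr ?V"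
  proof
  fix B assume "B : cr ?W"
  then have B: "inv_pair k ?t rx (blocks rxs) B" by simp
  have "hcat (zm k ?l) B : cr ?V" using inv_pair_blocks_Cons[OF r Cons(2) _ Bc[OF B], of "zm k ?l"] B Az by simp
  moreover have "p (hcat (zm k ?l) B) = B" using ph Bc[OF B] by simp
  ultimately show "B : p ` cr ?V" by (metis image_eqI)
  qed
 qed
 then have surj: "p ` cr ?V = cr ?W" .
 obtain v where "vdim ?V v" "v <= length (filter (rep_iso n rx) rxs) + (if rep_iso n rx so then 1 else 0)"
  "v = length (filter (rep_iso n rx) rxs) + (if rep_iso n rx so then 1 else 0) <-> p ` cr ?V = cr ?W"
  by (rule vdim_extension[OF V W pc w ka])
 then show ?case using surj by (cases "rep_iso n rx so") simp_all
qed

end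

section \<open>The skew group algebra\<close>

declare split_paired_All [simp del] split_paired_Ex [simp del]

definition sdeg :: "nat \<times> nat => int" where "sdeg k = int (fst k + snd k)"

lemma S_decomp: "(p :: S) = (SUM k:Poly_Mapping.keys p. Poly_Mapping.single k (Poly_Mapping.lookup p k))"
proof (rule poly_mapping_eqI)
 fix k
 have "Poly_Mapping.lookup (SUM k:Poly_Mapping.keys p. Poly_Mapping.single k (Poly_Mapping.lookup p k)) k
  = (SUM j:Poly_Mapping.keys p. if j = k then Poly_Mapping.lookup p k else 0)"
  unfolding lookup_sum by (intro sum.cong refl) (auto simp: lookup_single when_def)
 also have "... = Poly_Mapping.lookup p k" by (auto simp: in_keys_iff)
 finally show "Poly_Mapping.lookup p k = Poly_Mapping.lookup (SUM k:Poly_Mapping.keys p. Poly_Mapping.single k (Poly_Mapping.lookup p k)) k" by simp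
qed

lemma additive_sum:
 fixes f :: "'a::ab_group_add => 'b::ab_group_add"
 assumes "!!x y. f (x + y) = f x + f y"
 shows "f (sum g A) = (SUM i:A. f (g i))"
proof -
 have "f 0 + f 0 = f 0" using assms[of 0 0] by simp
 then have "f 0 = 0" by simp
 then show ?thesis by (induction A rule: infinite_finite_induct) (auto simp: assms)
qed

lemma S_ext:
 fixes f g :: "S => 'b::ab_group_add"
 assumes "!!x y. f (x + y) = f x + f y" "!!x y. g (x + y) = g x + g y"
  and "!!k c. f (Poly_Mapping.single k c) = g (Poly_Mapping.single k c)"
 shows "f p = g p"
 by (subst (1 2) S_decomp) (simp add: additive_sum[of f, OF assms(1)] additive_sum[of g, OF assms(2)] assms(3))

lemma poly_subst_superset:
 assumes "finite A" "Poly_Mapping.keys p <= A"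
 shows "poly_subst u v p = (SUM (a, b):A. constS (Poly_Mapping.lookup p (a, b)) * u ^ a * v ^ b)"
 unfolding poly_subst_def
 by (rule sum.mono_neutral_left[OF assms]) (auto simp: in_keys_iff constS_def)

lemma constS_add: "constS (a + b) = constS a + constS b"
 and constS_mult: "constS (a * b) = constS a * constS b"
 and constS_one [simp]: "constS 1 = 1"
 and constS_zero [simp]: "constS 0 = 0"
 using single_one[where ?'a = "nat \<times> nat" and ?'b = complex]
 by (auto simp: constS_def single_add mult_single zero_prod_def)

lemma constS_sum: "constS (sum f A) = (SUM i:A. constS (f i))"
 by (rule additive_sum) (rule constS_add)

lemma poly_subst_add: "poly_subst u v (p + q) = poly_subst u v p + poly_subst u v q"
proof -
 let ?A = "Poly_Mapping.keys p \<union> Poly_Mapping.keys q"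
 have "Poly_Mapping.keys (p + q) <= ?A" by (rule keys_add)
 then show ?thesis
  by (simp add: poly_subst_superset[of ?A] lookup_add constS_add algebra_simps case_prod_beta sum.distrib)
qed

lemma poly_subst_single: "poly_subst u v (Poly_Mapping.single (a, b) c) = constS c * u ^ a * v ^ b"
 by (subst poly_subst_superset[of "{(a, b)}"]) auto

lemma polyX_power: "polyX ^ a = Poly_Mapping.single (a, 0) 1"
 by (induction a) (auto simp: polyX_def mult_single zero_prod_def[symmetric])

lemma polyY_power: "polyY ^ a = Poly_Mapping.single (0, a) 1"
 by (induction a) (auto simp: polyY_def mult_single zero_prod_def[symmetric])

lemma constS_power: "constS c ^ a = constS (c ^ a)"
 by (induction a) (auto simp: constS_mult)

lemma constS_times_single: "constS c * Poly_Mapping.single k d = Poly_Mapping.single k (c * d)"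
 unfolding constS_def by (simp add: mult_single zero_prod_def[symmetric])

definition hS :: "int => S => S" where
 "hS i p = (SUM k:Poly_Mapping.keys p. if sdeg k = i then Poly_Mapping.single k (Poly_Mapping.lookup p k) else 0)"

lemma lookup_hS: "Poly_Mapping.lookup (hS i p) k = (if sdeg k = i then Poly_Mapping.lookup p k else 0)"
proof -
 have "Poly_Mapping.lookup (hS i p) k = (SUM j:Poly_Mapping.keys p. if j = k then (if sdeg k = i then Poly_Mapping.lookup p k else 0) else 0)"
  unfolding hS_def lookup_sum by (intro sum.cong refl) (auto simp: lookup_single when_def)
 also have "... = (if sdeg k = i then Poly_Mapping.lookup p k else 0)" by (auto simp: in_keys_iff)
 finally show ?thesis .
qed

lemma S_gr_iff: "p : S_gr i <-> (ALL k. sdeg k ~= i --> Poly_Mapping.lookup p k = 0)"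
proof -
 have "p : S_gr i <-> (ALL k:Poly_Mapping.keys p. sdeg k = i)"
  by (simp add: S_gr_def sdeg_def case_prod_beta)
 then show ?thesis by (metis in_keys_iff)
qed

lemma S_gr_zero [simp]: "0 : S_gr i"
 and S_gr_add: "p : S_gr i ==> q : S_gr i ==> p + q : S_gr i"
 and S_gr_uminus: "p : S_gr i ==> - p : S_gr i"
 and S_gr_single: "sdeg k = i ==> Poly_Mapping.single k c : S_gr i"
 by (auto simp: S_gr_iff lookup_add lookup_single when_def)

lemma S_gr_sum: "(!!x. x : A ==> f x : S_gr i) ==> sum f A : S_gr i"
 by (induction A rule: infinite_finite_induct) (auto intro: S_gr_add)

lemma S_gr_mult:
 assumes "p : S_gr i" "q : S_gr j" shows "p * q : S_gr (i + j)"
proof -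
 have "k : Poly_Mapping.keys (p * q) ==> sdeg k = i + j" for k
 proof -
  assume "k : Poly_Mapping.keys (p * q)"
  then obtain a b where ab: "a : Poly_Mapping.keys p" "b : Poly_Mapping.keys q" "k = a + b"
  using keys_mult[of p q] by auto
  have "sdeg a = i" "sdeg b = j" using ab assms unfolding S_gr_iff by (metis in_keys_iff)+
  then show "sdeg k = i + j" using ab unfolding sdeg_def by (auto simp: fst_add snd_add)
 qed
 then show ?thesis unfolding S_gr_iff by (meson in_keys_iff)
qed

lemma S_gr_neg: "i < 0 ==> p : S_gr i ==> p = 0"
 unfolding S_gr_iff sdeg_def by (intro poly_mapping_eqI) auto

lemma S_gr_0: "p : S_gr 0 ==> p = constS (Poly_Mapping.lookup p (0, 0))"
proof (rule poly_mapping_eqI)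
 fix k assume p: "p : S_gr 0"
 show "Poly_Mapping.lookup p k = Poly_Mapping.lookup (constS (Poly_Mapping.lookup p (0, 0))) k"
 proof (cases "k = (0, 0)")
  case False
  then have "sdeg k ~= 0" by (cases k) (auto simp: sdeg_def)
  then show ?thesis using p False unfolding S_gr_iff constS_def by (simp add: lookup_single when_def)
 qed (simp add: constS_def)
qed

lemma constS_gr [simp]: "constS c : S_gr 0"
 unfolding constS_def by (rule S_gr_single) (simp add: sdeg_def)

lemma one_S_gr [simp]: "1 : S_gr 0"
 using constS_gr[of 1] by simp

lemma hS_add: "hS i (p + q) = hS i p + hS i q"
 and hS_zero [simp]: "hS i 0 = 0"
 and hS_gr: "hS i p : S_gr i"
 by (auto intro!: poly_mapping_eqI simp: lookup_hS lookup_add S_gr_iff)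

lemma hS_same: "p : S_gr i ==> hS i p = p"
 and hS_other: "p : S_gr i ==> j ~= i ==> hS j p = 0"
 by (auto intro!: poly_mapping_eqI simp: lookup_hS S_gr_iff)

lemma hS_sum: "EX I. finite I & (ALL J. finite J --> I <= J --> p = (SUM i:J. hS i p))"
proof (intro exI conjI allI impI)
 show "finite (sdeg ` Poly_Mapping.keys p)" by simp
 fix J assume J: "finite J" "sdeg ` Poly_Mapping.keys p <= J"
 show "p = (SUM i:J. hS i p)"
 proof (rule poly_mapping_eqI)
  fix k
  have "Poly_Mapping.lookup (SUM i:J. hS i p) k = (SUM i:J. if sdeg k = i then Poly_Mapping.lookup p k else 0)"
  unfolding lookup_sum lookup_hS ..
  also have "... = Poly_Mapping.lookup p k" using J by (auto simp: in_keys_iff image_subset_iff)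
  finally show "Poly_Mapping.lookup p k = Poly_Mapping.lookup (SUM i:J. hS i p) k" by simp
 qed
qed

locale dihz = dih +
 fixes ze :: complex
 assumes zn: "ze ^ n = 1"
begin

abbreviation "dl == dual n ze"
abbreviation "G == gfree n ze"
abbreviation "PP == Pmod n ze"
abbreviation "TT == trace_sum n ze"
abbreviation "R == skew n ze"
abbreviation "ac == act ze"

lemma z0: "ze ~= 0"
 using zn n3 by (cases "ze = 0") (auto simp: power_0_left)

text \<open>The group law reduces exponents modulo \<open>n\<close>; this lets the action ignore the
  reduction.\<close>

lemma zpow_mod: "ze powi (k mod int n * j) = ze powi (k * j)"
proof -
 have "k * j = k mod int n * j + int n * (k div int n * j)"
  by (metis mult.assoc mult.commute distrib_right mod_mult_div_eq)
 then have "ze powi (k * j) = ze powi (k mod int n * j) * ze powi (int n * (k div int n * j))"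
  using z0 by (simp add: power_int_add)
 also have "ze powi (int n * (k div int n * j)) = 1"
  unfolding power_int_mult by (simp add: zn)
 finally show ?thesis by simp
qed

text \<open>On monomials \<open>ac w\<close> moves the exponent pair by \<open>wkey\<close> and
  multiplies by \<open>ze\<close> to the power \<open>wexp\<close>. Both are additive in the key,
  which is what makes the action multiplicative.\<close>

definition wkey :: "dih => nat \<times> nat => nat \<times> nat" where
 "wkey w k = (if snd w then (snd k, fst k) else k)"

definition wexp :: "dih => nat \<times> nat => int" where
 "wexp w k = fst w * (if snd w then int (snd k) - int (fst k) else int (fst k) - int (snd k))"

lemma act_single: "ac w (Poly_Mapping.single k c) = Poly_Mapping.single (wkey w k) (c * ze powi (wexp w k))"
proof (cases w; cases k)
 fix j b p q assume [simp]: "w = (j, b)" "k = (p, q)"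
 have e: "(ze powi j) ^ p = ze powi (j * int p)" "(ze powi - j) ^ p = ze powi (- j * int p)" for p
  by (simp_all only: power_int_power')
 show ?thesis
 proof (cases b)
  case True
  have "ac w (Poly_Mapping.single k c) = constS c * (constS (ze powi - j) * polyY) ^ p * (constS (ze powi j) * polyX) ^ q"
  using True by (simp add: act_def poly_subst_single)
  also have "... = constS (c * ((ze powi - j) ^ p * (ze powi j) ^ q)) * (polyY ^ p * polyX ^ q)"
  by (simp add: power_mult_distrib constS_power constS_mult algebra_simps)
  also have "polyY ^ p * polyX ^ q = Poly_Mapping.single (q, p) 1"
  by (simp add: polyX_power polyY_power mult_single)
  also have "(ze powi - j) ^ p * (ze powi j) ^ q = ze powi (wexp w k)"
  unfolding e using True z0 by (simp add: power_int_add[symmetric] wexp_def algebra_simps)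
  finally show ?thesis using True by (simp add: constS_times_single wkey_def)
 next
  case False
  have "ac w (Poly_Mapping.single k c) = constS c * (constS (ze powi j) * polyX) ^ p * (constS (ze powi - j) * polyY) ^ q"
  using False by (simp add: act_def poly_subst_single)
  also have "... = constS (c * ((ze powi j) ^ p * (ze powi - j) ^ q)) * (polyX ^ p * polyY ^ q)"
  by (simp add: power_mult_distrib constS_power constS_mult algebra_simps)
  also have "polyX ^ p * polyY ^ q = Poly_Mapping.single (p, q) 1"
  by (simp add: polyX_power polyY_power mult_single)
  also have "(ze powi j) ^ p * (ze powi - j) ^ q = ze powi (wexp w k)"
  unfolding e using False z0 by (simp add: power_int_add[symmetric] wexp_def algebra_simps)
  finally show ?thesis using False by (simp add: constS_times_single wkey_def)
 qed
qed

lemma act_add: "ac w (p + q) = ac w p + ac w q"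
 by (cases w) (auto simp: act_def poly_subst_add)

lemma act_sum: "ac w (sum f A) = (SUM i:A. ac w (f i))"
 by (rule additive_sum) (rule act_add)

lemma act_zero [simp]: "ac w 0 = 0" using act_sum[of w "%_. 0" "{}"] by simp

lemma act_mult: "ac w (p * q) = ac w p * ac w q"
proof (rule S_ext[of "%p. ac w (p * q)" "%p. ac w p * ac w q"])
 fix k c
 show "ac w (Poly_Mapping.single k c * q) = ac w (Poly_Mapping.single k c) * ac w q"
 proof (rule S_ext[of "%q. ac w (Poly_Mapping.single k c * q)" "%q. ac w (Poly_Mapping.single k c) * ac w q"])
  fix k' d
  have "wkey w (k + k') = wkey w k + wkey w k'" "wexp w (k + k') = wexp w k + wexp w k'"
  by (auto simp: wkey_def wexp_def plus_prod_def algebra_simps)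
  then show "ac w (Poly_Mapping.single k c * Poly_Mapping.single k' d) = ac w (Poly_Mapping.single k c) * ac w (Poly_Mapping.single k' d)"
  using z0 by (simp add: mult_single act_single power_int_add algebra_simps)
 qed (auto simp: act_add algebra_simps)
qed (auto simp: act_add algebra_simps)

lemma act_act: "ac (u ** v) p = ac u (ac v p)"
proof (rule S_ext[of "ac (u ** v)" "%p. ac u (ac v p)"])
 fix k c
 obtain i b where [simp]: "u = (i, b)" by (cases u)
 obtain j d where [simp]: "v = (j, d)" by (cases v)
 have "wkey (u ** v) k = wkey u (wkey v k)" by (auto simp: wkey_def D_mult)
 moreover have "ze powi (wexp (u ** v) k) = ze powi (wexp v k) * ze powi (wexp u (wkey v k))"
 proof -
  have "ze powi (wexp (u ** v) k) = ze powi ((if b then i - j else i + j) *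
  (if b ~= d then int (snd k) - int (fst k) else int (fst k) - int (snd k)))"
  unfolding wexp_def by (simp add: D_mult zpow_mod)
  also have "... = ze powi (wexp v k + wexp u (wkey v k))"
  by (rule arg_cong[of _ _ "%x. ze powi x"]) (cases b; cases d; simp add: wkey_def wexp_def algebra_simps)
  finally show ?thesis using z0 by (simp add: power_int_add)
 qed
 ultimately show "ac (u ** v) (Poly_Mapping.single k c) = ac u (ac v (Poly_Mapping.single k c))"
  by (simp add: act_single mult.assoc)
qed (auto simp: act_add)

lemma act_e0 [simp]: "ac e0 p = p"
 by (rule S_ext[of "ac e0" "%p. p"]) (auto simp: act_add act_single wkey_def wexp_def)

lemma act_constS [simp]: "ac w (constS c) = constS c"
 unfolding constS_def by (auto simp: act_single wkey_def wexp_def)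

lemma act_one [simp]: "ac w 1 = 1"
 using act_constS[of w 1] by simp

lemma act_gr:
 assumes "p : S_gr i" shows "ac w p : S_gr i"
proof -
 have "ac w p = (SUM k:Poly_Mapping.keys p. ac w (Poly_Mapping.single k (Poly_Mapping.lookup p k)))"
  by (subst S_decomp) (rule act_sum)
 moreover have "ac w (Poly_Mapping.single k (Poly_Mapping.lookup p k)) : S_gr i" if "k : Poly_Mapping.keys p" for k
 proof -
  have "sdeg k = i" using that assms unfolding S_gr_iff by (metis in_keys_iff)
  then show ?thesis unfolding act_single by (intro S_gr_single) (auto simp: wkey_def sdeg_def)
 qed
 ultimately show ?thesis by (auto intro: S_gr_sum)
qed

lemma R_carrier: "a : cr R <-> (ALL w. w ~: W --> a w = 0)"
 and R_add: "a +[R] b = (%w. a w + b w)"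
 and R_zero: "0[R] = (%w. 0)"
 and R_one: "1[R] = tensor 1 e0"
 and R_mult: "a \<otimes>[R] b = (%w. if w : W then SUM u:W. a u * ac u (b (dinv u ** w)) else 0)"
 by (auto simp: skew_def D_one)

lemma tensor_carrier [simp]: "w : W ==> tensor p w : cr R"
 by (auto simp: R_carrier tensor_def)

lemma ring_R: "ring R"
proof (rule ringI)
 show "abelian_group R"
 proof (rule abelian_groupI)
  fix x assume "x : cr R"
  then show "EX y:cr R. y +[R] x = 0[R]"
  by (intro bexI[of _ "%w. - x w"]) (auto simp: R_carrier R_add R_zero)
 qed (auto simp: R_carrier R_add R_zero algebra_simps)
 show "Group.monoid R"
 proof (rule monoidI)
  fix a b c assume a: "a : cr R" and b: "b : cr R" and c: "c : cr R"
  show "a \<otimes>[R] b \<otimes>[R] c = a \<otimes>[R] (b \<otimes>[R] c)"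
  proof
  fix w
  show "(a \<otimes>[R] b \<otimes>[R] c) w = (a \<otimes>[R] (b \<otimes>[R] c)) w"
  proof (cases "w : W")
  case True
  have "(a \<otimes>[R] (b \<otimes>[R] c)) w = (SUM v:W. a v * ac v (SUM t:W. b t * ac t (c (dinv t ** (dinv v ** w)))))"
  using True by (simp add: R_mult)
  \<comment> \<open>The inner sum is prepared for the substitution \<open>u = v ** t\<close>, after
    which the two sums can be exchanged.\<close>
  also have "... = (SUM v:W. SUM t:W. a v * ac v (b (dinv v ** (v ** t))) * ac (v ** t) (c (dinv (v ** t) ** w)))"
  unfolding act_sum sum_distrib_left
  proof (intro sum.cong refl)
  fix v t assume v: "v : W" and t: "t : W"
  have "dinv t ** (dinv v ** w) = dinv (v ** t) ** w" using v t True by (simp add: D.inv_mult_group D.m_assoc)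
  moreover have "dinv v ** (v ** t) = t" using v t by (simp add: D.m_assoc[symmetric])
  ultimately show "a v * ac v (b t * ac t (c (dinv t ** (dinv v ** w)))) = a v * ac v (b (dinv v ** (v ** t))) * ac (v ** t) (c (dinv (v ** t) ** w))"
  by (simp add: act_mult act_act mult.assoc)
  qed
  also have "... = (SUM v:W. SUM u:W. a v * ac v (b (dinv v ** u)) * ac u (c (dinv u ** w)))"
  by (intro sum.cong refl sum_W_shift[where f = "%u. a _ * ac _ (b (dinv _ ** u)) * ac u (c (dinv u ** w))"])
  also have "... = (SUM u:W. SUM v:W. a v * ac v (b (dinv v ** u)) * ac u (c (dinv u ** w)))"
  by (rule sum.swap)
  also have "... = (a \<otimes>[R] b \<otimes>[R] c) w"
  using True by (simp add: R_mult sum_distrib_right)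
  finally show ?thesis by simp
  qed (simp add: R_mult)
  qed
 next
  fix a assume a: "a : cr R"
  show "1[R] \<otimes>[R] a = a"
  proof
  fix w
  show "(1[R] \<otimes>[R] a) w = a w"
  proof (cases "w : W")
  case True
  have "(1[R] \<otimes>[R] a) w = (SUM u:W. if u = e0 then a w else 0)"
  using True by (simp only: R_mult R_one if_True) (rule sum.cong, auto simp: tensor_def)
  then show ?thesis by simp
  qed (use a in \<open>simp add: R_mult R_carrier\<close>)
  qed
  show "a \<otimes>[R] 1[R] = a"
  proof
  fix w
  show "(a \<otimes>[R] 1[R]) w = a w"
  proof (cases "w : W")
  case True
  have "dinv u ** w = e0 <-> u = w" if u: "u : W" for u
  using u True by (metis D.inv_equality D.inv_inv D.inv_closed D.l_inv)
  then have "(a \<otimes>[R] 1[R]) w = (SUM u:W. if u = w then a w else 0)"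
  using True by (simp only: R_mult R_one if_True) (rule sum.cong, auto simp: tensor_def)
  then show ?thesis using True by simp
  qed (use a in \<open>simp add: R_mult R_carrier\<close>)
  qed
 qed (auto simp: R_carrier R_mult R_one tensor_def)
qed (auto simp: R_mult R_add act_add algebra_simps sum.distrib)

sublocale R: ring R by (rule ring_R)

lemma tensor_mult:
 assumes "v : W" "w : W"
 shows "tensor p v \<otimes>[R] tensor q w = tensor (p * ac v q) (v ** w)"
proof
 fix x
 show "(tensor p v \<otimes>[R] tensor q w) x = tensor (p * ac v q) (v ** w) x"
 proof (cases "x : W")
  case True
  have "dinv v ** x = w <-> x = v ** w"
  using assms True by (metis D.inv_solve_left)
  then have "(tensor p v \<otimes>[R] tensor q w) x = (SUM u:W. if u = v then tensor (p * ac v q) (v ** w) x else 0)"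
  using True by (simp only: R_mult if_True) (rule sum.cong, auto simp: tensor_def)
  then show ?thesis using assms by simp
 next
  case False
  moreover have "v ** w : W" using assms by simp
  ultimately show ?thesis unfolding R_mult tensor_def by auto
 qed
qed

lemma R_finsum: "finite A ==> (!!i. i : A ==> f i : cr R) ==> (fs R A (%i. f i)) = (%w. SUM i:A. f i w)"
proof (induction A rule: finite_induct)
 case empty
 then show ?case by (simp add: R_zero)
next
 case (insert x F)
 then show ?case by (subst R.finsum_insert) (auto simp: R_add)
qed

lemma R_decomp: "a : cr R ==> a = (fs R W (%w. tensor (a w) w))"
proof -
 assume a: "a : cr R"
 have "(SUM w:W. tensor (a w) w v) = a v" for v
 proof -
  have "(SUM w:W. tensor (a w) w v) = (SUM w:W. if w = v then a v else 0)"
  by (intro sum.cong) (auto simp: tensor_def)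
  then show ?thesis using a unfolding R_carrier by (cases "v : W") simp_all
 qed
 then show ?thesis by (subst R_finsum) auto
qed

lemma tensor_add: "tensor (p + q) w = tensor p w +[R] tensor q w"
 by (auto simp: tensor_def R_add)

lemma tensor_zero: "tensor 0 w = 0[R]"
 by (auto simp: tensor_def R_zero)

lemma skew_gr_iff: "a : skew_gr n i <-> a : cr R & (ALL w. a w : S_gr i)"
 by (auto simp: skew_gr_def R_carrier)

lemma tensor_gr: "w : W ==> p : S_gr i ==> tensor p w : skew_gr n i"
 by (simp add: skew_gr_iff) (simp add: tensor_def)

lemma skew_gr_mult: "a : skew_gr n i ==> b : skew_gr n j ==> a \<otimes>[R] b : skew_gr n (i + j)"
 by (simp add: skew_gr_iff) (simp add: R_mult S_gr_sum S_gr_mult act_gr)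

end

section \<open>Graded modules\<close>

lemma (in abelian_monoid) finsum_single:
 assumes "i : J" "finite J" "f i : cr G" "!!j. j : J ==> j ~= i ==> f j = \<zero>"
 shows "(\<Oplus>j\<in>J. f j) = f i"
proof -
 have "(\<Oplus>j\<in>J. f j) = (\<Oplus>j\<in>J. if i = j then (%_. f i) j else \<zero>)"
  using assms by (intro finsum_cong') auto
 also have "... = f i" using assms by (intro finsum_singleton) auto
 finally show ?thesis .
qed

locale gring = ring R for R :: "('a, 'r) ring_scheme" (structure) +
 fixes Rg :: "int => 'a set"
 assumes Rg_sub: "Rg i <= cr R"
begin

text \<open>No decomposition into homogeneous components is demanded: functionals on an infinite
  dimensional module need not be sums of homogeneous ones, and duals of such modules occur below as
  targets of homomorphisms.\<close>

definition wgm :: "('a, 'b) gmodule => bool" where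
 "wgm M <-> lmod R M & (ALL i. gr M i <= cr M & 0[M] : gr M i &
  (ALL x:gr M i. ALL y:gr M i. x +[M] y : gr M i) & (ALL j. ALL a:Rg j. ALL x:gr M i. a *[M] x : gr M (i + j)))"

text \<open>\<open>h i\<close> projects to degree \<open>i\<close>. The last clause holds for every
  larger index set \<open>J\<close>, so an index set can always be enlarged to contain a prescribed
  degree.\<close>

definition has_hp :: "('a, 'b) gmodule => (int => 'b => 'b) => bool" where
 "has_hp M h <-> (ALL i. ALL x:cr M. h i x : gr M i & (ALL y:cr M. h i (x +[M] y) = h i x +[M] h i y)) &
  (ALL i. ALL x:gr M i. h i x = x & (ALL j. j ~= i --> h j x = 0[M])) &
  (ALL x:cr M. EX I. finite I & (ALL J. finite J --> I <= J --> x = (fs M J (%i. h i x))))"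

definition gmod :: "('a, 'b) gmodule => bool" where
 "gmod M <-> wgm M & (EX h. has_hp M h)"

definition hp :: "('a, 'b) gmodule => int => 'b => 'b" where
 "hp M = (SOME h. has_hp M h)"

lemma gmodI: "wgm M ==> has_hp M h ==> gmod M" unfolding gmod_def by auto
lemma gmod_wgm: "gmod M ==> wgm M" unfolding gmod_def by auto
lemma wgm_lmod: "wgm M ==> lmod R M" unfolding wgm_def by auto
lemma gmod_lmod: "gmod M ==> lmod R M" using gmod_wgm wgm_lmod by auto
lemma gr_carrier: "wgm M ==> x : gr M i ==> x : cr M"
 and gr_zero: "wgm M ==> 0[M] : gr M i"
 and gr_add: "wgm M ==> x : gr M i ==> y : gr M i ==> x +[M] y : gr M i"
 and gr_smult: "wgm M ==> a : Rg j ==> x : gr M i ==> a *[M] x : gr M (i + j)"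
 unfolding wgm_def by blast+

lemma has_hp_hp: "gmod M ==> has_hp M (hp M)"
 unfolding gmod_def hp_def using someI_ex[of "has_hp M"] by blast

lemma hp_gr: "gmod M ==> x : cr M ==> hp M i x : gr M i"
 and hp_add: "gmod M ==> x : cr M ==> y : cr M ==> hp M i (x +[M] y) = hp M i x +[M] hp M i y"
 and hp_same: "gmod M ==> x : gr M i ==> hp M i x = x"
 and hp_other: "gmod M ==> x : gr M i ==> j ~= i ==> hp M j x = 0[M]"
 and hp_decomp: "gmod M ==> x : cr M ==> EX I. finite I & (ALL J. finite J --> I <= J --> x = (fs M J (%i. hp M i x)))"
 using has_hp_hp[of M] unfolding has_hp_def by blast+

lemma hp_carrier: "gmod M ==> x : cr M ==> hp M i x : cr M"
 by (rule gr_carrier[OF gmod_wgm hp_gr])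

text \<open>Like membership in \<open>ghom\<close>, but without extensionality, so that plain
  composites and sums qualify; \<open>ghm_restrict\<close> leads back to
  \<open>ghom\<close>.\<close>

definition ghm :: "('a, 'b) gmodule => ('a, 'c) gmodule => int => ('b => 'c) => bool" where
 "ghm M N d f <-> (ALL x:cr M. f x : cr N & (ALL y:cr M. f (x +[M] y) = f x +[N] f y) &
  (ALL a:cr R. f (a *[M] x) = a *[N] f x)) & (ALL i. ALL x:gr M i. f x : gr N (i + d))"

lemma ghm_closed: "ghm M N d f ==> x : cr M ==> f x : cr N"
 and ghm_add: "ghm M N d f ==> x : cr M ==> y : cr M ==> f (x +[M] y) = f x +[N] f y"
 and ghm_smult: "ghm M N d f ==> x : cr M ==> a : cr R ==> f (a *[M] x) = a *[N] f x"
 and ghm_gr: "ghm M N d f ==> x : gr M i ==> f x : gr N (i + d)"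
 unfolding ghm_def by auto

lemma ghmI:
 assumes "!!x. x : cr M ==> f x : cr N"
  and "!!x y. x : cr M ==> y : cr M ==> f (x +[M] y) = f x +[N] f y"
  and "!!a x. a : cr R ==> x : cr M ==> f (a *[M] x) = a *[N] f x"
  and "!!i x. x : gr M i ==> f x : gr N (i + d)"
 shows "ghm M N d f"
 using assms unfolding ghm_def by auto

lemma ghom_iff: "f : ghom R M N d <-> ghm M N d f & f : extensional (cr M)"
 unfolding ghom_def ghm_def PiE_def Pi_def image_subset_iff by blast

lemma ghm_cong: "wgm M ==> ghm M N d f ==> (!!x. x : cr M ==> g x = f x) ==> ghm M N d g"
proof (rule ghmI)
 assume M: "wgm M" and f: "ghm M N d f" and e: "!!x. x : cr M ==> g x = f x"
 interpret M: lmod R M using M wgm_lmod by auto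
 show "g x : cr N" if "x : cr M" for x using e ghm_closed[OF f] that by simp
 show "g (x +[M] y) = g x +[N] g y" if "x : cr M" "y : cr M" for x y
  using e ghm_add[OF f] that by simp
 show "g (a *[M] x) = a *[N] g x" if "a : cr R" "x : cr M" for a x
  using e ghm_smult[OF f] that by simp
 show "g x : gr N (i + d)" if "x : gr M i" for i x
  using e ghm_gr[OF f that] gr_carrier[OF M that] by simp
qed

lemma ghm_restrict: "wgm M ==> ghm M N d f ==> restrict f (cr M) : ghom R M N d"
 unfolding ghom_iff by (auto intro: ghm_cong)

lemma ghm_comp: "ghm M N d f ==> ghm N L e g ==> ghm M L (d + e) (%x. g (f x))"
proof (rule ghmI)
 assume f: "ghm M N d f" and g: "ghm N L e g"
 show "g (f x) : cr L" if "x : cr M" for x using ghm_closed[OF g ghm_closed[OF f that]] .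
 show "g (f (x +[M] y)) = g (f x) +[L] g (f y)" if "x : cr M" "y : cr M" for x y
  using ghm_add[OF f that] ghm_add[OF g] ghm_closed[OF f] that by simp
 show "g (f (a *[M] x)) = a *[L] g (f x)" if "a : cr R" "x : cr M" for a x
  using ghm_smult[OF f] ghm_smult[OF g] ghm_closed[OF f] that by simp
 show "g (f x) : gr L (i + (d + e))" if "x : gr M i" for i x
  using ghm_gr[OF g ghm_gr[OF f that]] by (simp add: add.assoc)
qed

lemma ghm_zero:
 assumes "wgm M" "wgm N" "ghm M N d f" shows "f 0[M] = 0[N]"
proof -
 interpret M: lmod R M using assms wgm_lmod by auto
 interpret N: lmod R N using assms wgm_lmod by auto
 have "f (\<zero> *[M] 0[M]) = \<zero> *[N] f 0[M]" by (rule ghm_smult[OF assms(3)]) auto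
 then show ?thesis using ghm_closed[OF assms(3), of "0[M]"] by simp
qed

lemma ghm_uminus:
 assumes "wgm M" "wgm N" "ghm M N d f" "x : cr M" shows "f (-[M] x) = -[N] f x"
proof -
 interpret M: lmod R M using assms wgm_lmod by auto
 interpret N: lmod R N using assms wgm_lmod by auto
 have "f (-[M] x) +[N] f x = 0[N]"
  using ghm_add[OF assms(3), of "-[M] x" x] ghm_zero[OF assms(1-3)] assms(4) by (simp add: M.M.l_neg)
 then show ?thesis using N.M.minus_equality ghm_closed[OF assms(3)] assms(4) by (metis M.M.a_inv_closed)
qed

lemma ghm_minus:
 assumes "wgm M" "wgm N" "ghm M N d f" "x : cr M" "y : cr M"
 shows "f (x -[M] y) = f x -[N] f y"
proof -
 interpret M: lmod R M using assms wgm_lmod by auto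
 show ?thesis unfolding a_minus_def using ghm_add[OF assms(3)] ghm_uminus[OF assms(1-3)] assms(4,5) by simp
qed

lemma ghm_finsum:
 assumes "wgm M" "wgm N" "ghm M N d f" "finite A" "!!i. i : A ==> g i : cr M"
 shows "f (fs M A (%i. g i)) = (fs N A (%i. f (g i)))"
proof -
 interpret M: lmod R M using assms wgm_lmod by auto
 interpret N: lmod R N using assms wgm_lmod by auto
 show ?thesis using assms(4,5)
 proof (induction A rule: finite_induct)
  case empty
  then show ?case using ghm_zero[OF assms(1-3)] by simp
 next
  case (insert x F)
  then have "f (fs M (insert x F) (%i. g i)) = f (g x +[M] (fs M F (%i. g i)))"
  by (subst M.M.finsum_insert) auto
  also have "... = f (g x) +[N] (fs N F (%i. f (g i)))"
  using insert by (subst ghm_add[OF assms(3)]) (auto intro!: M.M.finsum_closed)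
  also have "... = (fs N (insert x F) (%i. f (g i)))"
  using insert ghm_closed[OF assms(3)] by (subst N.M.finsum_insert) auto
  finally show ?case .
 qed
qed

lemma hp_finsum:
 assumes M: "gmod M" and "finite A" "!!i. i : A ==> g i : cr M"
 shows "hp M k (fs M A (%i. g i)) = (fs M A (%i. hp M k (g i)))"
proof -
 interpret M: lmod R M using M gmod_lmod by auto
 show ?thesis using assms(2,3)
 proof (induction A rule: finite_induct)
  case empty
  have "hp M k 0[M] = 0[M]" using hp_same[OF M gr_zero[OF gmod_wgm[OF M]]] .
  then show ?case by simp
 next
  case (insert x F)
  then have "hp M k (fs M (insert x F) (%i. g i)) = hp M k (g x +[M] (fs M F (%i. g i)))"
  by (subst M.M.finsum_insert) auto
  also have "... = hp M k (g x) +[M] (fs M F (%i. hp M k (g i)))"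
  using insert by (subst hp_add[OF M]) (auto intro!: M.M.finsum_closed)
  also have "... = (fs M (insert x F) (%i. hp M k (g i)))"
  using insert hp_carrier[OF M] by (subst M.M.finsum_insert) auto
  finally show ?case .
 qed
qed

text \<open>Apply \<open>f\<close> to a decomposition of \<open>x\<close>: every component is moved
  by \<open>d\<close>, so exactly one of them lands in degree \<open>i\<close>.\<close>

lemma hp_ghm:
 assumes M: "gmod M" and N: "gmod N" and f: "ghm M N d f" and x: "x : cr M"
 shows "hp N i (f x) = f (hp M (i - d) x)"
proof -
 interpret M: lmod R M using M gmod_lmod by auto
 interpret N: lmod R N using N gmod_lmod by auto
 obtain I where I: "finite I" "ALL J. finite J --> I <= J --> x = (fs M J (%i. hp M i x))" using hp_decomp[OF M x] by auto
 define J where "J = insert (i - d) I"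
 have J: "finite J" "i - d : J" "x = (fs M J (%i. hp M i x))" unfolding J_def using I(1) by (auto intro!: mp[OF mp[OF spec[OF I(2)]]])
 have c: "hp M j x : cr M" for j using hp_carrier[OF M x] .
 have g: "f (hp M j x) : gr N (j + d)" for j using ghm_gr[OF f hp_gr[OF M x]] .
 have "f x = (fs N J (%j. f (hp M j x)))"
  using ghm_finsum[OF gmod_wgm[OF M] gmod_wgm[OF N] f J(1), of "%j. hp M j x"] c J(3) by metis
 then have "hp N i (f x) = (fs N J (%j. hp N i (f (hp M j x))))"
  using hp_finsum[OF N J(1), of "%j. f (hp M j x)"] ghm_closed[OF f c] by simp
 also have "... = hp N i (f (hp M (i - d) x))"
  by (rule N.M.finsum_single[OF J(2,1)]) (use hp_carrier[OF N ghm_closed[OF f c]] hp_other[OF N g] in auto)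
 also have "... = f (hp M (i - d) x)" using hp_same[OF N] g[of "i - d"] by simp
 finally show ?thesis .
qed

text \<open>Gradedness is stability under the projections \<open>hp M i\<close>, which is easier to
  verify for kernels, images and preimages than the existence of decompositions.\<close>

definition gsubm :: "('a, 'b) gmodule => 'b set => bool" where
 "gsubm M Z <-> Z <= cr M & 0[M] : Z & (ALL x:Z. ALL y:Z. x +[M] y : Z) &
  (ALL a:cr R. ALL x:Z. a *[M] x : Z) & (ALL i. ALL x:Z. hp M i x : Z)"

lemma gsubm_carrier: "gsubm M Z ==> x : Z ==> x : cr M"
 and gsubm_zero: "gsubm M Z ==> 0[M] : Z"
 and gsubm_add: "gsubm M Z ==> x : Z ==> y : Z ==> x +[M] y : Z"
 and gsubm_smult: "gsubm M Z ==> a : cr R ==> x : Z ==> a *[M] x : Z"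
 and gsubm_hp: "gsubm M Z ==> x : Z ==> hp M i x : Z"
 unfolding gsubm_def by auto

lemma gsubm_uminus: "gmod M ==> gsubm M Z ==> x : Z ==> -[M] x : Z"
proof -
 assume M: "gmod M" and Z: "gsubm M Z" and x: "x : Z"
 interpret M: lmod R M using M gmod_lmod by auto
 have "(\<ominus> \<one>) *[M] x = -[M] x" using M.smult_l_minus[of \<one> x] gsubm_carrier[OF Z x] by simp
 then show ?thesis using gsubm_smult[OF Z _ x, of "\<ominus> \<one>"] by simp
qed

lemma gsubm_minus: "gmod M ==> gsubm M Z ==> x : Z ==> y : Z ==> x -[M] y : Z"
 unfolding a_minus_def by (rule gsubm_add[OF _ _ gsubm_uminus])

lemma gsubm_subgroup: "gmod M ==> gsubm M Z ==> abelian_subgroup Z M"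
proof -
 assume M: "gmod M" and Z: "gsubm M Z"
 interpret M: lmod R M using M gmod_lmod by auto
 have "subgroup Z (add_monoid M)"
  using gsubm_uminus[OF M Z] Z unfolding gsubm_def by (intro M.M.add.subgroupI) (auto simp flip: a_inv_def)
 then show ?thesis by (intro abelian_subgroupI3 additive_subgroup.intro) (auto intro: M.M.abelian_group_axioms)
qed

lemma gsubm_all: "gmod M ==> gsubm M (cr M)"
proof -
 assume M: "gmod M"
 interpret M: lmod R M using M gmod_lmod by auto
 show ?thesis unfolding gsubm_def using hp_carrier[OF M] by auto
qed

lemma gsubm_triv: "gmod M ==> gsubm M {0[M]}"
proof -
 assume M: "gmod M"
 interpret M: lmod R M using M gmod_lmod by auto
 show ?thesis unfolding gsubm_def using hp_same[OF M gr_zero[OF gmod_wgm[OF M]]] by auto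
qed

lemma gsubm_finsum:
 assumes M: "gmod M" and Z: "gsubm M Z" and "finite A" "!!i. i : A ==> g i : Z"
 shows "(fs M A (%i. g i)) : Z"
proof -
 interpret M: lmod R M using M gmod_lmod by auto
 show ?thesis using assms(3,4)
 proof (induction A rule: finite_induct)
  case (insert x F)
  then show ?case using gsubm_carrier[OF Z] gsubm_add[OF Z] by (subst M.M.finsum_insert) auto
 qed (use gsubm_zero[OF Z] in auto)
qed

lemma graded_submodule_gsubm:
 assumes M: "gmod M" and Z: "graded_submodule R M Z"
 shows "gsubm M Z"
proof -
 interpret M: lmod R M using M gmod_lmod by auto
 have s: "Module.submodule Z R M" using Z unfolding graded_submodule_def by auto
 interpret Z: Module.submodule Z R M by fact
 have sub: "Z <= cr M" "0[M] : Z" using Z.subset Z.one_closed by auto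
 have add: "x +[M] y : Z" if "x : Z" "y : Z" for x y using Z.m_closed[OF that] by simp
 have sm: "a *[M] x : Z" if "a : cr R" "x : Z" for a x using Z.smult_closed[OF that] .
 have fs: "(fs M A (%i. g i)) : Z" if "finite A" "!!i. i : A ==> g i : Z" for A :: "int set" and g
  using that
 proof (induction A rule: finite_induct)
  case (insert x F)
  then show ?case using sub add by (subst M.M.finsum_insert) auto
 qed (use sub in auto)
 have "hp M j x : Z" if x: "x : Z" for x j
 proof -
  obtain I c where I: "finite I" "ALL i:I. c i : Z \<inter> gr M i" "x = (fs M I (%i. c i))"
  using Z x unfolding graded_submodule_def by blast
  have "hp M j x = (fs M I (%i. hp M j (c i)))"
  using hp_finsum[OF M I(1), of c] I sub by auto
  moreover have "hp M j (c i) : Z" if "i : I" for i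
  using hp_same[OF M, of "c i" j] hp_other[OF M, of "c i" i j] I(2) that sub by (cases "i = j") auto
  ultimately show ?thesis using fs[OF I(1), of "%i. hp M j (c i)"] by simp
 qed
 then show ?thesis unfolding gsubm_def using sub add sm by auto
qed

lemma gsubm_vimage:
 assumes M: "gmod M" and N: "gmod N" and f: "ghm M N d f" and Z: "gsubm N Z"
 shows "gsubm M {x : cr M. f x : Z}"
proof -
 interpret M: lmod R M using M gmod_lmod by auto
 interpret N: lmod R N using N gmod_lmod by auto
 show ?thesis
  unfolding gsubm_def
 proof (intro conjI ballI allI)
  show "0[M] : {x : cr M. f x : Z}" using ghm_zero[OF gmod_wgm[OF M] gmod_wgm[OF N] f] gsubm_zero[OF Z] by simp
  fix x i assume x: "x : {x : cr M. f x : Z}"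
  have "hp N (i + d) (f x) = f (hp M i x)" using hp_ghm[OF M N f, of x "i + d"] x by simp
  moreover have "hp N (i + d) (f x) : Z" using gsubm_hp[OF Z] x by simp
  ultimately show "hp M i x : {x : cr M. f x : Z}" using x hp_carrier[OF M] by auto
 qed (use ghm_add[OF f] ghm_smult[OF f] gsubm_add[OF Z] gsubm_smult[OF Z] in auto)
qed

lemma gsubm_image:
 assumes M: "gmod M" and N: "gmod N" and f: "ghm M N d f" and Z: "gsubm M Z"
 shows "gsubm N (f ` Z)"
proof -
 interpret M: lmod R M using M gmod_lmod by auto
 interpret N: lmod R N using N gmod_lmod by auto
 note Zc = gsubm_carrier[OF Z]
 show ?thesis
  unfolding gsubm_def
 proof (intro conjI ballI allI)
  show "f ` Z <= cr N" using ghm_closed[OF f] Zc by auto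
  show "0[N] : f ` Z" using ghm_zero[OF gmod_wgm[OF M] gmod_wgm[OF N] f] gsubm_zero[OF Z] by (metis image_eqI)
  fix y assume "y : f ` Z"
  then obtain x where x: "x : Z" "y = f x" by auto
  show "hp N i y : f ` Z" for i using hp_ghm[OF M N f Zc[OF x(1)], of i] x gsubm_hp[OF Z x(1)] by auto
  show "a *[N] y : f ` Z" if "a : cr R" for a
  using ghm_smult[OF f Zc[OF x(1)] that] gsubm_smult[OF Z that x(1)] x by (metis image_eqI)
  fix y' assume "y' : f ` Z"
  then obtain x' where x': "x' : Z" "y' = f x'" by auto
  show "y +[N] y' : f ` Z" using ghm_add[OF f Zc[OF x(1)] Zc[OF x'(1)]] gsubm_add[OF Z x(1) x'(1)] x x' by (metis image_eqI)
 qed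
qed

lemma gsub_simps [simp]:
 "cr (gsub M Z) = Z" "add (gsub M Z) = add M" "zero (gsub M Z) = zero M" "module.smult (gsub M Z) = module.smult M"
 "gr (gsub M Z) i = Z \<inter> gr M i"
 by (auto simp: gsub_def)

lemma finsum_gsub:
 assumes M: "gmod M" and Z: "gsubm M Z" and "finite A" "!!i. i : A ==> g i : Z"
 shows "lmod R (gsub M Z) & (fs (gsub M Z) A (%i. g i)) = (fs M A (%i. g i))"
proof -
 interpret M: lmod R M using M gmod_lmod by auto
 note Zc = gsubm_carrier[OF Z]
 have l: "lmod R (gsub M Z)"
  unfolding lmod_def lmod_axioms_def
 proof (intro conjI allI impI)
  show "abelian_group (gsub M Z)"
  proof (rule abelian_groupI)
  fix x assume x: "x : cr (gsub M Z)"
  then show "EX y:cr (gsub M Z). y +[gsub M Z] x = 0[gsub M Z]"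
  using gsubm_uminus[OF M Z] Zc by (intro bexI[of _ "-[M] x"]) (auto simp: M.M.l_neg)
  qed (use gsubm_add[OF Z] gsubm_zero[OF Z] Zc in \<open>auto simp: M.M.a_ac\<close>)
 qed (use gsubm_smult[OF Z] Zc in \<open>auto simp: M.smult_l_distr M.smult_r_distr M.smult_assoc1 ring_axioms\<close>)
 interpret Z: lmod R "gsub M Z" by (rule l)
 show ?thesis using assms(3,4)
 proof (induction A rule: finite_induct)
  case (insert x F)
  then show ?case using Zc by (subst Z.M.finsum_insert, simp, simp, simp add: Pi_iff, simp) (subst M.M.finsum_insert, auto simp: l)
 qed (simp add: l)
qed

lemma gmod_gsub: assumes M: "gmod M" and Z: "gsubm M Z" shows "gmod (gsub M Z)"
proof (rule gmodI[where h = "hp M"])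
 note Zc = gsubm_carrier[OF Z]
 have "lmod R (gsub M Z)" by (rule conjunct1[OF finsum_gsub[OF M Z finite.emptyI]]) simp
 then show "wgm (gsub M Z)"
  unfolding wgm_def using gr_carrier[OF gmod_wgm[OF M]] gr_zero[OF gmod_wgm[OF M]] gr_add[OF gmod_wgm[OF M]] gr_smult[OF gmod_wgm[OF M]]
  gsubm_zero[OF Z] gsubm_add[OF Z] gsubm_smult[OF Z] Rg_sub by (auto simp: subset_iff)
 show "has_hp (gsub M Z) (hp M)"
  unfolding has_hp_def
 proof (intro conjI allI ballI)
  fix x assume x: "x : cr (gsub M Z)"
  then have "x : cr M" using Zc by simp
  from hp_decomp[OF M this] obtain I where "finite I" "ALL J. finite J --> I <= J --> x = (fs M J (%i. hp M i x))" by blast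
  then show "EX I. finite I & (ALL J. finite J --> I <= J --> x = (fs (gsub M Z) J (%i. hp M i x)))"
  using finsum_gsub[OF M Z, of _ "%i. hp M i x"] gsubm_hp[OF Z] x by (intro exI[of _ I]) auto
 qed (use hp_gr[OF M] hp_add[OF M] hp_same[OF M] hp_other[OF M] Zc gsubm_hp[OF Z] in auto)
qed

lemma hp_gsub: assumes M: "gmod M" and Z: "gsubm M Z" and x: "x : Z" shows "hp (gsub M Z) i x = hp M i x"
proof -
 have "ghm (gsub M Z) M 0 (%x. x)" by (rule ghmI) (use gsubm_carrier[OF Z] in auto)
 from hp_ghm[OF gmod_gsub[OF M Z] M this, of x i] x show ?thesis by simp
qed

lemma gsubm_gsub: assumes M: "gmod M" and Z: "gsubm M Z" and Z': "Z' <= Z"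
 shows "gsubm (gsub M Z) Z' <-> gsubm M Z'"
 unfolding gsubm_def using Z' gsubm_carrier[OF Z] hp_gsub[OF M Z] by (auto simp: subset_iff)

lemma ghm_gsub_incl: "gsubm M Z ==> ghm M N d f ==> ghm (gsub M Z) N d f"
 unfolding ghm_def by (simp add: gsubm_carrier)

lemma ghm_gsub_codom: "ghm M N d f ==> (!!x. x : cr M ==> f x : Z) ==> wgm M ==> ghm M (gsub N Z) d f"
 by (rule ghmI) (auto simp: ghm_closed ghm_add ghm_smult ghm_gr gr_carrier)

lemma ghm_codom_incl: "ghm M (gsub N Z) d f ==> gsubm N Z ==> ghm M N d f"
 unfolding ghm_def by (auto dest: gsubm_carrier)

end

section \<open>Shifts and quotients of graded modules\<close>

context gring
begin

lemma shift_simps [simp]: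
 "cr (shift d M) = cr M" "add (shift d M) = add M" "zero (shift d M) = zero M"
 "module.smult (shift d M) = module.smult M" "gr (shift d M) i = gr M (i - d)"
 by (auto simp: shift_def)

lemma lmod_shift: "lmod R M ==> lmod R (shift d M)"
proof -
 assume "lmod R M"
 then interpret M: lmod R M .
 show ?thesis
  unfolding lmod_def lmod_axioms_def
 proof (intro conjI allI impI)
  show "abelian_group (shift d M)"
  proof (rule abelian_groupI)
  fix x assume x: "x : cr (shift d M)"
  then show "EX y:cr (shift d M). y +[shift d M] x = 0[shift d M]"
  by (intro bexI[of _ "-[M] x"]) (auto simp: M.M.l_neg)
  qed (auto simp: M.M.a_ac)
 qed (auto simp: M.smult_l_distr M.smult_r_distr M.smult_assoc1 ring_axioms)
qed

lemma wgm_shift: "wgm M ==> wgm (shift d M)"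
 unfolding wgm_def using lmod_shift[of M d]
 by (auto simp: subset_iff) (metis add.commute add_diff_eq)

lemma ghm_shift_codom: "ghm M (shift (- d) N) 0 f <-> ghm M N d f"
 unfolding ghm_def by simp

lemma ghm_shift_codom': "ghm M (shift d N) e f <-> ghm M N (e - d) f"
 unfolding ghm_def by (simp add: algebra_simps)

lemma gquot_simps:
 assumes M: "gmod M" and Z: "gsubm M Z"
 shows "cr (gquot M Z) = (%x. Z +>[M] x) ` cr M" "0[gquot M Z] = Z"
  "!!x y. x : cr M ==> y : cr M ==> (Z +>[M] x) +[gquot M Z] (Z +>[M] y) = Z +>[M] (x +[M] y)"
  "!!x a. x : cr M ==> a : cr R ==> a *[gquot M Z] (Z +>[M] x) = Z +>[M] (a *[M] x)"
  "!!i. gr (gquot M Z) i = (%x. Z +>[M] x) ` gr M i"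
  "!!x y. x : cr M ==> y : cr M ==> Z +>[M] x = Z +>[M] y <-> x -[M] y : Z"
proof -
 interpret M: lmod R M using M gmod_lmod by auto
 interpret Z: abelian_subgroup Z M by (rule gsubm_subgroup[OF M Z])
 show "cr (gquot M Z) = (%x. Z +>[M] x) ` cr M"
  by (auto simp: gquot_def quot_def module.extend_def A_RCOSETS_def')
 show "0[gquot M Z] = Z" "!!i. gr (gquot M Z) i = (%x. Z +>[M] x) ` gr M i"
  by (auto simp: gquot_def quot_def module.extend_def)
 show "(Z +>[M] x) +[gquot M Z] (Z +>[M] y) = Z +>[M] (x +[M] y)" if "x : cr M" "y : cr M" for x y
  using Z.a_rcos_sum[OF that] by (simp add: gquot_def quot_def module.extend_def)
 show eq: "Z +>[M] x = Z +>[M] y <-> x -[M] y : Z" if x: "x : cr M" and y: "y : cr M" for x y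
 proof
  assume "Z +>[M] x = Z +>[M] y"
  then have "x : Z +>[M] y" using Z.a_rcos_self[OF x] by simp
  then show "x -[M] y : Z" using Z.a_rcos_module[OF y x] by (simp add: a_minus_def)
 next
  assume "x -[M] y : Z"
  then have "x : Z +>[M] y" using Z.a_rcos_module[OF y x] by (simp add: a_minus_def)
  then show "Z +>[M] x = Z +>[M] y" using Z.a_repr_independence'[OF _ y] by simp
 qed
 show "a *[gquot M Z] (Z +>[M] x) = Z +>[M] (a *[M] x)" if x: "x : cr M" and a: "a : cr R" for x a
 proof -
  have "Z +>[M] (a *[M] y) = Z +>[M] (a *[M] x)" if "y : Z +>[M] x" for y
  proof -
  have y: "y : cr M" using that Z.a_elemrcos_carrier x by blast
  have "y -[M] x : Z" using that Z.a_rcos_module[OF x y] by (simp add: a_minus_def)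
  then have "a *[M] (y -[M] x) : Z" using gsubm_smult[OF Z a] by simp
  moreover have "a *[M] (y -[M] x) = a *[M] y -[M] a *[M] x"
  unfolding a_minus_def using a x y by (simp add: M.smult_r_distr M.smult_r_minus)
  ultimately show ?thesis using eq[of "a *[M] y" "a *[M] x"] a x y by simp
  qed
  moreover have "x : Z +>[M] x" using Z.a_rcos_self[OF x] .
  ultimately have "(\<Union>y\<in>Z +>[M] x. Z +>[M] (a *[M] y)) = Z +>[M] (a *[M] x)" by blast
  then show ?thesis by (simp add: gquot_def quot_def module.extend_def)
 qed
qed

definition proj :: "('a, 'b) gmodule => 'b set => 'b => 'b set" where "proj M Z x = Z +>[M] x"

lemma gmod_gquot_aux:
 assumes M: "gmod M" and Z: "gsubm M Z"
 shows "lmod R (gquot M Z)"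
  and "!!A g. finite A ==> (!!i. i : A ==> g i : cr M) ==> (fs (gquot M Z) A (%i. Z +>[M] g i)) = Z +>[M] (fs M A (%i. g i))"
proof -
 interpret M: lmod R M using M gmod_lmod by auto
 interpret Z: abelian_subgroup Z M by (rule gsubm_subgroup[OF M Z])
 note q = gquot_simps[OF M Z]
 have z: "Z +>[M] 0[M] = Z" using M.M.a_coset_add_zero Z.a_subset by blast
 show "lmod R (gquot M Z)"
  unfolding lmod_def lmod_axioms_def
 proof (intro conjI allI impI)
  show "abelian_group (gquot M Z)"
  proof (rule abelian_groupI)
  fix X assume "X : cr (gquot M Z)"
  then obtain x where x: "x : cr M" "X = Z +>[M] x" using q(1) by auto
  show "EX y:cr (gquot M Z). y +[gquot M Z] X = 0[gquot M Z]"
  by (rule bexI[of _ "Z +>[M] (-[M] x)"]) (use x q(1,2,3) z in \<open>auto simp: M.M.l_neg\<close>)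
  show "0[gquot M Z] +[gquot M Z] X = X" using q(3)[of "0[M]" x] x q(2) z by simp
  next
  show "0[gquot M Z] : cr (gquot M Z)" using q(1,2) z by (metis M.M.zero_closed image_eqI)
  qed (use q(1,3) in \<open>auto simp: M.M.a_ac\<close>)
 qed (use q(1,3,4) in \<open>auto simp: M.smult_l_distr M.smult_r_distr M.smult_assoc1 ring_axioms\<close>)
 then interpret Q: lmod R "gquot M Z" .
 show "(fs (gquot M Z) A (%i. Z +>[M] g i)) = Z +>[M] (fs M A (%i. g i))"
  if "finite A" "!!i. i : A ==> g i : cr M" for A :: "'z set" and g
  using that
 proof (induction A rule: finite_induct)
  case (insert x F)
  then have "(fs (gquot M Z) (insert x F) (%i. Z +>[M] g i)) = (Z +>[M] g x) +[gquot M Z] (fs (gquot M Z) F (%i. Z +>[M] g i))"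
  using q(1) by (intro Q.M.finsum_insert) auto
  also have "... = Z +>[M] (g x +[M] (fs M F (%i. g i)))"
  using insert q(3)[of "g x" "\<Oplus>\<^bsub>M\<^esub>i\<in>F. g i"] by (simp add: M.M.finsum_closed Pi_iff)
  also have "g x +[M] (fs M F (%i. g i)) = (fs M (insert x F) (%i. g i))"
  using insert by (intro M.M.finsum_insert[symmetric]) auto
  finally show ?case .
 qed (use q(2) z in auto)
qed

lemma gmod_gquot:
 assumes M: "gmod M" and Z: "gsubm M Z"
 shows "gmod (gquot M Z)" and "ghm M (gquot M Z) 0 (proj M Z)"
  and "!!x. x : cr M ==> proj M Z x = 0[gquot M Z] <-> x : Z"
  and "proj M Z ` cr M = cr (gquot M Z)"
proof -
 interpret M: lmod R M using M gmod_lmod by auto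
 interpret Z: abelian_subgroup Z M by (rule gsubm_subgroup[OF M Z])
 note q = gquot_simps[OF M Z]
 have z: "Z +>[M] 0[M] = Z" using M.M.a_coset_add_zero Z.a_subset by blast
 note grc = gr_carrier[OF gmod_wgm[OF M]] and gmw = gmod_wgm[OF M]
 show gh: "ghm M (gquot M Z) 0 (proj M Z)"
  by (rule ghmI) (use q in \<open>auto simp: proj_def\<close>)
 show "proj M Z x = 0[gquot M Z] <-> x : Z" if "x : cr M" for x
 proof -
  have "x +[M] -[M] 0[M] = x"
  using that M.M.r_neg[OF M.M.zero_closed] M.M.l_zero[OF M.M.a_inv_closed[OF M.M.zero_closed]] M.M.r_zero[OF that] by metis
  then show ?thesis using q(6)[OF that M.M.zero_closed] q(2) z unfolding proj_def a_minus_def by metis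
 qed
 show "proj M Z ` cr M = cr (gquot M Z)" using q(1) by (simp add: proj_def)
 \<comment> \<open>Components are well defined modulo \<open>Z\<close> because \<open>Z\<close>
   contains the components of its elements.\<close>
 have wd: "Z +>[M] hp M i x = Z +>[M] hp M i y" if "x : cr M" "y : cr M" "Z +>[M] x = Z +>[M] y" for x y i
 proof -
  have d: "x -[M] y : Z" using q(6) that by simp
  have "x = (x -[M] y) +[M] y" using that by (simp add: a_minus_def M.M.a_assoc M.M.l_neg)
  then have e: "hp M i x = hp M i (x -[M] y) +[M] hp M i y" using hp_add[OF M, of "x -[M] y" y i] that by simp
  have c: "hp M i x : cr M" "hp M i y : cr M" "hp M i (x -[M] y) : cr M" using hp_carrier[OF M] that by auto
  have "hp M i x -[M] hp M i y = hp M i (x -[M] y)" using e c by (simp add: a_minus_def M.M.a_assoc M.M.r_neg)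
  then show ?thesis using gsubm_hp[OF Z d, of i] q(6)[OF c(1,2)] by simp
 qed
 define h where "h i X = Z +>[M] hp M i (SOME x. x : cr M & X = Z +>[M] x)" for i X
 have h: "h i (Z +>[M] x) = Z +>[M] hp M i x" if x: "x : cr M" for i x
 proof -
  have "EX y. y : cr M & Z +>[M] x = Z +>[M] y" using x by auto
  from someI_ex[OF this] show ?thesis unfolding h_def using wd x by (metis (no_types, lifting))
 qed
 show "gmod (gquot M Z)"
 proof (rule gmodI[where h = h])
  show "wgm (gquot M Z)"
  unfolding wgm_def
  proof (intro conjI allI ballI)
  show "lmod R (gquot M Z)" by (rule gmod_gquot_aux(1)[OF M Z])
  fix i
  show "gr (gquot M Z) i <= cr (gquot M Z)" using q(1,5) grc by auto
  show "0[gquot M Z] : gr (gquot M Z) i" using q(2,5) z gr_zero[OF gmw] by (metis image_eqI)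
  fix X assume "X : gr (gquot M Z) i"
  then obtain x where x: "x : gr M i" "X = Z +>[M] x" using q(5) by auto
  { fix Y assume "Y : gr (gquot M Z) i"
  then obtain y where y: "y : gr M i" "Y = Z +>[M] y" using q(5) by auto
  then show "X +[gquot M Z] Y : gr (gquot M Z) i" using q(3,5) grc x gr_add[OF gmw x(1) y(1)] by auto }
  fix j a assume a: "a : Rg j"
  then have "a : cr R" using Rg_sub by auto
  then show "a *[gquot M Z] X : gr (gquot M Z) (i + j)" using q(4,5) grc x gr_smult[OF gmw a x(1)] by auto
  qed
  show "has_hp (gquot M Z) h"
  unfolding has_hp_def
  proof (intro conjI allI ballI impI)
  fix X i assume "X : cr (gquot M Z)"
  then obtain x where x: "x : cr M" "X = Z +>[M] x" using q(1) by auto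
  show "h i X : gr (gquot M Z) i" using x h q(5) hp_gr[OF M] by auto
  show "h i (X +[gquot M Z] Y) = h i X +[gquot M Z] h i Y" if Y: "Y : cr (gquot M Z)" for Y
  proof -
  obtain y where y: "y : cr M" "Y = Z +>[M] y" using Y q(1) by auto
  then show ?thesis using x h q(3) hp_add[OF M x(1) y(1)] hp_carrier[OF M] by simp
  qed
  next
  fix X i assume "X : gr (gquot M Z) i"
  then obtain x where x: "x : gr M i" "X = Z +>[M] x" using q(5) by auto
  show "h i X = X" using x h grc hp_same[OF M x(1)] by simp
  fix j assume "j ~= i"
  then show "h j X = 0[gquot M Z]" using x h grc hp_other[OF M x(1)] z q(2) by simp
  next
  fix X assume "X : cr (gquot M Z)"
  then obtain x where x: "x : cr M" "X = Z +>[M] x" using q(1) by auto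
  obtain I where I: "finite I" "ALL J. finite J --> I <= J --> x = (fs M J (%i. hp M i x))" using hp_decomp[OF M x(1)] by auto
  show "EX I. finite I & (ALL J. finite J --> I <= J --> X = (fs (gquot M Z) J (%i. h i X)))"
  proof (intro exI[of _ I] conjI allI impI I(1))
  fix J assume J: "finite J" "I <= J"
  have "(fs (gquot M Z) J (%i. h i X)) = (fs (gquot M Z) J (%i. Z +>[M] hp M i x))" using h[OF x(1)] x(2) by simp
  also have "... = Z +>[M] (fs M J (%i. hp M i x))"
  by (rule gmod_gquot_aux(2)[OF M Z J(1)]) (rule hp_carrier[OF M x(1)])
  also have "... = X" using I(2) J x(2) by simp
  finally show "X = (fs (gquot M Z) J (%i. h i X))" by simp
  qed
  qed
 qed
qed

end

section \<open>The modules P, free modules and duals over the skew group algebra\<close>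

context dihz
begin

sublocale gring R "skew_gr n"
 by (unfold_locales) (auto simp: skew_gr_iff)

text \<open>The parameter is a matrix representation, not a class; \<open>Pmod\<close> is the
  instance at the chosen representative.\<close>

definition Pm :: "nat => mrep => (A, S vec) gmodule" where
 "Pm m rx = (| carrier = cV m, monoid.mult = undefined, one = undefined, zero = zv m, add = (+),
  module.smult = (%a x. vec m (%i. SUM w : W. a w * (SUM j < m. constS (rx w $$ (i, j)) * ac w (x $ j)))),
  gr = (%i. {x : cV m. ALL j < m. x $ j : S_gr i}) |)"

lemma Pmod_Pm: "PP nu = Pm (rep_deg (rep_of nu)) (rep_of nu)"
 by (simp add: Pmod_def Pm_def Let_def)

lemma Pm_simps [simp]:
 "cr (Pm m rx) = cV m" "0[Pm m rx] = zv m" "x +[Pm m rx] y = x + y"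
 "gr (Pm m rx) i = {x : cV m. ALL j < m. x $ j : S_gr i}"
 by (auto simp: Pm_def)

lemma Pm_smult: "a *[Pm m rx] x = vec m (%i. SUM w : W. a w * (SUM j < m. constS (rx w $$ (i, j)) * ac w (x $ j)))"
 by (simp add: Pm_def)

lemma lmod_Pm: assumes rx: "rep m rx" shows "lmod R (Pm m rx)"
 unfolding lmod_def lmod_axioms_def
proof (intro conjI allI impI)
 show "ring R" by (rule ring_R)
 show "abelian_group (Pm m rx)"
 proof (rule abelian_groupI)
  fix x assume x: "x : cr (Pm m rx)"
  then show "EX y:cr (Pm m rx). y +[Pm m rx] x = 0[Pm m rx]"
  by (intro bexI[of _ "- x"]) auto
 qed (auto intro: comm_add_vec)
 fix a b x y
 assume a: "a : cr R" and x: "x : cr (Pm m rx)"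
 show "a *[Pm m rx] x : cr (Pm m rx)" by (simp add: Pm_smult)
 { assume b: "b : cr R"
  show "(a +[R] b) *[Pm m rx] x = a *[Pm m rx] x +[Pm m rx] b *[Pm m rx] x"
  by (intro eq_vecI) (auto simp: Pm_smult R_add distrib_right sum.distrib)
  show "(a \<otimes>[R] b) *[Pm m rx] x = a *[Pm m rx] (b *[Pm m rx] x)"
  proof (rule eq_vecI)
  fix i assume "i < dim_vec (a *[Pm m rx] (b *[Pm m rx] x))"
  then have i: "i < m" by (simp add: Pm_smult)
  define X where "X w = (SUM j<m. constS (rx w $$ (i, j)) * ac w (x $ j))" for w
  have "((a \<otimes>[R] b) *[Pm m rx] x) $ i = (SUM w:W. (SUM u:W. a u * ac u (b (dinv u ** w))) * X w)"
  using i by (simp add: Pm_smult R_mult X_def)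
  also have "... = (SUM u:W. SUM w:W. a u * ac u (b (dinv u ** w)) * X w)"
  unfolding sum_distrib_right by (rule sum.swap)
  \<comment> \<open>The substitution \<open>w = u ** t\<close> separates the group elements of the
    two factors.\<close>
  also have "... = (SUM u:W. SUM t:W. a u * ac u (b (dinv u ** (u ** t))) * X (u ** t))"
  by (intro sum.cong refl sum_W_shift[symmetric, where f = "%w. a _ * ac _ (b (dinv _ ** w)) * X w"])
  also have "... = (SUM u:W. SUM t:W. a u * (SUM k<m. constS (rx u $$ (i, k)) * ac u (b t * (SUM j<m. constS (rx t $$ (k, j)) * ac t (x $ j)))))"
  proof (intro sum.cong refl)
  fix u t assume u: "u : W" and t: "t : W"
  have 1: "dinv u ** (u ** t) = t" using u t by (simp add: D.m_assoc[symmetric])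
  have r: "rx (u ** t) $$ (i, j) = (SUM k<m. rx u $$ (i, k) * rx t $$ (k, j))" if "j < m" for j
  using rep_mult[OF rx u t] rep_carrier[OF rx u] rep_carrier[OF rx t] i that
  by (simp add: scalar_prod_def lessThan_atLeast0)
  have "X (u ** t) = (SUM j<m. SUM k<m. constS (rx u $$ (i, k)) * constS (rx t $$ (k, j)) * ac u (ac t (x $ j)))"
  unfolding X_def using r by (simp add: constS_sum constS_mult act_act sum_distrib_right)
  also have "... = (SUM k<m. SUM j<m. constS (rx u $$ (i, k)) * constS (rx t $$ (k, j)) * ac u (ac t (x $ j)))"
  by (rule sum.swap)
  finally have "ac u (b t) * X (u ** t) = (SUM k<m. constS (rx u $$ (i, k)) * ac u (b t * (SUM j<m. constS (rx t $$ (k, j)) * ac t (x $ j))))"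
  by (simp add: act_mult act_sum sum_distrib_left algebra_simps)
  then show "a u * ac u (b (dinv u ** (u ** t))) * X (u ** t) = a u * (SUM k<m. constS (rx u $$ (i, k)) * ac u (b t * (SUM j<m. constS (rx t $$ (k, j)) * ac t (x $ j))))"
  unfolding 1 by (simp add: mult.assoc)
  qed
  also have "... = (SUM u:W. a u * (SUM k<m. constS (rx u $$ (i, k)) * ac u (SUM t:W. b t * (SUM j<m. constS (rx t $$ (k, j)) * ac t (x $ j)))))"
  unfolding act_sum sum_distrib_left by (intro sum.cong refl sum.swap)
  also have "... = (a *[Pm m rx] (b *[Pm m rx] x)) $ i"
  using i by (simp add: Pm_smult)
  finally show "((a \<otimes>[R] b) *[Pm m rx] x) $ i = (a *[Pm m rx] (b *[Pm m rx] x)) $ i" .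
  qed (simp add: Pm_smult) }
 assume y: "y : cr (Pm m rx)"
 show "a *[Pm m rx] (x +[Pm m rx] y) = a *[Pm m rx] x +[Pm m rx] a *[Pm m rx] y"
  using x y by (intro eq_vecI) (auto simp: Pm_smult act_add distrib_left sum.distrib)
next
 fix x assume x: "x : cr (Pm m rx)"
 show "1[R] *[Pm m rx] x = x"
 proof (rule eq_vecI)
  fix i assume "i < dim_vec x"
  then have i: "i < m" using x by simp
  have "(1[R] *[Pm m rx] x) $ i = (SUM w:W. if w = e0 then (SUM j<m. constS (rx w $$ (i, j)) * ac w (x $ j)) else 0)"
  using i unfolding Pm_smult R_one by (simp only: index_vec) (rule sum.cong, auto simp: tensor_def)
  also have "... = (SUM j<m. constS (rx e0 $$ (i, j)) * x $ j)" by simp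
  also have "... = (SUM j<m. if j = i then x $ j else 0)"
  using rep_one[OF rx] i by (intro sum.cong) auto
  also have "... = x $ i" using i by simp
  finally show "(1[R] *[Pm m rx] x) $ i = x $ i" .
 qed (use x in \<open>simp add: Pm_smult\<close>)
qed

lemma finsum_Pm:
 assumes rx: "rep m rx" and "finite A" "!!i. i : A ==> f i : cV m"
 shows "(fs (Pm m rx) A (%i. f i)) = vec m (%j. SUM i:A. f i $ j)"
proof -
 interpret P: lmod R "Pm m rx" by (rule lmod_Pm[OF rx])
 show ?thesis using assms(2,3)
 proof (induction A rule: finite_induct)
  case (insert x F)
  then have "(fs (Pm m rx) (insert x F) (%i. f i)) = f x + vec m (%j. SUM i:F. f i $ j)"
  by (subst P.M.finsum_insert) auto
  also have "... = vec m (%j. SUM i:insert x F. f i $ j)"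
  using insert by (intro eq_vecI) auto
  finally show ?case .
 qed (auto intro!: eq_vecI)
qed

lemma gmod_Pm: assumes rx: "rep m rx" shows "gmod (Pm m rx)"
proof (rule gmodI[where h = "%i x. vec m (%j. hS i (x $ j))"])
 show "wgm (Pm m rx)"
  unfolding wgm_def
 proof (intro conjI allI ballI lmod_Pm[OF rx])
  fix i x assume x: "x : gr (Pm m rx) i"
  show "x +[Pm m rx] y : gr (Pm m rx) i" if "y : gr (Pm m rx) i" for y
  using x that by (auto simp: S_gr_add)
  fix j a assume a: "a : skew_gr n j"
  have "a w * (constS c * ac w (x $ k)) : S_gr (i + j)" if "k < m" for w c k
  proof -
  have "a w * (constS c * ac w (x $ k)) : S_gr (j + (0 + i))"
  using a x that by (intro S_gr_mult act_gr) (auto simp: skew_gr_iff)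
  then show ?thesis by (simp add: add.commute)
  qed
  then show "a *[Pm m rx] x : gr (Pm m rx) (i + j)"
  by (auto simp: Pm_smult sum_distrib_left intro!: S_gr_sum)
 qed auto
 show "has_hp (Pm m rx) (%i x. vec m (%j. hS i (x $ j)))"
  unfolding has_hp_def
 proof (intro conjI allI ballI impI)
  fix x assume x: "x : cr (Pm m rx)"
  have "ALL j. EX I. finite I & (ALL J. finite J --> I <= J --> x $ j = (SUM i:J. hS i (x $ j)))" using hS_sum by auto
  then obtain I where I: "!!j. finite (I j)" "!!j J. finite J ==> I j <= J ==> x $ j = (SUM i:J. hS i (x $ j))" by metis
  show "EX I. finite I & (ALL J. finite J --> I <= J --> x = (fs (Pm m rx) J (%i. vec m (%j. hS i (x $ j)))))"
  proof (intro exI[of _ "\<Union>j<m. I j"] conjI allI impI)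
  fix J assume J: "finite J" "(\<Union>j<m. I j) <= J"
  have "(fs (Pm m rx) J (%i. vec m (%j. hS i (x $ j)))) = vec m (%j. SUM i:J. hS i (x $ j))"
  by (subst finsum_Pm[OF rx J(1)]) (auto intro!: eq_vecI)
  also have "... = x"
  proof (rule eq_vecI)
  fix j assume "j < dim_vec x"
  then have j: "j < m" using x by simp
  then have "I j <= J" using J(2) by blast
  from I(2)[OF J(1) this] show "vec m (%j. SUM i:J. hS i (x $ j)) $ j = x $ j"
  unfolding index_vec[OF j] by (rule sym)
  qed (use x in auto)
  finally show "x = (fs (Pm m rx) J (%i. vec m (%j. hS i (x $ j))))" by simp
  qed (use I in auto)
 qed (auto simp: hS_gr hS_add hS_same hS_other intro!: eq_vecI)
qed

lemma gfree_simps [simp]: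
 "cr (G ds) = {x. (ALL j < length ds. x j : cr R) & (ALL j >= length ds. x j = 0[R])}"
 "0[G ds] = (%j. 0[R])" "x +[G ds] y = (%j. x j +[R] y j)" "a *[G ds] x = (%j. a \<otimes>[R] x j)"
 "gr (G ds) i = {x. (ALL j < length ds. x j : skew_gr n (i - ds ! j)) & (ALL j >= length ds. x j = 0[R])}"
 by (auto simp: gfree_def)

lemma gfree_comp_carrier: "x : cr (G ds) ==> x j : cr R"
 by (cases "j < length ds") auto

lemma lmod_gfree: "lmod R (G ds)"
 unfolding lmod_def lmod_axioms_def
proof (intro conjI allI impI)
 show "ring R" by (rule ring_R)
 show "abelian_group (G ds)"
 proof (rule abelian_groupI)
  fix x assume x: "x : cr (G ds)"
  show "EX y:cr (G ds). y +[G ds] x = 0[G ds]"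
  by (rule bexI[of _ "%j. -[R] x j"]) (use x gfree_comp_carrier[OF x] in \<open>auto simp: R.l_neg R.minus_zero\<close>)
  show "0[G ds] +[G ds] x = x" using gfree_comp_carrier[OF x] by auto
  fix y assume y: "y : cr (G ds)"
  show "x +[G ds] y : cr (G ds)" using x y by auto
  show "x +[G ds] y = y +[G ds] x"
  using gfree_comp_carrier[OF x] gfree_comp_carrier[OF y] by (auto simp: R.a_comm)
  fix z assume z: "z : cr (G ds)"
  show "x +[G ds] y +[G ds] z = x +[G ds] (y +[G ds] z)"
  using gfree_comp_carrier[OF x] gfree_comp_carrier[OF y] gfree_comp_carrier[OF z] by (auto simp: R.a_assoc)
 qed auto
 fix a b x y
 assume a: "a : cr R" and x: "x : cr (G ds)"
 note xc = gfree_comp_carrier[OF x]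
 show "a *[G ds] x : cr (G ds)" using a x by auto
 { assume b: "b : cr R"
  show "(a +[R] b) *[G ds] x = a *[G ds] x +[G ds] b *[G ds] x"
  using a b xc by (auto simp: R.l_distr)
  show "(a \<otimes>[R] b) *[G ds] x = a *[G ds] (b *[G ds] x)"
  using a b xc by (auto simp: R.m_assoc) }
 assume y: "y : cr (G ds)"
 show "a *[G ds] (x +[G ds] y) = a *[G ds] x +[G ds] a *[G ds] y"
  using a xc gfree_comp_carrier[OF y] by (auto simp: R.r_distr)
next
 fix x assume x: "x : cr (G ds)"
 show "1[R] *[G ds] x = x" using gfree_comp_carrier[OF x] by auto
qed

lemma finsum_gfree:
 assumes "finite A" "!!i. i : A ==> f i : cr (G ds)"
 shows "(fs (G ds) A (%i. f i)) = (%j. \<Oplus>\<^bsub>R\<^esub>i\<in>A. f i j)"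
proof -
 interpret P: lmod R "G ds" by (rule lmod_gfree)
 show ?thesis using assms
 proof (induction A rule: finite_induct)
  case (insert x F)
  have c: "f i j : cr R" if "i : insert x F" for i j using gfree_comp_carrier insert(4) that by blast
  have "(fs (G ds) (insert x F) (%i. f i)) = f x +[G ds] (fs (G ds) F (%i. f i))"
  using insert by (intro P.M.finsum_insert) blast+
  also have "... = (%j. \<Oplus>\<^bsub>R\<^esub>i\<in>insert x F. f i j)"
  proof
  fix j
  have "(fs R (insert x F) (%i. f i j)) = f x j +[R] (fs R F (%i. f i j))"
  using insert c by (intro R.finsum_insert) auto
  then show "(f x +[G ds] (fs (G ds) F (%i. f i))) j = (fs R (insert x F) (%i. f i j))"
  using insert by simp
  qed
  finally show ?case .
 qed simp
qed

lemma gmod_gfree: "gmod (G ds)"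
proof (rule gmodI[where h = "%i x j. if j < length ds then (%w. hS (i - ds ! j) (x j w)) else 0[R]"])
 have z: "(%w. 0) : skew_gr n i" for i by (simp add: skew_gr_iff R_carrier)
 have zR: "0[R] : skew_gr n i" for i using z by (simp add: R_zero)
 have addR: "a +[R] b : skew_gr n i" if "a : skew_gr n i" "b : skew_gr n i" for a b i
  using that by (simp add: skew_gr_iff R_add S_gr_add R_carrier)
 show "wgm (G ds)"
  unfolding wgm_def
 proof (intro conjI allI ballI lmod_gfree)
  fix i
  show "gr (G ds) i <= cr (G ds)" by (auto simp: skew_gr_iff)
  show "0[G ds] : gr (G ds) i" using zR by simp
  fix x assume x: "x : gr (G ds) i"
  show "x +[G ds] y : gr (G ds) i" if "y : gr (G ds) i" for y
  using x that addR by simp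
  fix j a assume a: "a : skew_gr n j"
  have "a \<otimes>[R] x k : skew_gr n (i + j - ds ! k)" if "k < length ds" for k
  proof -
  have "a \<otimes>[R] x k : skew_gr n (j + (i - ds ! k))" using x that a by (intro skew_gr_mult) auto
  then show ?thesis by (simp add: algebra_simps)
  qed
  moreover have "a : cr R" using a by (simp add: skew_gr_iff)
  ultimately show "a *[G ds] x : gr (G ds) (i + j)" using x by simp
 qed
 show "has_hp (G ds) (%i x j. if j < length ds then (%w. hS (i - ds ! j) (x j w)) else 0[R])"
  unfolding has_hp_def
 proof (intro conjI allI ballI impI)
  fix x i assume x: "x : cr (G ds)"
  show "(%j. if j < length ds then (%w. hS (i - ds ! j) (x j w)) else 0[R]) : gr (G ds) i"
  using x by (simp add: skew_gr_iff hS_gr R_carrier)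
  fix y assume y: "y : cr (G ds)"
  show "(%j. if j < length ds then (%w. hS (i - ds ! j) ((x +[G ds] y) j w)) else 0[R])
  = (%j. if j < length ds then (%w. hS (i - ds ! j) (x j w)) else 0[R]) +[G ds]
  (%j. if j < length ds then (%w. hS (i - ds ! j) (y j w)) else 0[R])"
  by (intro ext) (simp add: R_add R_zero hS_add)
 next
  fix x i assume x: "x : gr (G ds) i"
  show "(%j. if j < length ds then (%w. hS (i - ds ! j) (x j w)) else 0[R]) = x"
  using x by (auto simp: skew_gr_iff hS_same not_less)
  fix k assume k: "k ~= i"
  have "hS (k - ds ! j) (x j w) = 0" if "j < length ds" for j w
  using x k that by (intro hS_other[of _ "i - ds ! j"]) (auto simp: skew_gr_iff)
  then show "(%j. if j < length ds then (%w. hS (k - ds ! j) (x j w)) else 0[R]) = 0[G ds]"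
  by (intro ext) (simp add: R_zero)
 next
  fix x assume x: "x : cr (G ds)"
  have "ALL j w. EX I. finite I & (ALL J. finite J --> I <= J --> x j w = (SUM i:J. hS i (x j w)))" using hS_sum by auto
  then obtain I where I: "!!j w. finite (I j w)" "!!j w J. finite J ==> I j w <= J ==> x j w = (SUM i:J. hS i (x j w))" by metis
  \<comment> \<open>Generator \<open>j\<close> sits in degree \<open>ds ! j\<close>, so a polynomial
    of degree \<open>i\<close> in coordinate \<open>j\<close> contributes to degree
    \<open>i + ds ! j\<close>.\<close>
  let ?I = "\<Union>j<length ds. \<Union>w\<in>W. (%i. i + ds ! j) ` I j w"
  let ?h = "%i j. if j < length ds then (%w. hS (i - ds ! j) (x j w)) else 0[R]"
  show "EX I. finite I & (ALL J. finite J --> I <= J --> x = (fs (G ds) J (%i. ?h i)))"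
  proof (intro exI[of _ ?I] conjI allI impI)
  fix J assume J: "finite J" "?I <= J"
  have hc: "?h i j : cr R" for i j using x by (simp add: R_carrier R_zero)
  have "(fs (G ds) J (%i. ?h i)) = (%j. \<Oplus>\<^bsub>R\<^esub>i\<in>J. ?h i j)"
  by (rule finsum_gfree[OF J(1)]) (use x in \<open>simp add: R_carrier R_zero\<close>)
  also have "... = x"
  proof (intro ext)
  fix j w
  have "(fs R J (%i. ?h i j)) w = (SUM i:J. ?h i j w)" by (subst R_finsum[OF J(1) hc]) simp
  also have "... = x j w"
  proof (cases "j < length ds & w : W")
  case True
  have "I j w <= (%i. i - ds ! j) ` J"
  proof
  fix i assume "i : I j w"
  then have "i + ds ! j : J" using J True by blast
  then have "i + ds ! j - ds ! j : (%i. i - ds ! j) ` J" by (rule imageI)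
  then show "i : (%i. i - ds ! j) ` J" by simp
  qed
  then have "x j w = (SUM i:(%i. i - ds ! j) ` J. hS i (x j w))" using I(2) J(1) by blast
  also have "... = (SUM i:J. hS (i - ds ! j) (x j w))"
  by (subst sum.reindex) (auto simp: inj_on_def)
  finally show ?thesis using True by simp
  next
  case False
  then have "x j w = 0" using x by (cases "j < length ds") (simp_all add: R_carrier R_zero)
  then show ?thesis by (simp add: R_zero)
  qed
  finally show "(fs R J (%i. ?h i j)) w = x j w" .
  qed
  finally show "x = (fs (G ds) J (%i. ?h i))" by simp
  qed (use I in auto)
 qed
qed

lemma cscale_lmod:
 assumes "lmod R M" "x : cr M"
 shows "cscale M c x : cr M" "w : W ==> tensor p w *[M] cscale M c x = cscale M c (tensor p w *[M] x)"
proof -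
 interpret M: lmod R M by fact
 show "cscale M c x : cr M" unfolding cscale_def using assms by simp
 assume w: "w : W"
 show "tensor p w *[M] cscale M c x = cscale M c (tensor p w *[M] x)"
  unfolding cscale_def using assms w by (simp flip: M.smult_assoc1 add: tensor_mult mult.commute)
qed

text \<open>The anti-automorphism of the skew group algebra that fixes polynomials and inverts group
  elements, applied to \<open>tensor p w\<close>. It makes functionals a left module again.\<close>

definition dag :: "dih => S => A" where "dag w p = tensor (ac (dinv w) p) (dinv w)"

lemma dag_carrier [simp]: "w : W ==> dag w p : cr R"
 unfolding dag_def by simp

lemma dag_mult: "u : W ==> v : W ==> dag v q \<otimes>[R] dag u p = dag (u ** v) (p * ac u q)"
 unfolding dag_def by (subst tensor_mult)
  (auto simp: act_mult D.inv_mult_group act_act[symmetric] D.m_assoc mult.commute)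

lemma dual_simps [simp]:
 "cr (dl M) = dual_carrier M" "0[dl M] = (\<lambda>x\<in>cr M. 0)"
 "f +[dl M] g = (\<lambda>x\<in>cr M. f x + g x)"
 "gr (dl M) i = {f : dual_carrier M. ALL j. j ~= - i --> (ALL x : gr M j. f x = 0)}"
 by (auto simp: dual_def)

lemma dual_smult: "a *[dl M] f = (\<lambda>x\<in>cr M. SUM w : W. f (dag w (a w) *[M] x))"
 by (simp add: dual_def dag_def)

lemma dual_carrierD:
 assumes "f : dual_carrier M"
 shows "x : cr M ==> y : cr M ==> f (x +[M] y) = f x + f y"
  "x : cr M ==> f (cscale M c x) = c * f x" "f : extensional (cr M)"
 using assms unfolding dual_carrier_def by auto

lemma dual_zero:
 assumes "lmod R M" "f : dual_carrier M" shows "f 0[M] = 0"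
proof -
 interpret M: lmod R M by fact
 show ?thesis using dual_carrierD(1)[OF assms(2), of "0[M]" "0[M]"] by simp
qed

lemma dual_finsum:
 assumes "lmod R M" "f : dual_carrier M" "finite A" "!!i. i : A ==> g i : cr M"
 shows "f (fs M A (%i. g i)) = (SUM i:A. f (g i))"
proof -
 interpret M: lmod R M by fact
 show ?thesis using assms(3,4)
 proof (induction A rule: finite_induct)
  case (insert x F)
  then show ?case using dual_carrierD(1)[OF assms(2)] by (subst M.M.finsum_insert) (auto simp: M.M.finsum_closed)
 qed (use dual_zero[OF assms(1,2)] in simp)
qed

lemma lmod_dual: assumes M: "lmod R M" shows "lmod R (dl M)"
proof -
 interpret M: lmod R M by fact
 have C: "(\<lambda>x\<in>cr M. f x + g x) : dual_carrier M" if "f : dual_carrier M" "g : dual_carrier M" for f g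
  using dual_carrierD[OF that(1)] dual_carrierD[OF that(2)] cscale_lmod[OF M]
  unfolding dual_carrier_def by (auto simp: algebra_simps)
 have sm: "f ((dag w (p + q)) *[M] x) = f (dag w p *[M] x) + f (dag w q *[M] x)"
  if "f : dual_carrier M" "x : cr M" "w : W" for f w p q x
  using that dual_carrierD(1)[OF that(1)] by (simp add: dag_def act_add tensor_add M.smult_l_distr)
 have sms: "f (dag w (sum p A) *[M] x) = (SUM i:A. f (dag w (p i) *[M] x))"
  if "f : dual_carrier M" "x : cr M" "w : W" for f w p x and A :: "dih set"
  using additive_sum[of "%p. f (dag w p *[M] x)" p A] sm[OF that] by simp
 have Sc: "a *[dl M] f : dual_carrier M" if f: "f : dual_carrier M" for a f
  unfolding dual_carrier_def
 proof (intro CollectI conjI ballI allI)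
  show "a *[dl M] f : extensional (cr M)" by (simp add: dual_smult)
  fix x assume x: "x : cr M"
  show "(a *[dl M] f) (x +[M] y) = (a *[dl M] f) x + (a *[dl M] f) y" if y: "y : cr M" for y
  using x y dual_carrierD(1)[OF f] by (simp add: dual_smult M.smult_r_distr sum.distrib)
  show "(a *[dl M] f) (cscale M c x) = c * (a *[dl M] f) x" for c
  proof -
  have "f (dag w (a w) *[M] cscale M c x) = c * f (dag w (a w) *[M] x)" if "w : W" for w
  using cscale_lmod(2)[OF M x, of "dinv w"] dual_carrierD(2)[OF f, of "dag w (a w) *[M] x"] x that
  by (simp add: dag_def)
  then show ?thesis using x cscale_lmod(1)[OF M x] by (simp add: dual_smult sum_distrib_left)
  qed
 qed
 show ?thesis
  unfolding lmod_def lmod_axioms_def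
 proof (intro conjI allI impI)
  show "ring R" by (rule ring_R)
  show "abelian_group (dl M)"
  proof (rule abelian_groupI)
  fix f assume f: "f : cr (dl M)"
  then have f: "f : dual_carrier M" by simp
  have "(\<lambda>x\<in>cr M. - f x) : dual_carrier M"
  using dual_carrierD[OF f] cscale_lmod[OF M] unfolding dual_carrier_def by auto
  then show "EX g:cr (dl M). g +[dl M] f = 0[dl M]"
  by (intro bexI[of _ "\<lambda>x\<in>cr M. - f x"]) auto
  show "0[dl M] +[dl M] f = f"
  using dual_carrierD(3)[OF f] by (auto simp: extensional_def restrict_def)
  next
  show "0[dl M] : cr (dl M)"
  using cscale_lmod[OF M] unfolding dual_simps dual_carrier_def by auto
  qed (use C in \<open>auto simp: algebra_simps\<close>)
  fix a b f g
  assume f: "f : cr (dl M)" and a: "a : cr R"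
  then have f: "f : dual_carrier M" by simp
  show "a *[dl M] f : cr (dl M)" using Sc[OF f] by simp
  show "a *[dl M] (f +[dl M] g) = a *[dl M] f +[dl M] a *[dl M] g"
  unfolding dual_smult by (auto simp: sum.distrib intro!: restrict_ext)
  assume b: "b : cr R"
  show "(a +[R] b) *[dl M] f = a *[dl M] f +[dl M] b *[dl M] f"
  unfolding dual_smult R_add dual_simps
  proof (intro ext)
  fix x
  show "(\<lambda>x\<in>cr M. SUM w:W. f (dag w (a w + b w) *[M] x)) x = (\<lambda>x\<in>cr M.
  (\<lambda>x\<in>cr M. SUM w:W. f (dag w (a w) *[M] x)) x + (\<lambda>x\<in>cr M. SUM w:W. f (dag w (b w) *[M] x)) x) x"
  proof (cases "x : cr M")
  case True
  have "(SUM w:W. f (dag w (a w + b w) *[M] x)) = (SUM w:W. f (dag w (a w) *[M] x) + f (dag w (b w) *[M] x))"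
  by (rule sum.cong[OF refl]) (rule sm[OF f True])
  then show ?thesis using True by (simp add: sum.distrib)
  qed simp
  qed
  show "(a \<otimes>[R] b) *[dl M] f = a *[dl M] (b *[dl M] f)"
  unfolding dual_smult
  proof (rule restrict_ext)
  fix x assume x: "x : cr M"
  have "(SUM w:W. f (dag w ((a \<otimes>[R] b) w) *[M] x)) = (SUM w:W. SUM u:W. f (dag w (a u * ac u (b (dinv u ** w))) *[M] x))"
  using sms[OF f x] by (simp add: R_mult)
  also have "... = (SUM u:W. SUM w:W. f (dag w (a u * ac u (b (dinv u ** w))) *[M] x))" by (rule sum.swap)
  \<comment> \<open>After the substitution \<open>w = u ** t\<close>, \<open>dag_mult\<close>
    reverses the two factors.\<close>
  also have "... = (SUM u:W. SUM t:W. f (dag (u ** t) (a u * ac u (b (dinv u ** (u ** t)))) *[M] x))"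
  by (intro sum.cong refl sum_W_shift[symmetric, where f = "%w. f (dag w (a _ * ac _ (b (dinv _ ** w))) *[M] x)"])
  also have "... = (SUM u:W. SUM t:W. f (dag t (b t) *[M] (dag u (a u) *[M] x)))"
  proof (intro sum.cong refl)
  fix u t assume u: "u : W" and t: "t : W"
  have "dinv u ** (u ** t) = t" using u t by (simp add: D.m_assoc[symmetric])
  then show "f (dag (u ** t) (a u * ac u (b (dinv u ** (u ** t)))) *[M] x) = f (dag t (b t) *[M] (dag u (a u) *[M] x))"
  using u t x by (simp flip: M.smult_assoc1 add: dag_mult)
  qed
  also have "... = (SUM w:W. (\<lambda>x\<in>cr M. SUM w:W. f (dag w (b w) *[M] x)) (dag w (a w) *[M] x))"
  using x by (intro sum.cong) auto
  finally show "(SUM w:W. f (dag w ((a \<otimes>[R] b) w) *[M] x)) = ..." .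
  qed
 next
  fix f assume "f : cr (dl M)"
  then have f: "f : dual_carrier M" by simp
  show "1[R] *[dl M] f = f"
  proof
  fix x
  show "(1[R] *[dl M] f) x = f x"
  proof (cases "x : cr M")
  case True
  have z: "f (dag w 0 *[M] x) = 0" for w
  using dual_zero[OF M f] True by (simp add: dag_def tensor_zero)
  have i: "dinv e0 = e0" using D.inv_one by simp
  have "(1[R] *[dl M] f) x = (SUM w:W. if w = e0 then f x else 0)"
  proof -
  have "f (dag w (tensor 1 e0 w) *[M] x) = (if w = e0 then f x else 0)" for w
  proof (cases "w = e0")
  case True
  then have "dag w (tensor 1 e0 w) = 1[R]" by (simp add: dag_def i R_one) (simp add: tensor_def)
  then show ?thesis using True \<open>x : cr M\<close> by simp
  next
  case False
  then have "tensor 1 e0 w = 0" by (simp add: tensor_def)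
  then show ?thesis using False z by simp
  qed
  then show ?thesis using True unfolding dual_smult R_one by simp
  qed
  then show ?thesis by simp
  next
  case False
  then show ?thesis using dual_carrierD(3)[OF f] by (simp add: dual_smult extensional_def)
  qed
  qed
 qed
qed

lemma wgm_dual: assumes M: "wgm M" shows "wgm (dl M)"
 unfolding wgm_def
proof (intro conjI allI ballI)
 have lM: "lmod R M" using M wgm_lmod by auto
 interpret M: lmod R M by (rule lM)
 show L: "lmod R (dl M)" by (rule lmod_dual[OF lM])
 interpret N: lmod R "dl M" by (rule L)
 fix i
 show "gr (dl M) i <= cr (dl M)" by auto
 show "0[dl M] : gr (dl M) i" using N.M.zero_closed gr_carrier[OF M] by auto
 fix f assume f: "f : gr (dl M) i"
 { fix g assume "g : gr (dl M) i"
  then show "f +[dl M] g : gr (dl M) i" using f N.M.a_closed[of f g] gr_carrier[OF M] by auto }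
 fix j a assume a: "a : skew_gr n j"
 have "a *[dl M] f : dual_carrier M" using N.smult_closed[of a f] a f by (simp add: skew_gr_iff)
 moreover have "(a *[dl M] f) x = 0" if k: "k ~= - (i + j)" and x: "x : gr M k" for k x
 proof -
  have "f (dag w (a w) *[M] x) = 0" if w: "w : W" for w
  proof -
  have "dag w (a w) : skew_gr n j" unfolding dag_def using a w by (intro tensor_gr act_gr) (auto simp: skew_gr_iff)
  then have "dag w (a w) *[M] x : gr M (k + j)" using gr_smult[OF M _ x] by simp
  moreover have "k + j ~= - i" using k by auto
  ultimately show ?thesis using f by auto
  qed
  then show ?thesis using gr_carrier[OF M x] by (simp add: dual_smult)
 qed
 ultimately show "a *[dl M] f : gr (dl M) (i + j)" by simp
qed

end

section \<open>Extending homomorphisms\<close>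

context gring
begin

text \<open>The last two clauses say that \<open>fy\<close> induces an isomorphism of degree
  \<open>e\<close> from \<open>M1/Z1\<close> to \<open>M2/Z2\<close>, phrased without forming the
  quotients. The typical \<open>M1\<close> and \<open>Z1\<close> are \<open>P_alpha\<close> and
  \<open>T_alpha\<close>.\<close>

definition pres :: "('a, 'b) gmodule => 'b set => ('a, 'c) gmodule => 'c set => int => ('b => 'c) => bool" where
 "pres M1 Z1 M2 Z2 e fy <-> gmod M1 & gmod M2 & gsubm M1 Z1 & gsubm M2 Z2 & ghm M1 M2 e fy &
  (ALL y:cr M2. EX x:cr M1. EX z:Z2. y = fy x +[M2] z) & (ALL x:cr M1. fy x : Z2 <-> x : Z1)"

text \<open>\<open>M2\<close> is the pushout of \<open>M1\<close> and \<open>Z2\<close> over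
  \<open>Z1\<close>: maps on both that agree on \<open>Z1\<close> combine to a map on
  \<open>M2\<close>.\<close>

lemma glue:
 assumes p: "pres M1 Z1 M2 Z2 e fy" and N: "wgm N" and g: "ghm M1 N (d + e) g" and f: "ghm (gsub M2 Z2) N d f"
  and c: "!!x. x : Z1 ==> g x = f (fy x)"
 shows "EX h. ghm M2 N d h & (ALL x:cr M1. h (fy x) = g x) & (ALL z:Z2. h z = f z)"
proof -
 have M1: "gmod M1" and M2: "gmod M2" and Z1: "gsubm M1 Z1" and Z2: "gsubm M2 Z2" and fy: "ghm M1 M2 e fy"
  and s: "!!y. y : cr M2 ==> EX x:cr M1. EX z:Z2. y = fy x +[M2] z"
  and k: "!!x. x : cr M1 ==> fy x : Z2 <-> x : Z1" using p unfolding pres_def by auto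
 interpret M1: lmod R M1 using M1 gmod_lmod by auto
 interpret M2: lmod R M2 using M2 gmod_lmod by auto
 interpret N: lmod R N using N wgm_lmod by auto
 have G: "gmod (gsub M2 Z2)" by (rule gmod_gsub[OF M2 Z2])
 note Zc = gsubm_carrier[OF Z2]
 note fc = ghm_closed[OF f, simplified] and fa = ghm_add[OF f, simplified] and fs = ghm_smult[OF f, simplified]
 note gc = ghm_closed[OF g] and ga = ghm_add[OF g] and gs = ghm_smult[OF g]
 note fyc = ghm_closed[OF fy] and fya = ghm_add[OF fy] and fys = ghm_smult[OF fy]
 have wd: "g x +[N] f z = g x' +[N] f z'"
  if x: "x : cr M1" "x' : cr M1" and z: "z : Z2" "z' : Z2" and e: "fy x +[M2] z = fy x' +[M2] z'" for x x' z z'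
 proof -
  have zc: "z : cr M2" "z' : cr M2" using z Zc by auto
  have m: "fy (x -[M1] x') = z' -[M2] z"
  proof -
  have "fy (x -[M1] x') = fy x -[M2] fy x'" by (rule ghm_minus[OF gmod_wgm[OF M1] gmod_wgm[OF M2] fy x])
  also have "fy x = fy x' +[M2] z' -[M2] z"
  proof -
  have "fy x = fy x +[M2] z -[M2] z" using fyc x zc by (simp add: a_minus_def M2.M.a_assoc M2.M.r_neg)
  then show ?thesis using e by simp
  qed
  also have "fy x' +[M2] z' -[M2] z -[M2] fy x' = z' -[M2] z"
  using fyc x zc by (simp add: a_minus_def M2.M.a_ac M2.M.r_neg) (simp add: M2.M.a_lcomm[of "fy x'"] M2.M.r_neg)
  finally show ?thesis .
  qed
  have zz: "z' -[M2] z : Z2" by (rule gsubm_minus[OF M2 Z2 z(2,1)])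
  have xx: "x -[M1] x' : cr M1" using x by simp
  have "x -[M1] x' : Z1" using k[OF xx] m zz by simp
  then have 1: "g (x -[M1] x') = f (z' -[M2] z)" using c m by simp
  have x0: "x = (x -[M1] x') +[M1] x'" using x by (simp add: a_minus_def M1.M.a_assoc M1.M.l_neg)
  have z0: "z' = (z' -[M2] z) +[M2] z" using zc by (simp add: a_minus_def M2.M.a_assoc M2.M.l_neg)
  have "g x = g (x -[M1] x') +[N] g x'" using ga[OF xx x(2)] x0 by simp
  moreover have "f z' = f (z' -[M2] z) +[N] f z" using fa[OF zz z(1)] z0 by simp
  ultimately show ?thesis using 1 gc[OF x(2)] fc[OF zz] fc[OF z(1)] by (simp add: N.M.a_ac)
 qed
 \<comment> \<open>Every element of \<open>M2\<close> has the form \<open>fy x + z\<close>;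
   \<open>h\<close> uses a chosen representation, and \<open>wd\<close> makes the choice
   immaterial.\<close>
 define h where "h y = (let (x, z) = (SOME (x, z). x : cr M1 & z : Z2 & y = fy x +[M2] z) in g x +[N] f z)" for y
 have h: "h (fy x +[M2] z) = g x +[N] f z" if x: "x : cr M1" and z: "z : Z2" for x z
 proof -
  let ?P = "%(x', z'). x' : cr M1 & z' : Z2 & fy x +[M2] z = fy x' +[M2] z'"
  have "?P (x, z)" using x z by simp
  then have "?P (SOME p. ?P p)" by (rule someI)
  then obtain x' z' where "(SOME p. ?P p) = (x', z')" "x' : cr M1" "z' : Z2" "fy x +[M2] z = fy x' +[M2] z'"
  by (cases "SOME p. ?P p") auto
  then show ?thesis unfolding h_def using wd[OF x \<open>x' : _\<close> z \<open>z' : _\<close>] by simp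
 qed
 have "ghm M2 N d h"
 proof (rule ghmI)
  fix y assume y: "y : cr M2"
  obtain x z where xz: "x : cr M1" "z : Z2" "y = fy x +[M2] z" using s[OF y] by auto
  show "h y : cr N" using h xz gc fc by simp
  show "h (a *[M2] y) = a *[N] h y" if a: "a : cr R" for a
  proof -
  have "a *[M2] y = fy (a *[M1] x) +[M2] a *[M2] z"
  using xz a fys fyc Zc by (simp add: M2.smult_r_distr)
  then have "h (a *[M2] y) = g (a *[M1] x) +[N] f (a *[M2] z)"
  using h[of "a *[M1] x" "a *[M2] z"] xz a gsubm_smult[OF Z2] by simp
  then show ?thesis using h xz a gs fs gc fc by (simp add: N.smult_r_distr)
  qed
  fix y' assume y': "y' : cr M2"
  obtain x' z' where xz': "x' : cr M1" "z' : Z2" "y' = fy x' +[M2] z'" using s[OF y'] by auto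
  have "y +[M2] y' = fy (x +[M1] x') +[M2] (z +[M2] z')"
  using xz xz' fya fyc Zc by (simp add: M2.M.a_ac)
  then have "h (y +[M2] y') = g (x +[M1] x') +[N] f (z +[M2] z')"
  using h[of "x +[M1] x'" "z +[M2] z'"] xz xz' gsubm_add[OF Z2] by simp
  then show "h (y +[M2] y') = h y +[N] h y'"
  using h xz xz' ga fa gc fc by (simp add: N.M.a_ac)
 next
  fix y i assume y: "y : gr M2 i"
  have yc: "y : cr M2" by (rule gr_carrier[OF gmod_wgm[OF M2] y])
  obtain x z where xz: "x : cr M1" "z : Z2" "y = fy x +[M2] z" using s[OF yc] by auto
  have "y = hp M2 i (fy x +[M2] z)" using hp_same[OF M2 y] xz by simp
  also have "... = fy (hp M1 (i - e) x) +[M2] hp M2 i z"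
  using hp_add[OF M2 fyc[OF xz(1)] Zc[OF xz(2)]] hp_ghm[OF M1 M2 fy xz(1)] by simp
  finally have "h y = g (hp M1 (i - e) x) +[N] f (hp M2 i z)"
  using h[OF hp_carrier[OF M1 xz(1)] gsubm_hp[OF Z2 xz(2)]] by simp
  moreover have "g (hp M1 (i - e) x) : gr N (i + d)"
  using ghm_gr[OF g hp_gr[OF M1 xz(1), of "i - e"]] by (simp add: algebra_simps)
  moreover have "f (hp M2 i z) : gr N (i + d)"
  using ghm_gr[OF f, of "hp M2 i z" i] gsubm_hp[OF Z2 xz(2)] hp_gr[OF M2 Zc[OF xz(2)]] by simp
  ultimately show "h y : gr N (i + d)" using gr_add[OF N] by simp
 qed
 moreover have "h (fy x) = g x" if "x : cr M1" for x
 proof -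
  have "f 0[M2] = 0[N]" using ghm_zero[OF gmod_wgm[OF G] N f] by simp
  then show ?thesis using h[OF that gsubm_zero[OF Z2]] fyc gc that by simp
 qed
 moreover have "h z = f z" if "z : Z2" for z
  using h[OF M1.M.zero_closed that] ghm_zero[OF gmod_wgm[OF M1] gmod_wgm[OF M2] fy] ghm_zero[OF gmod_wgm[OF M1] N g] Zc fc that by simp
 ultimately show ?thesis by blast
qed

text \<open>For projective \<open>M\<close> this is the vanishing of the first Ext group of
  \<open>M/Z\<close> with values in \<open>N\<close>, in all degrees.\<close>

definition ext :: "('a, 'b) gmodule => 'b set => ('a, 'c) gmodule => bool" where
 "ext M Z N <-> (ALL d f. ghm (gsub M Z) N d f --> (EX h. ghm M N d h & (ALL z:Z. h z = f z)))"

lemma presD: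
 assumes "pres M1 Z1 M2 Z2 e fy"
 shows "gmod M1" "gmod M2" "gsubm M1 Z1" "gsubm M2 Z2" "ghm M1 M2 e fy"
  "!!y. y : cr M2 ==> EX x:cr M1. EX z:Z2. y = fy x +[M2] z"
  "!!x. x : cr M1 ==> fy x : Z2 <-> x : Z1"
 using assms unfolding pres_def by auto

lemma pres_restrict:
 assumes p: "pres M1 Z1 M2 Z2 e fy"
 shows "ghm (gsub M1 Z1) (gsub M2 Z2) e fy"
 by (rule ghm_gsub_codom[OF ghm_gsub_incl[OF presD(3,5)[OF p]] _ gmod_wgm[OF gmod_gsub[OF presD(1,3)[OF p]]]])
  (use presD(7)[OF p] gsubm_carrier[OF presD(3)[OF p]] in auto)

text \<open>A map on \<open>Z2\<close> is pulled back to \<open>Z1\<close> and extended to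
  \<open>M1\<close>; the extension and the given map then glue to one on \<open>M2\<close>.\<close>

lemma ext_transfer:
 assumes p: "pres M1 Z1 M2 Z2 e fy" and N: "wgm N" and "ext M1 Z1 N"
 shows "ext M2 Z2 N"
 unfolding ext_def
proof (intro allI impI)
 fix d f assume f: "ghm (gsub M2 Z2) N d f"
 have "ghm (gsub M1 Z1) N (e + d) (%x. f (fy x))" by (rule ghm_comp[OF pres_restrict[OF p] f])
 then obtain g where g: "ghm M1 N (e + d) g" "ALL z:Z1. g z = f (fy z)" using assms(3) unfolding ext_def by blast
 have g': "ghm M1 N (d + e) g" using g(1) by (simp add: add.commute)
 from glue[OF p N g' f] g(2) show "EX h. ghm M2 N d h & (ALL z:Z2. h z = f z)" by auto
qed

lemma pres_proj: "gmod M ==> gsubm M Z ==> pres M Z (gquot M Z) {0[gquot M Z]} 0 (proj M Z)"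
proof -
 assume M: "gmod M" and Z: "gsubm M Z"
 note q = gmod_gquot[OF M Z]
 interpret Q: lmod R "gquot M Z" by (rule gmod_lmod[OF q(1)])
 show ?thesis unfolding pres_def
 proof (intro conjI ballI M Z q(1,2) gsubm_triv)
  fix y assume "y : cr (gquot M Z)"
  then obtain x where "x : cr M" "y = proj M Z x" using q(4) by (metis imageE)
  with \<open>y : cr (gquot M Z)\<close> show "EX x:cr M. EX z:{0[gquot M Z]}. y = proj M Z x +[gquot M Z] z"
  by (intro bexI[of _ x]) simp_all
 qed (use q(3) in auto)
qed

text \<open>\<open>te\<close> lifts one presentation of \<open>Q\<close> modulo \<open>K\<close>
  through another, so it inherits both clauses of \<open>pres\<close>: it is onto modulo
  \<open>Z2\<close> and pulls \<open>Z2\<close> back to \<open>Z1\<close>.\<close>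

lemma pres_compare:
 assumes p1: "pres M1 Z1 Q K e1 fy1" and p2: "pres M2 Z2 Q K e2 fy2" and te: "ghm M1 M2 (e1 - e2) te"
  and c: "!!x. x : cr M1 ==> fy2 (te x) = fy1 x"
 shows "pres M1 Z1 M2 Z2 (e1 - e2) te"
 unfolding pres_def
proof (intro conjI ballI)
 note d1 = presD[OF p1] and d2 = presD[OF p2]
 interpret M2: lmod R M2 using d2(1) gmod_lmod by auto
 interpret Q: lmod R Q using d2(2) gmod_lmod by auto
 show "gmod M1" "gmod M2" "gsubm M1 Z1" "gsubm M2 Z2" "ghm M1 M2 (e1 - e2) te" by fact+
 show "te x : Z2 <-> x : Z1" if "x : cr M1" for x
  using d2(7)[OF ghm_closed[OF te that]] d1(7)[OF that] c[OF that] by simp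
 fix y assume y: "y : cr M2"
 obtain x z where xz: "x : cr M1" "z : K" "fy2 y = fy1 x +[Q] z" using d1(6)[OF ghm_closed[OF d2(5) y]] by auto
 have tx: "te x : cr M2" by (rule ghm_closed[OF te xz(1)])
 have zc: "z : cr Q" using gsubm_carrier[OF d2(4) xz(2)] .
 have "fy2 (y -[M2] te x) = fy1 x +[Q] z -[Q] fy1 x"
  using ghm_minus[OF gmod_wgm[OF d2(1)] gmod_wgm[OF d2(2)] d2(5) y tx] c[OF xz(1)] xz(3) by simp
 also have "... = z" using zc ghm_closed[OF d1(5) xz(1)] by (simp add: a_minus_def Q.M.a_ac Q.M.r_neg)
 finally have "y -[M2] te x : Z2" using d2(7)[of "y -[M2] te x"] y tx xz(2) by simp
 moreover have "y = te x +[M2] (y -[M2] te x)" using y tx by (simp add: a_minus_def M2.M.a_lcomm M2.M.r_neg)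
 ultimately show "EX x:cr M1. EX z:Z2. y = te x +[M2] z" using xz(1) by blast
qed

end

section \<open>Spaces of homomorphisms of fixed degree\<close>

lemma vdim_iso_rev:
 assumes "vdim W k" "clin V W r" "bij_betw r (cr V) (cr W)" "cvs V"
 shows "vdim V k"
proof (rule vdim_iso[OF assms(1)])
 interpret V: lmod complex_ring V by fact
 let ?s = "inv_into (cr V) r"
 show "bij_betw ?s (cr W) (cr V)" by (rule bij_betw_inv_into[OF assms(3)])
 have s: "?s y : cr V" "r (?s y) = y" if "y : cr W" for y
  using that assms(3) unfolding bij_betw_def by (auto intro: inv_into_into f_inv_into_f)
 have inv: "?s (r x) = x" if "x : cr V" for x using that assms(3) unfolding bij_betw_def by auto
 show "clin W V ?s"
  unfolding clin_def
 proof (intro ballI conjI allI)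
  fix x c assume x: "x : cr W"
  show "?s x : cr V" using s x by auto
  have "r (c *[V] ?s x) = c *[W] x" using clin_smult[OF assms(2), of "?s x" c] s[OF x] by simp
  then show "?s (c *[W] x) = c *[V] ?s x" using inv[of "c *[V] ?s x"] s[OF x] by simp
  fix y assume y: "y : cr W"
  have "r (?s x +[V] ?s y) = x +[W] y" using clin_add[OF assms(2), of "?s x" "?s y"] s[OF x] s[OF y] by simp
  then show "?s (x +[W] y) = ?s x +[V] ?s y" using inv[of "?s x +[V] ?s y"] s[OF x] s[OF y] by simp
 qed
qed

context dihz
begin

abbreviation cst :: "complex => A" where "cst c == tensor (constS c) e0"

lemma cst_central: "a : cr R ==> a \<otimes>[R] cst c = cst c \<otimes>[R] a"
proof
 assume a: "a : cr R"
 fix w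
 show "(a \<otimes>[R] cst c) w = (cst c \<otimes>[R] a) w"
 proof (cases "w : W")
  case True
  have i: "dinv u ** w = e0 <-> u = w" if u: "u : W" for u
  using u True by (metis D.inv_equality D.inv_inv D.inv_closed D.l_inv)
  have "(a \<otimes>[R] cst c) w = (SUM u:W. if u = w then a w * constS c else 0)"
  using True by (simp only: R_mult if_True) (rule sum.cong, auto simp: tensor_def i)
  moreover have "(cst c \<otimes>[R] a) w = (SUM u:W. if u = e0 then constS c * a w else 0)"
  using True by (simp only: R_mult if_True) (rule sum.cong, auto simp: tensor_def)
  ultimately show ?thesis using True by (simp add: mult.commute)
 qed (simp add: R_mult)
qed

lemma cst_gr: "cst c : skew_gr n 0" by (rule tensor_gr) auto

lemma cscale_simps:
 assumes "lmod R N" and "y : cr N"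
 shows "cscale N c y : cr N" "cscale N (c + d) y = cscale N c y +[N] cscale N d y"
  "z : cr N ==> cscale N c (y +[N] z) = cscale N c y +[N] cscale N c z"
  "cscale N (c * d) y = cscale N c (cscale N d y)" "cscale N 1 y = y"
  "a : cr R ==> a *[N] cscale N c y = cscale N c (a *[N] y)"
proof -
 interpret N: lmod R N by fact
 show "cscale N c y : cr N" "cscale N (c + d) y = cscale N c y +[N] cscale N d y"
  "z : cr N ==> cscale N c (y +[N] z) = cscale N c y +[N] cscale N c z"
  unfolding cscale_def using assms by (auto simp: N.smult_r_distr N.smult_l_distr constS_add tensor_add)
 have "cst (c * d) = cst c \<otimes>[R] cst d" by (subst tensor_mult) (auto simp: constS_mult)
 then show "cscale N (c * d) y = cscale N c (cscale N d y)" unfolding cscale_def using assms by (simp add: N.smult_assoc1)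
 have "cst 1 = 1[R]" by (simp add: R_one)
 then show "cscale N 1 y = y" unfolding cscale_def using assms by simp
 show "a *[N] cscale N c y = cscale N c (a *[N] y)" if "a : cr R"
  unfolding cscale_def using assms that by (simp flip: N.smult_assoc1 add: cst_central)
qed

lemma cscale_gr: "wgm N ==> y : gr N i ==> cscale N c y : gr N i"
 unfolding cscale_def using gr_smult[of N "cst c" 0 y i] cst_gr by simp

lemma cscale_zero: "lmod R N ==> cscale N c 0[N] = 0[N]"
 unfolding cscale_def by (simp add: lmod.smult_r_null)

lemma ghm_cscale: "ghm M N d f ==> x : cr M ==> f (cscale M c x) = cscale N c (f x)"
 unfolding cscale_def by (simp add: ghm_smult)

text \<open>The homomorphisms of degree \<open>d\<close> from \<open>M/Z\<close> to
  \<open>N\<close>, kept as functions on \<open>M\<close> that kill \<open>Z\<close> so that the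
  source type does not change.\<close>

definition HS :: "(A, 'b) gmodule => 'b set => (A, 'c) gmodule => int => (complex, 'b => 'c) module" where
 "HS M Z N d = (|carrier = {f : ghom R M N d. ALL z:Z. f z = 0[N]}, monoid.mult = undefined, one = undefined,
  zero = (\<lambda>x\<in>cr M. 0[N]), add = (%f g. \<lambda>x\<in>cr M. f x +[N] g x),
  module.smult = (%c f. \<lambda>x\<in>cr M. cscale N c (f x))|)"

lemma HS_simps [simp]:
 "cr (HS M Z N d) = {f : ghom R M N d. ALL z:Z. f z = 0[N]}" "0[HS M Z N d] = (\<lambda>x\<in>cr M. 0[N])"
 "f +[HS M Z N d] g = (\<lambda>x\<in>cr M. f x +[N] g x)" "c *[HS M Z N d] f = (\<lambda>x\<in>cr M. cscale N c (f x))"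
 by (auto simp: HS_def)

lemma ghm_plus:
 assumes "wgm M" "wgm N" "ghm M N d f" "ghm M N d g"
 shows "ghm M N d (%x. f x +[N] g x)"
proof -
 interpret N: lmod R N using assms wgm_lmod by auto
 note [simp] = ghm_closed[OF assms(3)] ghm_closed[OF assms(4)] ghm_add[OF assms(3)] ghm_add[OF assms(4)]
  ghm_smult[OF assms(3)] ghm_smult[OF assms(4)]
 show ?thesis
 proof (rule ghmI)
  show "f (x +[M] y) +[N] g (x +[M] y) = f x +[N] g x +[N] (f y +[N] g y)" if "x : cr M" "y : cr M" for x y
  using that by (simp add: N.M.a_ac)
  show "f (a *[M] x) +[N] g (a *[M] x) = a *[N] (f x +[N] g x)" if "a : cr R" "x : cr M" for a x
  using that by (simp add: N.smult_r_distr)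
  show "f x +[N] g x : gr N (i + d)" if "x : gr M i" for x i
  using gr_add[OF assms(2)] ghm_gr[OF assms(3) that] ghm_gr[OF assms(4) that] by simp
 qed simp
qed

lemma ghm_scale:
 assumes "wgm M" "wgm N" "ghm M N d f"
 shows "ghm M N d (%x. cscale N c (f x))"
proof (rule ghmI)
 have N: "lmod R N" using assms wgm_lmod by auto
 note fc = ghm_closed[OF assms(3)]
 show "cscale N c (f x) : cr N" if "x : cr M" for x using cscale_simps(1)[OF N fc[OF that]] .
 show "cscale N c (f (x +[M] y)) = cscale N c (f x) +[N] cscale N c (f y)" if "x : cr M" "y : cr M" for x y
  using cscale_simps(3)[OF N] fc ghm_add[OF assms(3)] that by simp
 show "cscale N c (f (a *[M] x)) = a *[N] cscale N c (f x)" if "a : cr R" "x : cr M" for a x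
  using cscale_simps(6)[OF N] fc ghm_smult[OF assms(3)] that by simp
 show "cscale N c (f x) : gr N (i + d)" if "x : gr M i" for x i
  using cscale_gr[OF assms(2) ghm_gr[OF assms(3) that]] .
qed

lemma ghm_null: assumes "wgm M" "wgm N" shows "ghm M N d (%x. 0[N])"
proof -
 interpret N: lmod R N using assms wgm_lmod by auto
 show ?thesis by (rule ghmI) (use gr_zero[OF assms(2)] in auto)
qed

lemma cvs_HS:
 assumes M: "wgm M" and N: "wgm N" and Z: "Z <= cr M"
 shows "cvs (HS M Z N d)"
proof -
 have lN: "lmod R N" using N wgm_lmod by auto
 interpret N: lmod R N by (rule lN)
 have fc: "f x : cr N" if "f : ghom R M N d" "x : cr M" for f x
  using that unfolding ghom_iff by (auto intro: ghm_closed)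
 have fx: "f = (\<lambda>x\<in>cr M. f x)" if "f : ghom R M N d" for f
  using that unfolding ghom_iff by (simp add: extensional_restrict)
 have A: "(\<lambda>x\<in>cr M. f x +[N] g x) : cr (HS M Z N d)" if "f : cr (HS M Z N d)" "g : cr (HS M Z N d)" for f g
  using that Z ghm_restrict[OF M ghm_plus[OF M N]] by (auto simp: ghom_iff subset_iff)
 have B: "(\<lambda>x\<in>cr M. cscale N c (f x)) : cr (HS M Z N d)" if "f : cr (HS M Z N d)" for f c
  using that Z ghm_restrict[OF M ghm_scale[OF M N]] cscale_zero[OF lN] by (auto simp: ghom_iff subset_iff)
 have O: "(\<lambda>x\<in>cr M. 0[N]) : cr (HS M Z N d)"
  using Z ghm_restrict[OF M ghm_null[OF M N]] by (auto simp: subset_iff)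
 have zs: "cscale N 0 y = 0[N]" if "y : cr N" for y
  using that by (simp add: cscale_def tensor_zero)
 show ?thesis
 proof (rule cvsI)
  show "abelian_group (HS M Z N d)"
  proof (rule abelian_groupI)
  show "0[HS M Z N d] : cr (HS M Z N d)" using O by simp
  fix f assume f: "f : cr (HS M Z N d)"
  then have fg: "f : ghom R M N d" by simp
  show "0[HS M Z N d] +[HS M Z N d] f = f" by (subst (2) fx[OF fg]) (auto simp: fc[OF fg])
  have "(\<lambda>x\<in>cr M. cscale N (-1) (f x)) +[HS M Z N d] f = 0[HS M Z N d]"
  proof -
  have "cscale N (-1) (f x) +[N] f x = 0[N]" if "x : cr M" for x
  using cscale_simps(2)[OF lN fc[OF fg that], of "-1" 1] cscale_simps(5)[OF lN fc[OF fg that]] zs[OF fc[OF fg that]] by simp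
  then show ?thesis by auto
  qed
  then show "EX g:cr (HS M Z N d). g +[HS M Z N d] f = 0[HS M Z N d]" using B[OF f, of "-1"] by blast
  fix g assume g: "g : cr (HS M Z N d)"
  then have gg: "g : ghom R M N d" by simp
  show "f +[HS M Z N d] g : cr (HS M Z N d)" using A[OF f g] by simp
  show "f +[HS M Z N d] g = g +[HS M Z N d] f" using fc[OF fg] fc[OF gg] by (auto simp: N.M.a_comm)
  fix h assume h: "h : cr (HS M Z N d)"
  then have hg: "h : ghom R M N d" by simp
  show "f +[HS M Z N d] g +[HS M Z N d] h = f +[HS M Z N d] (g +[HS M Z N d] h)"
  using fc[OF fg] fc[OF gg] fc[OF hg] by (auto simp: N.M.a_assoc)
  qed
  fix a b f assume f: "f : cr (HS M Z N d)"
  then have fg: "f : ghom R M N d" by simp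
  note cs = cscale_simps[OF lN fc[OF fg]]
  show "a *[HS M Z N d] f : cr (HS M Z N d)" using B[OF f] by simp
  show "(a + b) *[HS M Z N d] f = a *[HS M Z N d] f +[HS M Z N d] b *[HS M Z N d] f"
  using cs(2) by auto
  show "(a * b) *[HS M Z N d] f = a *[HS M Z N d] (b *[HS M Z N d] f)" using cs(4) by auto
  show "1 *[HS M Z N d] f = f" by (subst (2) fx[OF fg]) (use cs(5) in auto)
  show "a *[HS M Z N d] (f +[HS M Z N d] g) = a *[HS M Z N d] f +[HS M Z N d] a *[HS M Z N d] g"
  if "g : cr (HS M Z N d)" for g
  using cs(3) fc[of g] that by auto
 qed
qed

text \<open>Composition with \<open>fy\<close> is injective because \<open>fy\<close> is onto modulo
  \<open>Z2\<close>; surjectivity comes from gluing with the zero map on \<open>Z2\<close>.\<close>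

lemma HS_pres_iso:
 assumes p: "pres M1 Z1 M2 Z2 e fy" and N: "wgm N"
 defines "r == %f. \<lambda>x\<in>cr M1. f (fy x)"
 shows "clin (HS M2 Z2 N d) (HS M1 Z1 N (d + e)) r" "bij_betw r (cr (HS M2 Z2 N d)) (cr (HS M1 Z1 N (d + e)))"
proof -
 note pd = presD[OF p]
 have w1: "wgm M1" and w2: "wgm M2" using pd gmod_wgm by auto
 have lN: "lmod R N" using N wgm_lmod by auto
 interpret N: lmod R N by (rule lN)
 interpret M2: lmod R M2 using w2 wgm_lmod by auto
 note fyc = ghm_closed[OF pd(5)]
 have in1: "r f : cr (HS M1 Z1 N (d + e))" if "f : cr (HS M2 Z2 N d)" for f
 proof -
  have f: "ghm M2 N d f" "ALL z:Z2. f z = 0[N]" using that by (auto simp: ghom_iff)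
  have "ghm M1 N (d + e) (%x. f (fy x))" using ghm_comp[OF pd(5) f(1)] by (simp add: add.commute)
  then show ?thesis unfolding r_def using ghm_restrict[OF w1] f(2) pd(7) gsubm_carrier[OF pd(3)] by auto
 qed
 show "clin (HS M2 Z2 N d) (HS M1 Z1 N (d + e)) r"
  unfolding clin_def
 proof (intro ballI conjI allI in1)
  show "r (x +[HS M2 Z2 N d] y) = r x +[HS M1 Z1 N (d + e)] r y" for x y unfolding r_def using fyc by auto
  show "r (c *[HS M2 Z2 N d] x) = c *[HS M1 Z1 N (d + e)] r x" for x c unfolding r_def using fyc by auto
 qed
 have "inj_on r (cr (HS M2 Z2 N d))"
 proof (rule inj_onI)
  fix f f' assume f: "f : cr (HS M2 Z2 N d)" and f': "f' : cr (HS M2 Z2 N d)" and e: "r f = r f'"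
  have fg: "ghm M2 N d f" "f : extensional (cr M2)" "ghm M2 N d f'" "f' : extensional (cr M2)"
  using f f' by (auto simp: ghom_iff)
  have ep: "f (fy x) = f' (fy x)" if "x : cr M1" for x using fun_cong[OF e, of x] that unfolding r_def by simp
  show "f = f'"
  proof (rule extensionalityI[OF fg(2,4)])
  fix y assume y: "y : cr M2"
  obtain x z where xz: "x : cr M1" "z : Z2" "y = fy x +[M2] z" using pd(6)[OF y] by auto
  have zc: "z : cr M2" using gsubm_carrier[OF pd(4) xz(2)] .
  have "f z = f' z" using f f' xz(2) by simp
  then show "f y = f' y" using xz ghm_add[OF fg(1) fyc[OF xz(1)] zc] ghm_add[OF fg(3) fyc[OF xz(1)] zc] ep by simp
  qed
 qed
 moreover have "r ` cr (HS M2 Z2 N d) = cr (HS M1 Z1 N (d + e))"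
 proof
  show "r ` cr (HS M2 Z2 N d) <= cr (HS M1 Z1 N (d + e))" using in1 by auto
  show "cr (HS M1 Z1 N (d + e)) <= r ` cr (HS M2 Z2 N d)"
  proof
  fix g assume g: "g : cr (HS M1 Z1 N (d + e))"
  then have gg: "ghm M1 N (d + e) g" "g : extensional (cr M1)" "ALL z:Z1. g z = 0[N]" by (auto simp: ghom_iff)
  have n: "ghm (gsub M2 Z2) N d (%x. 0[N])" by (rule ghm_null[OF gmod_wgm[OF gmod_gsub[OF pd(2,4)]] N])
  obtain h where h: "ghm M2 N d h" "ALL x:cr M1. h (fy x) = g x" "ALL z:Z2. h z = 0[N]"
  using glue[OF p N gg(1) n] gg(3) by auto
  have "restrict h (cr M2) : cr (HS M2 Z2 N d)"
  using ghm_restrict[OF w2 h(1)] h(3) gsubm_carrier[OF pd(4)] by auto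
  moreover have "r (restrict h (cr M2)) = g"
  unfolding r_def using h(2) fyc gg(2) by (auto intro!: extensionalityI[of _ "cr M1"])
  ultimately show "g : r ` cr (HS M2 Z2 N d)" by (metis image_eqI)
  qed
 qed
 ultimately show "bij_betw r (cr (HS M2 Z2 N d)) (cr (HS M1 Z1 N (d + e)))" unfolding bij_betw_def by simp
qed

lemma vdim_HS_pres:
 assumes p: "pres M1 Z1 M2 Z2 e fy" and N: "wgm N"
 shows "vdim (HS M2 Z2 N d) k <-> vdim (HS M1 Z1 N (d + e)) k"
proof -
 have Z: "Z2 <= cr M2" using presD(4)[OF p] gsubm_carrier by auto
 show ?thesis
  using vdim_iso[OF _ HS_pres_iso[OF p N]] vdim_iso_rev[OF _ HS_pres_iso[OF p N] cvs_HS[OF gmod_wgm[OF presD(2)[OF p]] N Z]] by blast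
qed

end

section \<open>Homomorphisms out of P and out of free modules\<close>

context gring
begin

lemma gr_finsum:
 assumes M: "wgm M" and "finite A" "!!i. i : A ==> g i : gr M k"
 shows "(fs M A (%i. g i)) : gr M k"
proof -
 interpret M: lmod R M using M wgm_lmod by auto
 show ?thesis using assms(2,3)
 proof (induction A rule: finite_induct)
  case (insert x F)
  then show ?case using gr_carrier[OF M] gr_add[OF M] by (subst M.M.finsum_insert) auto
 qed (use gr_zero[OF M] in simp)
qed

end

lemma (in abelian_monoid) finsum_eqI:
 assumes "!!i. i : A ==> f i = g i" "!!i. i : A ==> g i : cr G"
 shows "(\<Oplus>i\<in>A. f i) = (\<Oplus>i\<in>A. g i)"
 using assms by (intro finsum_cong' refl) auto

lemma (in abelian_monoid) additive_finsum:
 assumes "abelian_monoid H" "!!x. x : cr G ==> f x : cr H" "f \<zero> = 0[H]"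
  "!!x y. x : cr G ==> y : cr G ==> f (x \<oplus> y) = f x +[H] f y" "finite A" "!!i. i : A ==> g i : cr G"
 shows "f (\<Oplus>i\<in>A. g i) = (fs H A (%i. f (g i)))"
proof -
 interpret H: abelian_monoid H by fact
 show ?thesis using assms(5,6)
 proof (induction A rule: finite_induct)
  case (insert x F)
  then show ?case using assms(2,4) by (subst finsum_insert, simp, simp, blast, blast) (subst H.finsum_insert, auto)
 qed (use assms(3) in simp)
qed

context dihz
begin

lemma R_linearI:
 assumes M: "lmod R M" and N: "lmod R N" and c: "!!x. x : cr M ==> f x : cr N"
  and add: "!!x y. x : cr M ==> y : cr M ==> f (x +[M] y) = f x +[N] f y"
  and t: "!!p w x. w : W ==> x : cr M ==> f (tensor p w *[M] x) = tensor p w *[N] f x"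
  and a: "a : cr R" and x: "x : cr M"
 shows "f (a *[M] x) = a *[N] f x"
proof -
 interpret M: lmod R M by fact
 interpret N: lmod R N by fact
 have z: "f 0[M] = 0[N]"
  using t[OF e0_W M.M.zero_closed, of 0] c[OF M.M.zero_closed] by (simp add: tensor_zero)
 have "f (a *[M] x) = f (fs M W (%w. tensor (a w) w *[M] x))"
  by (subst R_decomp[OF a]) (use x in \<open>simp add: M.finsum_smult\<close>)
 also have "... = (fs N W (%w. f (tensor (a w) w *[M] x)))"
  by (rule M.M.additive_finsum[OF N.M.abelian_monoid_axioms c z add]) (use x in auto)
 also have "... = (fs N W (%w. tensor (a w) w *[N] f x))"
  using t x c by (intro N.M.finsum_cong') auto
 also have "... = a *[N] f x"
  by (subst (2) R_decomp[OF a]) (use x c in \<open>simp add: N.finsum_smult\<close>)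
 finally show ?thesis .
qed

text \<open>These are the possible values on the standard generators of a homomorphism from
  \<open>Pm m rx\<close>: under \<open>w\<close> they transform by the columns of
  \<open>rx w\<close>.\<close>

definition equiv_tuple :: "nat => mrep => (A, 'b) gmodule => (nat => 'b) => bool" where
 "equiv_tuple m rx N u <-> (ALL j<m. u j : cr N) &
  (ALL w:W. ALL j<m. tensor 1 w *[N] u j = (fs N {..<m} (%i. cscale N (rx w $$ (i, j)) (u i))))"

abbreviation eP :: "nat => nat => S vec" where "eP m j == unit_vec m j"

lemma Pm_tensor_smult:
 assumes "w : W"
 shows "tensor p w *[Pm m rx] x = vec m (%i. p * (SUM j<m. constS (rx w $$ (i, j)) * ac w (x $ j)))"
proof (rule eq_vecI)
 fix i assume "i < dim_vec (vec m (%i. p * (SUM j<m. constS (rx w $$ (i, j)) * ac w (x $ j))))"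
 then have i: "i < m" by simp
 have "(tensor p w *[Pm m rx] x) $ i = (SUM v:W. if v = w then p * (SUM j<m. constS (rx w $$ (i, j)) * ac w (x $ j)) else 0)"
  unfolding Pm_smult index_vec[OF i] by (rule sum.cong) (auto simp: tensor_def)
 then show "(tensor p w *[Pm m rx] x) $ i = vec m (%i. p * (SUM j<m. constS (rx w $$ (i, j)) * ac w (x $ j))) $ i"
  using assms i by simp
qed (simp add: Pm_smult)

lemma Pm_scalar_smult:
 assumes "rep m rx" "x : cV m"
 shows "tensor p e0 *[Pm m rx] x = vec m (%i. p * x $ i)"
proof (rule eq_vecI)
 fix i assume "i < dim_vec (vec m (%i. p * x $ i))"
 then have i: "i < m" by simp
 have "(SUM j<m. constS (rx e0 $$ (i, j)) * ac e0 (x $ j)) = (SUM j<m. if j = i then x $ i else 0)"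
  using rep_one[OF assms(1)] i by (intro sum.cong) auto
 then show "(tensor p e0 *[Pm m rx] x) $ i = vec m (%i. p * x $ i) $ i"
  using i by (simp add: Pm_tensor_smult)
qed (simp add: Pm_smult)

lemma Pm_expand:
 assumes "rep m rx" "x : cV m"
 shows "x = (fs (Pm m rx) {..<m} (%j. tensor (x $ j) e0 *[Pm m rx] eP m j))"
proof -
 have "(fs (Pm m rx) {..<m} (%j. tensor (x $ j) e0 *[Pm m rx] eP m j)) = vec m (%i. SUM j<m. (tensor (x $ j) e0 *[Pm m rx] eP m j) $ i)"
  by (rule finsum_Pm[OF assms(1)]) (simp_all add: Pm_smult)
 also have "... = x"
 proof (rule eq_vecI)
  fix i assume "i < dim_vec x"
  then have i: "i < m" using assms by simp
  have "(SUM j<m. (tensor (x $ j) e0 *[Pm m rx] eP m j) $ i) = (SUM j<m. if j = i then x $ i else 0)"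
  using i by (intro sum.cong refl) (simp add: Pm_scalar_smult[OF assms(1)] unit_vec_def)
  then show "vec m (%i. SUM j<m. (tensor (x $ j) e0 *[Pm m rx] eP m j) $ i) $ i = x $ i" using i by simp
 qed (use assms in simp)
 finally show ?thesis by simp
qed

lemma eP_gr: "eP m j : gr (Pm m rx) 0"
 by (auto simp: unit_vec_def)

lemma Pm_equiv_tuple:
 assumes rx: "rep m rx" shows "equiv_tuple m rx (Pm m rx) (eP m)"
 unfolding equiv_tuple_def
proof (intro conjI ballI allI impI)
 fix w j assume w: "w : W" and j: "j < m"
 have cs: "cscale (Pm m rx) c (eP m i) = vec m (%k. if k = i then constS c else 0)" if "i < m" for c i
  unfolding cscale_def using that by (subst Pm_scalar_smult[OF rx]) (auto simp: unit_vec_def intro!: eq_vecI)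
 have "(fs (Pm m rx) {..<m} (%i. cscale (Pm m rx) (rx w $$ (i, j)) (eP m i))) = vec m (%k. SUM i<m. cscale (Pm m rx) (rx w $$ (i, j)) (eP m i) $ k)"
  by (rule finsum_Pm[OF rx]) (simp_all add: cs)
 also have "... = vec m (%k. constS (rx w $$ (k, j)))"
 proof (rule eq_vecI)
  fix k assume "k < dim_vec (vec m (%k. constS (rx w $$ (k, j))))"
  then have k: "k < m" by simp
  have "(SUM i<m. cscale (Pm m rx) (rx w $$ (i, j)) (eP m i) $ k) = (SUM i<m. if i = k then constS (rx w $$ (k, j)) else 0)"
  using k by (intro sum.cong) (auto simp: cs)
  then show "vec m (%k. SUM i<m. cscale (Pm m rx) (rx w $$ (i, j)) (eP m i) $ k) $ k = vec m (%k. constS (rx w $$ (k, j))) $ k"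
  using k by simp
 qed simp
 also have "... = tensor 1 w *[Pm m rx] eP m j"
 proof (rule eq_vecI)
  fix k assume "k < dim_vec (tensor 1 w *[Pm m rx] eP m j)"
  then have k: "k < m" by (simp add: Pm_smult)
  have "(SUM i<m. constS (rx w $$ (k, i)) * ac w (eP m j $ i)) = (SUM i<m. if i = j then constS (rx w $$ (k, j)) else 0)"
  using j by (intro sum.cong) (auto simp: unit_vec_def)
  then show "vec m (%k. constS (rx w $$ (k, j))) $ k = (tensor 1 w *[Pm m rx] eP m j) $ k"
  using k j w by (simp add: Pm_tensor_smult)
 qed (simp add: Pm_smult)
 finally show "tensor 1 w *[Pm m rx] eP m j = (fs (Pm m rx) {..<m} (%i. cscale (Pm m rx) (rx w $$ (i, j)) (eP m i)))" by simp
qed simp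

lemma ghm_equiv_tuple:
 assumes "wgm M" "wgm N" "ghm M N d f" "equiv_tuple m rx M u"
 shows "equiv_tuple m rx N (%j. f (u j))"
 unfolding equiv_tuple_def
proof (intro conjI ballI allI impI)
 have uc: "u j : cr M" if "j < m" for j using assms(4) that unfolding equiv_tuple_def by auto
 show "f (u j) : cr N" if "j < m" for j using ghm_closed[OF assms(3) uc[OF that]] .
 fix w j assume w: "w : W" and j: "j < m"
 have cc: "cscale M c (u i) : cr M" if "i < m" for c i using cscale_lmod(1)[OF wgm_lmod[OF assms(1)] uc[OF that]] .
 have "tensor 1 w *[N] f (u j) = f (tensor 1 w *[M] u j)" using ghm_smult[OF assms(3) uc[OF j], of "tensor 1 w"] w by simp
 also have "... = f (fs M {..<m} (%i. cscale M (rx w $$ (i, j)) (u i)))" using assms(4) w j unfolding equiv_tuple_def by simp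
 also have "... = (fs N {..<m} (%i. f (cscale M (rx w $$ (i, j)) (u i))))"
  by (rule ghm_finsum[OF assms(1-3)]) (use cc in auto)
 also have "... = (fs N {..<m} (%i. cscale N (rx w $$ (i, j)) (f (u i))))"
 proof -
  interpret N: lmod R N using assms(2) wgm_lmod by auto
  show ?thesis using ghm_cscale[OF assms(3)] ghm_closed[OF assms(3) cc] uc
  by (intro N.M.finsum_cong') (auto simp: cscale_simps(1)[OF wgm_lmod[OF assms(2)] ghm_closed[OF assms(3) uc]])
 qed
 finally show "tensor 1 w *[N] f (u j) = (fs N {..<m} (%i. cscale N (rx w $$ (i, j)) (f (u i))))" .
qed

text \<open>Frobenius reciprocity. Over the polynomials \<open>Pm m rx\<close> is free on its
  generators, and equivariance of the tuple is exactly what linearity over the group elements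
  requires.\<close>

lemma Pm_hom:
 assumes rx: "rep m rx" and N: "wgm N" and u: "equiv_tuple m rx N u" and ug: "!!j. j < m ==> u j : gr N e"
 obtains g where "ghm (Pm m rx) N e g" "ALL j<m. g (eP m j) = u j"
proof -
 have lN: "lmod R N" using N wgm_lmod by auto
 interpret N: lmod R N by (rule lN)
 interpret P: lmod R "Pm m rx" by (rule lmod_Pm[OF rx])
 have uc: "u j : cr N" if "j < m" for j using u that unfolding equiv_tuple_def by auto
 define g where "g x = (fs N {..<m} (%j. tensor (x $ j) e0 *[N] u j))" for x :: "S vec"
 have c: "(%j. tensor (x $ j) e0 *[N] u j) : {..<m} \<rightarrow> cr N" for x :: "S vec" using uc by auto
 have gc: "g x : cr N" for x unfolding g_def by (rule N.M.finsum_closed[OF c])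
 have ga: "g (x +[Pm m rx] y) = g x +[N] g y" if x: "x : cr (Pm m rx)" and y: "y : cr (Pm m rx)" for x y
 proof -
  have "g (x +[Pm m rx] y) = (fs N {..<m} (%j. tensor (x $ j) e0 *[N] u j +[N] tensor (y $ j) e0 *[N] u j))"
  unfolding g_def using x y uc by (intro N.M.finsum_cong') (auto simp: tensor_add N.smult_l_distr)
  also have "... = g x +[N] g y" unfolding g_def by (rule N.M.finsum_addf[OF c c])
  finally show ?thesis .
 qed
 have gt: "g (tensor p w *[Pm m rx] x) = tensor p w *[N] g x" if w: "w : W" and x: "x : cr (Pm m rx)" for p w x
 proof -
  let ?q = "%i j. p * ac w (x $ i) * constS (rx w $$ (j, i))"
  have t1: "tensor (sum q A) e0 *[N] y = (fs N A (%i. tensor (q i) e0 *[N] y))"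
  if "finite A" "y : cr N" for q and A :: "nat set" and y using that
  proof (induction A rule: finite_induct)
  case (insert k F)
  then show ?case by (subst N.M.finsum_insert) (auto simp: tensor_add N.smult_l_distr)
  qed (simp add: tensor_zero)
  have cq: "tensor (?q i j) e0 *[N] u j : cr N" if "j < m" for i j using uc that by simp
  have "g (tensor p w *[Pm m rx] x) = (fs N {..<m} (%j. tensor (SUM i<m. ?q i j) e0 *[N] u j))"
  unfolding g_def
  proof (intro N.M.finsum_cong')
  fix j assume "j : {..<m}"
  then have "(tensor p w *[Pm m rx] x) $ j = (SUM i<m. ?q i j)"
  using w by (simp add: Pm_tensor_smult sum_distrib_left algebra_simps)
  then show "tensor ((tensor p w *[Pm m rx] x) $ j) e0 *[N] u j = tensor (SUM i<m. ?q i j) e0 *[N] u j" by simp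
  qed (use uc in auto)
  also have "... = (fs N {..<m} (%j. \<Oplus>\<^bsub>N\<^esub>i\<in>{..<m}. tensor (?q i j) e0 *[N] u j))"
  using uc by (intro N.M.finsum_cong' refl t1) (auto intro!: N.M.finsum_closed)
  also have "... = (fs N {..<m} (%i. \<Oplus>\<^bsub>N\<^esub>j\<in>{..<m}. tensor (?q i j) e0 *[N] u j))"
  by (rule N.M.finsum_swap) (use cq in auto)
  also have "... = (fs N {..<m} (%i. tensor p w *[N] (tensor (x $ i) e0 *[N] u i)))"
  proof (intro N.M.finsum_cong' refl)
  fix i assume i: "i : {..<m}"
  then have im: "i < m" by simp
  have "tensor p w *[N] (tensor (x $ i) e0 *[N] u i) = (tensor p w \<otimes>[R] tensor (x $ i) e0) *[N] u i"
  using w uc[OF im] by (simp add: N.smult_assoc1)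
  \<comment> \<open>The group element is moved next to \<open>u i\<close>, where equivariance of the
    tuple applies.\<close>
  also have "tensor p w \<otimes>[R] tensor (x $ i) e0 = tensor (p * ac w (x $ i)) e0 \<otimes>[R] tensor 1 w"
  using w by (simp add: tensor_mult)
  also have "... *[N] u i = tensor (p * ac w (x $ i)) e0 *[N] (tensor 1 w *[N] u i)"
  using w uc[OF im] by (simp add: N.smult_assoc1)
  also have "... = tensor (p * ac w (x $ i)) e0 *[N] (fs N {..<m} (%j. cscale N (rx w $$ (j, i)) (u j)))"
  using u w im unfolding equiv_tuple_def by simp
  also have "... = (fs N {..<m} (%j. tensor (p * ac w (x $ i)) e0 *[N] cscale N (rx w $$ (j, i)) (u j)))"
  by (rule N.smult_finsum) (use uc cscale_simps(1)[OF lN uc] in auto)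
  also have "... = (fs N {..<m} (%j. tensor (?q i j) e0 *[N] u j))"
  unfolding cscale_def using uc cq by (intro N.M.finsum_cong' refl) (auto simp flip: N.smult_assoc1 simp: tensor_mult)
  finally show "(fs N {..<m} (%j. tensor (?q i j) e0 *[N] u j)) = tensor p w *[N] (tensor (x $ i) e0 *[N] u i)" by simp
  qed (use w uc in auto)
  also have "... = tensor p w *[N] g x" unfolding g_def by (rule N.smult_finsum[symmetric]) (use w uc in auto)
  finally show ?thesis .
 qed
 have "ghm (Pm m rx) N e g"
 proof (rule ghmI)
  show "g (a *[Pm m rx] x) = a *[N] g x" if "a : cr R" "x : cr (Pm m rx)" for a x
  by (rule R_linearI[OF lmod_Pm[OF rx] lN gc ga gt that])
  fix i x assume x: "x : gr (Pm m rx) i"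
  show "g x : gr N (i + e)" unfolding g_def
  proof (rule gr_finsum[OF N])
  fix j assume "j : {..<m}"
  then have j: "j < m" by simp
  have "tensor (x $ j) e0 : skew_gr n i" using x j by (intro tensor_gr) auto
  from gr_smult[OF N this ug[OF j]] show "tensor (x $ j) e0 *[N] u j : gr N (i + e)" by (simp add: add.commute)
  qed simp
 qed (use gc ga in auto)
 moreover have "g (eP m j) = u j" if j: "j < m" for j
 proof -
  have "g (eP m j) = tensor (eP m j $ j) e0 *[N] u j" unfolding g_def
  by (rule N.M.finsum_single) (use j uc in \<open>auto simp: unit_vec_def tensor_zero\<close>)
  also have "... = u j" using j uc by (simp add: R_one[symmetric])
  finally show ?thesis .
 qed
 ultimately show ?thesis using that by blast
qed

lemma Pm_hom_unique:
 assumes rx: "rep m rx" and N: "wgm N" and f: "ghm (Pm m rx) N e f" and g: "ghm (Pm m rx) N e' g"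
  and eq: "!!j. j < m ==> f (eP m j) = g (eP m j)" and x: "x : cV m"
 shows "f x = g x"
proof -
 note wP = gmod_wgm[OF gmod_Pm[OF rx]]
 interpret N: lmod R N using N wgm_lmod by auto
 have ex: "h x = (fs N {..<m} (%j. tensor (x $ j) e0 *[N] h (eP m j)))" if h: "ghm (Pm m rx) N d h" for h d
 proof -
  have "h x = h (fs (Pm m rx) {..<m} (%j. tensor (x $ j) e0 *[Pm m rx] eP m j))" using Pm_expand[OF rx x] by simp
  also have "... = (fs N {..<m} (%j. h (tensor (x $ j) e0 *[Pm m rx] eP m j)))"
  by (rule ghm_finsum[OF wP N h]) (auto simp: Pm_smult)
  also have "... = (fs N {..<m} (%j. tensor (x $ j) e0 *[N] h (eP m j)))"
  using ghm_smult[OF h] ghm_closed[OF h] by (intro N.M.finsum_cong' refl) auto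
  finally show ?thesis .
 qed
 have "(fs N {..<m} (%j. tensor (x $ j) e0 *[N] f (eP m j))) = (fs N {..<m} (%j. tensor (x $ j) e0 *[N] g (eP m j)))"
  using eq ghm_closed[OF g] by (intro N.M.finsum_cong' refl) auto
 then show ?thesis using ex[OF f] ex[OF g] by simp
qed

lemma finsum_W_shift:
 assumes "lmod R M" "u : W" "!!w. w : W ==> f w : cr M"
 shows "(fs M W (%w. f (u ** w))) = (fs M W (%w. f w))"
proof -
 interpret M: lmod R M by fact
 have inj: "inj_on (%w. u ** w) W" using assms(2) by (intro inj_onI) simp
 have im: "(%w. u ** w) ` W = W"
 proof
  show "W <= (%w. u ** w) ` W"
  proof
  fix w assume w: "w : W"
  have "w = u ** (dinv u ** w)" using w assms(2) by (simp add: D.m_assoc[symmetric])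
  then show "w : (%w. u ** w) ` W" using w assms(2) by blast
  qed
 qed (use assms(2) in auto)
 show ?thesis using M.M.add.finprod_reindex[of f "%w. u ** w" W] inj im assms(3) by auto
qed

lemma finsum_const_cscale:
 assumes "lmod R M" "y : cr M" "finite A"
 shows "(fs M A (%i. y)) = cscale M (of_nat (card A)) y"
proof -
 interpret M: lmod R M by fact
 show ?thesis using assms(3)
 proof (induction A rule: finite_induct)
  case (insert x F)
  have "(fs M (insert x F) (%i. y)) = y +[M] cscale M (of_nat (card F)) y"
  using insert assms(2) by (subst M.M.finsum_insert) auto
  also have "... = cscale M (1 + of_nat (card F)) y"
  using cscale_simps(2,5)[OF assms(1,2)] by simp
  finally show ?case using insert by simp
 qed (use assms(2) in \<open>simp add: cscale_def tensor_zero\<close>)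
qed

lemma cscale_finsum:
 assumes "lmod R M" "finite A" "!!i. i : A ==> g i : cr M"
 shows "cscale M c (fs M A (%i. g i)) = (fs M A (%i. cscale M c (g i)))"
proof -
 interpret M: lmod R M by fact
 show ?thesis unfolding cscale_def using assms by (intro M.smult_finsum) auto
qed

lemma finsum_cscale_sum:
 assumes "lmod R M" "finite A" "y : cr M"
 shows "cscale M (sum c A) y = (fs M A (%i. cscale M (c i) y))"
proof -
 interpret M: lmod R M by fact
 show ?thesis using assms(2)
 proof (induction A rule: finite_induct)
  case (insert x F)
  then show ?case using cscale_simps(1,2)[OF assms(1,3)] by (subst M.M.finsum_insert) auto
 qed (use assms(3) in \<open>simp add: cscale_def tensor_zero\<close>)
qed

text \<open>A tuple is a linear map from the space of \<open>rx\<close> to \<open>M\<close>. It is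
  conjugated by each group element and averaged, which makes it equivariant.\<close>

definition avg :: "nat => mrep => (A, 'b) gmodule => (nat => 'b) => nat => 'b" where
 "avg m rx M u j = cscale M (inverse (of_nat (card W)))
  (fs M W (%w. \<Oplus>\<^bsub>M\<^esub>i\<in>{..<m}. cscale M (rx (dinv w) $$ (i, j)) (tensor 1 w *[M] u i)))"

lemma avg_equiv:
 assumes rx: "rep m rx" and M: "lmod R M" and u: "!!j. j < m ==> u j : cr M"
 shows "equiv_tuple m rx M (avg m rx M u)"
proof -
 interpret M: lmod R M by (rule M)
 define c where "c = inverse (of_nat (card W) :: complex)"
 define V where "V w j = (fs M {..<m} (%i. cscale M (rx (dinv w) $$ (i, j)) (tensor 1 w *[M] u i)))" for w j
 note cs = cscale_simps[OF M]
 have tc: "tensor 1 w *[M] u i : cr M" if "w : W" "i < m" for w i using u that by simp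
 have Vc: "V w j : cr M" if "w : W" for w j unfolding V_def by (rule M.M.finsum_closed) (use cs(1)[OF tc] that in auto)
 have av: "avg m rx M u j = cscale M c (fs M W (%w. V w j))" for j unfolding avg_def V_def c_def ..
 have sc: "(fs M W (%w. V w j)) : cr M" for j by (rule M.M.finsum_closed) (use Vc in auto)
 show ?thesis
  unfolding equiv_tuple_def
 proof (intro conjI ballI allI impI)
  show "avg m rx M u j : cr M" for j unfolding av using cs(1)[OF sc] .
  fix v j assume v: "v : W" and j: "j < m"
  have v1: "tensor 1 v *[M] V w j = (fs M {..<m} (%k. cscale M (rx v $$ (k, j)) (V (v ** w) k)))" if w: "w : W" for w
  proof -
  have vw: "v ** w : W" "dinv (v ** w) : W" using v w by auto
  have r: "rx (dinv w) $$ (i, j) = (SUM k<m. rx v $$ (k, j) * rx (dinv (v ** w)) $$ (i, k))" if i: "i < m" for i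
  proof -
  have "dinv w = dinv (v ** w) ** v" using v w by (simp add: D.inv_mult_group D.m_assoc)
  then have "rx (dinv w) = rx (dinv (v ** w)) * rx v" using rep_mult[OF rx vw(2) v] by simp
  then show ?thesis using rep_carrier[OF rx vw(2)] rep_carrier[OF rx v] i j
  by (simp add: scalar_prod_def lessThan_atLeast0 mult.commute)
  qed
  have "tensor 1 v *[M] V w j = (fs M {..<m} (%i. tensor 1 v *[M] cscale M (rx (dinv w) $$ (i, j)) (tensor 1 w *[M] u i)))"
  unfolding V_def by (rule M.smult_finsum) (use v cs(1)[OF tc[OF w]] in auto)
  also have "... = (fs M {..<m} (%i. \<Oplus>\<^bsub>M\<^esub>k\<in>{..<m}. cscale M (rx v $$ (k, j)) (cscale M (rx (dinv (v ** w)) $$ (i, k)) (tensor 1 (v ** w) *[M] u i))))"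
  proof (rule M.M.finsum_eqI)
  fix i assume "i : {..<m}"
  then have i: "i < m" by simp
  have "tensor 1 v *[M] cscale M (rx (dinv w) $$ (i, j)) (tensor 1 w *[M] u i) = cscale M (rx (dinv w) $$ (i, j)) (tensor 1 (v ** w) *[M] u i)"
  using cs(6)[OF tc[OF w i], of "tensor 1 v"] v w u[OF i] by (simp flip: M.smult_assoc1 add: tensor_mult)
  also have "... = (fs M {..<m} (%k. cscale M (rx v $$ (k, j) * rx (dinv (v ** w)) $$ (i, k)) (tensor 1 (v ** w) *[M] u i)))"
  unfolding r[OF i] by (rule finsum_cscale_sum[OF M]) (use tc[OF vw(1) i] in auto)
  also have "... = (fs M {..<m} (%k. cscale M (rx v $$ (k, j)) (cscale M (rx (dinv (v ** w)) $$ (i, k)) (tensor 1 (v ** w) *[M] u i))))"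
  using cs(4)[OF tc[OF vw(1) i]] cs(1)[OF cs(1)[OF tc[OF vw(1) i]]] by (intro M.M.finsum_cong' refl) auto
  finally show "tensor 1 v *[M] cscale M (rx (dinv w) $$ (i, j)) (tensor 1 w *[M] u i) = ..." .
  have "cscale M x (cscale M y (tensor 1 (v ** w) *[M] u i)) : cr M" for x y
  using cs(1)[OF cs(1)[OF tc[OF vw(1) i]]] .
  then show "(fs M {..<m} (%k. cscale M (rx v $$ (k, j)) (cscale M (rx (dinv (v ** w)) $$ (i, k)) (tensor 1 (v ** w) *[M] u i)))) : cr M"
  by (intro M.M.finsum_closed) auto
  qed
  also have "... = (fs M {..<m} (%k. \<Oplus>\<^bsub>M\<^esub>i\<in>{..<m}. cscale M (rx v $$ (k, j)) (cscale M (rx (dinv (v ** w)) $$ (i, k)) (tensor 1 (v ** w) *[M] u i))))"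
  by (rule M.M.finsum_swap) (use cs(1)[OF cs(1)[OF tc[OF vw(1)]]] in auto)
  also have "... = (fs M {..<m} (%k. cscale M (rx v $$ (k, j)) (V (v ** w) k)))"
  proof (rule M.M.finsum_eqI)
  fix k
  show "(fs M {..<m} (%i. cscale M (rx v $$ (k, j)) (cscale M (rx (dinv (v ** w)) $$ (i, k)) (tensor 1 (v ** w) *[M] u i)))) = cscale M (rx v $$ (k, j)) (V (v ** w) k)"
  unfolding V_def by (rule cscale_finsum[symmetric, OF M]) (use cs(1)[OF tc[OF vw(1)]] in auto)
  show "cscale M (rx v $$ (k, j)) (V (v ** w) k) : cr M" using cs(1)[OF Vc[OF vw(1)]] .
  qed
  finally show ?thesis .
  qed
  have vm: "tensor 1 v : cr R" using v by simp
  have "tensor 1 v *[M] avg m rx M u j = cscale M c (tensor 1 v *[M] (fs M W (%w. V w j)))"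
  unfolding av by (rule cs(6)[OF sc vm])
  also have "tensor 1 v *[M] (fs M W (%w. V w j)) = (fs M W (%w. tensor 1 v *[M] V w j))"
  by (rule M.smult_finsum) (use vm Vc in auto)
  also have "... = (fs M W (%w. \<Oplus>\<^bsub>M\<^esub>k\<in>{..<m}. cscale M (rx v $$ (k, j)) (V (v ** w) k)))"
  using v1 v cs(1)[OF Vc] by (intro M.M.finsum_cong' refl) (auto intro!: M.M.finsum_closed)
  also have "... = (fs M W (%w. \<Oplus>\<^bsub>M\<^esub>k\<in>{..<m}. cscale M (rx v $$ (k, j)) (V w k)))"
  by (rule finsum_W_shift[OF M v, of "%w. \<Oplus>\<^bsub>M\<^esub>k\<in>{..<m}. cscale M (rx v $$ (k, j)) (V w k)"])
  (use cs(1)[OF Vc] in \<open>auto intro!: M.M.finsum_closed\<close>)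
  also have "... = (fs M {..<m} (%k. \<Oplus>\<^bsub>M\<^esub>w\<in>W. cscale M (rx v $$ (k, j)) (V w k)))"
  by (rule M.M.finsum_swap) (use cs(1)[OF Vc] in auto)
  also have "... = (fs M {..<m} (%k. cscale M (rx v $$ (k, j)) (fs M W (%w. V w k))))"
  proof (rule M.M.finsum_eqI)
  fix k
  show "(fs M W (%w. cscale M (rx v $$ (k, j)) (V w k))) = cscale M (rx v $$ (k, j)) (fs M W (%w. V w k))"
  by (rule cscale_finsum[symmetric, OF M]) (use Vc in auto)
  show "cscale M (rx v $$ (k, j)) (fs M W (%w. V w k)) : cr M" using cs(1)[OF sc] .
  qed
  also have "cscale M c ... = (fs M {..<m} (%k. cscale M c (cscale M (rx v $$ (k, j)) (fs M W (%w. V w k)))))"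
  by (rule cscale_finsum[OF M]) (use cs(1)[OF sc] in auto)
  also have "... = (fs M {..<m} (%k. cscale M (rx v $$ (k, j)) (avg m rx M u k)))"
  proof (rule M.M.finsum_eqI)
  fix k
  show "cscale M c (cscale M (rx v $$ (k, j)) (fs M W (%w. V w k))) = cscale M (rx v $$ (k, j)) (avg m rx M u k)"
  unfolding av cs(4)[OF sc, symmetric] by (simp add: mult.commute)
  show "cscale M (rx v $$ (k, j)) (avg m rx M u k) : cr M" unfolding av using cs(1)[OF cs(1)[OF sc]] .
  qed
  finally show "tensor 1 v *[M] avg m rx M u j = (fs M {..<m} (%k. cscale M (rx v $$ (k, j)) (avg m rx M u k)))" .
 qed
qed

lemma avg_gr:
 assumes M: "wgm M" and u: "!!j. j < m ==> u j : gr M e"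
 shows "avg m rx M u j : gr M e"
 unfolding avg_def
proof (intro cscale_gr[OF M] gr_finsum[OF M])
 fix w i assume w: "w : W" and i: "i : {..<m}"
 show "tensor 1 w *[M] u i : gr M e"
  using gr_smult[OF M tensor_gr[OF w one_S_gr] u, of i] i by simp
qed auto

text \<open>Averaging commutes with \<open>te\<close> and fixes tuples that are already equivariant,
  so the average of a lift is still a lift.\<close>

lemma avg_image:
 assumes rx: "rep m rx" and M: "wgm M" and N: "wgm N" and te: "ghm M N d te" and u: "!!j. j < m ==> u j : cr M"
  and y: "equiv_tuple m rx N y" "!!j. j < m ==> te (u j) = y j" and j: "j < m"
 shows "te (avg m rx M u j) = y j"
proof -
 have lM: "lmod R M" and lN: "lmod R N" using M N wgm_lmod by auto
 interpret M: lmod R M by (rule lM)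
 interpret N: lmod R N by (rule lN)
 note csM = cscale_simps[OF lM] and csN = cscale_simps[OF lN]
 have yc: "y j : cr N" if "j < m" for j using y(1) that unfolding equiv_tuple_def by auto
 have tc: "tensor 1 w *[M] u i : cr M" if "w : W" "i < m" for w i using u that by simp
 have ic: "(fs M {..<m} (%i. cscale M (rx (dinv w) $$ (i, j)) (tensor 1 w *[M] u i))) : cr M" if "w : W" for w
  by (rule M.M.finsum_closed) (use csM(1)[OF tc[OF that]] in auto)
 have 1: "te (fs M {..<m} (%i. cscale M (rx (dinv w) $$ (i, j)) (tensor 1 w *[M] u i))) = y j" if w: "w : W" for w
 proof -
  have w': "dinv w : W" using w by simp
  have "te (fs M {..<m} (%i. cscale M (rx (dinv w) $$ (i, j)) (tensor 1 w *[M] u i))) = (fs N {..<m} (%i. te (cscale M (rx (dinv w) $$ (i, j)) (tensor 1 w *[M] u i))))"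
  by (rule ghm_finsum[OF M N te]) (use csM(1)[OF tc[OF w]] in auto)
  also have "... = (fs N {..<m} (%i. tensor 1 w *[N] cscale N (rx (dinv w) $$ (i, j)) (y i)))"
  proof (rule N.M.finsum_eqI)
  fix i assume "i : {..<m}"
  then have i: "i < m" by simp
  show "te (cscale M (rx (dinv w) $$ (i, j)) (tensor 1 w *[M] u i)) = tensor 1 w *[N] cscale N (rx (dinv w) $$ (i, j)) (y i)"
  using ghm_cscale[OF te tc[OF w i]] ghm_smult[OF te u[OF i], of "tensor 1 w"] w y(2)[OF i] csN(6)[OF yc[OF i], of "tensor 1 w"] by simp
  show "tensor 1 w *[N] cscale N (rx (dinv w) $$ (i, j)) (y i) : cr N" using w csN(1)[OF yc[OF i]] by simp
  qed
  also have "... = tensor 1 w *[N] (fs N {..<m} (%i. cscale N (rx (dinv w) $$ (i, j)) (y i)))"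
  by (rule N.smult_finsum[symmetric]) (use w csN(1)[OF yc] in auto)
  also have "... = tensor 1 w *[N] (tensor 1 (dinv w) *[N] y j)" using y(1) w' j unfolding equiv_tuple_def by simp
  also have "... = y j" using w w' yc[OF j] by (simp flip: N.smult_assoc1 add: tensor_mult) (simp add: R_one[symmetric])
  finally show ?thesis .
 qed
 have sc: "(fs M W (%w. \<Oplus>\<^bsub>M\<^esub>i\<in>{..<m}. cscale M (rx (dinv w) $$ (i, j)) (tensor 1 w *[M] u i))) : cr M"
  by (rule M.M.finsum_closed) (use ic in auto)
 have "te (avg m rx M u j) = cscale N (inverse (of_nat (card W))) (te (fs M W (%w. \<Oplus>\<^bsub>M\<^esub>i\<in>{..<m}. cscale M (rx (dinv w) $$ (i, j)) (tensor 1 w *[M] u i))))"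
  unfolding avg_def by (rule ghm_cscale[OF te sc])
 also have "te (fs M W (%w. \<Oplus>\<^bsub>M\<^esub>i\<in>{..<m}. cscale M (rx (dinv w) $$ (i, j)) (tensor 1 w *[M] u i))) = (fs N W (%w. y j))"
  by (subst ghm_finsum[OF M N te finite_W ic]) (use 1 yc[OF j] in \<open>auto intro!: N.M.finsum_cong'\<close>)
 also have "... = cscale N (of_nat (card W)) (y j)" by (rule finsum_const_cscale[OF lN yc[OF j] finite_W])
 also have "cscale N (inverse (of_nat (card W))) ... = cscale N (inverse (of_nat (card W)) * of_nat (card W)) (y j)"
  using csN(4)[OF yc[OF j]] by simp
 also have "inverse (of_nat (card W)) * of_nat (card W) = (1::complex)" using card_W_pos by (metis left_inverse less_irrefl of_nat_eq_0_iff)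
 finally show ?thesis using csN(5)[OF yc[OF j]] by simp
qed

lemma Pm_lift_tuple:
 assumes rx: "rep m rx" and M: "wgm M" and N: "wgm N" and te: "ghm M N c te" and g: "ghm (Pm m rx) N d g"
  and u: "!!j. j < m ==> u j : gr M (d - c)" "!!j. j < m ==> te (u j) = g (eP m j)"
 obtains g' where "ghm (Pm m rx) M (d - c) g'" "ALL x:cV m. te (g' x) = g x"
proof -
 note wP = gmod_wgm[OF gmod_Pm[OF rx]]
 have uc: "u j : cr M" if "j < m" for j using gr_carrier[OF M u(1)[OF that]] .
 have lM: "lmod R M" using M wgm_lmod by auto
 have e: "equiv_tuple m rx M (avg m rx M u)" by (rule avg_equiv[OF rx lM uc])
 have ag: "avg m rx M u j : gr M (d - c)" for j by (rule avg_gr[OF M u(1)])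
 obtain g' where g': "ghm (Pm m rx) M (d - c) g'" "ALL j<m. g' (eP m j) = avg m rx M u j"
  by (rule Pm_hom[OF rx M e ag])
 have y: "equiv_tuple m rx N (%j. g (eP m j))" by (rule ghm_equiv_tuple[OF wP N g Pm_equiv_tuple[OF rx]])
 have "te (g' x) = g x" if "x : cV m" for x
 proof (rule Pm_hom_unique[OF rx N ghm_comp[OF g'(1) te] g _ that])
  fix j assume j: "j < m"
  show "te (g' (eP m j)) = g (eP m j)" using g'(2) j avg_image[OF rx M N te uc y u(2) j] by simp
 qed
 then show ?thesis using that g'(1) by blast
qed

text \<open>The component of degree \<open>d - c\<close> of any preimage is again a
  preimage.\<close>

lemma hom_preimage:
 assumes M: "gmod M" and N: "gmod N" and te: "ghm M N c te" and y: "y : gr N d" "y : te ` cr M"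
 obtains x where "x : gr M (d - c)" "te x = y"
proof -
 obtain x where x: "x : cr M" "te x = y" using y by auto
 have "te (hp M (d - c) x) = y" using hp_ghm[OF M N te x(1), of d] hp_same[OF N y(1)] x(2) by simp
 then show ?thesis using that hp_gr[OF M x(1)] by blast
qed

text \<open>Graded projectivity. Preimages of the generators are chosen arbitrarily and then
  averaged; \<open>te\<close> has to reach only these finitely many elements.\<close>

lemma Pm_lift:
 assumes rx: "rep m rx" and M: "gmod M" and N: "gmod N" and te: "ghm M N c te" and g: "ghm (Pm m rx) N d g"
  and im: "!!j. j < m ==> g (eP m j) : te ` cr M"
 obtains g' where "ghm (Pm m rx) M (d - c) g'" "ALL x:cV m. te (g' x) = g x"
proof -
 have "EX x. x : gr M (d - c) & te x = g (eP m j)" if "j < m" for j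
  using hom_preimage[OF M N te, of "g (eP m j)" d] ghm_gr[OF g eP_gr] im[OF that] by auto
 then obtain u where "!!j. j < m ==> u j : gr M (d - c)" "!!j. j < m ==> te (u j) = g (eP m j)" by metis
 from Pm_lift_tuple[OF rx gmod_wgm[OF M] gmod_wgm[OF N] te g this] show ?thesis using that by blast
qed

definition eb :: "nat => nat => A" where "eb j = (%i. if i = j then 1[R] else 0[R])"

lemma eb_gr: "j < length ds ==> eb j : gr (G ds) (ds ! j)"
proof -
 have z: "0[R] : skew_gr n i" for i by (simp add: skew_gr_iff R_zero R_carrier)
 have o: "1[R] : skew_gr n 0" unfolding R_one by (rule tensor_gr) auto
 assume "j < length ds"
 then show ?thesis using z o by (auto simp: eb_def)
qed

lemma gfree_expand:
 assumes "x : cr (G ds)"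
 shows "x = (fs (G ds) {..<length ds} (%j. x j *[G ds] eb j))"
proof -
 have xc: "x j : cr R" for j by (rule gfree_comp_carrier[OF assms])
 have c: "x j *[G ds] eb j : cr (G ds)" if "j < length ds" for j
  using xc that by (auto simp: eb_def)
 have "(fs (G ds) {..<length ds} (%j. x j *[G ds] eb j)) = (%i. \<Oplus>\<^bsub>R\<^esub>j\<in>{..<length ds}. (x j *[G ds] eb j) i)"
  by (rule finsum_gfree) (use c in auto)
 also have "... = x"
 proof
  fix i
  have e: "(x j *[G ds] eb j) i = (if j = i then x i else 0[R])" for j using xc by (simp add: eb_def)
  show "(fs R {..<length ds} (%j. (x j *[G ds] eb j) i)) = x i"
  proof (cases "i < length ds")
  case True
  then show ?thesis unfolding e by (subst R.finsum_single[of i]) (use xc in auto)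
  next
  case False
  then have "x i = 0[R]" using assms by auto
  then show ?thesis unfolding e by simp
  qed
 qed
 finally show ?thesis by simp
qed

lemma gfree_hom_unique:
 assumes N: "wgm N" and f: "ghm (G ds) N d f" and g: "ghm (G ds) N d' g"
  and eq: "!!j. j < length ds ==> f (eb j) = g (eb j)" and x: "x : cr (G ds)"
 shows "f x = g x"
proof -
 let ?F = "G ds"
 note wF = gmod_wgm[OF gmod_gfree]
 interpret N: lmod R N using N wgm_lmod by auto
 interpret F: lmod R ?F by (rule lmod_gfree)
 have xc: "x j : cr R" for j by (rule gfree_comp_carrier[OF x])
 have ebc: "eb j : cr ?F" if "j < length ds" for j using gr_carrier[OF wF eb_gr[OF that]] .
 have ex: "h x = (fs N {..<length ds} (%j. x j *[N] h (eb j)))" if h: "ghm ?F N d h" for h d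
 proof -
  have "h x = h (fs ?F {..<length ds} (%j. x j *[?F] eb j))" using gfree_expand[OF x] by simp
  also have "... = (fs N {..<length ds} (%j. h (x j *[?F] eb j)))"
  by (rule ghm_finsum[OF wF N h]) (use F.smult_closed[OF xc ebc] in auto)
  also have "... = (fs N {..<length ds} (%j. x j *[N] h (eb j)))"
  using ghm_smult[OF h ebc xc] ghm_closed[OF h ebc] xc by (intro N.M.finsum_cong' refl) auto
  finally show ?thesis .
 qed
 have "(fs N {..<length ds} (%j. x j *[N] f (eb j))) = (fs N {..<length ds} (%j. x j *[N] g (eb j)))"
  using eq ghm_closed[OF g ebc] xc by (intro N.M.finsum_cong' refl) auto
 then show ?thesis using ex[OF f] ex[OF g] by simp
qed

lemma gfree_hom:
 assumes N: "wgm N" and u: "!!j. j < length ds ==> u j : gr N (ds ! j + d)"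
 obtains g where "ghm (G ds) N d g" "ALL j<length ds. g (eb j) = u j"
proof -
 let ?F = "G ds"
 interpret N: lmod R N using N wgm_lmod by auto
 have uc: "u j : cr N" if "j < length ds" for j using gr_carrier[OF N u[OF that]] .
 define g where "g x = (fs N {..<length ds} (%j. x j *[N] u j))" for x
 have c: "(%j. x j *[N] u j) : {..<length ds} \<rightarrow> cr N" if "x : cr ?F" for x
  using uc gfree_comp_carrier[OF that] by auto
 have "ghm ?F N d g"
 proof (rule ghmI)
  fix x assume x: "x : cr ?F"
  note xc = gfree_comp_carrier[OF x]
  show "g x : cr N" unfolding g_def by (rule N.M.finsum_closed[OF c[OF x]])
  show "g (a *[?F] x) = a *[N] g x" if a: "a : cr R" for a
  proof -
  have "g (a *[?F] x) = (fs N {..<length ds} (%j. a *[N] (x j *[N] u j)))"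
  unfolding g_def using a xc uc by (intro N.M.finsum_cong' refl) (auto simp: N.smult_assoc1)
  also have "... = a *[N] g x" unfolding g_def by (rule N.smult_finsum[symmetric]) (use a c[OF x] in auto)
  finally show ?thesis .
  qed
  fix y assume y: "y : cr ?F"
  note yc = gfree_comp_carrier[OF y]
  have "g (x +[?F] y) = (fs N {..<length ds} (%j. x j *[N] u j +[N] y j *[N] u j))"
  unfolding g_def using xc yc uc by (intro N.M.finsum_cong' refl) (auto simp: N.smult_l_distr)
  also have "... = g x +[N] g y" unfolding g_def by (rule N.M.finsum_addf[OF c[OF x] c[OF y]])
  finally show "g (x +[?F] y) = g x +[N] g y" .
 next
  fix i x assume x: "x : gr ?F i"
  show "g x : gr N (i + d)" unfolding g_def
  proof (rule gr_finsum[OF N])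
  fix j assume "j : {..<length ds}"
  then have j: "j < length ds" by simp
  have "x j : skew_gr n (i - ds ! j)" using x j by simp
  from gr_smult[OF N this u[OF j]] show "x j *[N] u j : gr N (i + d)" by (simp add: algebra_simps)
  qed simp
 qed
 moreover have "g (eb j) = u j" if j: "j < length ds" for j
  unfolding g_def by (subst N.M.finsum_single[of j]) (use j uc in \<open>auto simp: eb_def\<close>)
 ultimately show ?thesis using that by blast
qed

lemma gfree_lift:
 assumes M: "gmod M" and N: "gmod N" and te: "ghm M N c te" and g: "ghm (G ds) N d g"
  and im: "!!x. x : cr (G ds) ==> g x : te ` cr M"
 obtains g' where "ghm (G ds) M (d - c) g'" "ALL x:cr (G ds). te (g' x) = g x"
proof -
 note wF = gmod_wgm[OF gmod_gfree]
 have "EX x. x : gr M (ds ! j + (d - c)) & te x = g (eb j)" if j: "j < length ds" for j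
 proof -
  have "g (eb j) : gr N (ds ! j + d)" using ghm_gr[OF g eb_gr[OF j]] .
  moreover have "g (eb j) : te ` cr M" using im gr_carrier[OF wF eb_gr[OF j]] by blast
  ultimately obtain x where "x : gr M (ds ! j + d - c)" "te x = g (eb j)" by (rule hom_preimage[OF M N te])
  then show ?thesis by (auto simp: algebra_simps)
 qed
 then obtain u where u: "!!j. j < length ds ==> u j : gr M (ds ! j + (d - c))" "!!j. j < length ds ==> te (u j) = g (eb j)" by metis
 obtain g' where g': "ghm (G ds) M (d - c) g'" "ALL j<length ds. g' (eb j) = u j"
  using gfree_hom[OF gmod_wgm[OF M] u(1)] by blast
 have "te (g' x) = g x" if "x : cr (G ds)" for x
  by (rule gfree_hom_unique[OF gmod_wgm[OF N] ghm_comp[OF g'(1) te] g _ that]) (use g' u in auto)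
 then show ?thesis using that g'(1) by blast
qed

end

section \<open>Homomorphisms to duals\<close>

lemma linear_functional_vec:
 fixes f :: "complex vec => complex"
 assumes "!!u v. u : cV l ==> v : cV l ==> f (u + v) = f u + f v"
  and "!!c u. u : cV l ==> f (c *s u) = c * f u" and u: "u : cV l"
 shows "f u = (SUM t<l. u $ t * f (unit_vec l t))"
proof -
 obtain M where M: "M : cM 1 l" "!!x. x : cV l ==> vec 1 (%_. f x) = M *v x"
  by (rule linear_mat[of l "%x. vec 1 (%_. f x)" 1]) (use assms in auto)
 have f: "f x = (SUM t<l. M $$ (0, t) * x $ t)" if "x : cV l" for x
  using arg_cong[OF M(2)[OF that], of "%v. v $ 0"] M(1) that by (simp add: scalar_prod_def lessThan_atLeast0)
 have "f (unit_vec l t) = M $$ (0, t)" if "t < l" for t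
  using that by (subst f) (auto simp: unit_vec_def if_distrib[of "%x. _ * x"] cong: if_cong)
 then show ?thesis using f[OF u] by (simp add: mult.commute)
qed

lemma (in gring) hp_smult0:
 assumes M: "gmod M" and a: "a : Rg 0" and x: "x : cr M"
 shows "hp M i (a *[M] x) = a *[M] hp M i x"
proof -
 interpret M: lmod R M by (rule gmod_lmod[OF M])
 note wM = gmod_wgm[OF M]
 have aR: "a : cr R" using a Rg_sub by auto
 obtain I where I: "finite I" "!!J. finite J ==> I <= J ==> x = (fs M J (%j. hp M j x))" using hp_decomp[OF M x] by blast
 have hc: "hp M j x : cr M" for j by (rule hp_carrier[OF M x])
 have g: "a *[M] hp M j x : gr M j" for j using gr_smult[OF wM a hp_gr[OF M x, of j]] by simp
 have "a *[M] x = (fs M (insert i I) (%j. a *[M] hp M j x))"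
  by (subst I(2)[of "insert i I"]) (use I(1) aR hc in \<open>auto intro!: M.smult_finsum\<close>)
 then have "hp M i (a *[M] x) = (fs M (insert i I) (%j. hp M i (a *[M] hp M j x)))"
  using I(1) aR hc by (simp only:) (rule hp_finsum[OF M], auto)
 also have "... = hp M i (a *[M] hp M i x)"
  by (rule M.M.finsum_single) (use I(1) hp_other[OF M g] hp_carrier[OF M] aR hc in auto)
 finally show ?thesis using hp_same[OF M g] by simp
qed

context dihz
begin

lemma dual_tensor_eval:
 assumes M: "lmod R M" and f: "f : dual_carrier M" and w: "w : W" and y: "y : cr M"
 shows "(tensor p w *[dl M] f) y = f (dag w p *[M] y)"
proof -
 interpret M: lmod R M by (rule M)
 have z: "f (dag v (tensor p w v) *[M] y) = (if v = w then f (dag w p *[M] y) else 0)" for v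
  using dual_zero[OF M f] y by (cases "v = w") (simp_all add: tensor_def[of p] dag_def tensor_zero)
 show ?thesis using y w by (simp add: dual_smult z)
qed

lemma dual_cscale_eval:
 assumes M: "lmod R M" and f: "f : dual_carrier M" and y: "y : cr M"
 shows "cscale (dl M) c f y = c * f y"
proof -
 have "dag e0 (constS c) = cst c" unfolding dag_def by simp
 then show ?thesis using dual_tensor_eval[OF M f e0_W y] dual_carrierD(2)[OF f y] unfolding cscale_def by simp
qed

lemma dual_finsum_eval:
 assumes M: "lmod R M" and "finite A" "!!i. i : A ==> F i : dual_carrier M" and y: "y : cr M"
 shows "(fs (dl M) A (%i. F i)) y = (SUM i:A. F i y)"
proof -
 interpret N: lmod R "dl M" by (rule lmod_dual[OF M])
 show ?thesis using assms(2,3)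
 proof (induction A rule: finite_induct)
  case (insert x F')
  then show ?case using y by (subst N.M.finsum_insert) auto
 qed (use y in simp)
qed

lemma dag_one: "dag w 1 = tensor 1 (dinv w)" unfolding dag_def by simp

lemma dual_hom_tensor:
 assumes M: "lmod R M" and Q: "lmod R Q" and g: "ghm M (dl Q) c g" and w: "w : W"
  and x: "x : cr M" and y: "y : cr Q"
 shows "g (tensor p w *[M] x) y = g x (dag w p *[Q] y)"
 using ghm_smult[OF g x, of "tensor p w"] ghm_closed[OF g x] w dual_tensor_eval[OF Q _ w y] by simp

lemma dag_inv: "w : W ==> dag (dinv w) (ac (dinv w) p) = tensor p w"
 unfolding dag_def by (simp flip: act_act)

text \<open>A map into a dual is a pairing, and exchanging its arguments gives a map of the same
  degree in the other direction. Compatibility with group elements uses that \<open>dag\<close>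
  undoes itself.\<close>

lemma transpose_hom:
 assumes M: "wgm M" and Q: "wgm Q" and g: "ghm M (dl Q) c g"
 shows "ghm Q (dl M) c (%y. \<lambda>x\<in>cr M. g x y)"
proof -
 have lM: "lmod R M" and lQ: "lmod R Q" using M Q wgm_lmod by auto
 interpret M: lmod R M by (rule lM)
 interpret Q: lmod R Q by (rule lQ)
 have lD: "lmod R (dl M)" by (rule lmod_dual[OF lM])
 have gd: "g x : dual_carrier Q" if "x : cr M" for x using ghm_closed[OF g that] by simp
 note dc = dual_carrierD[OF gd]
 have cl: "(\<lambda>x\<in>cr M. g x y) : dual_carrier M" if y: "y : cr Q" for y
  unfolding dual_carrier_def using ghm_add[OF g] ghm_cscale[OF g] dual_cscale_eval[OF lQ gd y] cscale_simps(1)[OF lM] y by auto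
 have t: "(\<lambda>x\<in>cr M. g x (tensor p w *[Q] y)) = tensor p w *[dl M] (\<lambda>x\<in>cr M. g x y)"
  if w: "w : W" and y: "y : cr Q" for p w y
 proof
  fix x
  show "(\<lambda>x\<in>cr M. g x (tensor p w *[Q] y)) x = (tensor p w *[dl M] (\<lambda>x\<in>cr M. g x y)) x"
  proof (cases "x : cr M")
  case True
  have w': "dinv w : W" using w by simp
  have "g (dag w p *[M] x) y = g x (tensor p w *[Q] y)"
  unfolding dag_def[of w p] dual_hom_tensor[OF lM lQ g w' True y] dag_inv[OF w] ..
  then show ?thesis using True w dual_tensor_eval[OF lM cl[OF y] w True] by simp
  qed (simp add: dual_smult)
 qed
 show ?thesis
 proof (rule ghmI)
  show "(\<lambda>x\<in>cr M. g x y) : cr (dl M)" if "y : cr Q" for y using cl[OF that] by simp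
  show add: "(\<lambda>x\<in>cr M. g x (y +[Q] z)) = (\<lambda>x\<in>cr M. g x y) +[dl M] (\<lambda>x\<in>cr M. g x z)"
  if "y : cr Q" "z : cr Q" for y z using dc(1) that by auto
  show "(\<lambda>x\<in>cr M. g x (a *[Q] y)) = a *[dl M] (\<lambda>x\<in>cr M. g x y)" if "a : cr R" "y : cr Q" for a y
  by (rule R_linearI[OF lQ lD _ add t that]) (use cl in \<open>auto simp only: dual_simps\<close>)
  fix i y assume y: "y : gr Q i"
  have "g x y = 0" if "x : gr M j" "j ~= - (i + c)" for x j
  proof -
  have "i ~= - (j + c)" using that(2) by linarith
  then show ?thesis using ghm_gr[OF g that(1)] y by auto
  qed
  then show "(\<lambda>x\<in>cr M. g x y) : gr (dl M) (i + c)" using cl[OF gr_carrier[OF Q y]] gr_carrier[OF M] by auto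
 qed
qed

definition grrep :: "(A, 'b) gmodule => int => nat => mrep => (complex vec => 'b) => bool" where
 "grrep Q i l ta fy <-> bij_betw fy (cV l) (gr Q i) & (ALL u:cV l.
  (ALL v:cV l. fy (u + v) = fy u +[Q] fy v) & (ALL c. fy (c *s u) = cscale Q c (fy u)) &
  (ALL w:W. fy (ta w *v u) = tensor 1 w *[Q] fy u))"

lemma decomposition_iff: "decomposition n Q i rxs <-> (EX fy. grrep Q i (tdeg rxs) (blocks rxs) fy)"
 unfolding decomposition_def grrep_def tdeg_def blocks_def ..

lemma conj_entry:
 fixes b :: "complex mat"
 assumes "A : cM m m" "b : cM m l" "B : cM l l" "j < m" "t < l"
 shows "(A\<^sup>T * b * B) $$ (j, t) = (SUM a<m. A $$ (a, j) * (SUM s<l. B $$ (s, t) * b $$ (a, s)))"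
 using assms by (simp add: scalar_prod_def lessThan_atLeast0 sum_distrib_left sum_distrib_right mult.assoc mult.commute)

text \<open>The pairing between \<open>rx\<close> and the homogeneous piece parametrized by
  \<open>fy\<close> that a homomorphism into the dual of \<open>Q\<close> induces on the generators
  of \<open>P\<close>.\<close>

definition pmat :: "nat => nat => (complex vec => 'b) => (S vec => 'b => complex) => complex mat" where
 "pmat m l fy g = mat m l (%(j, t). g (eP m j) (fy (unit_vec l t)))"

lemma pmat_simps [simp]: "pmat m l fy g : cM m l" "j < m ==> t < l ==> pmat m l fy g $$ (j, t) = g (eP m j) (fy (unit_vec l t))"
 "dim_row (pmat m l fy g) = m" "dim_col (pmat m l fy g) = l"
 unfolding pmat_def by auto

context
 fixes Q :: "(A, 'b) gmodule" and i :: int and l :: nat and ta :: mrep and fy and m :: nat and rx :: mrep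
 assumes Q: "gmod Q" and rx: "rep m rx" and ta: "rep l ta" and fy: "grrep Q i l ta fy"
begin

lemma grrepD:
 "bij_betw fy (cV l) (gr Q i)" "u : cV l ==> fy u : gr Q i" "u : cV l ==> fy u : cr Q"
 "u : cV l ==> v : cV l ==> fy (u + v) = fy u +[Q] fy v" "u : cV l ==> fy (c *s u) = cscale Q c (fy u)"
 "u : cV l ==> w : W ==> fy (ta w *v u) = tensor 1 w *[Q] fy u"
proof -
 show 1: "bij_betw fy (cV l) (gr Q i)" using fy unfolding grrep_def by auto
 show 2: "u : cV l ==> fy u : gr Q i" by (rule bij_betwE[OF 1, rule_format])
 show "u : cV l ==> fy u : cr Q" using gr_carrier[OF gmod_wgm[OF Q] 2] .
qed (use fy in \<open>auto simp: grrep_def\<close>)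

lemma functional_grrep:
 assumes f: "f : dual_carrier Q" and u: "u : cV l"
 shows "f (fy u) = (SUM t<l. u $ t * f (fy (unit_vec l t)))"
 by (rule linear_functional_vec[of l "%u. f (fy u)"])
  (use dual_carrierD[OF f] grrepD u in auto)

lemma pmat_inv_pair:
 assumes g: "ghm (Pm m rx) (dl Q) c g"
 shows "inv_pair m l rx ta (pmat m l fy g)"
proof -
 have lQ: "lmod R Q" using Q gmod_lmod by auto
 have lP: "lmod R (Pm m rx)" by (rule lmod_Pm[OF rx])
 note wP = gmod_wgm[OF gmod_Pm[OF rx]] and wD = wgm_dual[OF gmod_wgm[OF Q]]
 interpret Q: lmod R Q by (rule lQ)
 have gc: "g (eP m a) : dual_carrier Q" for a using ghm_closed[OF g, of "eP m a"] by simp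
 note et = ghm_equiv_tuple[OF wP wD g Pm_equiv_tuple[OF rx]]
 have e: "((rx w)\<^sup>T * pmat m l fy g * ta w) $$ (j, t) = pmat m l fy g $$ (j, t)" if w: "w : W" and j: "j < m" and t: "t < l" for w j t
 proof -
  have rc: "rx w : cM m m" "ta w : cM l l" using rep_carrier rx ta w by auto
  let ?y = "fy (unit_vec l t)"
  have yc: "?y : cr Q" and wy: "tensor 1 w *[Q] ?y : cr Q" using grrepD(3) w by auto
  have "(SUM s<l. ta w $$ (s, t) * pmat m l fy g $$ (a, s)) = g (eP m a) (tensor 1 w *[Q] ?y)" if a: "a < m" for a
  proof -
  have "(ta w *v unit_vec l t) $ s = ta w $$ (s, t)" if "s < l" for s
  using that t rc by (simp add: scalar_prod_right_unit)
  then show ?thesis using functional_grrep[OF gc, of "ta w *v unit_vec l t" a] grrepD(6)[OF _ w, of "unit_vec l t"] rc a by simp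
  qed
  then have "((rx w)\<^sup>T * pmat m l fy g * ta w) $$ (j, t) = (SUM a<m. rx w $$ (a, j) * g (eP m a) (tensor 1 w *[Q] ?y))"
  unfolding conj_entry[OF rc(1) pmat_simps(1) rc(2) j t] by (intro sum.cong) auto
  also have "... = (fs (dl Q) {..<m} (%a. cscale (dl Q) (rx w $$ (a, j)) (g (eP m a)))) (tensor 1 w *[Q] ?y)"
  using dual_cscale_eval[OF lQ gc wy] cscale_simps(1)[OF lmod_dual[OF lQ]] gc by (subst dual_finsum_eval[OF lQ _ _ wy]) auto
  also have "... = (tensor 1 w *[dl Q] g (eP m j)) (tensor 1 w *[Q] ?y)" using et w j unfolding equiv_tuple_def by simp
  also have "... = g (eP m j) ?y" unfolding dual_tensor_eval[OF lQ gc w wy] dag_one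
  using w yc by (simp flip: Q.smult_assoc1 add: tensor_mult) (simp flip: R_one)
  finally show ?thesis using j t by simp
 qed
 then have "(rx w)\<^sup>T * pmat m l fy g * ta w = pmat m l fy g" if "w : W" for w
  by (rule eq_matI) (use that rep_carrier[OF rx that] rep_carrier[OF ta that] in \<open>simp_all del: index_mult_mat(1) add: e[OF that]\<close>)
 then show ?thesis unfolding inv_pair_def by simp
qed

lemma pmat_surj:
 assumes b: "inv_pair m l rx ta b"
 obtains g where "ghm (Pm m rx) (dl Q) (- i) g" "pmat m l fy g = b"
proof -
 note wQ = gmod_wgm[OF Q]
 have lQ: "lmod R Q" using Q gmod_lmod by auto
 interpret Q: lmod R Q by (rule lQ)
 have bc: "b : cM m l" using b unfolding inv_pair_def by auto
 \<comment> \<open>\<open>th q\<close> are the coordinates of the degree \<open>i\<close> component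
   of \<open>q\<close>; through them a pairing with \<open>gr Q i\<close> becomes a family of
   functionals on \<open>Q\<close> that vanish in all other degrees.\<close>
 define th where "th q = inv_into (cV l) fy (hp Q i q)" for q
 have thc: "th q : cV l" and thfy: "fy (th q) = hp Q i q" if "q : cr Q" for q
  using bij_betw_inv_into_right[OF grrepD(1)] inv_into_into[of _ fy "cV l"] hp_gr[OF Q that, of i] bij_betw_imp_surj_on[OF grrepD(1)]
  unfolding th_def by auto
 have inj: "u = v" if "u : cV l" "v : cV l" "fy u = fy v" for u v
  using grrepD(1) that unfolding bij_betw_def inj_on_def by auto
 have tha: "th (x +[Q] y) = th x + th y" if "x : cr Q" "y : cr Q" for x y
  using that grrepD(4) thc thfy hp_add[OF Q] by (intro inj) auto
 have thg: "th (fy u) = u" if "u : cV l" for u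
  using that thc thfy grrepD(2,3) hp_same[OF Q] by (intro inj) auto
 have ths: "th (cscale Q c x) = c *s th x" if "x : cr Q" for x c
  using that grrepD(5) thc thfy hp_smult0[OF Q cst_gr] by (intro inj) (auto simp: cscale_def)
 have thw: "th (tensor 1 w *[Q] x) = ta w *v th x" if "x : cr Q" "w : W" for x w
  using that grrepD(6) thc thfy hp_smult0[OF Q tensor_gr] rep_carrier[OF ta, of w] by (intro inj) auto
 have tho: "th x = zv l" if "x : gr Q j" "j ~= i" for x j
 proof -
  note xc = gr_carrier[OF wQ that(1)]
  have "th (cscale Q 0 x) = th x" unfolding th_def
  using hp_other[OF Q that(1)] that(2) hp_same[OF Q gr_zero[OF wQ]] xc by (simp add: cscale_def tensor_zero)
  moreover have "0 *s th x = zv l" using thc[OF xc] by auto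
  ultimately show ?thesis using ths[OF xc, of 0] by simp
 qed
 define u where "u j = (\<lambda>q\<in>cr Q. (b *v th q) $ j)" for j
 have bt: "b *v th q : cV m" if "q : cr Q" for q using bc thc[OF that] by simp
 have uc: "u j : dual_carrier Q" if j: "j < m" for j
  unfolding dual_carrier_def u_def using tha ths bc thc bt j cscale_simps(1)[OF lQ]
  by (auto simp: scalar_prod_add_distrib[of _ l] scalar_prod_smult_distrib[of _ l] row_carrier_vec[OF _ bc])
 have ug: "u j : gr (dl Q) (- i)" if j: "j < m" for j
  using uc[OF j] tho bc gr_carrier[OF wQ] j by (auto simp: u_def)
 have ue: "equiv_tuple m rx (dl Q) u"
  unfolding equiv_tuple_def
 proof (intro conjI ballI allI impI)
  show "u j : cr (dl Q)" if "j < m" for j using uc[OF that] by simp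
  fix w j assume w: "w : W" and j: "j < m"
  interpret N: lmod R "dl Q" by (rule lmod_dual[OF lQ])
  have wi: "dinv w : W" using w by simp
  have rc: "rx w : cM m m" "ta w : cM l l" "ta (dinv w) : cM l l" using rep_carrier rx ta w wi by auto
  have "b * ta (dinv w) = (rx w)\<^sup>T * b * ta w * ta (dinv w)" using b w unfolding inv_pair_def by simp
  also have "... = (rx w)\<^sup>T * b * (ta w * ta (dinv w))" by (rule assoc_mult_mat[of _ m l _ l _ l]) (use bc rc in auto)
  also have "... = (rx w)\<^sup>T * b" using rep_inv(2)[OF ta w] bc rc by simp
  finally have bi: "b * ta (dinv w) = (rx w)\<^sup>T * b" .
  show "tensor 1 w *[dl Q] u j = (fs (dl Q) {..<m} (%a. cscale (dl Q) (rx w $$ (a, j)) (u a)))"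
  proof (rule extensionalityI[of _ "cr Q"])
  have fc: "(fs (dl Q) {..<m} (%a. cscale (dl Q) (rx w $$ (a, j)) (u a))) : cr (dl Q)"
  by (rule N.M.finsum_closed) (use cscale_simps(1)[OF lmod_dual[OF lQ]] uc in auto)
  then show "(fs (dl Q) {..<m} (%a. cscale (dl Q) (rx w $$ (a, j)) (u a))) : extensional (cr Q)"
  using dual_carrierD(3) by auto
  show "tensor 1 w *[dl Q] u j : extensional (cr Q)" by (simp add: dual_smult)
  fix q assume q: "q : cr Q"
  have "(tensor 1 w *[dl Q] u j) q = (b *v (ta (dinv w) *v th q)) $ j"
  unfolding dual_tensor_eval[OF lQ uc[OF j] w q] dag_one using q wi thw[OF q wi] by (simp add: u_def)
  also have "... = ((rx w)\<^sup>T *v (b *v th q)) $ j"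
  using assoc_mult_mat_vec[of b m l "ta (dinv w)" l "th q"] assoc_mult_mat_vec[of "(rx w)\<^sup>T" m m b l "th q"] bc rc thc[OF q] bi by simp
  also have "... = (SUM a<m. rx w $$ (a, j) * u a q)" using j rc bt[OF q] q bc
  by (simp add: scalar_prod_def lessThan_atLeast0 u_def)
  also have "... = (fs (dl Q) {..<m} (%a. cscale (dl Q) (rx w $$ (a, j)) (u a))) q"
  using dual_cscale_eval[OF lQ uc q] cscale_simps(1)[OF lmod_dual[OF lQ]] uc by (subst dual_finsum_eval[OF lQ _ _ q]) auto
  finally show "(tensor 1 w *[dl Q] u j) q = ..." .
  qed
 qed
 obtain g where g: "ghm (Pm m rx) (dl Q) (- i) g" "ALL j<m. g (eP m j) = u j"
  by (rule Pm_hom[OF rx wgm_dual[OF wQ] ue ug])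
 have "pmat m l fy g = b"
  using g(2) bc grrepD(3) thg by (auto intro!: eq_matI simp: u_def scalar_prod_right_unit)
 then show ?thesis using that g(1) by blast
qed

lemma gr_dual_eqI:
 assumes f: "f : gr (dl Q) (- i)" and f': "f' : gr (dl Q) (- i)"
  and eq: "!!t. t < l ==> f (fy (unit_vec l t)) = f' (fy (unit_vec l t))"
 shows "f = f'"
proof -
 have lQ: "lmod R Q" using Q gmod_lmod by auto
 have fc: "f : dual_carrier Q" "f' : dual_carrier Q" using f f' by auto
 have hpz: "F q = F (hp Q i q)" if F: "F : gr (dl Q) (- i)" and q: "q : cr Q" for F q
 proof -
  have c: "F : dual_carrier Q" using F by simp
  obtain I where I: "finite I" "!!J. finite J ==> I <= J ==> q = (fs Q J (%k. hp Q k q))" using hp_decomp[OF Q q] by blast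
  have z: "F (hp Q k q) = 0" if "k ~= i" for k using F hp_gr[OF Q q, of k] that by auto
  have "F q = (SUM k:insert i I. F (hp Q k q))"
  using arg_cong[OF I(2)[of "insert i I"], of F] I(1) dual_finsum[OF lQ c, of "insert i I" "%k. hp Q k q"] hp_carrier[OF Q q] by auto
  also have "... = F (hp Q i q)" using I(1) z by (subst sum.remove[of _ i]) (auto intro!: sum.neutral)
  finally show ?thesis .
 qed
 show ?thesis
 proof (rule extensionalityI[of _ "cr Q"])
  show "f : extensional (cr Q)" "f' : extensional (cr Q)" using dual_carrierD(3) fc by blast+
  fix q assume q: "q : cr Q"
  obtain v where v: "v : cV l" "hp Q i q = fy v"
  using hp_gr[OF Q q, of i] bij_betw_imp_surj_on[OF grrepD(1)] by auto
  have "f (fy v) = f' (fy v)" unfolding functional_grrep[OF fc(1) v(1)] functional_grrep[OF fc(2) v(1)] using eq by simp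
  then show "f q = f' q" using hpz[OF f q] hpz[OF f' q] v(2) by simp
 qed
qed

text \<open>Degree \<open>-i\<close> is where the generators of \<open>P\<close>, which have degree
  0, are sent to functionals supported on \<open>gr Q i\<close>. The pairing with this piece then
  determines the homomorphism.\<close>

lemma pmat_iso:
 shows "clin (HS (Pm m rx) {} (dl Q) (- i)) (pairs m l rx ta) (pmat m l fy)"
  and "bij_betw (pmat m l fy) (cr (HS (Pm m rx) {} (dl Q) (- i))) (cr (pairs m l rx ta))"
proof -
 have lQ: "lmod R Q" using Q gmod_lmod by auto
 note wQ = gmod_wgm[OF Q] and wP = gmod_wgm[OF gmod_Pm[OF rx]]
 have gc: "g (eP m a) : dual_carrier Q" if "g : ghom R (Pm m rx) (dl Q) (- i)" for a g
  using that ghm_closed[of "Pm m rx" "dl Q" "- i" g "eP m a"] by (simp add: ghom_iff)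
 have u: "fy (unit_vec l t) : cr Q" for t using grrepD(3) by simp
 show "clin (HS (Pm m rx) {} (dl Q) (- i)) (pairs m l rx ta) (pmat m l fy)"
  unfolding clin_def
 proof (intro ballI conjI allI)
  fix g assume g: "g : cr (HS (Pm m rx) {} (dl Q) (- i))"
  then show "pmat m l fy g : cr (pairs m l rx ta)" using pmat_inv_pair[of "- i" g] by (simp add: ghom_iff)
  show "pmat m l fy (c *[HS (Pm m rx) {} (dl Q) (- i)] g) = c *[pairs m l rx ta] pmat m l fy g" for c
  using dual_cscale_eval[OF lQ gc u] g by (auto intro!: eq_matI)
  fix h
  show "pmat m l fy (g +[HS (Pm m rx) {} (dl Q) (- i)] h) = pmat m l fy g +[pairs m l rx ta] pmat m l fy h"
  using u by (auto intro!: eq_matI)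
 qed
 show "bij_betw (pmat m l fy) (cr (HS (Pm m rx) {} (dl Q) (- i))) (cr (pairs m l rx ta))"
  unfolding bij_betw_def
 proof (intro conjI subset_antisym)
  show "pmat m l fy ` cr (HS (Pm m rx) {} (dl Q) (- i)) <= cr (pairs m l rx ta)"
  using pmat_inv_pair by (auto simp: ghom_iff)
  show "cr (pairs m l rx ta) <= pmat m l fy ` cr (HS (Pm m rx) {} (dl Q) (- i))"
  proof
  fix b assume "b : cr (pairs m l rx ta)"
  then have "inv_pair m l rx ta b" by simp
  then obtain g where g: "ghm (Pm m rx) (dl Q) (- i) g" "pmat m l fy g = b" by (rule pmat_surj)
  have "pmat m l fy (restrict g (cr (Pm m rx))) = b" unfolding g(2)[symmetric] by (auto intro!: eq_matI)
  then show "b : pmat m l fy ` cr (HS (Pm m rx) {} (dl Q) (- i))" using ghm_restrict[OF wP g(1)] by (intro image_eqI) auto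
  qed
  show "inj_on (pmat m l fy) (cr (HS (Pm m rx) {} (dl Q) (- i)))"
  proof (rule inj_onI)
  fix g h assume g: "g : cr (HS (Pm m rx) {} (dl Q) (- i))" and h: "h : cr (HS (Pm m rx) {} (dl Q) (- i))"
  and eq: "pmat m l fy g = pmat m l fy h"
  have gh: "g : ghom R (Pm m rx) (dl Q) (- i)" "h : ghom R (Pm m rx) (dl Q) (- i)" using g h by auto
  then have g1: "ghm (Pm m rx) (dl Q) (- i) g" "ghm (Pm m rx) (dl Q) (- i) h" unfolding ghom_iff by auto
  have ee: "g (eP m j) = h (eP m j)" if j: "j < m" for j
  proof (rule gr_dual_eqI)
  show "g (eP m j) : gr (dl Q) (- i)" "h (eP m j) : gr (dl Q) (- i)"
  using ghm_gr[OF g1(1) eP_gr] ghm_gr[OF g1(2) eP_gr] by simp_all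
  show "g (eP m j) (fy (unit_vec l t)) = h (eP m j) (fy (unit_vec l t))" if "t < l" for t
  using arg_cong[OF eq, of "%b. b $$ (j, t)"] j that by simp
  qed
  show "g = h"
  by (rule extensionalityI[of _ "cV m"])
  (use gh Pm_hom_unique[OF rx wgm_dual[OF wQ] g1 ee] in \<open>auto simp: ghom_iff\<close>)
  qed
 qed
qed

end

end

section \<open>Graded multiplicities as dimensions\<close>

lemma vdim_of_surj:
 assumes V: "cvs V" and f: "clin (vecs k) V f" "f ` cV k = cr V"
 obtains l where "vdim V l"
proof -
 interpret V: lmod complex_ring V by (rule V)
 define U where "U = {x : cV k. f x = 0[V]}"
 have f0: "f (zv k) = 0[V]" using clin_zero[OF f(1) cvs_vecs V] by simp
 have fa: "f (x + y) = f x +[V] f y" if "x : cV k" "y : cV k" for x y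
  using clin_add[OF f(1), of x y] that by simp
 have fs: "f (c *s x) = c *[V] f x" if "x : cV k" for x c
  using clin_smult[OF f(1), of x c] that by simp
 have fc: "f x : cr V" if "x : cV k" for x using clin_closed[OF f(1), of x] that by simp
 have "vsub k U" unfolding vsub_def U_def using f0 fa fs fc V.smult_r_null by auto
 then obtain u B where B: "B : cM k u" "minj B" "U = (*v) B ` cV u" by (rule subspace_basis)
 \<comment> \<open>\<open>C\<close> inverts a basis matrix of the kernel from the left. The kernel
   of \<open>C\<close> is therefore a complement of the kernel of \<open>f\<close>, and
   \<open>f\<close> is bijective on it.\<close>
 obtain C where C: "C : cM u k" "C * B = om u" by (rule minj_left_inverse[OF B(1,2)])
 have "vsub k {x : cV k. C *v x = zv u}"
  unfolding vsub_def using C(1) by (auto simp: mult_add_distrib_mat_vec[OF C(1)] mult_mat_vec[OF C(1)])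
 then obtain l E where E: "E : cM k l" "minj E" "{x : cV k. C *v x = zv u} = (*v) E ` cV l"
  by (rule subspace_basis)
 have Ec: "E *v y : cV k" if "y : cV l" for y using E(1) that by auto
 have CB: "C *v (B *v x) = x" if "x : cV u" for x
  using assoc_mult_mat_vec[OF C(1) B(1) that] C(2) that by simp
 let ?g = "%y. f (E *v y)"
 have g: "clin (vecs l) V ?g" unfolding clin_def
  using Ec fc fa fs by (auto simp: mult_add_distrib_mat_vec[OF E(1)] mult_mat_vec[OF E(1)])
 have "inj_on ?g (cV l)"
 proof (rule inj_onI)
  fix x y assume x: "x : cV l" and y: "y : cV l" and eq: "?g x = ?g y"
  have d: "x - y : cV l" using x y by simp
  have "x = (x - y) + y" using x y by auto
  then have "?g x = ?g (x - y) +[V] ?g y" using mult_add_distrib_mat_vec[OF E(1) d y] fa[OF Ec[OF d] Ec[OF y]] by simp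
  then have "?g (x - y) = 0[V]" using eq fc[OF Ec[OF d]] fc[OF Ec[OF y]] by (metis V.M.add.r_cancel_one')
  then have "E *v (x - y) : U" unfolding U_def using Ec[OF d] by simp
  then obtain t where t: "t : cV u" "E *v (x - y) = B *v t" using B(3) by auto
  have "C *v (E *v (x - y)) = zv u" using E(3) d by blast
  then have "t = zv u" using CB[OF t(1)] t(2) by simp
  then have "E *v (x - y) = zv k" using t(2) B(1) by auto
  then have "x - y = zv l" by (rule minj_D[OF E(2,1) d])
  then show "x = y" by (rule vec_minus_eq_zero[OF x y])
 qed
 moreover have "?g ` cV l = cr V"
 proof
  show "?g ` cV l <= cr V" using fc Ec by auto
  show "cr V <= ?g ` cV l"
  proof
  fix v assume "v : cr V"
  then obtain x where x: "x : cV k" "v = f x" using f(2) by auto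
  define z where "z = B *v (C *v x)"
  have Cx: "C *v x : cV u" using C(1) x by simp
  have zc: "z : cV k" using B(1) Cx unfolding z_def by simp
  have "z : U" using B(3) Cx unfolding z_def by auto
  then have z0: "f z = 0[V]" unfolding U_def by simp
  have "C *v (x - z) = C *v x - C *v z" by (rule mult_minus_distrib_mat_vec[OF C(1) x(1) zc])
  also have "... = zv u" using CB[OF Cx] Cx unfolding z_def by simp
  finally have "x - z : {x : cV k. C *v x = zv u}" using x(1) zc by simp
  then have "x - z : (*v) E ` cV l" unfolding E(3) .
  then obtain y where y: "y : cV l" "x - z = E *v y" by auto
  have "x = (x - z) + z" using x(1) zc by auto
  then have "v = f (x - z)" using fa[of "x - z" z] x zc z0 fc[of "x - z"] by simp
  then show "v : ?g ` cV l" using y by auto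
  qed
 qed
 ultimately have "vdim V l" unfolding vdim_def bij_betw_def using g by blast
 then show ?thesis by (rule that)
qed

text \<open>The monomials of degree \<open>i\<close> have exponents \<open>(a, i - a)\<close>; for
  negative \<open>i\<close> the index set is empty.\<close>

lemma S_gr_expand:
 assumes "p : S_gr i"
 shows "p = (SUM a<nat (i + 1). Poly_Mapping.single (a, nat i - a) (Poly_Mapping.lookup p (a, nat i - a)))"
proof (rule poly_mapping_eqI)
 fix k :: "nat \<times> nat"
 show "Poly_Mapping.lookup p k = Poly_Mapping.lookup (SUM a<nat (i + 1). Poly_Mapping.single (a, nat i - a) (Poly_Mapping.lookup p (a, nat i - a))) k"
 proof (cases "sdeg k = i")
  case True
  then have "fst k < nat (i + 1)" "k = (fst k, nat i - fst k)" unfolding sdeg_def by (auto simp: prod_eq_iff)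
  then obtain b where a: "b < nat (i + 1)" "k = (b, nat i - b)" by blast
  have "(SUM a<nat (i + 1). Poly_Mapping.lookup (Poly_Mapping.single (a, nat i - a) (Poly_Mapping.lookup p (a, nat i - a))) k) = (SUM a<nat (i + 1). if a = b then Poly_Mapping.lookup p k else 0)"
  unfolding a(2) by (rule sum.cong) (auto simp: lookup_single when_def)
  then show ?thesis using a(1) by (simp add: lookup_sum)
 next
  case False
  have "Poly_Mapping.lookup (Poly_Mapping.single (a, nat i - a) (Poly_Mapping.lookup p (a, nat i - a))) k = 0" if "a < nat (i + 1)" for a
  proof -
  have "0 <= i" using that by simp
  then show ?thesis using False that by (auto simp: lookup_single when_def sdeg_def)
  qed
  then show ?thesis using assms False by (simp add: lookup_sum S_gr_iff)
 qed
qed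

context dihz
begin

definition grV :: "(A, 'b) gmodule => int => (complex, 'b) module" where
 "grV Q i = (|carrier = gr Q i, monoid.mult = undefined, one = undefined, zero = 0[Q], add = add Q, module.smult = cscale Q|)"

lemma grV_simps [simp]:
 "cr (grV Q i) = gr Q i" "0[grV Q i] = 0[Q]" "x +[grV Q i] y = x +[Q] y" "c *[grV Q i] x = cscale Q c x"
 unfolding grV_def by auto

lemma cvs_grV:
 assumes Q: "wgm Q" shows "cvs (grV Q i)"
proof -
 have lQ: "lmod R Q" using Q wgm_lmod by auto
 interpret Q: lmod R Q by (rule lQ)
 note c = gr_carrier[OF Q] and cs = cscale_simps[OF lQ]
 have inv: "cscale Q (- 1) x +[Q] x = 0[Q]" if "x : cr Q" for x
  using cs(2)[OF that, of "- 1" 1] cs(5)[OF that] that by (simp add: cscale_def tensor_zero)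
 have "abelian_group (grV Q i)"
 proof (rule abelian_groupI)
  show "EX y:cr (grV Q i). y +[grV Q i] x = 0[grV Q i]" if "x : cr (grV Q i)" for x
  using that inv c cscale_gr[OF Q] by (intro bexI[of _ "cscale Q (- 1) x"]) auto
 qed (use gr_add[OF Q] gr_zero[OF Q] c in \<open>auto simp: Q.M.a_ac\<close>)
 then show ?thesis by (rule cvsI) (use c cs cscale_gr[OF Q] in auto)
qed

text \<open>Linear coordinates on \<open>gr Q i\<close> turn the action of \<open>W\<close> into
  matrices \<open>ta\<close>; complete reducibility then supplies coordinates in which they are
  block diagonal.\<close>

lemma grrep_of_vdim:
 assumes Q: "gmod Q" and k: "vdim (grV Q i) l"
 obtains rxs fy where "irreps rxs" "grrep Q i (tdeg rxs) (blocks rxs) fy"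
proof -
 note wQ = gmod_wgm[OF Q]
 have lQ: "lmod R Q" using Q gmod_lmod by auto
 interpret Q: lmod R Q by (rule lQ)
 obtain f where f: "clin (vecs l) (grV Q i) f" "bij_betw f (cV l) (gr Q i)" using k unfolding vdim_def by auto
 have fa: "f (x + y) = f x +[Q] f y" if "x : cV l" "y : cV l" for x y
  using clin_add[OF f(1), of x y] that by simp
 have fs: "f (c *s x) = cscale Q c (f x)" if "x : cV l" for x c
  using clin_smult[OF f(1), of x c] that by simp
 have fg: "f x : gr Q i" if "x : cV l" for x using clin_closed[OF f(1), of x] that by simp
 have fc: "f x : cr Q" if "x : cV l" for x using gr_carrier[OF wQ fg[OF that]] .
 have inj: "u = v" if "u : cV l" "v : cV l" "f u = f v" for u v
  using f(2) that unfolding bij_betw_def inj_on_def by auto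
 have ex: "EX M:cM l l. ALL u:cV l. f (M *v u) = tensor 1 w *[Q] f u" if w: "w : W" for w
 proof -
  define h where "h u = inv_into (cV l) f (tensor 1 w *[Q] f u)" for u
  have tg: "tensor 1 w *[Q] f u : gr Q i" if "u : cV l" for u
  using gr_smult[OF wQ tensor_gr[OF w one_S_gr] fg[OF that]] by simp
  have hc: "h u : cV l" and fh: "f (h u) = tensor 1 w *[Q] f u" if "u : cV l" for u
  using bij_betw_inv_into_right[OF f(2) tg[OF that]] inv_into_into[of _ f "cV l"] tg[OF that] bij_betw_imp_surj_on[OF f(2)]
  unfolding h_def by auto
  obtain M where "M : cM l l" "!!x. x : cV l ==> h x = M *v x"
  proof (rule linear_mat[of l h l])
  show "h (x + y) = h x + h y" if "x : cV l" "y : cV l" for x y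
  using that hc fh fa fc w Q.smult_r_distr by (intro inj) auto
  show "h (c *s x) = c *s h x" if "x : cV l" for x c
  using that hc fh fs fc w cscale_simps(6)[OF lQ fc[OF that]] by (intro inj) auto
  qed (use hc in auto)
  then show ?thesis using fh by (intro bexI[of _ M]) auto
 qed
 then obtain ta where ta: "!!w. w : W ==> ta w : cM l l"
  "!!w u. w : W ==> u : cV l ==> f (ta w *v u) = tensor 1 w *[Q] f u" by metis
 have mateq: "A = B" if A: "A : cM l l" "B : cM l l" "!!u. u : cV l ==> f (A *v u) = f (B *v u)" for A B
 proof (rule eq_matI)
  show "A $$ (s, t) = B $$ (s, t)" if "s < dim_row B" "t < dim_col B" for s t
  proof -
  have "A *v unit_vec l t = B *v unit_vec l t" using A by (intro inj) auto
  then have "(A *v unit_vec l t) $ s = (B *v unit_vec l t) $ s" by simp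
  then show ?thesis using that A(1,2) by (simp add: scalar_prod_right_unit)
  qed
 qed (use A in auto)
 have tar: "rep l ta" unfolding rep_def
 proof (intro conjI ballI)
  show "ta w : cM l l" if "w : W" for w using ta(1)[OF that] .
  show "ta e0 = om l" using ta[OF e0_W] fc by (intro mateq) (auto simp: R_one[symmetric])
  fix v w assume v: "v : W" and w: "w : W"
  have "f (ta (v ** w) *v u) = f (ta v * ta w *v u)" if u: "u : cV l" for u
  proof -
  have "ta w *v u : cV l" using ta(1)[OF w] u by simp
  then show ?thesis using ta(2) v w u fc[OF u] assoc_mult_mat_vec[OF ta(1)[OF v] ta(1)[OF w] u]
  by (simp flip: Q.smult_assoc1 add: tensor_mult)
  qed
  then show "ta (v ** w) = ta v * ta w"
  using ta(1)[OF D.m_closed[OF v w]] mult_carrier_mat[OF ta(1)[OF v] ta(1)[OF w]] by (intro mateq)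
 qed
 obtain rxs Ph where Ph: "irreps rxs" "tdeg rxs = l" "Ph : cM l l" "minj Ph" "ALL w:W. ta w * Ph = Ph * blocks rxs w"
  by (rule complete_reducibility[OF tar])
 have Phc: "Ph *v u : cV l" if "u : cV l" for u using Ph(3) that by simp
 have bb: "bij_betw ((*v) Ph) (cV l) (cV l)"
  unfolding bij_betw_def
 proof (intro conjI subset_antisym)
  show "inj_on ((*v) Ph) (cV l)" by (rule inj_onI) (rule minj_inj[OF Ph(4,3)])
  show "cV l <= (*v) Ph ` cV l" using minj_square_surj[OF Ph(3,4)] by (metis imageI subsetI)
 qed (use Phc in auto)
 have "grrep Q i (tdeg rxs) (blocks rxs) (%u. f (Ph *v u))"
  unfolding grrep_def Ph(2)
 proof (intro conjI ballI allI)
  show "bij_betw (%u. f (Ph *v u)) (cV l) (gr Q i)" using bij_betw_trans[OF bb f(2)] by (simp add: comp_def)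
  show "f (Ph *v (u + v)) = f (Ph *v u) +[Q] f (Ph *v v)" if "u : cV l" "v : cV l" for u v
  using that fa Phc by (simp add: mult_add_distrib_mat_vec[OF Ph(3)])
  show "f (Ph *v (c *s u)) = cscale Q c (f (Ph *v u))" if "u : cV l" for u c
  using that fs Phc by (simp add: mult_mat_vec[OF Ph(3)])
  fix u :: "complex vec" and w assume u: "u : cV l" and w: "w : W"
  have bc: "blocks rxs w : cM l l" using blocks_carrier[OF Ph(1) w] Ph(2) by simp
  have "Ph *v (blocks rxs w *v u) = ta w *v (Ph *v u)"
  using assoc_mult_mat_vec[OF Ph(3) bc u] assoc_mult_mat_vec[OF ta(1)[OF w] Ph(3) u] Ph(5) w by simp
  then show "f (Ph *v (blocks rxs w *v u)) = tensor 1 w *[Q] f (Ph *v u)" using ta(2)[OF w Phc[OF u]] by simp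
 qed
 then show ?thesis using that Ph(1) by blast
qed

lemma grV_finite:
 assumes rx: "rep m rx" and Q: "gmod Q" and pj: "ghm (Pm m rx) Q 0 pj" "pj ` cV m = cr Q"
 obtains l where "vdim (grV Q i) l"
proof -
 note gP = gmod_Pm[OF rx] and wQ = gmod_wgm[OF Q]
 define I where "I = nat (i + 1)"
 \<comment> \<open>Slot \<open>j * I + a\<close> of \<open>u\<close> holds the coefficient of the
   monomial with exponents \<open>(a, i - a)\<close> in coordinate \<open>j\<close>.\<close>
 define F where "F u = vec m (%j. SUM a<I. Poly_Mapping.single (a, nat i - a) (u $ (j * I + a)))" for u :: "complex vec"
 have ix: "j * I + a < m * I" if "j < m" "a < I" for j a
 proof -
  have "j * I + a < Suc j * I" using that by simp
  also have "... <= m * I" using that by (intro mult_le_mono1) simp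
  finally show ?thesis .
 qed
 have Fg: "F u : gr (Pm m rx) i" for u unfolding F_def I_def by (auto intro!: S_gr_sum S_gr_single simp: sdeg_def)
 have Fa: "F (u + v) = F u + F v" if "u : cV (m * I)" "v : cV (m * I)" for u v
  unfolding F_def using that ix by (intro eq_vecI) (auto simp: single_add sum.distrib)
 have Fs: "F (c *s u) = cscale (Pm m rx) c (F u)" if "u : cV (m * I)" for u c
  unfolding F_def cscale_def using that ix by (intro eq_vecI) (auto simp: Pm_scalar_smult[OF rx] sum_distrib_left constS_times_single)
 have Fsurj: "EX u:cV (m * I). F u = x" if x: "x : gr (Pm m rx) i" for x
 proof -
  define u where "u = vec (m * I) (%t. Poly_Mapping.lookup (x $ (t div I)) (t mod I, nat i - t mod I))"
  have "F u = x" unfolding F_def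
  proof (rule eq_vecI)
  fix j assume "j < dim_vec x"
  then have j: "j < m" "x $ j : S_gr i" using x by auto
  have "u $ (j * I + a) = Poly_Mapping.lookup (x $ j) (a, nat i - a)" if "a < I" for a
  using ix[OF j(1) that] that unfolding u_def by simp
  then show "vec m (%j. SUM a<I. Poly_Mapping.single (a, nat i - a) (u $ (j * I + a))) $ j = x $ j"
  using S_gr_expand[OF j(2)] j(1) unfolding I_def by simp
  qed (use x in auto)
  then show ?thesis unfolding u_def by auto
 qed
 have Fc: "F u : cV m" for u unfolding F_def by simp
 have "clin (vecs (m * I)) (grV Q i) (%u. pj (F u))"
  unfolding clin_def using ghm_gr[OF pj(1) Fg] ghm_add[OF pj(1)] Fc Fa Fs ghm_cscale[OF pj(1)] by auto
 moreover have "(%u. pj (F u)) ` cV (m * I) = cr (grV Q i)"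
 proof
  show "(%u. pj (F u)) ` cV (m * I) <= cr (grV Q i)" using ghm_gr[OF pj(1) Fg] by auto
  show "cr (grV Q i) <= (%u. pj (F u)) ` cV (m * I)"
  proof
  fix y assume y: "y : cr (grV Q i)"
  then have "y : pj ` cr (Pm m rx)" using pj(2) gr_carrier[OF wQ] by auto
  with y obtain x where "x : gr (Pm m rx) (i - 0)" "pj x = y" using hom_preimage[OF gP Q pj(1), of y i] by auto
  then show "y : (%u. pj (F u)) ` cV (m * I)" using Fsurj[of x] by force
  qed
 qed
 ultimately show ?thesis using vdim_of_surj[OF cvs_grV[OF wQ]] that by blast
qed

lemma rep_of_rep: "nu : Irr n ==> irr_rep (rep_deg (rep_of nu)) (rep_of nu)"
 using rep_of_irr irreducible_iff by auto

lemma gmod_Pmod: "nu : Irr n ==> gmod (PP nu)"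
 unfolding Pmod_Pm by (rule gmod_Pm[OF irr_rep_rep[OF rep_of_rep]])

text \<open>The graded piece has a decomposition because \<open>Q\<close> is a quotient of some
  \<open>Pm m rx\<close>; by \<open>pmat_iso\<close> its count is the dimension of a space of
  homomorphisms.\<close>

lemma vdim_graded_mult:
 assumes nu: "nu : Irr n" and Q: "gmod Q" and rx: "rep m rx" and pj: "ghm (Pm m rx) Q 0 pj" "pj ` cV m = cr Q"
 shows "vdim (HS (PP nu) {} (dl Q) (- i)) (graded_mult n Q nu i)"
proof -
 let ?V = "HS (PP nu) {} (dl Q) (- i)"
 let ?P = "%k. EX rxs. (ALL rx : set rxs. irreducible_rep n rx) & decomposition n Q i rxs & k = length (filter (%rx. rx : nu) rxs)"
 note r = rep_of_rep[OF nu]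
 have cv: "cvs ?V" unfolding Pmod_Pm
  by (rule cvs_HS[OF gmod_wgm[OF gmod_Pm[OF irr_rep_rep[OF r]]] wgm_dual[OF gmod_wgm[OF Q]]]) auto
 \<comment> \<open>Every decomposition computes the dimension of the same space, so the number
   described in \<open>graded_mult\<close> is unique.\<close>
 have vd: "vdim ?V k" if k: "?P k" for k
 proof -
  obtain rxs where rxs: "ALL rx : set rxs. irreducible_rep n rx" "decomposition n Q i rxs" "k = length (filter (%rx. rx : nu) rxs)"
  using k by auto
  have irr: "irreps rxs" using rxs(1) unfolding irreps_def irreducible_iff by auto
  obtain fy where fy: "grrep Q i (tdeg rxs) (blocks rxs) fy" using iffD1[OF decomposition_iff rxs(2)] by blast
  have "filter (%rx. rx : nu) rxs = filter (rep_iso n (rep_of nu)) rxs" using rxs(1) in_Irr_iff[OF nu] by (intro filter_cong) auto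
  then have "vdim (pairs (rep_deg (rep_of nu)) (tdeg rxs) (rep_of nu) (blocks rxs)) k"
  using vdim_pairs_blocks[OF r irr] rxs(3) by simp
  then show ?thesis using cv[unfolded Pmod_Pm] vdim_iso_rev pmat_iso[OF Q irr_rep_rep[OF r] blocks_rep[OF irr] fy] unfolding Pmod_Pm by blast
 qed
 obtain l where "vdim (grV Q i) l" by (rule grV_finite[OF rx Q pj])
 then obtain rxs fy where rxs: "irreps rxs" "grrep Q i (tdeg rxs) (blocks rxs) fy" by (rule grrep_of_vdim[OF Q])
 then have "?P (length (filter (%rx. rx : nu) rxs))"
  unfolding irreps_def by (intro exI[of _ rxs] conjI iffD2[OF decomposition_iff]) (auto simp: irreducible_iff)
 then have "?P (graded_mult n Q nu i)" unfolding graded_mult_def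
  by (rule theI) (use vdim_unique[OF cv] vd \<open>?P _\<close> in blast)
 then show ?thesis by (rule vd)
qed

end

section \<open>Maps from P to duals of quotients of P, and trace submodules\<close>

context dihz
begin

text \<open>Vectors of constants: the representation itself as the degree 0 part of
  \<open>P\<close>.\<close>

definition cv :: "nat => complex vec => S vec" where "cv k u = vec k (%i. constS (u $ i))"

lemma cv_unit: "cv k (unit_vec k t) = eP k t"
 unfolding cv_def by (intro eq_vecI) (auto simp: unit_vec_def)

lemma cv_gr: "x : gr (Pm k so) 0 ==> EX u:cV k. x = cv k u"
 using S_gr_0 by (intro bexI[of _ "vec k (%i. Poly_Mapping.lookup (x $ i) (0, 0))"] eq_vecI) (auto simp: cv_def)

lemma constS_inject: "constS a = constS b ==> a = b"
 unfolding constS_def by (metis lookup_single_eq)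

lemma Pm_neg: "i < 0 ==> x : gr (Pm k so) i ==> x = zv k"
 using S_gr_neg by (intro eq_vecI) auto

text \<open>A quotient of \<open>P\<close> whose kernel has no degree 0 part keeps the
  representation \<open>so\<close> in degree 0.\<close>

lemma grrep_cv:
 assumes so: "rep k so" and Q: "gmod Q" and pj: "ghm (Pm k so) Q 0 pj" "pj ` cV k = cr Q"
  and ker: "!!x. x : gr (Pm k so) 0 ==> pj x = 0[Q] ==> x = zv k"
 shows "grrep Q 0 k so (%u. pj (cv k u))"
proof -
 note gP = gmod_Pm[OF so] and wQ = gmod_wgm[OF Q]
 have lQ: "lmod R Q" using Q gmod_lmod by auto
 interpret Q: lmod R Q by (rule lQ)
 interpret P: lmod R "Pm k so" by (rule lmod_Pm[OF so])
 have cc: "cv k u : cV k" and cg: "cv k u : gr (Pm k so) 0" for u unfolding cv_def by auto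
 have ca: "cv k (u + v) = cv k u + cv k v" if "u : cV k" "v : cV k" for u v
  unfolding cv_def using that by (intro eq_vecI) (auto simp: constS_add)
 have cs: "cv k (c *s u) = cscale (Pm k so) c (cv k u)" if "u : cV k" for c u
  unfolding cscale_def Pm_scalar_smult[OF so cc] using that unfolding cv_def by (intro eq_vecI) (auto simp: constS_mult)
 have cw: "cv k (so w *v u) = tensor 1 w *[Pm k so] cv k u" if u: "u : cV k" and w: "w : W" for u w
  unfolding Pm_tensor_smult[OF w] cv_def using u rep_carrier[OF so w]
  by (intro eq_vecI) (auto simp: scalar_prod_def lessThan_atLeast0 constS_sum constS_mult)
 have inj: "u = v" if u: "u : cV k" and v: "v : cV k" and e: "pj (cv k u) = pj (cv k v)" for u v
 proof -
  have d: "u - v : cV k" "u = (u - v) + v" using u v by auto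
  have "pj (cv k u) = pj (cv k (u - v)) +[Q] pj (cv k v)"
  using ghm_add[OF pj(1), of "cv k (u - v)" "cv k v"] ca[OF d(1) v] cc d(2) by simp
  then have "pj (cv k (u - v)) = 0[Q]" using e ghm_closed[OF pj(1)] cc by (metis Pm_simps(1) Q.M.add.r_cancel_one')
  then have z: "cv k (u - v) = zv k" by (rule ker[OF cg])
  have "u - v = zv k"
  proof (rule eq_vecI)
  fix t assume t: "t < dim_vec (zv k :: complex vec)"
  have "cv k (u - v) $ t = 0" using z t by simp
  then have "constS ((u - v) $ t) = constS 0" using t unfolding cv_def by simp
  then have "(u - v) $ t = 0" by (rule constS_inject)
  then show "(u - v) $ t = zv k $ t" using t by simp
  qed (use u v in auto)
  then show ?thesis by (rule vec_minus_eq_zero[OF u v])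
 qed
 have surj: "EX u:cV k. y = pj (cv k u)" if y: "y : gr Q 0" for y
 proof -
  have "y : pj ` cr (Pm k so)" using pj(2) gr_carrier[OF wQ y] by auto
  then obtain x where "x : gr (Pm k so) (0 - 0)" "pj x = y" by (rule hom_preimage[OF gP Q pj(1) y])
  then show ?thesis using cv_gr[of x k so] by auto
 qed
 show ?thesis unfolding grrep_def
 proof (intro conjI ballI allI)
  show "bij_betw (%u. pj (cv k u)) (cV k) (gr Q 0)" unfolding bij_betw_def
  proof (intro conjI subset_antisym)
  show "inj_on (%u. pj (cv k u)) (cV k)" by (rule inj_onI) (rule inj)
  show "(%u. pj (cv k u)) ` cV k <= gr Q 0" using ghm_gr[OF pj(1) cg] by auto
  show "gr Q 0 <= (%u. pj (cv k u)) ` cV k" using surj by auto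
  qed
  show "pj (cv k (u + v)) = pj (cv k u) +[Q] pj (cv k v)" if "u : cV k" "v : cV k" for u v
  using ca[OF that] ghm_add[OF pj(1), of "cv k u" "cv k v"] cc by simp
  show "pj (cv k (c *s u)) = cscale Q c (pj (cv k u))" if "u : cV k" for u c
  using cs[OF that] ghm_cscale[OF pj(1), of "cv k u"] cc by simp
  show "pj (cv k (so w *v u)) = tensor 1 w *[Q] pj (cv k u)" if "u : cV k" "w : W" for u w
  using cw[OF that] ghm_smult[OF pj(1), of "cv k u" "tensor 1 w"] cc that by simp
 qed
qed

lemma dual_nonzero:
 assumes f: "f : dual_carrier Q" "f ~= 0[dl Q]"
 obtains q where "q : cr Q" "f q ~= 0"
proof (rule ccontr)
 assume "~ thesis"
 then have "ALL q:cr Q. f q = 0" using that by auto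
 then have "f = 0[dl Q]" using dual_carrierD(3)[OF f(1)] by (intro extensionalityI[of _ "cr Q"]) auto
 then show False using f(2) by simp
qed

lemma dag_e0 [simp]: "dag e0 p = tensor p e0" unfolding dag_def by simp

text \<open>A nonzero \<open>g\<close> is nonzero on \<open>P\<^sub>-\<^sub>c\<close>, which it pairs with the generators of \<open>Q\<close>.  For \<open>c < 0\<close> the
  vectors obtained from this pairing form, by self-duality and irreducibility, the whole space.\<close>

lemma hom_dual_cases:
 assumes rx: "irr_rep m rx" and so: "irr_rep k so" and Q: "gmod Q"
  and pj: "ghm (Pm k so) Q 0 pj" "pj ` cV k = cr Q"
  and ker: "!!x. x : gr (Pm k so) 0 ==> pj x = 0[Q] ==> x = zv k"
  and g: "ghm (Pm m rx) (dl Q) c g" and x0: "x0 : cV m" "g x0 ~= 0[dl Q]"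
 shows "(rep_iso n rx so & c = 0) |
  (c < 0 & (EX si. ghm (Pm k so) (Pm m rx) (- c) si & (EX x:cV k. g (si x) ~= 0[dl Q])))"
proof -
 note rrx = irr_rep_rep[OF rx] and rso = irr_rep_rep[OF so]
 note gP = gmod_Pm[OF rrx] and gP' = gmod_Pm[OF rso] and wQ = gmod_wgm[OF Q]
 note wD = wgm_dual[OF wQ] and wP = gmod_wgm[OF gP] and lP = lmod_Pm[OF rrx]
 have lQ: "lmod R Q" using Q gmod_lmod by auto
 interpret Q: lmod R Q by (rule lQ)
 interpret P: lmod R "Pm m rx" by (rule lP)
 define fy where "fy = (%u. pj (cv k u))"
 have fy: "grrep Q 0 k so fy" unfolding fy_def by (rule grrep_cv[OF rso Q pj ker])
 note gD = grrepD[OF Q rrx rso fy] and fg = functional_grrep[OF Q rrx rso fy]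
 define e where "e i = fy (unit_vec k i)" for i
 have e: "e i = pj (eP k i)" "e i : cr Q" "e i : gr Q 0" for i using gD(2,3)[of "unit_vec k i"] unfolding e_def fy_def cv_unit by auto
 have gd: "g x : dual_carrier Q" if "x : cV m" for x using ghm_closed[OF g, of x] that by simp
 obtain q where q: "q : cr Q" "g x0 q ~= 0" by (rule dual_nonzero[OF gd[OF x0(1)] x0(2)])
 obtain y where y: "y : cV k" "q = pj y" using q(1) pj(2) by auto
 have tc: "tensor p e0 *[Pm k so] eP k i : cr (Pm k so)" for p i
  using lmod.smult_closed[OF lmod_Pm[OF rso], of "tensor p e0" "eP k i"] by simp
 have "q = pj (fs (Pm k so) {..<k} (%i. tensor (y $ i) e0 *[Pm k so] eP k i))" using y Pm_expand[OF rso y(1)] by simp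
 also have "... = (fs Q {..<k} (%i. tensor (y $ i) e0 *[Q] e i))"
  unfolding ghm_finsum[OF gmod_wgm[OF gP'] wQ pj(1) finite_lessThan tc] using ghm_smult[OF pj(1), of "eP k _" "tensor (y $ _) e0"] e
  by (intro Q.M.finsum_eqI) auto
 finally have "g x0 q = (SUM i<k. g x0 (tensor (y $ i) e0 *[Q] e i))"
  using dual_finsum[OF lQ gd[OF x0(1)], of "{..<k}" "%i. tensor (y $ i) e0 *[Q] e i"] e by simp
 then obtain i where i: "i < k" "g x0 (tensor (y $ i) e0 *[Q] e i) ~= 0" using q(2) by (metis (no_types, lifting) lessThan_iff sum.neutral)
 \<comment> \<open>The coefficient \<open>y $ i\<close> is moved across the pairing, so that
   \<open>x1\<close> pairs nontrivially with the generator \<open>e i\<close> itself.\<close>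
 define x1 where "x1 = tensor (y $ i) e0 *[Pm m rx] x0"
 have x1: "x1 : cV m" "g x1 (e i) ~= 0"
  using dual_hom_tensor[OF lP lQ g e0_W _ e(2), of x0 "y $ i" i] P.smult_closed[of "tensor (y $ i) e0" x0] x0(1) i(2) unfolding x1_def by auto
 have hc: "hp (Pm m rx) t x1 : cr (Pm m rx)" for t using hp_carrier[OF gP] x1 by simp
 obtain I where I: "finite I" "x1 = (fs (Pm m rx) I (%t. hp (Pm m rx) t x1))" using hp_decomp[OF gP, of x1] x1 by auto
 have "g x1 (e i) = (SUM t:I. g (hp (Pm m rx) t x1) (e i))"
  using arg_cong[OF I(2), of g] ghm_finsum[OF wP wD g I(1) hc] dual_finsum_eval[OF lQ I(1) _ e(2), of "%t. g (hp (Pm m rx) t x1)"] gd hc by simp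
 then obtain t where t: "g (hp (Pm m rx) t x1) (e i) ~= 0" using x1(2) by (metis (no_types, lifting) sum.neutral)
 define x2 where "x2 = hp (Pm m rx) t x1"
 have x2g: "x2 : gr (Pm m rx) t" unfolding x2_def using hp_gr[OF gP] x1 by simp
 have x2c: "x2 : cV m" using x2g by simp
 \<comment> \<open>\<open>g x2\<close> has degree \<open>t + c\<close> and sees only elements of
   degree \<open>-(t + c)\<close>, whereas \<open>e i\<close> has degree 0.\<close>
 have tce: "t = - c"
 proof (rule ccontr)
  assume "t ~= - c"
  then have "0 ~= - (t + c)" by simp
  moreover have "ALL j. j ~= - (t + c) --> (ALL q:gr Q j. g x2 q = 0)" using ghm_gr[OF g x2g] by simp
  ultimately show False using e(3) t unfolding x2_def by blast
 qed
 have "t >= 0"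
 proof (rule ccontr)
  assume "~ t >= 0"
  then have "x2 = 0[Pm m rx]" using Pm_neg[OF _ x2g] by simp
  then show False using ghm_zero[OF wP wD g] t e(2) unfolding x2_def by simp
 qed
 then consider "c = 0" | "c < 0" using tce by linarith
 then show ?thesis
 proof cases
  case 1
  \<comment> \<open>For \<open>c = 0\<close> the values on the generators of both modules form an
    invariant pairing; if it were zero, \<open>g\<close> would pair all constants with
    \<open>e i\<close> to zero.\<close>
  have ip: "inv_pair m k rx so (pmat m k fy g)" by (rule pmat_inv_pair[OF Q rrx rso fy g])
  have "pmat m k fy g ~= zm m k"
  proof
  assume z: "pmat m k fy g = zm m k"
  have z': "g (eP m j) (e i) = 0" if "j < m" for j
  using pmat_simps(2)[OF that i(1), of fy g] z that i(1) unfolding e_def by simp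
  obtain u where u: "x2 = cv m u" using cv_gr[of x2 m rx] x2g tce 1 by auto
  have cc: "cscale (Pm m rx) (u $ j) (eP m j) : cr (Pm m rx)" for j by (rule cscale_simps(1)[OF lP]) simp
  have "x2 = (fs (Pm m rx) {..<m} (%j. tensor (x2 $ j) e0 *[Pm m rx] eP m j))" by (rule Pm_expand[OF rrx x2c])
  also have "... = (fs (Pm m rx) {..<m} (%j. cscale (Pm m rx) (u $ j) (eP m j)))"
  by (rule P.M.finsum_eqI) (use cc in \<open>simp_all add: u cv_def cscale_def\<close>)
  finally have "g x2 = (fs (dl Q) {..<m} (%j. g (cscale (Pm m rx) (u $ j) (eP m j))))"
  using ghm_finsum[OF wP wD g finite_lessThan cc] by simp
  then have "g x2 (e i) = (SUM j<m. g (cscale (Pm m rx) (u $ j) (eP m j)) (e i))"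
  using dual_finsum_eval[OF lQ finite_lessThan _ e(2), of m "%j. g (cscale (Pm m rx) (u $ j) (eP m j))" i] gd cc by simp
  also have "... = 0" using z' ghm_cscale[OF g, of "eP m _"] dual_cscale_eval[OF lQ gd e(2)] by simp
  finally show False using t unfolding x2_def by simp
  qed
  then have "rep_iso n rx so" using rep_iso_pairing[OF rx so] ip by auto
  then show ?thesis using 1 by simp
 next
  case 2
  obtain bq where bq: "inv_pair k k so so bq" "bq ~= zm k k" by (rule self_dual[OF so])
  have bqc: "bq : cM k k" using bq(1) unfolding inv_pair_def by auto
  have bqt: "inv_pair k k so so bq\<^sup>T" by (rule inv_pair_transpose[OF rso rso bq(1)])
  have btc: "bq\<^sup>T : cM k k" using bqc by simp
  have "det bq\<^sup>T ~= 0" using schur_nondeg(2)[OF so so bq] det_transpose[OF bqc] by simp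
  then have mj: "minj bq\<^sup>T" using minj_det[OF btc] by simp
  \<comment> \<open>\<open>r x\<close> lists the values of the functional \<open>g x\<close> on the
    generators of \<open>Q\<close>; by \<open>rw\<close> below, \<open>W\<close> acts on these lists
    by the contragredient of \<open>so\<close>.\<close>
  define r where "r x = vec k (%s. g x (e s))" for x
  have rd [simp]: "r x : cV k" for x unfolding r_def by simp
  have ra: "r (x + y) = r x + r y" if "x : cV m" "y : cV m" for x y
  using ghm_add[OF g, of x y] that e unfolding r_def by (intro eq_vecI) auto
  have rs: "r (cscale (Pm m rx) a x) = a *s r x" if "x : cV m" for x a
  using ghm_cscale[OF g, of x a] that e dual_cscale_eval[OF lQ gd[OF that]] unfolding r_def by (intro eq_vecI) auto
  have rw: "r (tensor 1 w *[Pm m rx] x) = (so (dinv w))\<^sup>T *v r x" if x: "x : cV m" and w: "w : W" for x w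
  proof (rule eq_vecI)
  have wi: "dinv w : W" using w by simp
  note sc = rep_carrier[OF rso wi]
  show "dim_vec (r (tensor 1 w *[Pm m rx] x)) = dim_vec ((so (dinv w))\<^sup>T *v r x)" using sc unfolding r_def by simp
  fix s assume "s < dim_vec ((so (dinv w))\<^sup>T *v r x)"
  then have s: "s < k" using sc by simp
  have "r (tensor 1 w *[Pm m rx] x) $ s = g x (tensor 1 (dinv w) *[Q] e s)"
  using dual_hom_tensor[OF lP lQ g w _ e(2), of x 1 s] x s unfolding r_def dag_one by simp
  also have "... = g x (fy (so (dinv w) *v unit_vec k s))" unfolding e_def using gD(6)[OF _ wi, of "unit_vec k s"] by simp
  also have "... = (SUM a<k. (so (dinv w) *v unit_vec k s) $ a * g x (e a))"
  using fg[OF gd[OF x], of "so (dinv w) *v unit_vec k s"] sc unfolding e_def by simp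
  also have "... = ((so (dinv w))\<^sup>T *v r x) $ s"
  proof -
  have "(so (dinv w) *v unit_vec k s) $ a = so (dinv w) $$ (a, s)" if "a < k" for a
  using that sc s by (simp add: scalar_prod_right_unit)
  then show ?thesis using sc s by (simp add: scalar_prod_def[of "row _ _"] lessThan_atLeast0 r_def del: index_mult_mat_vec(1)) (simp add: scalar_prod_def)
  qed
  finally show "r (tensor 1 w *[Pm m rx] x) $ s = ((so (dinv w))\<^sup>T *v r x) $ s" .
  qed
  \<comment> \<open>The transpose of \<open>bq\<close> carries \<open>so\<close> to its
    contragredient, so this transported set of values is stable under \<open>so\<close>;
    \<open>x2\<close> makes it nonzero and irreducibility makes it everything.\<close>
  define U where "U = {u : cV k. EX x:gr (Pm m rx) t. r x = bq\<^sup>T *v u}"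
  have UI: "u : U" if "u : cV k" "x : gr (Pm m rx) t" "r x = bq\<^sup>T *v u" for u x using that unfolding U_def by auto
  have "minv k so U" unfolding minv_def vsub_def
  proof (intro conjI ballI allI)
  show "U <= cV k" unfolding U_def by auto
  have "r (cscale (Pm m rx) 0 x2) = zv k" unfolding rs[OF x2c] by (rule eq_vecI) (auto simp: r_def)
  then show "zv k : U" using btc cscale_gr[OF wP x2g, of 0] by (intro UI[of _ "cscale (Pm m rx) 0 x2"]) auto
  fix u assume u: "u : U"
  then obtain x where x: "u : cV k" "x : gr (Pm m rx) t" "r x = bq\<^sup>T *v u" unfolding U_def by auto
  have xc: "x : cV m" using x by simp
  show "a *s u : U" for a using x rs[OF xc] mult_mat_vec[OF btc x(1)] cscale_gr[OF wP x(2)] by (intro UI[of _ "cscale (Pm m rx) a x"]) auto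
  show "u + v : U" if v: "v : U" for v
  proof -
  obtain x' where x': "v : cV k" "x' : gr (Pm m rx) t" "r x' = bq\<^sup>T *v v" using v unfolding U_def by auto
  have "x + x' : gr (Pm m rx) t" using gr_add[OF wP x(2) x'(2)] by simp
  then show ?thesis using x x' ra[OF xc, of x'] mult_add_distrib_mat_vec[OF btc x(1) x'(1)] by (intro UI[of _ "x + x'"]) auto
  qed
  fix w assume w: "w : W"
  have wi: "dinv w : W" using w by simp
  note sc = rep_carrier[OF rso w] rep_carrier[OF rso wi]
  have "(so (dinv w))\<^sup>T * bq\<^sup>T = (so (dinv w))\<^sup>T * bq\<^sup>T * (so (dinv w) * so w)" using rep_inv(1)[OF rso w] btc sc by simp
  also have "... = (so (dinv w))\<^sup>T * bq\<^sup>T * so (dinv w) * so w"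
  by (rule assoc_mult_mat[symmetric, of _ k k _ k _ k]) (use btc sc in auto)
  also have "... = bq\<^sup>T * so w" using bqt wi unfolding inv_pair_def by simp
  finally have eq: "(so (dinv w))\<^sup>T * bq\<^sup>T = bq\<^sup>T * so w" .
  have "r (tensor 1 w *[Pm m rx] x) = bq\<^sup>T *v (so w *v u)"
  unfolding rw[OF xc w] x(3) using assoc_mult_mat_vec[of "(so (dinv w))\<^sup>T" k k "bq\<^sup>T" k u] assoc_mult_mat_vec[OF btc sc(1) x(1)] sc btc x(1) eq by simp
  moreover have "tensor 1 w *[Pm m rx] x : gr (Pm m rx) t" using gr_smult[OF wP tensor_gr[OF w one_S_gr] x(2)] by simp
  ultimately show "so w *v u : U" using sc x(1) by (intro UI[of _ "tensor 1 w *[Pm m rx] x"]) auto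
  qed
  moreover have "U ~= {zv k}"
  proof
  assume U0: "U = {zv k}"
  obtain u where u: "u : cV k" "bq\<^sup>T *v u = r x2" using minj_square_surj[OF btc mj rd[of x2]] by blast
  then have "u = zv k" using UI[OF u(1) x2g] U0 by simp
  moreover have "bq\<^sup>T *v zv k = zv k" by (rule eq_vecI) (use btc in auto)
  ultimately have "r x2 = zv k" using u(2) by metis
  then have "r x2 $ i = 0" using i(1) by simp
  then show False using t i(1) unfolding r_def x2_def by simp
  qed
  ultimately have Uall: "U = cV k" using so unfolding irr_rep_def by blast
  have "EX x. x : gr (Pm m rx) t & r x = bq\<^sup>T *v unit_vec k j" for j
  using Uall unit_vec_carrier[of k j] unfolding U_def by blast
  then obtain u0 where u0: "u0 j : gr (Pm m rx) t" "r (u0 j) = bq\<^sup>T *v unit_vec k j" for j by metis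
  \<comment> \<open>\<open>gm\<close> is the homomorphism that \<open>bq\<close> itself defines on
    \<open>P_nu\<close>. Its values on the generators are attained by \<open>g\<close> at the
    elements \<open>u0 j\<close>, so \<open>gm\<close> lifts through \<open>g\<close> to the desired
    \<open>si\<close>.\<close>
  obtain gm where gm: "ghm (Pm k so) (dl Q) (- 0) gm" "pmat k k fy gm = bq" by (rule pmat_surj[OF Q rso rso fy bq(1)])
  have gm0: "ghm (Pm k so) (dl Q) 0 gm" using gm(1) by simp
  have eq: "g (u0 j) = gm (eP k j)" if j: "j < k" for j
  proof (rule gr_dual_eqI[OF Q rrx rso fy])
  show "g (u0 j) : gr (dl Q) (- 0)" using ghm_gr[OF g u0(1)] tce by simp
  show "gm (eP k j) : gr (dl Q) (- 0)" using ghm_gr[OF gm0 eP_gr] by simp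
  fix s assume s: "s < k"
  have "g (u0 j) (fy (unit_vec k s)) = r (u0 j) $ s" using s unfolding r_def e_def by simp
  also have "... = bq $$ (j, s)" unfolding u0(2) using j s bqc by (simp add: scalar_prod_right_unit)
  also have "... = gm (eP k j) (fy (unit_vec k s))" using pmat_simps(2)[OF j s, of fy gm] gm(2) by simp
  finally show "g (u0 j) (fy (unit_vec k s)) = gm (eP k j) (fy (unit_vec k s))" .
  qed
  obtain si where si: "ghm (Pm k so) (Pm m rx) (0 - c) si" "ALL x:cV k. g (si x) = gm x"
  by (rule Pm_lift_tuple[OF rso wP wD g gm0, of u0]) (use u0(1) tce eq in auto)
  have "EX j s. j < k & s < k & bq $$ (j, s) ~= 0" using bq(2) bqc by (metis eq_matI index_zero_mat carrier_matD)
  then obtain j s where js: "j < k" "s < k" "bq $$ (j, s) ~= 0" by auto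
  have "gm (eP k j) (fy (unit_vec k s)) ~= 0" using pmat_simps(2)[OF js(1,2), of fy gm] gm(2) js(3) by simp
  then have "gm (eP k j) ~= 0[dl Q]" using e(2)[of s] unfolding e_def by auto
  then have "g (si (eP k j)) ~= 0[dl Q]" using si(2) by simp
  moreover have "ghm (Pm k so) (Pm m rx) (- c) si" using si(1) by simp
  ultimately show ?thesis using 2 unit_vec_carrier[of k j] by blast
 qed
qed

text \<open>The induction principle for traces. It suffices to consider homogeneous maps, since the
  elements of \<open>ghom_pos\<close> are finite sums of them.\<close>

lemma trace_least:
 assumes J: "J <= Irr n" and nu: "nu : Irr n" and z: "0[PP nu] : Z"
  and add: "!!x y. x : Z ==> y : Z ==> x +[PP nu] y : Z" and neg: "!!x. x : Z ==> -[PP nu] x : Z"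
  and im: "!!mu e si x. mu : J ==> e > 0 ==> ghm (PP mu) (PP nu) e si ==> x : cr (PP mu) ==> si x : Z"
 shows "TT J nu <= Z"
proof
 interpret P: lmod R "PP nu" by (rule gmod_lmod[OF gmod_Pmod[OF nu]])
 have gen: "f x : Z" if mu: "mu : J" and f: "f : ghom_pos R (PP mu) (PP nu)" and x: "x : cr (PP mu)" for mu f x
 proof -
  obtain D g where D: "finite D" "D <= {0<..}" "ALL d:D. g d : ghom R (PP mu) (PP nu) d"
  "f = restrict (%x. \<Oplus>\<^bsub>PP nu\<^esub>d\<in>D. g d x) (cr (PP mu))"
  using f unfolding ghom_pos_def by auto
  have gh: "ghm (PP mu) (PP nu) d (g d)" if "d : D" for d using D(3) that by (auto simp: ghom_iff)
  have "(fs (PP nu) D (%d. g d x)) : Z" using D(1) gh D(2)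
  proof (induction D rule: finite_induct)
  case (insert d D)
  then have "g d x : Z" using im[OF mu _ _ x, of d "g d"] by auto
  then show ?case using insert add ghm_closed[OF insert.prems(1) x] by (subst P.M.finsum_insert) auto
  qed (use z in simp)
  then show ?thesis using D(4) x by simp
 qed
 fix x assume "x : TT J nu"
 then show "x : Z" unfolding trace_sum_def
 proof (induction rule: generate.induct)
  case one then show ?case using z by simp
 next
  case (incl h) then show ?case using gen by auto
 next
  case (inv h) then show ?case using gen neg unfolding a_inv_def by auto
 next
  case (eng h1 h2) then show ?case using add by simp
 qed
qed

context
 fixes J nu
 assumes J: "J <= Irr n" and nu: "nu : Irr n"
begin

lemma trace_carrier: "TT J nu <= cr (PP nu)"
proof -
 interpret P: lmod R "PP nu" by (rule gmod_lmod[OF gmod_Pmod[OF nu]])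
 show ?thesis by (rule trace_least[OF J nu]) (use ghm_closed in auto)
qed

lemma trace_mem:
 assumes "mu : J" "e > 0" "ghm (PP mu) (PP nu) e si" "x : cr (PP mu)"
 shows "si x : TT J nu"
proof -
 interpret P: lmod R "PP nu" by (rule gmod_lmod[OF gmod_Pmod[OF nu]])
 let ?f = "restrict (%x. \<Oplus>\<^bsub>PP nu\<^esub>d\<in>{e}. restrict si (cr (PP mu)) x) (cr (PP mu))"
 have w: "wgm (PP mu)" using gmod_Pmod J assms(1) gmod_wgm by blast
 have "?f : ghom_pos R (PP mu) (PP nu)"
  unfolding ghom_pos_def using assms(2) ghm_restrict[OF w assms(3)]
  by (intro CollectI exI[of _ "{e}"] exI[of _ "%_. restrict si (cr (PP mu))"]) auto
 moreover have "?f x = si x" using assms(4) ghm_closed[OF assms(3,4)] by simp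
 ultimately show ?thesis unfolding trace_sum_def using assms(1,4) by (intro generate.incl) (metis (no_types, lifting) UN_I image_eqI)
qed

text \<open>Only additive closure is built into the trace. Closure under scalars and under
  components follows because the elements all of whose multiples, respectively components, stay in
  the trace form a subgroup to which \<open>trace_least\<close> applies.\<close>

lemma gsubm_trace: "gsubm (PP nu) (TT J nu)"
proof -
 let ?P = "PP nu" and ?T = "TT J nu"
 note gP = gmod_Pmod[OF nu]
 note wP = gmod_wgm[OF gP]
 interpret P: lmod R ?P by (rule gmod_lmod[OF gP])
 have "(\<Union>mu\<in>J. \<Union>f\<in>ghom_pos R (PP mu) ?P. f ` cr (PP mu)) <= cr (add_monoid ?P)"
  using trace_carrier generate.incl[of _ _ "add_monoid ?P"] unfolding trace_sum_def by (auto simp: subset_iff)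
 then have sg: "subgroup ?T (add_monoid ?P)" unfolding trace_sum_def by (rule group.generate_is_subgroup[OF P.M.a_group])
 have z: "0[?P] : ?T" using subgroup.one_closed[OF sg] by simp
 have add: "x +[?P] y : ?T" if "x : ?T" "y : ?T" for x y using subgroup.m_closed[OF sg that] by simp
 have neg: "-[?P] x : ?T" if "x : ?T" for x using subgroup.m_inv_closed[OF sg that] unfolding a_inv_def by simp
 have gmu: "gmod (PP mu)" if "mu : J" for mu using J that gmod_Pmod by auto
 have "?T <= {x : cr ?P. ALL a:cr R. a *[?P] x : ?T}"
 proof (rule trace_least[OF J nu])
  fix mu e si x assume mu: "mu : J" and e: "(e::int) > 0" and si: "ghm (PP mu) ?P e si" and x: "x : cr (PP mu)"
  interpret M: lmod R "PP mu" by (rule gmod_lmod[OF gmu[OF mu]])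
  show "si x : {x : cr ?P. ALL a:cr R. a *[?P] x : ?T}"
  using ghm_closed[OF si x] ghm_smult[OF si x, symmetric] trace_mem[OF mu e si] x by auto
 qed (use z add neg P.smult_r_distr P.smult_r_minus in auto)
 moreover have "?T <= {x : cr ?P. ALL i. hp ?P i x : ?T}"
 proof (rule trace_least[OF J nu])
  show "0[?P] : {x : cr ?P. ALL i. hp ?P i x : ?T}" using gsubm_hp[OF gsubm_triv[OF gP], of "0[?P]"] z by auto
  show "-[?P] x : {x : cr ?P. ALL i. hp ?P i x : ?T}" if x: "x : {x : cr ?P. ALL i. hp ?P i x : ?T}" for x
  proof -
  have m: "-[?P] y = tensor (- 1) e0 *[?P] y" if "y : cr ?P" for y
  proof (rule P.M.minus_equality)
  have "tensor (- 1) e0 +[R] tensor 1 e0 = 0[R]" by (simp flip: tensor_add add: tensor_zero)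
  then show "tensor (- 1) e0 *[?P] y +[?P] y = 0[?P]"
  using P.smult_l_distr[of "tensor (- 1) e0" "tensor 1 e0" y] P.smult_one[OF that] that unfolding R_one by simp
  qed (use that in auto)
  have "tensor (- 1) e0 : skew_gr n 0" by (rule tensor_gr) (use S_gr_uminus[OF one_S_gr] in auto)
  from hp_smult0[OF gP this, of x] have h: "hp ?P i (-[?P] x) = -[?P] hp ?P i x" for i using x m hp_carrier[OF gP, of x] by simp
  show ?thesis using x by (auto simp: h neg)
  qed
  fix mu e si x assume mu: "mu : J" and e: "(e::int) > 0" and si: "ghm (PP mu) ?P e si" and x: "x : cr (PP mu)"
  show "si x : {x : cr ?P. ALL i. hp ?P i x : ?T}"
  using ghm_closed[OF si x] hp_ghm[OF gmu[OF mu] gP si x] trace_mem[OF mu e si] hp_carrier[OF gmu[OF mu] x] by auto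
 qed (use hp_add[OF gP] add in auto)
 ultimately show ?thesis unfolding gsubm_def using trace_carrier z add by blast
qed

text \<open>\<open>P\<close> has no negative degrees, so the image of a map of positive degree has
  no degree 0 component.\<close>

lemma trace_gr0:
 assumes "x : TT J nu" "x : gr (PP nu) 0"
 shows "x = 0[PP nu]"
proof -
 let ?P = "PP nu"
 note gP = gmod_Pmod[OF nu]
 note wP = gmod_wgm[OF gP]
 interpret P: lmod R ?P by (rule gmod_lmod[OF gP])
 have h0: "hp ?P 0 0[?P] = 0[?P]" using hp_same[OF gP gr_zero[OF wP]] .
 have "TT J nu <= {x : cr ?P. hp ?P 0 x = 0[?P]}"
 proof (rule trace_least[OF J nu])
  show "-[?P] x : {x : cr ?P. hp ?P 0 x = 0[?P]}" if x: "x : {x : cr ?P. hp ?P 0 x = 0[?P]}" for x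
  using x hp_add[OF gP, of x "-[?P] x"] hp_carrier[OF gP, of "-[?P] x" 0] h0 by (auto simp: P.M.r_neg)
  fix mu e si x assume mu: "mu : J" and e: "(e::int) > 0" and si: "ghm (PP mu) ?P e si" and x: "x : cr (PP mu)"
  have gmu: "gmod (PP mu)" using J mu gmod_Pmod by auto
  have "hp (PP mu) (0 - e) x = 0[PP mu]"
  using Pm_neg[of "0 - e" "hp (PP mu) (0 - e) x"] e hp_gr[OF gmu x, of "0 - e"] unfolding Pmod_Pm by simp
  then show "si x : {x : cr ?P. hp ?P 0 x = 0[?P]}"
  using ghm_closed[OF si x] hp_ghm[OF gmu gP si x, of 0] ghm_zero[OF gmod_wgm[OF gmu] wP si] by simp
 qed (use hp_add[OF gP] h0 in auto)
 then show ?thesis using hp_same[OF gP assms(2)] assms(1) by auto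
qed

end

end

section \<open>Quotients by traces and their duals\<close>

context gring
begin

lemma gsub_all: "wgm M ==> gsub M (cr M) = M"
proof -
 assume "wgm M"
 then have "(%i. cr M \<inter> gr M i) = gr M" using gr_carrier by (intro ext) auto
 then show ?thesis unfolding gsub_def by simp
qed

lemma gsub_gsub: "Z' <= Z ==> gsub (gsub M Z) Z' = gsub M Z'"
proof -
 assume "Z' <= Z"
 then have "(%i. Z' \<inter> (Z \<inter> gr M i)) = (%i. Z' \<inter> gr M i)" by (intro ext) auto
 then show ?thesis unfolding gsub_def by simp
qed

text \<open>The isomorphism of the factor with \<open>P/T\<close> becomes a map out of
  \<open>P\<close> once the projection of \<open>P\<close> is lifted to \<open>X\<close>.
  Projectivity of \<open>P\<close> enters as the premise \<open>lift\<close>, since the graded ring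
  is arbitrary here.\<close>

lemma pres_of_giso:
 assumes X: "gmod X" and Z: "gsubm X Z" and P: "gmod P" and T: "gsubm P T"
  and iso: "giso R (gquot X Z) (shift e (gquot P T))"
  and lift: "!!te. ghm X (gquot P T) (- e) te ==> te ` cr X = cr (gquot P T) ==>
  EX fy. ghm P X e fy & (ALL x:cr P. te (fy x) = proj P T x)"
 shows "EX fy. pres P T X Z e fy"
proof -
 note Q = gmod_gquot[OF X Z] and K = gmod_gquot[OF P T]
 interpret K: lmod R "gquot P T" by (rule gmod_lmod[OF K(1)])
 interpret X: lmod R X by (rule gmod_lmod[OF X])
 obtain f where f: "ghm (gquot X Z) (shift e (gquot P T)) 0 f" "bij_betw f (cr (gquot X Z)) (cr (gquot P T))"
  using iso unfolding giso_def by (auto simp: ghom_iff)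
 have f0: "f 0[gquot X Z] = 0[gquot P T]"
  using ghm_zero[OF gmod_wgm[OF Q(1)] wgm_shift[OF gmod_wgm[OF K(1)]] f(1)] by simp
 let ?te = "%x. f (proj X Z x)"
 have pc: "proj X Z x : cr (gquot X Z)" if "x : cr X" for x using Q(4) that by auto
 have te: "ghm X (gquot P T) (- e) ?te" using ghm_comp[OF Q(2) f(1)] by (simp add: ghm_shift_codom')
 have sj: "?te ` cr X = cr (gquot P T)"
  using f(2) Q(4) unfolding bij_betw_def by (metis image_image)
 have k: "?te x = 0[gquot P T] <-> x : Z" if x: "x : cr X" for x
 proof -
  have "0[gquot X Z] : cr (gquot X Z)" using gr_carrier[OF gmod_wgm[OF Q(1)] gr_zero[OF gmod_wgm[OF Q(1)]]] .
  then show ?thesis using f(2) f0 pc[OF x] Q(3)[OF x] unfolding bij_betw_def by (metis inj_onD)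
 qed
 have p2: "pres X Z (gquot P T) {0[gquot P T]} (- e) ?te"
  unfolding pres_def
 proof (intro conjI X K(1) Z gsubm_triv te ballI)
  fix y assume yc: "y : cr (gquot P T)"
  then have "y : ?te ` cr X" unfolding sj .
  then obtain x where x: "x : cr X" "y = ?te x" by blast
  then have "y = ?te x +[gquot P T] 0[gquot P T]" using K.M.r_zero[OF yc] by simp
  then show "EX x:cr X. EX z:{0[gquot P T]}. y = ?te x +[gquot P T] z" using x(1) by blast
 qed (use k in simp)
 obtain fy where fy: "ghm P X e fy" "ALL x:cr P. ?te (fy x) = proj P T x" using lift[OF te sj] by auto
 have "pres P T X Z (0 - (- e)) fy" by (rule pres_compare[OF pres_proj[OF P T] p2]) (use fy in auto)
 then show ?thesis by auto
qed

end

context dihz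
begin

text \<open>Four choices of \<open>J\<close> occur: the empty set gives a copy of
  \<open>P_nu\<close>, \<open>up nu\<close> gives the module \<open>Ktilde\<close>,
  \<open>upeq nu\<close> gives \<open>Kmod\<close>, and \<open>I\<close> the simple
  quotient.\<close>

abbreviation QQ :: "irr set => irr => (A, S vec set) gmodule" where "QQ J nu == gquot (PP nu) (TT J nu)"
abbreviation I :: "irr set" where "I == Irr n"

text \<open>The kernel of \<open>f\<close> is a subgroup, so \<open>trace_least\<close> applies;
  \<open>f\<close> has to be defined on the trace only.\<close>

lemma trace_kill:
 assumes J: "J <= I" and nu: "nu : I" and N: "wgm N" and f: "ghm (gsub (PP nu) (TT J nu)) N d f"
  and im: "!!mu e si x. mu : J ==> e > 0 ==> ghm (PP mu) (PP nu) e si ==> x : cr (PP mu) ==> f (si x) = 0[N]"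
  and z: "z : TT J nu"
 shows "f z = 0[N]"
proof -
 note gP = gmod_Pmod[OF nu] and gT = gsubm_trace[OF J nu]
 interpret N: lmod R N using N wgm_lmod by auto
 interpret P: lmod R "PP nu" by (rule gmod_lmod[OF gP])
 have f0: "f 0[PP nu] = 0[N]" using ghm_zero[OF gmod_wgm[OF gmod_gsub[OF gP gT]] N f] by simp
 have fa: "f (x +[PP nu] y) = f x +[N] f y" if "x : TT J nu" "y : TT J nu" for x y using ghm_add[OF f, of x y] that by simp
 have fc: "f x : cr N" if "x : TT J nu" for x using ghm_closed[OF f, of x] that by simp
 have "TT J nu <= {x : TT J nu. f x = 0[N]}"
 proof (rule trace_least[OF J nu])
  fix x assume x: "x : {x : TT J nu. f x = 0[N]}"
  then have xT: "x : TT J nu" "f x = 0[N]" by simp_all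
  have n: "-[PP nu] x : TT J nu" by (rule gsubm_uminus[OF gP gT xT(1)])
  have "f (-[PP nu] x) = 0[N] +[N] f (-[PP nu] x)" using N.M.l_zero[OF fc[OF n]] by simp
  also have "... = f (x +[PP nu] -[PP nu] x)" unfolding fa[OF xT(1) n] xT(2) ..
  also have "... = 0[N]" unfolding P.M.r_neg[OF gsubm_carrier[OF gT xT(1)]] by (rule f0)
  finally have "f (-[PP nu] x) = 0[N]" .
  then show "-[PP nu] x : {x : TT J nu. f x = 0[N]}" using n by simp
 next
  show "x +[PP nu] y : {x : TT J nu. f x = 0[N]}" if "x : {x : TT J nu. f x = 0[N]}" "y : {x : TT J nu. f x = 0[N]}" for x y
  using that fa gsubm_add[OF gT] by simp
  show "si x : {x : TT J nu. f x = 0[N]}"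
  if "mu : J" "0 < e" "ghm (PP mu) (PP nu) e si" "x : cr (PP mu)" for mu e si x
  using im[OF that] trace_mem[OF J nu that] by simp
 qed (use f0 gsubm_zero[OF gT] in simp)
 then show ?thesis using z by blast
qed

lemma trace_stable:
 assumes J: "J <= I" and nu: "nu : I" and fy: "ghm (PP nu) (PP nu) 0 fy" and x: "x : TT J nu"
 shows "fy x : TT J nu"
proof -
 note gP = gmod_Pmod[OF nu] and gT = gsubm_trace[OF J nu]
 have g: "gsubm (PP nu) {x : cr (PP nu). fy x : TT J nu}" by (rule gsubm_vimage[OF gP gP fy gT])
 have "TT J nu <= {x : cr (PP nu). fy x : TT J nu}"
 proof (rule trace_least[OF J nu])
  fix mu e si x assume a: "mu : J" "(e::int) > 0" "ghm (PP mu) (PP nu) e si" "x : cr (PP mu)"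
  then show "si x : {x : cr (PP nu). fy x : TT J nu}"
  using trace_mem[OF J nu a(1,2) _ a(4), of "%x. fy (si x)"] ghm_comp[OF a(3) fy] ghm_closed[OF a(3,4)] by simp
 qed (use gsubm_zero[OF g] gsubm_add[OF g] gsubm_uminus[OF gP g] in blast)+
 then show ?thesis using x by auto
qed

lemma hom_dual_irr:
 assumes al: "al : I" and nu: "nu : I" and Q: "gmod Q" and "ghm (PP nu) Q 0 pj" "pj ` cr (PP nu) = cr Q"
  and "!!x. x : gr (PP nu) 0 ==> pj x = 0[Q] ==> x = 0[PP nu]"
  and "ghm (PP al) (dl Q) c g" "x0 : cr (PP al)" "g x0 ~= 0[dl Q]"
 shows "(al = nu & c = 0) |
  (c < 0 & (EX si. ghm (PP nu) (PP al) (- c) si & (EX x:cr (PP nu). g (si x) ~= 0[dl Q])))"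
proof -
 note a = assms(4-)[unfolded Pmod_Pm Pm_simps]
 have a3: "x = zv (rep_deg (rep_of nu))" if "x : gr (Pm (rep_deg (rep_of nu)) (rep_of nu)) 0" "pj x = 0[Q]" for x
  using a(3)[of x] that by simp
 show ?thesis
  using hom_dual_cases[OF rep_of_rep[OF al] rep_of_rep[OF nu] Q a(1,2) a3 a(4-6)] Irr_eqI[OF al nu]
  unfolding Pmod_Pm Pm_simps by blast
qed

context
 fixes J nu
 assumes J: "J <= I" and nu: "nu : I"
begin

lemma QQ_facts:
 "gmod (QQ J nu)" "ghm (PP nu) (QQ J nu) 0 (proj (PP nu) (TT J nu))"
 "!!x. x : cr (PP nu) ==> proj (PP nu) (TT J nu) x = 0[QQ J nu] <-> x : TT J nu"
 "proj (PP nu) (TT J nu) ` cr (PP nu) = cr (QQ J nu)"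
 "!!x. x : gr (PP nu) 0 ==> proj (PP nu) (TT J nu) x = 0[QQ J nu] ==> x = 0[PP nu]"
 "wgm (dl (QQ J nu))"
proof -
 note q = gmod_gquot[OF gmod_Pmod[OF nu] gsubm_trace[OF J nu]]
 show "gmod (QQ J nu)" "ghm (PP nu) (QQ J nu) 0 (proj (PP nu) (TT J nu))" "proj (PP nu) (TT J nu) ` cr (PP nu) = cr (QQ J nu)"
  by (fact q)+
 show k: "proj (PP nu) (TT J nu) x = 0[QQ J nu] <-> x : TT J nu" if "x : cr (PP nu)" for x by (rule q(3)[OF that])
 show "x = 0[PP nu]" if "x : gr (PP nu) 0" "proj (PP nu) (TT J nu) x = 0[QQ J nu]" for x
  using trace_gr0[OF J nu _ that(1)] k[OF gr_carrier[OF gmod_wgm[OF gmod_Pmod[OF nu]] that(1)]] that(2) by simp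
 show "wgm (dl (QQ J nu))" by (rule wgm_dual[OF gmod_wgm[OF q(1)]])
qed

lemma hom_dual_QQ:
 assumes al: "al : I" and g: "ghm (PP al) (dl (QQ J nu)) c g"
  and x0: "x0 : cr (PP al)" "g x0 ~= 0[dl (QQ J nu)]"
 shows "(al = nu & c = 0) |
  (c < 0 & (EX si. ghm (PP nu) (PP al) (- c) si & (EX x:cr (PP nu). g (si x) ~= 0[dl (QQ J nu)])))"
 by (rule hom_dual_irr[OF al nu QQ_facts(1,2,4,5) g x0])

text \<open>Transpose \<open>g\<close> and pull it back to \<open>P_nu\<close>, so that the two
  modules exchange roles. In negative degree there would be a map \<open>P_al -> P_nu\<close> of
  positive degree on which the transpose is nonzero, but for \<open>al\<close> in \<open>J\<close>
  its image lies in the trace that has been divided out.\<close>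

lemma hom_dual_QQ_mem:
 assumes al: "al : J" and g: "ghm (PP al) (dl (QQ J nu)) c g"
  and x0: "x0 : cr (PP al)" "g x0 ~= 0[dl (QQ J nu)]"
 shows "al = nu & c = 0"
proof -
 have alI: "al : I" using al J by auto
 note gA = gmod_Pmod[OF alI] and Qf = QQ_facts
 note wA = gmod_wgm[OF gA] and wQ = gmod_wgm[OF Qf(1)]
 let ?pj = "proj (PP nu) (TT J nu)"
 define h where "h = (%y. \<lambda>x\<in>cr (PP al). g x (?pj y))"
 have t: "ghm (QQ J nu) (dl (PP al)) c (%y. \<lambda>x\<in>cr (PP al). g x y)" by (rule transpose_hom[OF wA wQ g])
 have h: "ghm (PP nu) (dl (PP al)) c h" using ghm_comp[OF Qf(2) t] unfolding h_def by simp
 have gd: "g x0 : dual_carrier (QQ J nu)" using ghm_closed[OF g x0(1)] by simp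
 obtain q where q: "q : cr (QQ J nu)" "g x0 q ~= 0" by (rule dual_nonzero[OF gd x0(2)])
 obtain y where y: "y : cr (PP nu)" "q = ?pj y" using q(1) Qf(4) by auto
 have hz: "h y ~= 0[dl (PP al)]"
 proof
  assume "h y = 0[dl (PP al)]"
  then have "h y x0 = 0" using x0(1) by simp
  then show False using q y x0(1) unfolding h_def by simp
 qed
 have id: "ghm (PP al) (PP al) 0 (%x. x)" by (rule ghmI) auto
 have nz: "h (si x) = 0[dl (PP al)]" if "c < 0" "ghm (PP al) (PP nu) (- c) si" "x : cr (PP al)" for si x
 proof -
  have "si x : TT J nu" by (rule trace_mem[OF J nu al _ that(2,3)]) (use that(1) in simp)
  then have "?pj (si x) = 0[QQ J nu]" using Qf(3)[OF ghm_closed[OF that(2,3)]] by simp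
  then have "g z (?pj (si x)) = 0" if "z : cr (PP al)" for z
  using dual_zero[OF gmod_lmod[OF Qf(1)], of "g z"] ghm_closed[OF g that] by simp
  then show ?thesis unfolding h_def by auto
 qed
 have "(nu = al & c = 0) |
  (c < 0 & (EX si. ghm (PP al) (PP nu) (- c) si & (EX x:cr (PP al). h (si x) ~= 0[dl (PP al)])))"
  by (rule hom_dual_irr[OF nu alI gA id _ _ h y(1) hz]) auto
 then show ?thesis using nz by blast
qed

text \<open>The invariant form on nu, read as a pairing of generators with the degree 0 part of the
  quotient, gives the nonzero map; Schur's lemma makes the space a line.\<close>

lemma dual_QQ_hom:
 obtains gm j where "ghm (PP nu) (dl (QQ J nu)) 0 gm" "gm (eP (rep_deg (rep_of nu)) j) ~= 0[dl (QQ J nu)]"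
  "vdim (HS (PP nu) {} (dl (QQ J nu)) 0) 1"
proof -
 define k so where "k = rep_deg (rep_of nu)" and "so = rep_of nu"
 have so: "irr_rep k so" unfolding k_def so_def by (rule rep_of_rep[OF nu])
 note r = irr_rep_rep[OF so]
 have PPe: "PP nu = Pm k so" unfolding k_def so_def Pmod_Pm ..
 note Qf = QQ_facts[unfolded PPe]
 define fy where "fy = (%u. proj (Pm k so) (TT J nu) (cv k u))"
 have fy: "grrep (QQ J nu) 0 k so fy" unfolding fy_def PPe by (rule grrep_cv[OF r Qf(1,2)]) (use Qf(4,5) in auto)
 note iso = pmat_iso[OF QQ_facts(1) r r fy]
 obtain bq where bq: "inv_pair k k so so bq" "bq ~= zm k k" by (rule self_dual[OF so])
 obtain gm where gm: "ghm (Pm k so) (dl (QQ J nu)) (- 0) gm" "pmat k k fy gm = bq" by (rule pmat_surj[OF QQ_facts(1) r r fy bq(1)])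
 have "bq : cM k k" using bq(1) unfolding inv_pair_def by auto
 then have "EX j s. j < k & s < k & bq $$ (j, s) ~= 0" using bq(2) by (metis eq_matI index_zero_mat carrier_matD)
 then obtain j s where js: "j < k" "s < k" "bq $$ (j, s) ~= 0" by auto
 have "gm (eP k j) (fy (unit_vec k s)) ~= 0" using pmat_simps(2)[OF js(1,2), of fy gm] gm(2) js(3) by simp
 moreover have "fy (unit_vec k s) : cr (QQ J nu)" by (rule grrepD(3)[OF QQ_facts(1) r r fy]) simp
 ultimately have nz: "gm (eP k j) ~= 0[dl (QQ J nu)]" by auto
 have w: "wgm (PP nu)" by (rule gmod_wgm[OF gmod_Pmod[OF nu]])
 have "vdim (pairs k k so so) 1" using vdim_pairs_irr[OF so so] rep_iso_refl[OF r] by simp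
 from vdim_iso_rev[OF this iso] have "vdim (HS (PP nu) {} (dl (QQ J nu)) 0) 1" unfolding PPe
  using cvs_HS[OF w QQ_facts(6), of "{}" 0] by (simp add: PPe)
 then show ?thesis using that[of gm j] gm(1) nz unfolding PPe k_def[symmetric] by simp
qed

end

end

section \<open>Filtrations\<close>

locale tracefilt = dihz +
 fixes L :: "irr rel" and len :: "irr => nat" and Fil :: "irr => nat => S vec set"
 assumes L: "preorder_on (Irr n) L"
  and fil: "!!mu. mu : Irr n ==> shift_filtration (skew n ze) (PP mu) (Irr n) (Ktilde n ze L) (len mu) (Fil mu)"
begin

abbreviation "KT == Ktilde n ze L"
abbreviation up :: "irr => irr set" where "up nu == {mu : Irr n. strict_in L nu mu}"
abbreviation upeq :: "irr => irr set" where "upeq nu == {mu : Irr n. (nu, mu) : L}"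
abbreviation T :: "irr => S vec set" where "T nu == TT (up nu) nu"
abbreviation NN :: "irr => (A, S vec set => complex) gmodule" where "NN nu == dl (QQ (upeq nu) nu)"
abbreviation FF :: "irr => nat => (A, S vec) gmodule" where "FF mu i == gsub (PP mu) (Fil mu i)"

abbreviation label :: "irr => nat => irr => int => bool" where
 "label mu i nu d == giso R (factor (PP mu) (Fil mu) i) (shift d (KT nu))"

lemma up_sub: "up nu <= I" "upeq nu <= I" by auto

lemma strict_trans: "strict_in L al bq ==> strict_in L bq gm ==> strict_in L al gm"
 using L unfolding strict_in_def equiv_in_def preorder_on_def by (meson transD)

lemma fil_facts:
 assumes mu: "mu : I"
 shows "Fil mu 0 = cr (PP mu)" "Fil mu (len mu) = {0[PP mu]}" "i <= len mu ==> gsubm (PP mu) (Fil mu i)"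
  "i : {1..len mu} ==> Fil mu i <= Fil mu (i - 1)" "i <= len mu ==> gmod (FF mu i)"
  "i : {1..len mu} ==> gsubm (FF mu (i - 1)) (Fil mu i)"
  "i : {1..len mu} ==> gsub (FF mu (i - 1)) (Fil mu i) = FF mu i"
  "i : {1..len mu} ==> Fil mu (i - 1) ~= Fil mu i ==> EX al:I. EX e. label mu i al e"
proof -
 note f = fil[OF mu, unfolded shift_filtration_def] and gP = gmod_Pmod[OF mu]
 show "Fil mu 0 = cr (PP mu)" "Fil mu (len mu) = {0[PP mu]}" using f by auto
 show g: "gsubm (PP mu) (Fil mu i)" if "i <= len mu" for i using f that graded_submodule_gsubm[OF gP] by auto
 show m: "gmod (FF mu i)" if "i <= len mu" for i by (rule gmod_gsub[OF gP g[OF that]])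
 show s: "Fil mu i <= Fil mu (i - 1)" if "i : {1..len mu}" for i using f that by auto
 have i1: "i - 1 <= len mu" "i <= len mu" if "i : {1..len mu}" for i using that by auto
 show gs: "gsubm (FF mu (i - 1)) (Fil mu i)" if "i : {1..len mu}" for i
  using gsubm_gsub[OF gP g[OF i1(1)] s] g[OF i1(2)] that by blast
 show "gsub (FF mu (i - 1)) (Fil mu i) = FF mu i" if "i : {1..len mu}" by (rule gsub_gsub[OF s[OF that]])
 show "EX al:I. EX e. label mu i al e" if i: "i : {1..len mu}" and ne: "Fil mu (i - 1) ~= Fil mu i"
 proof -
  note q = gmod_gquot[OF m[OF i1(1)[OF i]] gs[OF i]]
  have "cr (factor (PP mu) (Fil mu) i) ~= {0[factor (PP mu) (Fil mu) i]}"
  proof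
  assume "cr (factor (PP mu) (Fil mu) i) = {0[factor (PP mu) (Fil mu) i]}"
  then have "x : Fil mu i" if "x : Fil mu (i - 1)" for x
  using q(3)[of x] q(4) that unfolding factor_def by auto
  then show False using s[OF i] ne by auto
  qed
  moreover have "cr (factor (PP mu) (Fil mu) i) = {0[factor (PP mu) (Fil mu) i]} | (EX al:I. EX d. label mu i al d)"
  using f i by blast
  ultimately show ?thesis by blast
 qed
qed

text \<open>The projection from \<open>P_al\<close> onto its \<open>Ktilde\<close> quotient lifts
  through the filtration step by projectivity.\<close>

lemma step_pres:
 assumes mu: "mu : I" and al: "al : I" and i: "i : {1..len mu}" and l: "label mu i al e"
 obtains fy where "pres (PP al) (T al) (FF mu (i - 1)) (Fil mu i) e fy"
proof -
 have i1: "i - 1 <= len mu" using i by auto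
 note gX = fil_facts(5)[OF mu i1] and gA = gmod_Pmod[OF al]
 note Q = QQ_facts[OF up_sub(1)[of al] al]
 have g: "ghm (Pm (rep_deg (rep_of al)) (rep_of al)) (QQ (up al) al) 0 (proj (PP al) (T al))" using Q(2) unfolding Pmod_Pm[of al] .
 have "EX fy. pres (PP al) (T al) (FF mu (i - 1)) (Fil mu i) e fy"
 proof (rule pres_of_giso[OF gX fil_facts(6)[OF mu i] gA gsubm_trace[OF up_sub(1) al]])
  show "giso R (gquot (FF mu (i - 1)) (Fil mu i)) (shift e (QQ (up al) al))" using l unfolding factor_def Ktilde_def .
  fix te assume te: "ghm (FF mu (i - 1)) (QQ (up al) al) (- e) te" "te ` cr (FF mu (i - 1)) = cr (QQ (up al) al)"
  have "proj (PP al) (T al) (eP (rep_deg (rep_of al)) j) : te ` cr (FF mu (i - 1))" for j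
  unfolding te(2) using ghm_closed[OF Q(2), of "eP (rep_deg (rep_of al)) j"] by (simp add: Pmod_Pm)
  then obtain g' where g': "ghm (Pm (rep_deg (rep_of al)) (rep_of al)) (FF mu (i - 1)) (0 - (- e)) g'"
  "ALL x:cV (rep_deg (rep_of al)). te (g' x) = proj (PP al) (T al) x"
  by (rule Pm_lift[OF irr_rep_rep[OF rep_of_rep[OF al]] gX Q(1) te(1) g])
  then show "EX fy. ghm (PP al) (FF mu (i - 1)) e fy & (ALL x:cr (PP al). te (fy x) = proj (PP al) (T al) x)"
  unfolding Pmod_Pm[of al] by (intro exI[of _ g']) (simp add: Pmod_Pm)
 qed
 then show ?thesis using that by blast
qed

text \<open>The first proper step of \<open>P\<^sub>\<mu>\<close> has label \<open>(\<mu>, 0)\<close>, since its factor is generated by the irreducible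
  degree \<open>0\<close> part of \<open>P\<^sub>\<mu>\<close>; the lift \<open>P\<^sub>\<mu> \<rightarrow> P\<^sub>\<mu>\<close> is then surjective, hence split, and preserves traces.\<close>

lemma first_step:
 assumes mu: "mu : I"
 obtains i where "i : {1..len mu}" "Fil mu (i - 1) = cr (PP mu)" "Fil mu i = T mu"
proof -
 define k so where "k = rep_deg (rep_of mu)" and "so = rep_of mu"
 have so: "irr_rep k so" unfolding k_def so_def by (rule rep_of_rep[OF mu])
 note r = irr_rep_rep[OF so] and gP = gmod_Pmod[OF mu]
 note wP = gmod_wgm[OF gP]
 interpret P: lmod R "PP mu" by (rule gmod_lmod[OF gP])
 have PPe: "PP mu = Pm k so" unfolding k_def so_def Pmod_Pm ..
 have k0: "0 < k" using so unfolding irr_rep_def by auto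
 have Pc: "eP k j : cr (PP mu)" for j unfolding PPe by simp
 have en: "eP k 0 ~= 0[PP mu]" using k0 unfolding PPe by (auto simp: unit_vec_def vec_eq_iff)
 have ex: "Fil mu (len mu) ~= cr (PP mu)" using fil_facts(2)[OF mu] en Pc by auto
 \<comment> \<open>\<open>i\<close> is the first index at which the filtration leaves
   \<open>P_mu\<close>; earlier steps have zero factor.\<close>
 define i where "i = (LEAST i. Fil mu i ~= cr (PP mu))"
 have Fi: "Fil mu i ~= cr (PP mu)" unfolding i_def by (rule LeastI[of _ "len mu"]) (rule ex)
 have "i <= len mu" unfolding i_def by (rule Least_le) (rule ex)
 moreover have "i ~= 0" using Fi fil_facts(1)[OF mu] by metis
 ultimately have i: "i : {1..len mu}" by auto
 have F1: "Fil mu (i - 1) = cr (PP mu)" using not_less_Least[of "i - 1" "%i. Fil mu i ~= cr (PP mu)"] i unfolding i_def by auto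
 have iN: "i <= len mu" using i by simp
 note gF = fil_facts(3)[OF mu iN]
 obtain al e where al: "al : I" "label mu i al e" using fil_facts(8)[OF mu i] F1 Fi by metis
 obtain fy where "pres (PP al) (T al) (FF mu (i - 1)) (Fil mu i) e fy" by (rule step_pres[OF mu al(1) i al(2)])
 then have p: "pres (PP al) (T al) (PP mu) (Fil mu i) e fy" unfolding F1 gsub_all[OF wP] .
 note pd = presD[OF p]
 have cv: "grrep (Pm k so) 0 k so (%u. cv k u)"
  by (rule grrep_cv[OF r gmod_Pm[OF r], of "%x. x"]) (auto intro!: ghmI)
 note gD = grrepD[OF gmod_Pm[OF r] r r cv]
 \<comment> \<open>\<open>U\<close> is the degree 0 part of the proper step, a stable subspace of an
   irreducible representation. It is zero, since a submodule that contains all generators is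
   \<open>P_mu\<close>.\<close>
 define U where "U = {u : cV k. cv k u : Fil mu i}"
 have "minv k so U" unfolding minv_def vsub_def U_def
 proof (intro conjI ballI allI CollectI)
  have "cv k (zv k) = 0[PP mu]" unfolding PPe cv_def by (intro eq_vecI) auto
  then show "cv k (zv k) : Fil mu i" using gsubm_zero[OF gF] by simp
  show "cv k (u + v) : Fil mu i" if "u : {u : cV k. cv k u : Fil mu i}" "v : {u : cV k. cv k u : Fil mu i}" for u v
  using that gD(4)[of u v] gsubm_add[OF gF, of "cv k u" "cv k v"] unfolding PPe by simp
  show "cv k (c *s u) : Fil mu i" if "u : {u : cV k. cv k u : Fil mu i}" for c u
  using that gD(5)[of u c] gsubm_smult[OF gF, of "cst c" "cv k u"] unfolding PPe cscale_def by simp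
  show "cv k (so w *v u) : Fil mu i" if "w : W" "u : {u : cV k. cv k u : Fil mu i}" for w u
  using that gD(6)[of u w] gsubm_smult[OF gF, of "tensor 1 w" "cv k u"] unfolding PPe by simp
  show "so w *v u : cV k" if "w : W" "u : {u : cV k. cv k u : Fil mu i}" for w u
  using that rep_carrier[OF r that(1)] by simp
 qed auto
 moreover have "U ~= cV k"
 proof
  assume "U = cV k"
  then have "cv k (unit_vec k j) : Fil mu i" for j using unit_vec_carrier[of k j] unfolding U_def by blast
  then have eF: "eP k j : Fil mu i" for j unfolding cv_unit .
  have "x : Fil mu i" if "x : cr (PP mu)" for x
  proof -
  have "tensor (x $ j) e0 *[PP mu] eP k j : Fil mu i" for j by (rule gsubm_smult[OF gF _ eF]) simp
  then have "(fs (PP mu) {..<k} (%j. tensor (x $ j) e0 *[PP mu] eP k j)) : Fil mu i" by (intro gsubm_finsum[OF gP gF]) auto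
  then show ?thesis using Pm_expand[OF r, of x] that unfolding PPe by simp
  qed
  then show False using Fi gsubm_carrier[OF gF] by blast
 qed
 ultimately have U0: "U = {zv k}" using so unfolding irr_rep_def by blast
 have F0: "x = 0[PP mu]" if x: "x : Fil mu i" "x : gr (PP mu) 0" for x
 proof -
  obtain u where u: "u : cV k" "x = cv k u" using cv_gr[of x k so] x(2) unfolding PPe by blast
  then have "u : U" using x(1) unfolding U_def by simp
  then have "u = zv k" using U0 by simp
  then show ?thesis unfolding u(2) PPe cv_def by (intro eq_vecI) auto
 qed
 have ej: "EX x:gr (PP al) (0 - e). eP k j = fy x" for j
 proof -
  obtain x z where xz: "x : cr (PP al)" "z : Fil mu i" "eP k j = fy x +[PP mu] z" using pd(6)[OF Pc] by blast
  have zc: "z : cr (PP mu)" by (rule gsubm_carrier[OF gF xz(2)])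
  have "hp (PP mu) 0 z = 0[PP mu]" by (rule F0[OF gsubm_hp[OF gF xz(2)] hp_gr[OF gP zc]])
  moreover have "hp (PP mu) 0 (eP k j) = eP k j" using hp_same[OF gP, of "eP k j" 0] eP_gr[of k j so] unfolding PPe by simp
  ultimately have "eP k j = fy (hp (PP al) (0 - e) x)"
  using hp_add[OF gP ghm_closed[OF pd(5) xz(1)] zc, of 0] hp_ghm[OF pd(1) gP pd(5) xz(1), of 0] xz(3)
  hp_carrier[OF gP ghm_closed[OF pd(5) xz(1)], of 0] P.M.r_zero by metis
  then show ?thesis using hp_gr[OF pd(1) xz(1)] by blast
 qed
 \<comment> \<open>Composing \<open>fy\<close> with a pairing of \<open>P_mu\<close> with itself
   lets \<open>hom_dual_QQ\<close> restrict the label: positive \<open>e\<close> is impossible, and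
   \<open>e = 0\<close> forces \<open>al = mu\<close>.\<close>
 obtain gm j where gm: "ghm (PP mu) (dl (QQ {} mu)) 0 gm" "gm (eP k j) ~= 0[dl (QQ {} mu)]"
  unfolding k_def by (rule dual_QQ_hom[OF empty_subsetI mu])
 obtain x where x: "x : gr (PP al) (0 - e)" "eP k j = fy x" using ej by blast
 have xc: "x : cr (PP al)" by (rule gr_carrier[OF gmod_wgm[OF pd(1)] x(1)])
 have "(al = mu & e + 0 = 0) | e + 0 < 0"
  using hom_dual_QQ[OF empty_subsetI mu al(1) ghm_comp[OF pd(5) gm(1)] xc] gm(2) x(2) by auto
 \<comment> \<open>For negative \<open>e\<close> the generators of \<open>P_al\<close> would land in
   a negative degree of \<open>P_mu\<close>, so \<open>fy\<close> would vanish.\<close>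
 moreover have "~ e < 0"
 proof
  assume e: "e < 0"
  define m rx where "m = rep_deg (rep_of al)" and "rx = rep_of al"
  have rrx: "rep m rx" unfolding m_def rx_def by (rule irr_rep_rep[OF rep_of_rep[OF al(1)]])
  have PA: "PP al = Pm m rx" unfolding m_def rx_def Pmod_Pm ..
  have z: "fy (eP m t) = 0[PP mu]" for t
  using Pm_neg[OF e, of "fy (eP m t)" k so] ghm_gr[OF pd(5), of "eP m t" 0] eP_gr[of m t rx] unfolding PA PPe by simp
  have "fy x = 0[PP mu]"
  by (rule Pm_hom_unique[OF rrx wP pd(5)[unfolded PA] ghm_null[OF pd(1)[unfolded PA, THEN gmod_wgm] wP] z]) (use xc in \<open>simp add: PA\<close>)
  then have "gm (eP k j) = 0[dl (QQ {} mu)]"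
  unfolding x(2) using ghm_zero[OF wP QQ_facts(6)[OF empty_subsetI mu] gm(1)] by simp
  then show False using gm(2) by simp
 qed
 ultimately have ae: "al = mu" "e = 0" by auto
 note p' = p[unfolded ae] and pd' = pd[unfolded ae]
 have id: "ghm (PP mu) (PP mu) 0 (%x. x)" by (rule ghmI) auto
 have im: "eP k j : fy ` cr (Pm k so)" for j
  using ej[of j] gr_carrier[OF wP] unfolding ae PPe by blast
 obtain fy' where fy': "ghm (Pm k so) (Pm k so) (0 - 0) fy'" "ALL x:cV k. fy (fy' x) = x"
  by (rule Pm_lift[OF r gmod_Pm[OF r] gmod_Pm[OF r] pd'(5)[unfolded PPe] id[unfolded PPe] im])
 have fy1: "ghm (PP mu) (PP mu) 0 fy'" "!!x. x : cr (PP mu) ==> fy (fy' x) = x" using fy' unfolding PPe by auto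
 note Tc = trace_carrier[OF up_sub(1)[of mu] mu]
 have "Fil mu i = T mu"
 proof
  show "Fil mu i <= T mu"
  proof
  fix y assume y: "y : Fil mu i"
  have yc: "y : cr (PP mu)" by (rule gsubm_carrier[OF gF y])
  have "fy' y : T mu" using pd'(7)[OF ghm_closed[OF fy1(1) yc]] fy1(2)[OF yc] y by simp
  from trace_stable[OF up_sub(1) mu pd'(5) this] show "y : T mu" using fy1(2)[OF yc] by simp
  qed
  show "T mu <= Fil mu i"
  proof
  fix y assume y: "y : T mu"
  then have yc: "y : cr (PP mu)" using Tc by blast
  have "fy' y : T mu" by (rule trace_stable[OF up_sub(1) mu fy1(1) y])
  then show "y : Fil mu i" using pd'(7)[OF ghm_closed[OF fy1(1) yc]] fy1(2)[OF yc] by simp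
  qed
 qed
 then show ?thesis using that i F1 by blast
qed

text \<open>A nonzero homomorphism from a step labelled \<open>\<nu>\<close> to the dual of the simple quotient of \<open>P\<^sub>\<nu>\<close>, extended as far as
  possible up the filtration, either reaches \<open>P\<^sub>\<mu>\<close> or is obstructed at an earlier step, whose label lies
  strictly below \<open>\<nu>\<close>.\<close>

lemma step_label:
 assumes mu: "mu : I" and "nu : I" and "i : {1..len mu}" and "label mu i nu d"
 shows "(nu = mu & d = 0) | strict_in L mu nu"
 using assms(2-)
proof (induction i arbitrary: nu d rule: less_induct)
 case (less i)
 note nu = less.prems(1) and i = less.prems(2)
 \<comment> \<open>With \<open>J = I\<close> the target is the dual of the simple quotient; by
   \<open>N3\<close> it receives nonzero maps only from \<open>P_nu\<close>, and only in degree
   0.\<close>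
 define N where "N = dl (QQ I nu)"
 note gP = gmod_Pmod[OF mu]
 have wN: "wgm N" unfolding N_def by (rule QQ_facts(6)[OF subset_refl nu])
 interpret N: lmod R N by (rule wgm_lmod[OF wN])
 have N3: "xi = nu & c = 0" if "xi : I" "ghm (PP xi) N c g" "x : cr (PP xi)" "g x ~= 0[N]" for xi c g x
  using hom_dual_QQ_mem[OF subset_refl nu that(1) that(2-4)[unfolded N_def]] .
 obtain gm x where gm: "ghm (PP nu) N 0 gm" "x : cr (PP nu)" "gm x ~= 0[N]"
 proof -
  obtain gm j where "ghm (PP nu) N 0 gm" "gm (eP (rep_deg (rep_of nu)) j) ~= 0[N]"
  unfolding N_def by (rule dual_QQ_hom[OF subset_refl nu])
  then show ?thesis using that[of gm "eP (rep_deg (rep_of nu)) j"] by (simp add: Pmod_Pm)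
 qed
 obtain fy where p: "pres (PP nu) (T nu) (FF mu (i - 1)) (Fil mu i) d fy" by (rule step_pres[OF mu nu i less.prems(3)])
 note pd = presD[OF p]
 have gk: "gm z = 0[N]" if "z : T nu" for z
 proof (rule trace_kill[OF up_sub(1) nu wN ghm_gsub_incl[OF pd(3) gm(1)] _ that])
  fix xi e si y assume a: "xi : up nu" "(e::int) > 0" "ghm (PP xi) (PP nu) e si" "y : cr (PP xi)"
  then have "xi : I" by simp
  from N3[OF this ghm_comp[OF a(3) gm(1)] a(4)] show "gm (si y) = 0[N]" using a(2) by auto
 qed
 have n0: "ghm (gsub (FF mu (i - 1)) (Fil mu i)) N (- d) (%x. 0[N])"
  by (rule ghm_null[OF gmod_wgm[OF gmod_gsub[OF pd(2,4)]] wN])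
 obtain h where h: "ghm (FF mu (i - 1)) N (- d) h" "ALL x:cr (PP nu). h (fy x) = gm x"
  using glue[OF p wN _ n0, of gm] gm(1) gk by auto
 \<comment> \<open>Minimality of \<open>j\<close> is the obstruction: no nonzero map of this degree
   exists one stage further up.\<close>
 let ?ex = "%j. EX h y. ghm (FF mu j) N (- d) h & y : Fil mu j & h y ~= 0[N]"
 have ex: "?ex (i - 1)" using h gm(2,3) ghm_closed[OF pd(5) gm(2)] by (intro exI[of _ h] exI[of _ "fy x"]) auto
 define j where "j = (LEAST j. ?ex j)"
 have exj: "?ex j" unfolding j_def by (rule LeastI[of ?ex, OF ex])
 have ji: "j <= i - 1" unfolding j_def by (rule Least_le[of ?ex, OF ex])
 obtain h y where h: "ghm (FF mu j) N (- d) h" "y : Fil mu j" "h y ~= 0[N]" using exj by blast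
 show ?case
 proof (cases "j = 0")
  case True
  have "FF mu j = PP mu" unfolding True fil_facts(1)[OF mu] by (rule gsub_all[OF gmod_wgm[OF gP]])
  then have "mu = nu & - d = 0" using N3[OF mu, of "- d" h y] h fil_facts(1)[OF mu] True by auto
  then show ?thesis by simp
 next
  case False
  have jl: "j : {1..len mu}" "j < i" "j - 1 < j" "j <= len mu" using False ji i by auto
  have nex: "~ ?ex (j - 1)" using not_less_Least[of "j - 1" ?ex] jl(3) unfolding j_def by blast
  have ne: "Fil mu (j - 1) ~= Fil mu j" using nex h by metis
  obtain ka e where ka: "ka : I" "label mu j ka e" using fil_facts(8)[OF mu jl(1) ne] by auto
  obtain fy' where p': "pres (PP ka) (T ka) (FF mu (j - 1)) (Fil mu j) e fy'" by (rule step_pres[OF mu ka(1) jl(1) ka(2)])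
  note pd' = presD[OF p']
  have FFj: "gsub (FF mu (j - 1)) (Fil mu j) = FF mu j" by (rule fil_facts(7)[OF mu jl(1)])
  have rp: "ghm (gsub (PP ka) (T ka)) (FF mu j) e fy'" using pres_restrict[OF p'] unfolding FFj .
  note hc = ghm_comp[OF rp h(1)]
  \<comment> \<open>If \<open>h\<close> pulled back to \<open>T ka\<close> were zero, it would glue
    with zero to a map on the previous stage. So some \<open>P_xi\<close> with \<open>xi\<close>
    strictly above \<open>ka\<close> maps nontrivially to \<open>N\<close>, which forces
    \<open>xi = nu\<close>.\<close>
  have "EX xi:up ka. xi = nu"
  proof (rule ccontr)
  assume no: "~ ?thesis"
  have z: "h (fy' x) = 0[N]" if "x : T ka" for x
  proof (rule trace_kill[OF up_sub(1) ka(1) wN hc _ that])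
  fix xi e' si y assume a: "xi : up ka" "(e'::int) > 0" "ghm (PP xi) (PP ka) e' si" "y : cr (PP xi)"
  have xi: "xi : I" using a(1) by simp
  have "ghm (PP xi) (gsub (PP ka) (T ka)) e' si"
  by (rule ghm_gsub_codom[OF a(3) _ gmod_wgm[OF gmod_Pmod[OF xi]]]) (rule trace_mem[OF up_sub(1) ka(1) a(1-3)])
  from N3[OF xi ghm_comp[OF this hc] a(4)] show "h (fy' (si y)) = 0[N]" using no a(1) by blast
  qed
  have nl: "ghm (PP ka) N (- d + e) (%x. 0[N])" by (rule ghm_null[OF gmod_wgm[OF pd'(1)] wN])
  obtain h' where "ghm (FF mu (j - 1)) N (- d) h'" "ALL z:Fil mu j. h' z = h z"
  using glue[OF p' wN nl, of h] z h(1) unfolding FFj by auto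
  then have "?ex (j - 1)" using h(2,3) fil_facts(4)[OF mu jl(1)] by (intro exI[of _ h'] exI[of _ y]) auto
  then show False using nex by blast
  qed
  then have "strict_in L ka nu" by auto
  then show ?thesis using less.IH[OF jl(2) ka(1) jl(1) ka(2)] strict_trans by auto
 qed
qed

end

section \<open>Counting homomorphisms along a filtration\<close>

context dihz
begin

lemma HS_full_zero:
 assumes M: "wgm M" and N: "wgm N" shows "vdim (HS M (cr M) N c) 0"
proof -
 have "cr (HS M (cr M) N c) = {0[HS M (cr M) N c]}"
 proof (intro equalityI subsetI)
  fix f assume "f : cr (HS M (cr M) N c)"
  then have "f : extensional (cr M)" "ALL z:cr M. f z = 0[N]" by (auto simp: ghom_iff)
  then have "f = (\<lambda>x\<in>cr M. 0[N])" by (intro extensionalityI[of f "cr M"]) auto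
  then show "f : {0[HS M (cr M) N c]}" by simp
 qed (use ghm_restrict[OF M ghm_null[OF M N]] in simp)
 then show ?thesis using vdim_zero[OF cvs_HS[OF M N subset_refl]] by blast
qed

text \<open>Rank-nullity for restriction from \<open>M\<close> to \<open>Z\<close>: the kernel is
  \<open>HS M Z N c\<close>, and equality means that every map on \<open>Z\<close> extends in this
  degree.\<close>

lemma vdim_HS_restrict:
 assumes M: "gmod M" and Z: "gsubm M Z" and N: "wgm N" and w: "vdim (HS (gsub M Z) {} N c) w" and k: "vdim (HS M Z N c) k"
 obtains v where "vdim (HS M {} N c) v" "v <= w + k"
  "v = w + k <-> (ALL f. ghm (gsub M Z) N c f --> (EX h. ghm M N c h & (ALL z:Z. h z = f z)))"
proof -
 note wM = gmod_wgm[OF M] and wZ = gmod_wgm[OF gmod_gsub[OF M Z]]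
 let ?V = "HS M {} N c" and ?W = "HS (gsub M Z) {} N c" and ?r = "%f. restrict f Z"
 have Zc: "z : cr M" if "z : Z" for z by (rule gsubm_carrier[OF Z that])
 have rh: "ghm M N c f ==> ?r f : cr ?W" for f using ghm_restrict[OF wZ ghm_gsub_incl[OF Z]] by simp
 have r: "clin ?V ?W ?r" unfolding clin_def using rh Zc by (auto simp: ghom_iff fun_eq_iff restrict_def)
 have "?V(|carrier := {x : cr ?V. ?r x = 0[?W]}|) = HS M Z N c"
 proof -
  have "?r f = (\<lambda>x\<in>Z. 0[N]) <-> (ALL z:Z. f z = 0[N])" for f by (auto simp: restrict_def fun_eq_iff)
  then show ?thesis unfolding HS_def by simp
 qed
 then have kk: "vdim (?V(|carrier := {x : cr ?V. ?r x = 0[?W]}|)) k" using k by simp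
 obtain v where v: "vdim ?V v" "v <= w + k" "v = w + k <-> ?r ` cr ?V = cr ?W"
  by (rule vdim_extension[OF cvs_HS[OF wM N] cvs_HS[OF wZ N] r w kk]) auto
 have "?r ` cr ?V = cr ?W <-> (ALL f. ghm (gsub M Z) N c f --> (EX h. ghm M N c h & (ALL z:Z. h z = f z)))"
 proof
  assume e: "?r ` cr ?V = cr ?W"
  show "ALL f. ghm (gsub M Z) N c f --> (EX h. ghm M N c h & (ALL z:Z. h z = f z))"
  proof (intro allI impI)
  fix f assume "ghm (gsub M Z) N c f"
  then have "restrict f Z : ?r ` cr ?V" unfolding e using ghm_restrict[OF wZ] by simp
  then obtain h where "ghm M N c h" "restrict f Z = ?r h" by (auto simp: ghom_iff)
  then show "EX h. ghm M N c h & (ALL z:Z. h z = f z)" by (metis restrict_apply')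
  qed
 next
  assume s: "ALL f. ghm (gsub M Z) N c f --> (EX h. ghm M N c h & (ALL z:Z. h z = f z))"
  show "?r ` cr ?V = cr ?W"
  proof (intro equalityI subsetI)
  fix f assume "f : cr ?W"
  then have f: "ghm (gsub M Z) N c f" "f : extensional Z" by (auto simp: ghom_iff)
  then obtain h where h: "ghm M N c h" "ALL z:Z. h z = f z" using s by blast
  have "f = ?r (restrict h (cr M))" using f(2) h(2) Zc by (intro extensionalityI[of f Z]) auto
  then show "f : ?r ` cr ?V" using ghm_restrict[OF wM h(1)] by (intro image_eqI) auto
  qed (use rh in \<open>auto simp: ghom_iff\<close>)
 qed
 then show ?thesis using that v by blast
qed

end

context tracefilt
begin

text \<open>The \<open>i = 0\<close> part of the orthogonality: the dimensions of the spaces of maps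
  from \<open>Ktilde\<close> of \<open>al\<close> to the dual of \<open>Kmod\<close> of
  \<open>nu\<close>.\<close>

definition hyp0 :: "irr => bool" where
 "hyp0 nu <-> (ALL al:I. ALL c. vdim (HS (PP al) (T al) (NN nu) c) (if al = nu & c = 0 then 1 else 0))"

abbreviation rsurj :: "irr => irr => nat => int => bool" where
 "rsurj mu nu i d == ALL f. ghm (FF mu i) (NN nu) (- d) f --> (EX h. ghm (FF mu (i - 1)) (NN nu) (- d) h & (ALL z:Fil mu i. h z = f z))"

abbreviation fmult :: "irr => irr => int => nat" where
 "fmult mu nu == filtration_mult R (PP mu) (len mu) (Fil mu) (KT nu)"

lemma wgm_NN: "nu : I ==> wgm (NN nu)" by (rule QQ_facts(6)[OF up_sub(2)])

lemma step_dim: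
 assumes h: "hyp0 nu" and mu: "mu : I" and nu: "nu : I" and i: "i : {1..len mu}"
 shows "vdim (HS (FF mu (i - 1)) (Fil mu i) (NN nu) (- d)) (if label mu i nu d then 1 else 0)"
proof (cases "label mu i nu d")
 case True
 obtain fy where "pres (PP nu) (T nu) (FF mu (i - 1)) (Fil mu i) d fy" by (rule step_pres[OF mu nu i True])
 moreover have "vdim (HS (PP nu) (T nu) (NN nu) 0) 1" using h[unfolded hyp0_def, rule_format, OF nu, of 0] by simp
 ultimately show ?thesis using vdim_HS_pres[of "PP nu" "T nu" _ _ d _ "NN nu" "- d" 1] wgm_NN[OF nu] True by auto
next
 case False
 have "i - 1 <= len mu" using i by auto
 note wF = gmod_wgm[OF fil_facts(5)[OF mu this]]
 show ?thesis
 proof (cases "Fil mu (i - 1) = Fil mu i")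
  case True
  then show ?thesis using HS_full_zero[OF wF wgm_NN[OF nu], of "- d"] False by simp
 next
  case ne: False
  obtain al e where al: "al : I" "label mu i al e" using fil_facts(8)[OF mu i ne] by auto
  obtain fy where p: "pres (PP al) (T al) (FF mu (i - 1)) (Fil mu i) e fy" by (rule step_pres[OF mu al(1) i al(2)])
  \<comment> \<open>A factor labelled \<open>(al, e)\<close> shifts the degree from
    \<open>-d\<close> to \<open>-d + e\<close>, so under \<open>hyp0\<close> only the label
    \<open>(nu, d)\<close> contributes.\<close>
  have "~ (al = nu & - d + e = 0)" using False al(2) by auto
  then have "vdim (HS (PP al) (T al) (NN nu) (- d + e)) 0" using h[unfolded hyp0_def, rule_format, OF al(1), of "- d + e"] by (simp only: if_False)
  then show ?thesis using vdim_HS_pres[OF p wgm_NN[OF nu], of "- d" 0] False by (simp only: if_False)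
 qed
qed

text \<open>Induction from the zero end of the filtration towards \<open>P_mu\<close>. Each step
  adds at most its own contribution, and adds all of it exactly when maps extend over it; the total
  is exact only if no step loses anything.\<close>

lemma chain_count:
 assumes h: "hyp0 nu" and mu: "mu : I" and nu: "nu : I" and j: "j <= len mu"
 shows "EX v. vdim (HS (FF mu j) {} (NN nu) (- d)) v & v <= card {i : {j + 1..len mu}. label mu i nu d} &
  (v = card {i : {j + 1..len mu}. label mu i nu d} <-> (ALL i:{j + 1..len mu}. rsurj mu nu i d))"
 using j
proof (induction j rule: inc_induct)
 case base
 note w = gmod_wgm[OF fil_facts(5)[OF mu le_refl]]
 have "HS (FF mu (len mu)) {} (NN nu) (- d) = HS (FF mu (len mu)) (cr (FF mu (len mu))) (NN nu) (- d)"
 proof -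
  have "f 0[PP mu] = 0[NN nu]" if "f : ghom R (FF mu (len mu)) (NN nu) (- d)" for f
  using ghm_zero[OF w wgm_NN[OF nu], of "- d" f] that by (simp add: ghom_iff)
  then show ?thesis unfolding HS_def using fil_facts(2)[OF mu] by auto
 qed
 then have "vdim (HS (FF mu (len mu)) {} (NN nu) (- d)) 0" using HS_full_zero[OF w wgm_NN[OF nu], of "- d"] by simp
 then show ?case by auto
next
 case (step j)
 have i: "Suc j : {1..len mu}" and j: "j <= len mu" using step by auto
 let ?C = "%j. {i : {j + 1..len mu}. label mu i nu d}"
 obtain w where w: "vdim (HS (FF mu (Suc j)) {} (NN nu) (- d)) w" "w <= card (?C (Suc j))"
  "w = card (?C (Suc j)) <-> (ALL i:{Suc j + 1..len mu}. rsurj mu nu i d)" using step.IH by blast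
 have k: "vdim (HS (FF mu j) (Fil mu (Suc j)) (NN nu) (- d)) (if label mu (Suc j) nu d then 1 else 0)"
  using step_dim[OF h mu nu i, of d] by simp
 have FFs: "gsub (FF mu j) (Fil mu (Suc j)) = FF mu (Suc j)" and gs: "gsubm (FF mu j) (Fil mu (Suc j))"
  using fil_facts(6,7)[OF mu i] by simp_all
 obtain v where v: "vdim (HS (FF mu j) {} (NN nu) (- d)) v" "v <= w + (if label mu (Suc j) nu d then 1 else 0)"
  "v = w + (if label mu (Suc j) nu d then 1 else 0) <-> rsurj mu nu (Suc j) d"
  using vdim_HS_restrict[OF fil_facts(5)[OF mu j] gs wgm_NN[OF nu] _ k, unfolded FFs, OF w(1)] by auto
 have C: "?C j = (if label mu (Suc j) nu d then insert (Suc j) (?C (Suc j)) else ?C (Suc j))"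
 proof -
  have "{j + 1..len mu} = insert (Suc j) {Suc j + 1..len mu}" using i by auto
  then show ?thesis by auto
 qed
 have c: "card (?C j) = card (?C (Suc j)) + (if label mu (Suc j) nu d then 1 else 0)" unfolding C by auto
 have "(ALL i:{j + 1..len mu}. rsurj mu nu i d) <-> rsurj mu nu (Suc j) d & (ALL i:{Suc j + 1..len mu}. rsurj mu nu i d)"
 proof -
  have "{j + 1..len mu} = insert (Suc j) {Suc j + 1..len mu}" using i by auto
  then have "(ALL i:{j + 1..len mu}. P i) <-> P (Suc j) & (ALL i:{Suc j + 1..len mu}. P i)" for P by auto
  then show ?thesis .
 qed
 also have "... <-> v = card (?C j)" unfolding c v(3)[symmetric] w(3)[symmetric] using v(2) w(2) by linarith
 finally show ?case using v(1,2) w(2) c by (intro exI[of _ v]) linarith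
qed

lemma vdim_gmult:
 assumes mu: "mu : I" and nu: "nu : I"
 shows "vdim (HS (PP mu) {} (NN nu) (- d)) (graded_mult n (Kmod n ze L nu) mu d)"
 unfolding Kmod_def using QQ_facts[OF up_sub(2) nu] 
 by (intro vdim_graded_mult[OF mu _ irr_rep_rep[OF rep_of_rep[OF nu]], folded Pmod_Pm, where pj = "proj (PP nu) (TT (upeq nu) nu)"]) (auto simp: Pmod_Pm)

text \<open>Both numbers are compared with the space of maps \<open>P_mu -> NN nu\<close> of degree
  \<open>-d\<close>: its dimension is \<open>graded_mult\<close>, and \<open>chain_count\<close> at
  stage 0 bounds it by \<open>fmult\<close>.\<close>

lemma mult_eq_iff:
 assumes h: "hyp0 nu" and mu: "mu : I" and nu: "nu : I"
 shows "fmult mu nu d = graded_mult n (Kmod n ze L nu) mu d <-> (ALL i:{1..len mu}. rsurj mu nu i d)"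
proof -
 have F0: "FF mu 0 = PP mu" unfolding fil_facts(1)[OF mu] by (rule gsub_all[OF gmod_wgm[OF gmod_Pmod[OF mu]]])
 obtain v where v: "vdim (HS (PP mu) {} (NN nu) (- d)) v" "v = fmult mu nu d <-> (ALL i:{1..len mu}. rsurj mu nu i d)"
  using chain_count[OF h mu nu le0, of d] unfolding F0 filtration_mult_def by auto
 have "cvs (HS (PP mu) {} (NN nu) (- d))" by (rule cvs_HS[OF gmod_wgm[OF gmod_Pmod[OF mu]] wgm_NN[OF nu]]) simp
 from vdim_unique[OF this v(1) vdim_gmult[OF mu nu]] show ?thesis using v(2) by auto
qed

lemma ext_imp_mult_eq:
 assumes h: "hyp0 nu" and mu: "mu : I" and nu: "nu : I" and e: "!!al. al : I ==> ext (PP al) (T al) (NN nu)"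
 shows "fmult mu nu = graded_mult n (Kmod n ze L nu) mu"
proof
 fix d
 have "rsurj mu nu i d" if i: "i : {1..len mu}" for i
 proof (cases "Fil mu (i - 1) = Fil mu i")
  case False
  obtain al e' where al: "al : I" "label mu i al e'" using fil_facts(8)[OF mu i False] by auto
  obtain fy where p: "pres (PP al) (T al) (FF mu (i - 1)) (Fil mu i) e' fy" by (rule step_pres[OF mu al(1) i al(2)])
  have "ext (FF mu (i - 1)) (Fil mu i) (NN nu)" by (rule ext_transfer[OF p wgm_NN[OF nu] e[OF al(1)]])
  then show ?thesis unfolding ext_def fil_facts(7)[OF mu i] by blast
 qed auto
 then show "fmult mu nu d = graded_mult n (Kmod n ze L nu) mu d" using mult_eq_iff[OF h mu nu] by blast
qed

text \<open>By \<open>first_step\<close> one of the steps is the pair of \<open>P_mu\<close> and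
  \<open>T mu\<close>, and extension over that step is the assertion.\<close>

lemma mult_eq_imp_ext:
 assumes h: "hyp0 nu" and mu: "mu : I" and nu: "nu : I" and e: "fmult mu nu = graded_mult n (Kmod n ze L nu) mu"
 shows "ext (PP mu) (T mu) (NN nu)"
proof -
 obtain i where i: "i : {1..len mu}" "Fil mu (i - 1) = cr (PP mu)" "Fil mu i = T mu" by (rule first_step[OF mu])
 have F: "FF mu (i - 1) = PP mu" unfolding i(2) by (rule gsub_all[OF gmod_wgm[OF gmod_Pmod[OF mu]]])
 show ?thesis unfolding ext_def
 proof (intro allI impI)
  fix c f assume f: "ghm (gsub (PP mu) (T mu)) (NN nu) c f"
  \<comment> \<open>Index \<open>d\<close> of a multiplicity belongs to maps of degree
    \<open>-d\<close>, so maps of degree \<open>c\<close> are read at \<open>-c\<close>.\<close>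
  have "rsurj mu nu i (- c)" using mult_eq_iff[OF h mu nu, of "- c"] e i(1) by simp
  from this[unfolded F i(3), rule_format, of f] f show "EX h. ghm (PP mu) (NN nu) c h & (ALL z:T mu. h z = f z)" by simp
 qed
qed

lemma mult_eq_imp_hyp0:
 assumes e: "!!mu. mu : I ==> fmult mu nu = graded_mult n (Kmod n ze L nu) mu" and nu: "nu : I"
 shows "hyp0 nu"
 unfolding hyp0_def
proof (intro ballI allI)
 fix al c assume al: "al : I"
 let ?V = "HS (PP al) (T al) (NN nu) c"
 note wA = gmod_wgm[OF gmod_Pmod[OF al]] and wN = wgm_NN[OF nu]
 note cV = cvs_HS[OF wA wN trace_carrier[OF up_sub(1) al], of al c]
 show "vdim ?V (if al = nu & c = 0 then 1 else 0)"
 proof (cases "al = nu & c = 0")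
  case True
  \<comment> \<open>Composing a degree 0 map with a map of positive degree gives a map of positive
    degree into a dual, which \<open>hom_dual_QQ\<close> forces to be zero. So the whole line of
    degree 0 maps kills \<open>T nu\<close>.\<close>
  have "f z = 0[NN nu]" if f: "ghm (PP nu) (NN nu) 0 f" and z: "z : T nu" for f z
  proof (rule trace_kill[OF up_sub(1) nu wN ghm_gsub_incl[OF gsubm_trace[OF up_sub(1) nu] f] _ z])
  fix xi e' si y assume a: "xi : up nu" "(e'::int) > 0" "ghm (PP xi) (PP nu) e' si" "y : cr (PP xi)"
  then have "xi : I" by simp
  from hom_dual_QQ[OF up_sub(2) nu this ghm_comp[OF a(3) f] a(4)] show "f (si y) = 0[NN nu]" using a(2) by auto
  qed
  then have "HS (PP nu) (T nu) (NN nu) 0 = HS (PP nu) {} (NN nu) 0" unfolding HS_def by (auto simp: ghom_iff)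
  moreover have "vdim (HS (PP nu) {} (NN nu) 0) 1" by (rule dual_QQ_hom[OF up_sub(2) nu])
  ultimately show ?thesis using True by simp
 next
  case False
  have "f x = 0[NN nu]" if f: "ghm (PP al) (NN nu) c f" "ALL z:T al. f z = 0[NN nu]" and x: "x : cr (PP al)" for f x
  proof (rule ccontr)
  assume nz: "f x ~= 0[NN nu]"
  obtain si y where c: "c < 0" and si: "ghm (PP nu) (PP al) (- c) si" "y : cr (PP nu)" "f (si y) ~= 0[NN nu]"
  using hom_dual_QQ[OF up_sub(2) nu al f(1) x nz] False by blast
  have nup: "~ strict_in L al nu"
  proof
  assume "strict_in L al nu"
  then have "si y : T al" using trace_mem[OF up_sub(1) al _ _ si(1,2)] nu c by simp
  then show False using f(2) si(3) by blast
  qed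
  \<comment> \<open>By reflexivity \<open>nu\<close> lies in \<open>upeq nu\<close>, and for members
    of this set only degree 0 is possible.\<close>
  have "al ~= nu" using hom_dual_QQ_mem[OF up_sub(2) nu _ f(1) x nz] False L nu unfolding preorder_on_def refl_on_def by auto
  have vd: "vdim (HS (PP al) {} (NN nu) c) (fmult al nu (- c))" using vdim_gmult[OF al nu, of "- c"] e[OF al] by simp
  have cv: "cvs (HS (PP al) {} (NN nu) c)" by (rule cvs_HS[OF wA wN]) simp
  have rf: "restrict f (cr (PP al)) : cr (HS (PP al) {} (NN nu) c)" using ghm_restrict[OF wA f(1)] by simp
  \<comment> \<open>The assumed equality of multiplicities turns the nonzero map into a factor of
    \<open>P_al\<close> labelled \<open>nu\<close>. By \<open>step_label\<close> this puts
    \<open>nu\<close> strictly above \<open>al\<close> or equal to it, both already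
    excluded.\<close>
  have "fmult al nu (- c) ~= 0"
  proof
  assume "fmult al nu (- c) = 0"
  then have "restrict f (cr (PP al)) = (\<lambda>x\<in>cr (PP al). 0[NN nu])" using vd vdim_zero[OF cv] rf by auto
  then have "restrict f (cr (PP al)) x = (\<lambda>x\<in>cr (PP al). 0[NN nu]) x" by simp
  then show False using x nz by simp
  qed
  then obtain i where "i : {1..len al}" "label al i nu (- c)" unfolding filtration_mult_def by (auto simp: card_eq_0_iff)
  from step_label[OF al nu this] show False using nup \<open>al ~= nu\<close> by auto
  qed
  then have z: "f x = 0[NN nu]" if "f : cr ?V" "x : cr (PP al)" for f x
  using that unfolding HS_simps ghom_iff by blast
  have "f = 0[?V]" if f: "f : cr ?V" for f
  by (rule extensionalityI[of _ "cr (PP al)"]) (use f z[OF f] in \<open>simp_all only: HS_simps ghom_iff mem_Collect_eq restrict_extensional restrict_apply' simp_thms\<close>)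
  then have "cr ?V <= {0[?V]}" by blast
  moreover have "0[?V] : cr ?V" using lmod.axioms(2)[OF cV] by (meson abelian_group.axioms(1) abelian_monoid.zero_closed)
  ultimately show ?thesis using False vdim_zero[OF cV] by auto
 qed
qed

theorem mult_eq_iff_ext:
 "(ALL nu:I. hyp0 nu & (ALL al:I. ext (PP al) (T al) (NN nu))) <-> (ALL nu:I. ALL mu:I. fmult mu nu = graded_mult n (Kmod n ze L nu) mu)"
proof
 assume "ALL nu:I. hyp0 nu & (ALL al:I. ext (PP al) (T al) (NN nu))"
 then show "ALL nu:I. ALL mu:I. fmult mu nu = graded_mult n (Kmod n ze L nu) mu" using ext_imp_mult_eq by blast
next
 assume e: "ALL nu:I. ALL mu:I. fmult mu nu = graded_mult n (Kmod n ze L nu) mu"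
 then have "hyp0 nu" if "nu : I" for nu using mult_eq_imp_hyp0 that by blast
 then show "ALL nu:I. hyp0 nu & (ALL al:I. ext (PP al) (T al) (NN nu))" using mult_eq_imp_ext e by blast
qed

end

section \<open>Resolutions\<close>

context abelian_group
begin

lemma sub_add: "x : cr G ==> y : cr G ==> (x \<ominus> y) \<oplus> y = x"
 unfolding a_minus_def by (simp add: a_assoc l_neg)

lemma sub_self: "x : cr G ==> x \<ominus> x = \<zero>"
 unfolding a_minus_def by (rule r_neg)

end

context gring
begin

lemma ext_trans:
 assumes "gsubm M B" "C <= B" "ext (gsub M B) C N" "ext M B N"
 shows "ext M C N"
 unfolding ext_def
proof (intro allI impI)
 fix d f assume "ghm (gsub M C) N d f"
 then obtain g where g: "ghm (gsub M B) N d g" "ALL z:C. g z = f z" using assms(3) unfolding ext_def gsub_gsub[OF assms(2)] by blast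
 then obtain h where "ghm M N d h" "ALL z:B. h z = g z" using assms(4) unfolding ext_def by blast
 then show "EX h. ghm M N d h & (ALL z:C. h z = f z)" using g(2) assms(2) by (intro exI[of _ h]) auto
qed

lemma ghm_onto_gsub: "ghm M N d f ==> wgm M ==> f ` cr M = Z ==> ghm M (gsub N Z) d f"
 by (rule ghm_gsub_codom) auto

end

context dihz
begin


lemma ghm_sub:
 assumes M: "wgm M" and N: "wgm N" and f: "ghm M N d f" and g: "ghm M N d g"
 shows "ghm M N d (%x. f x -[N] g x)"
proof -
 have lN: "lmod R N" using N wgm_lmod by auto
 interpret N: lmod R N by (rule lN)
 have e: "-[N] y = cscale N (- 1) y" if "y : cr N" for y
 proof (rule N.M.minus_equality)
  show "cscale N (- 1) y +[N] y = 0[N]"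
  using cscale_simps(2)[OF lN that, of "- 1" 1] cscale_simps(5)[OF lN that] that by (simp add: cscale_def tensor_zero)
 qed (use that cscale_simps(1)[OF lN that] in auto)
 show ?thesis
  by (rule ghm_cong[OF M ghm_plus[OF M N f ghm_scale[OF M N g, of "- 1"]]]) (simp add: a_minus_def e ghm_closed[OF g])
qed

text \<open>Inclusion of the second summand of \<open>G (ds @ es)\<close> and the two projections.
  Tuples are zero beyond their length, so the inclusion of the first summand is the
  identity.\<close>

definition i2 :: "nat => (nat => A) => nat => A" where "i2 l x = (%j. if j < l then 0[R] else x (j - l))"
definition p1 :: "nat => (nat => A) => nat => A" where "p1 l x = (%j. if j < l then x j else 0[R])"
definition p2 :: "nat => (nat => A) => nat => A" where "p2 l x = (%j. x (j + l))"

lemma zero_skew_gr: "0[R] : skew_gr n i" unfolding skew_gr_iff by (simp add: R_zero R_carrier)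

lemma append_homs:
 "ghm (G ds) (G (ds @ es)) 0 (%x. x)" "ghm (G es) (G (ds @ es)) 0 (i2 (length ds))"
 "ghm (G (ds @ es)) (G ds) 0 (p1 (length ds))" "ghm (G (ds @ es)) (G es) 0 (p2 (length ds))"
 "x : cr (G ds) ==> p1 (length ds) x = x" "x : cr (G ds) ==> p2 (length ds) x = 0[G es]"
 "y : cr (G es) ==> p1 (length ds) (i2 (length ds) y) = 0[G ds]" "y : cr (G es) ==> p2 (length ds) (i2 (length ds) y) = y"
 "z : cr (G (ds @ es)) ==> z = p1 (length ds) z +[G (ds @ es)] i2 (length ds) (p2 (length ds) z)"
proof -
 show "ghm (G ds) (G (ds @ es)) 0 (%x. x)"
 proof (rule ghmI)
  show "x : cr (G (ds @ es))" if "x : cr (G ds)" for x using gfree_comp_carrier[OF that] that by auto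
 qed (auto simp: nth_append zero_skew_gr)
 show "ghm (G es) (G (ds @ es)) 0 (i2 (length ds))"
  by (rule ghmI) (auto simp: i2_def nth_append zero_skew_gr fun_eq_iff)
 show "ghm (G (ds @ es)) (G ds) 0 (p1 (length ds))"
 proof (rule ghmI)
  fix i x assume x: "x : gr (G (ds @ es)) i"
  have "x j : skew_gr n (i - ds ! j)" if "j < length ds" for j
  using x that by (auto simp: nth_append dest: spec[of _ j])
  then show "p1 (length ds) x : gr (G ds) (i + 0)" by (auto simp: p1_def)
 qed (auto simp: p1_def fun_eq_iff)
 show "ghm (G (ds @ es)) (G es) 0 (p2 (length ds))"
 proof (rule ghmI)
  fix i x assume x: "x : gr (G (ds @ es)) i"
  have "x (j + length ds) : skew_gr n (i - es ! j)" if "j < length es" for j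
  using x that by (auto simp: nth_append dest: spec[of _ "j + length ds"])
  then show "p2 (length ds) x : gr (G es) (i + 0)" using x by (auto simp: p2_def)
 qed (auto simp: p2_def fun_eq_iff)
 show "z = p1 (length ds) z +[G (ds @ es)] i2 (length ds) (p2 (length ds) z)" if "z : cr (G (ds @ es))"
  using gfree_comp_carrier[OF that] by (auto simp: p1_def p2_def i2_def fun_eq_iff)
qed (auto simp: p1_def p2_def i2_def fun_eq_iff)

declare gfree_simps [simp del]

text \<open>The projective modules used below are retracts of free modules.\<close>

definition psum :: "int list => (nat => A) set => ((nat => A) => nat => A) => bool" where
 "psum ds X r <-> gsubm (G ds) X & ghm (G ds) (G ds) 0 r & (ALL x:cr (G ds). r x : X) & (ALL x:X. r x = x)"

lemma psumD:
 assumes "psum ds X r"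
 shows "gsubm (G ds) X" "gmod (gsub (G ds) X)" "ghm (G ds) (gsub (G ds) X) 0 r" "x : X ==> r x = x" "x : X ==> x : cr (G ds)"
  "x : cr (G ds) ==> r x : X"
proof -
 show g: "gsubm (G ds) X" using assms unfolding psum_def by auto
 show "gmod (gsub (G ds) X)" by (rule gmod_gsub[OF gmod_gfree g])
 show "ghm (G ds) (gsub (G ds) X) 0 r"
  by (rule ghm_gsub_codom[OF _ _ gmod_wgm[OF gmod_gfree]]) (use assms in \<open>auto simp only: psum_def\<close>)
 show "x : X ==> x : cr (G ds)" by (rule gsubm_carrier[OF g])
qed (use assms in \<open>auto simp only: psum_def\<close>)

text \<open>The generators are placed in degree \<open>e\<close> so that \<open>s\<close> has degree
  \<open>e\<close>, the degree of the presentation it is combined with; \<open>s\<close> splits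
  \<open>c\<close> by projectivity of \<open>Pm m rx\<close>.\<close>

lemma Pm_cover:
 assumes rx: "rep m rx"
 obtains c s where "ghm (G (replicate m e)) (Pm m rx) (- e) c" "ghm (Pm m rx) (G (replicate m e)) e s"
  "ALL x:cr (Pm m rx). c (s x) = x"
proof -
 note gP = gmod_Pm[OF rx]
 obtain c where c: "ghm (G (replicate m e)) (Pm m rx) (- e) c" "ALL j<length (replicate m e). c (eb j) = eP m j"
  by (rule gfree_hom[OF gmod_wgm[OF gP], of "replicate m e" "%j. eP m j" "- e"]) (use eP_gr[of m] in auto)
 have id: "ghm (Pm m rx) (Pm m rx) 0 (%x. x)" by (rule ghmI) auto
 have im: "eP m j : c ` cr (G (replicate m e))" if "j < m" for j
  using c(2) that gr_carrier[OF gmod_wgm[OF gmod_gfree] eb_gr, of j "replicate m e"] by (intro image_eqI[of _ _ "eb j"]) auto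
 obtain s where "ghm (Pm m rx) (G (replicate m e)) (0 - (- e)) s" "ALL x:cV m. c (s x) = x"
  by (rule Pm_lift[OF rx gmod_gfree gP c(1) id im])
 then show ?thesis using that c(1) by simp
qed

end

section \<open>Filtered submodules and their covers\<close>

context tracefilt
begin

text \<open>\<open>Z\<close> has a finite filtration by shifts of the \<open>Ktilde\<close> modules
  inside the fixed module \<open>M\<close>. Each step is recorded by a presentation through
  \<open>P_al\<close> instead of an isomorphism of its factor.\<close>

inductive good :: "(A, 'b) gmodule => 'b set => bool" for M where
 good_zero: "gmod M ==> good M {0[M]}"
| good_step: "gsubm M Z ==> Z' <= Z ==> good M Z' ==> al : I ==> pres (PP al) (T al) (gsub M Z) Z' e fy ==> good M Z"

lemma good_gmod: "good M Z ==> gmod M" by (induction rule: good.induct)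
lemma good_gsubm: "good M Z ==> gsubm M Z" by (induction rule: good.induct) (simp_all add: gsubm_triv)

lemma good_Fil:
 assumes mu: "mu : I" and j: "j <= len mu"
 shows "good (PP mu) (Fil mu j)"
 using j
proof (induction j rule: inc_induct)
 case base
 show ?case unfolding fil_facts(2)[OF mu] by (intro good_zero gmod_Pmod mu)
next
 case (step j)
 have i: "Suc j : {1..len mu}" "j <= len mu" using step by auto
 show ?case
 proof (cases "Fil mu j = Fil mu (Suc j)")
  case False
  obtain al e where al: "al : I" "label mu (Suc j) al e" using fil_facts(8)[OF mu i(1)] False by auto
  obtain fy where "pres (PP al) (T al) (FF mu (Suc j - 1)) (Fil mu (Suc j)) e fy" by (rule step_pres[OF mu al(1) i(1) al(2)])
  then have "pres (PP al) (T al) (FF mu j) (Fil mu (Suc j)) e fy" by simp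
  from good_step[OF fil_facts(3)[OF mu i(2)] _ step.IH al(1) this] show ?thesis
  using fil_facts(4)[OF mu i(1)] by simp
 qed (use step in simp)
qed

text \<open>\<open>T al\<close> is itself a step of the filtration of \<open>P_al\<close>, so the
  rest of that filtration serves. This lets the covering argument be iterated on kernels.\<close>

lemma good_T: assumes al: "al : I" shows "good (PP al) (T al)"
proof -
 obtain i where "i : {1..len al}" "Fil al i = T al" by (rule first_step[OF al])
 then show ?thesis using good_Fil[OF al, of i] by simp
qed

lemma good_Ktilde: assumes al: "al : I" shows "good (QQ (up al) al) (cr (QQ (up al) al))"
proof -
 note g = QQ_facts(1)[OF up_sub(1)[of al] al]
 note p = pres_proj[OF gmod_Pmod[OF al] gsubm_trace[OF up_sub(1)[of al] al]]
 show ?thesis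
  by (rule good_step[OF gsubm_all[OF g] _ good_zero[OF g] al, unfolded gsub_all[OF gmod_wgm[OF g]], OF _ p])
  (use gsubm_carrier[OF gsubm_triv[OF g]] in auto)
qed

text \<open>The filtration of the image \<open>Z1\<close> is pulled back along \<open>rx\<close> and
  continued by that of the kernel; projectivity lifts the presentation of each step.\<close>

lemma good_extension:
 assumes "good M' Z1" and F: "gmod F" and "gsubm F Y" and "ghm (gsub F Y) M' d rx" and "rx ` Y = Z1"
  and "good F {y : Y. rx y = 0[M']}"
 shows "good F Y"
 using assms(1,3-6)
proof (induction arbitrary: Y rule: good.induct)
 case good_zero
 then have "{y : Y. rx y = 0[M']} = Y" by auto
 then show ?case using good_zero by simp
next
 case (good_step Z Z' al e fy)
 note Y = good_step.prems(1) and rx = good_step.prems(2) and im = good_step.prems(3) and k = good_step.prems(4)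
 have M': "gmod M'" by (rule good_gmod[OF good_step.hyps(3)])
 note gY = gmod_gsub[OF F Y] and pd = presD[OF good_step.hyps(5)] and gZ' = good_gsubm[OF good_step.hyps(3)]
 define Y' where "Y' = {y : cr (gsub F Y). rx y : Z'}"
 have gY': "gsubm (gsub F Y) Y'" unfolding Y'_def by (rule gsubm_vimage[OF gY M' rx gZ'])
 have sub: "Y' <= Y" unfolding Y'_def by auto
 have g': "gsubm F Y'" using gsubm_gsub[OF F Y sub] gY' by simp
 have "ghm (gsub (gsub F Y) Y') M' d rx" by (rule ghm_gsub_incl[OF gY' rx])
 then have r': "ghm (gsub F Y') M' d rx" unfolding gsub_gsub[OF sub] .
 have "{y : Y'. rx y = 0[M']} = {y : Y. rx y = 0[M']}" using gsubm_zero[OF gZ'] unfolding Y'_def by auto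
 moreover have "rx ` Y' = Z'" using im good_step.hyps(2) unfolding Y'_def by auto
 ultimately have gd: "good F Y'" using good_step.IH[OF g' r'] k by simp
 have rxZ: "ghm (gsub F Y) (gsub M' Z) d rx" by (rule ghm_onto_gsub[OF rx gmod_wgm[OF gY]]) (simp add: im)
 have p2: "pres (gsub F Y) Y' (gsub M' Z) Z' d rx"
  unfolding pres_def
 proof (intro conjI gY gY' rxZ pd ballI)
  interpret Z: lmod R "gsub M' Z" by (rule gmod_lmod[OF pd(2)])
  show "EX x:cr (gsub F Y). EX z:Z'. y = rx x +[gsub M' Z] z" if yZ: "y : cr (gsub M' Z)" for y
  proof -
  obtain x where "x : Y" "y = rx x" using yZ im by auto
  then show ?thesis using Z.M.r_zero[OF yZ] gsubm_zero[OF gZ'] by (intro bexI[of _ x] bexI[of _ "0[M']"]) auto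
  qed
 qed (auto simp: Y'_def)
 define m so where "m = rep_deg (rep_of al)" and "so = rep_of al"
 have PA: "PP al = Pm m so" unfolding m_def so_def Pmod_Pm ..
 have so: "rep m so" unfolding m_def so_def by (rule irr_rep_rep[OF rep_of_rep[OF good_step.hyps(4)]])
 have "fy (eP m j) : rx ` cr (gsub F Y)" for j
  using ghm_closed[OF pd(5), of "eP m j"] im by (simp add: PA)
 then obtain g where "ghm (Pm m so) (gsub F Y) (e - d) g" "ALL x:cV m. rx (g x) = fy x"
  by (rule Pm_lift[OF so gY pd(2) rxZ pd(5)[unfolded PA]])
 then have "pres (PP al) (T al) (gsub F Y) Y' (e - d) g"
  by (intro pres_compare[OF good_step.hyps(5) p2]) (simp_all add: PA)
 from good.good_step[OF Y sub gd good_step.hyps(4) this] show ?case .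
qed

text \<open>The assumption that all pairs of \<open>P_al\<close> and \<open>T al\<close> have the
  extension property into \<open>NN mu\<close> is part of the predicate, so that a cover can be
  chosen before \<open>mu\<close> is fixed.\<close>

definition EXT :: "(A, 'b) gmodule => 'b set => bool" where
 "EXT M Z <-> (ALL mu:I. (ALL al:I. ext (PP al) (T al) (NN mu)) --> ext M Z (NN mu))"

lemma EXT_transfer:
 assumes "pres M1 Z1 M2 Z2 e fy" "EXT M1 Z1" shows "EXT M2 Z2"
 using assms(2) ext_transfer[OF assms(1) wgm_NN] unfolding EXT_def by blast

lemma EXT_trans:
 assumes "gsubm M B" "C <= B" "EXT (gsub M B) C" "EXT M B" shows "EXT M C"
 using assms(3,4) ext_trans[OF assms(1,2)] unfolding EXT_def by blast

lemma EXT_T: "al : I ==> EXT (PP al) (T al)" unfolding EXT_def by blast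

text \<open>The horseshoe construction: a cover of \<open>Z'\<close> and the cover of \<open>P\<^sub>\<alpha>\<close> by a free module are added up.  The kernel \<open>K\<close>
  is an extension of \<open>T\<^sub>\<alpha>\<close>, and \<open>B\<close> is the preimage of \<open>T\<^sub>\<alpha>\<close>.\<close>

lemma good_cover:
 assumes "good M Z"
 shows "EX ds X r eps. psum ds X r & ghm (gsub (G ds) X) M 0 eps & eps ` X = Z &
  good (G ds) {x : X. eps x = 0[M]} & EXT (gsub (G ds) X) {x : X. eps x = 0[M]}"
 using assms
proof (induction rule: good.induct)
 case good_zero
 let ?X = "{0[G []]}"
 have X: "psum [] ?X (%x. x)" unfolding psum_def using gsubm_triv[OF gmod_gfree] by (auto intro!: ghmI simp: gfree_simps)
 note wX = gmod_wgm[OF psumD(2)[OF X]]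
 have "ext (gsub (G []) ?X) ?X N" for N :: "(A, S vec set => complex) gmodule"
  unfolding ext_def gsub_gsub[OF subset_refl] by blast
 then have "EXT (gsub (G []) ?X) {x : ?X. 0[M] = 0[M]}" unfolding EXT_def by simp
 moreover have "good (G []) {x : ?X. 0[M] = 0[M]}" using good.good_zero[OF gmod_gfree, of "[]"] by simp
 ultimately show ?case using X ghm_null[OF wX gmod_wgm[OF good_zero], of 0]
  by (intro exI[of _ "[]"] exI[of _ ?X] exI[of _ "%x. x"] exI[of _ "%x. 0[M]"]) simp
next
 case (good_step Z Z' al e fy)
 obtain ds X1 r1 eps1 where IH: "psum ds X1 r1" "ghm (gsub (G ds) X1) M 0 eps1" "eps1 ` X1 = Z'"
  "good (G ds) {x : X1. eps1 x = 0[M]}" "EXT (gsub (G ds) X1) {x : X1. eps1 x = 0[M]}"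
  using good_step.IH by blast
 note gM = good_gmod[OF good_step.hyps(3)] and gZ = good_step.hyps(1) and gZ' = good_gsubm[OF good_step.hyps(3)]
 note al = good_step.hyps(4) and p = good_step.hyps(5)
 note pd = presD[OF p] and wM = gmod_wgm[OF gM] and X1 = psumD[OF IH(1)]
 interpret M: lmod R M by (rule gmod_lmod[OF gM])
 define m where "m = rep_deg (rep_of al)"
 have PA: "PP al = Pm m (rep_of al)" unfolding m_def Pmod_Pm ..
 define es where "es = replicate m e"
 obtain c s where c: "ghm (G es) (PP al) (- e) c" and s: "ghm (PP al) (G es) e s" and cs: "ALL x:cr (PP al). c (s x) = x"
  unfolding es_def PA by (rule Pm_cover) (use irr_rep_rep[OF rep_of_rep[OF al]] m_def in auto)
 define l F q1 q2 j2 where "l = length ds" and "F = G (ds @ es)" and "q1 = p1 l" and "q2 = p2 l" and "j2 = i2 l"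
 note A = append_homs(1-4)[where ds = ds and es = es, folded l_def, folded q1_def q2_def j2_def F_def]
  append_homs(5)[where ds = ds, folded l_def, folded q1_def] append_homs(6-9)[where ds = ds and es = es, folded l_def, folded q1_def q2_def j2_def F_def]
 have gF: "gmod F" and gE: "gmod (G es)" and gD: "gmod (G ds)" unfolding F_def by (rule gmod_gfree)+
 note wF = gmod_wgm[OF gF] and wE = gmod_wgm[OF gE] and wD = gmod_wgm[OF gD] and wP = gmod_wgm[OF pd(1)]
 interpret F: lmod R F by (rule gmod_lmod[OF gF])
 interpret P: lmod R "PP al" by (rule gmod_lmod[OF pd(1)])
 have i1: "ghm (G ds) F 0 (%x. x)" and j2: "ghm (G es) F 0 j2" and q1: "ghm F (G ds) 0 q1" and q2: "ghm F (G es) 0 q2" by (fact A(1-4))+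
 have q2x: "q2 x = 0[G es]" and q1x: "q1 x = x" if "x : cr (G ds)" for x by (fact A(6)[OF that] A(5)[OF that])+
 have q1y: "q1 (j2 y) = 0[G ds]" and q2y: "q2 (j2 y) = y" if "y : cr (G es)" for y by (fact A(7,8)[OF that])+
 have split: "z = q1 z +[F] j2 (q2 z)" if "z : cr F" for z using A(9)[OF that] .
 have cq: "ghm F (PP al) (- e) (%x. c (q2 x))" using ghm_comp[OF q2 c] by simp
 have t: "ghm F (G es) 0 (%x. s (c (q2 x)))" using ghm_comp[OF cq s] by simp
 have js: "ghm (PP al) F e (%x. j2 (s x))" using ghm_comp[OF s j2] by simp
 have c0: "c 0[G es] = 0[PP al]" and s0: "s 0[PP al] = 0[G es]" and j0: "j2 0[G es] = 0[F]"
  using ghm_zero[OF wE wP c] ghm_zero[OF wP wE s] ghm_zero[OF wE wF j2] by auto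
 have zE: "0[G es] : cr (G es)" and zD: "0[G ds] : cr (G ds)"
  using gr_carrier[OF wE gr_zero[OF wE]] gr_carrier[OF wD gr_zero[OF wD]] by auto
 \<comment> \<open>\<open>X\<close> is the sum of the old retract \<open>X1\<close> and of the copy
   \<open>s\<close> of \<open>P_al\<close> inside the second free summand; \<open>r\<close> retracts
   \<open>F\<close> onto it.\<close>
 define X where "X = {x : cr F. q1 x : X1 & s (c (q2 x)) = q2 x}"
 define r where "r x = r1 (q1 x) +[F] j2 (s (c (q2 x)))" for x
 have Xc: "x : cr F" "q1 x : X1" "s (c (q2 x)) = q2 x" if "x : X" for x using that unfolding X_def by auto
 have gX1: "ghm (gsub (G ds) X1) F 0 (%x. x)" by (rule ghm_gsub_incl[OF X1(1) i1])
 have r1': "ghm (G ds) F 0 r1" using ghm_comp[OF X1(3) gX1] by simp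
 have r: "ghm F F 0 r" unfolding r_def
  using ghm_plus[OF wF wF ghm_comp[OF q1 r1', simplified] ghm_comp[OF t j2, simplified]] by simp
 have rX: "r x : X" if x: "x : cr F" for x
 proof -
  have a: "r1 (q1 x) : X1" by (rule X1(6)[OF ghm_closed[OF q1 x]])
  then have a': "r1 (q1 x) : cr (G ds)" "r1 (q1 x) : cr F" using X1(5) ghm_closed[OF i1] by auto
  have b: "s (c (q2 x)) : cr (G es)" by (rule ghm_closed[OF t x])
  have b': "j2 (s (c (q2 x))) : cr F" by (rule ghm_closed[OF j2 b])
  have e1: "q1 (r x) = r1 (q1 x)" unfolding r_def
  using ghm_add[OF q1 a'(2) b'] q1x[OF a'(1)] q1y[OF b] lmod.axioms(2)[OF gmod_lmod[OF gD]] a'(1) by (simp add: abelian_monoid.r_zero[OF abelian_group.axioms(1)])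
  have e2: "q2 (r x) = s (c (q2 x))" unfolding r_def
  using ghm_add[OF q2 a'(2) b'] q2x[OF a'(1)] q2y[OF b] lmod.axioms(2)[OF gmod_lmod[OF gE]] b by (simp add: abelian_monoid.l_zero[OF abelian_group.axioms(1)])
  have "c (s (c (q2 x))) = c (q2 x)" using cs ghm_closed[OF cq x] by blast
  then show ?thesis unfolding X_def using e1 e2 a ghm_closed[OF r x] by simp
 qed
 have rid: "r x = x" if x: "x : X" for x
  unfolding r_def Xc(3)[OF x] X1(4)[OF Xc(2)[OF x]] using split[OF Xc(1)[OF x]] by simp
 have "gsubm F X"
 proof -
  have e: "X = {x : cr F. r x -[F] x : {0[F]}}"
  proof (intro equalityI subsetI)
  fix x assume x: "x : {x : cr F. r x -[F] x : {0[F]}}"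
  then have "r x = x" using F.M.sub_add[OF ghm_closed[OF r, of x], of x] by auto
  then show "x : X" using rX[of x] x by simp
  qed (use rid Xc(1) F.M.sub_self in auto)
  have h: "ghm F F 0 (%x. r x -[F] x)" by (rule ghm_sub[OF wF wF r]) (rule ghmI, auto)
  show ?thesis by (subst e) (rule gsubm_vimage[OF gF gF h gsubm_triv[OF gF]])
 qed
 then have ps: "psum (ds @ es) X r" unfolding psum_def using r rX rid unfolding F_def by blast
 note Xp = psumD[OF ps, folded F_def]
 have iX: "x : X" if "x : X1" for x
  using that X1(5)[OF that] ghm_closed[OF i1 X1(5)[OF that]] q1x[OF X1(5)[OF that]] q2x[OF X1(5)[OF that]] c0 s0 unfolding X_def by simp
 have jX: "j2 (s u) : X" if u: "u : cr (PP al)" for u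
  using q1y[OF ghm_closed[OF s u]] q2y[OF ghm_closed[OF s u]] cs u ghm_closed[OF js u] gsubm_zero[OF X1(1)] unfolding X_def by simp
 have q1X: "ghm (gsub F X) (gsub (G ds) X1) 0 q1"
  by (rule ghm_gsub_codom[OF ghm_gsub_incl[OF Xp(1) q1] _ gmod_wgm[OF Xp(2)]]) (use Xc in simp)
 have cX: "ghm (gsub F X) (PP al) (- e) (%x. c (q2 x))" by (rule ghm_gsub_incl[OF Xp(1) cq])
 have fyM: "ghm (PP al) M e fy" by (rule ghm_codom_incl[OF pd(5) gZ])
 \<comment> \<open>The old cover takes care of \<open>Z'\<close>, and \<open>fy\<close> reaches the
   rest of \<open>Z\<close> modulo \<open>Z'\<close>.\<close>
 define eps where "eps x = eps1 (q1 x) +[M] fy (c (q2 x))" for x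
 have eps: "ghm (gsub F X) M 0 eps" unfolding eps_def
  using ghm_plus[OF gmod_wgm[OF Xp(2)] wM ghm_comp[OF q1X IH(2), simplified] ghm_comp[OF cX fyM, simplified]] by simp
 have e1Z: "eps1 x : Z'" if "x : X1" for x using IH(3) that by auto
 have fyZ: "fy u : Z" if "u : cr (PP al)" for u using ghm_closed[OF pd(5) that] by simp
 have Zc: "z : cr M" if "z : Z" for z by (rule gsubm_carrier[OF gZ that])
 have Z'Z: "z : Z" if "z : Z'" for z using that good_step.hyps(2) by auto
 have epsi: "eps x = eps1 x" if x: "x : X1" for x
  using q1x[OF X1(5)[OF x]] q2x[OF X1(5)[OF x]] c0 ghm_zero[OF wP wM fyM] Zc[OF Z'Z[OF e1Z[OF x]]] unfolding eps_def by simp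
 have epsj: "eps (j2 (s u)) = fy u" if u: "u : cr (PP al)" for u
  using q1y[OF ghm_closed[OF s u]] q2y[OF ghm_closed[OF s u]] cs u ghm_zero[OF gmod_wgm[OF X1(2)] wM IH(2)] Zc[OF fyZ[OF u]] unfolding eps_def by simp
 have im: "eps ` X = Z"
 proof (intro equalityI subsetI)
  fix y assume "y : eps ` X"
  then obtain x where x: "x : X" "y = eps x" by auto
  show "y : Z" unfolding x(2) eps_def
  by (rule gsubm_add[OF gZ Z'Z[OF e1Z[OF Xc(2)[OF x(1)]]] fyZ[OF ghm_closed[OF cq Xc(1)[OF x(1)]]]])
 next
  fix y assume "y : Z"
  then obtain u z where u: "u : cr (PP al)" "z : Z'" "y = fy u +[M] z" using pd(6)[of y] by auto
  then obtain x where x: "x : X1" "z = eps1 x" using IH(3) by auto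
  have "eps (j2 (s u) +[F] x) = y" using ghm_add[OF eps, of "j2 (s u)" x] jX[OF u(1)] iX[OF x(1)] epsi[OF x(1)] epsj[OF u(1)] u x by simp
  then show "y : eps ` X" using gsubm_add[OF Xp(1) jX[OF u(1)] iX[OF x(1)]] by force
 qed
 define K B where "K = {x : X. eps x = 0[M]}" and "B = {x : X. c (q2 x) : T al}"
 have gB': "gsubm (gsub F X) B" using gsubm_vimage[OF Xp(2) pd(1) cX pd(3)] unfolding B_def by simp
 have gK': "gsubm (gsub F X) K" using gsubm_vimage[OF Xp(2) gM eps gsubm_triv[OF gM]] unfolding K_def by simp
 have KX: "K <= X" and BX: "B <= X" unfolding K_def B_def by auto
 have gK: "gsubm F K" and gB: "gsubm F B" using gsubm_gsub[OF gF Xp(1)] gK' gB' KX BX by blast+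
 have cT: "c (q2 x) : T al" if "x : X" "eps x : Z'" for x
 proof -
  have u: "c (q2 x) : cr (PP al)" by (rule ghm_closed[OF cq Xc(1)[OF that(1)]])
  have a: "eps1 (q1 x) : Z'" by (rule e1Z[OF Xc(2)[OF that(1)]])
  note ac = Zc[OF Z'Z[OF a]] Zc[OF fyZ[OF u]]
  have "fy (c (q2 x)) = eps x -[M] eps1 (q1 x)" unfolding eps_def a_minus_def using ac by (simp add: M.M.a_comm[OF ac] M.M.a_assoc M.M.r_neg)
  then have "fy (c (q2 x)) : Z'" using gsubm_minus[OF gM gZ' that(2) a] by simp
  then show ?thesis using pd(7)[OF u] by simp
 qed
 have KB: "K <= B" using cT gsubm_zero[OF gZ'] unfolding K_def B_def by auto
 have Tfy: "EX x:X1. eps1 x = -[M] fy u" if u: "u : T al" for u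
 proof -
  have "fy u : Z'" using pd(7)[OF gsubm_carrier[OF pd(3) u]] u by simp
  then have "-[M] fy u : eps1 ` X1" using gsubm_uminus[OF gM gZ'] IH(3) by simp
  then show ?thesis by auto
 qed
 have cK: "ghm (gsub F K) (PP al) (- e) (%x. c (q2 x))" by (rule ghm_gsub_incl[OF gK cq])
 have ker: "{x : K. c (q2 x) = 0[PP al]} = {x : X1. eps1 x = 0[M]}"
 proof (intro equalityI subsetI)
  fix x assume x: "x : {x : K. c (q2 x) = 0[PP al]}"
  then have xX: "x : X" unfolding K_def by simp
  have "q2 x = 0[G es]" using Xc(3)[OF xX] x s0 by simp
  then have "x = q1 x" using split[OF Xc(1)[OF xX]] j0 F.M.r_zero[OF ghm_closed[OF i1 ghm_closed[OF q1 Xc(1)[OF xX]]]] by simp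
  then have "x : X1" using Xc(2)[OF xX] by simp
  then show "x : {x : X1. eps1 x = 0[M]}" using x epsi unfolding K_def by simp
 qed (use iX epsi q2x[OF X1(5)] c0 in \<open>auto simp: K_def\<close>)
 have "good F {x : X1. eps1 x = 0[M]}"
 proof -
  let ?Y = "{x : X1. eps1 x = 0[M]}"
  have sub: "{x : K. c (q2 x) = 0[PP al]} <= K" by auto
  have gY: "gsubm F ?Y" using gsubm_vimage[OF gmod_gsub[OF gF gK] pd(1) cK gsubm_triv[OF pd(1)]] gsubm_gsub[OF gF gK sub]
  unfolding ker[symmetric] by simp
  have q: "ghm (gsub F ?Y) (G ds) 0 q1" by (rule ghm_gsub_incl[OF gY q1])
  have e: "q1 ` ?Y = ?Y" using q1x[OF X1(5)] by (auto simp: image_iff)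
  have "y = 0[F]" if "y : ?Y" "q1 y = 0[G ds]" for y
  using that q1x[OF X1(5)[of y]] ghm_zero[OF wD wF i1] by simp
  moreover have "q1 0[F] = 0[G ds]" by (rule ghm_zero[OF wF wD q1])
  ultimately have "{y : ?Y. q1 y = 0[G ds]} = {0[F]}" using gsubm_zero[OF gY] by blast
  then show ?thesis using good_extension[OF IH(4) gF gY q e] good.good_zero[OF gF] by simp
 qed
 \<comment> \<open>For \<open>u\<close> in \<open>T al\<close> the value \<open>fy u\<close> lies in
   \<open>Z'\<close>, so some \<open>x\<close> in \<open>X1\<close> cancels it;
   \<open>x + j2 (s u)\<close> is then a preimage of \<open>u\<close> in \<open>K\<close>.\<close>
 moreover have imK: "(%x. c (q2 x)) ` K = T al"
 proof (intro equalityI subsetI)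
  fix u assume u: "u : T al"
  then have uc: "u : cr (PP al)" by (rule gsubm_carrier[OF pd(3)])
  obtain x where x: "x : X1" "eps1 x = -[M] fy u" using Tfy[OF u] by auto
  let ?y = "x +[F] j2 (s u)"
  have y: "?y : X" by (rule gsubm_add[OF Xp(1) iX[OF x(1)] jX[OF uc]])
  have "eps ?y = 0[M]" using ghm_add[OF eps, of x "j2 (s u)"] iX[OF x(1)] jX[OF uc] epsi[OF x(1)] epsj[OF uc] x(2) Zc[OF fyZ[OF uc]] by (simp add: M.M.l_neg)
  moreover have "c (q2 ?y) = u"
  using ghm_add[OF cX, of x "j2 (s u)"] iX[OF x(1)] jX[OF uc] q2x[OF X1(5)[OF x(1)]] c0 q2y[OF ghm_closed[OF s uc]] cs uc by simp
  ultimately show "u : (%x. c (q2 x)) ` K" unfolding K_def using y by force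
 qed (use KB in \<open>auto simp: B_def\<close>)
 ultimately have gdK: "good F K" using good_extension[OF good_T[OF al] gF gK cK] ker by simp
 \<comment> \<open>On \<open>B\<close> the values of \<open>eps\<close> lie in \<open>Z'\<close>,
   the image of \<open>eps1\<close>. Every element of \<open>B\<close> therefore differs from one of
   \<open>X1\<close> by an element of \<open>K\<close>.\<close>
 have "pres (gsub (G ds) X1) {x : X1. eps1 x = 0[M]} (gsub F B) K 0 (%x. x)"
  unfolding pres_def
 proof (intro conjI X1(2) gmod_gsub[OF gF gB] ballI)
  show "gsubm (gsub (G ds) X1) {x : X1. eps1 x = 0[M]}" using gsubm_vimage[OF X1(2) gM IH(2) gsubm_triv[OF gM]] by simp
  show "gsubm (gsub F B) K" using gsubm_gsub[OF gF gB KB] gK by simp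
  show "ghm (gsub (G ds) X1) (gsub F B) 0 (%x. x)"
  by (rule ghm_gsub_codom[OF gX1 _ gmod_wgm[OF X1(2)]]) (use iX q2x[OF X1(5)] c0 gsubm_zero[OF pd(3)] in \<open>auto simp: B_def\<close>)
  fix y assume "y : cr (gsub F B)"
  then have y: "y : X" "c (q2 y) : T al" unfolding B_def by auto
  have "eps y : Z'" unfolding eps_def
  by (rule gsubm_add[OF gZ' e1Z[OF Xc(2)[OF y(1)]]]) (use pd(7)[OF gsubm_carrier[OF pd(3) y(2)]] y(2) in simp)
  then obtain x where x: "x : X1" "eps y = eps1 x" using IH(3) by auto
  have "eps (y -[F] x) = 0[M]"
  proof -
  have m: "y -[F] x : X" by (rule gsubm_minus[OF gF Xp(1) y(1) iX[OF x(1)]])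
  have "eps y = eps (y -[F] x) +[M] eps x"
  using ghm_add[OF eps, of "y -[F] x" x] m iX[OF x(1)] F.M.sub_add[OF Xc(1)[OF y(1)] Xc(1)[OF iX[OF x(1)]]] by simp
  then show ?thesis using epsi[OF x(1)] x(2) Zc[OF Z'Z[OF e1Z[OF x(1)]]] ghm_closed[OF eps, of "y -[F] x"] m
  by (metis M.M.add.r_cancel_one' gsub_simps(1))
  qed
  then have "y -[F] x : K" unfolding K_def using gsubm_minus[OF gF Xp(1) y(1) iX[OF x(1)]] by simp
  moreover have "y = x +[F] (y -[F] x)"
  using F.M.sub_add[OF Xc(1)[OF y(1)] Xc(1)[OF iX[OF x(1)]]] F.M.a_comm F.M.minus_closed Xc(1)[OF y(1)] Xc(1)[OF iX[OF x(1)]] by metis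
  ultimately show "EX x:cr (gsub (G ds) X1). EX z:K. y = x +[gsub F B] z" using x(1) by auto
 qed (use iX epsi in \<open>auto simp: K_def\<close>)
 from EXT_transfer[OF this IH(5)] have E1: "EXT (gsub F B) K" .
 \<comment> \<open>Modulo \<open>B\<close> only the part of an element in \<open>P_al\<close>
   counts, and that modulo \<open>T al\<close>.\<close>
 have "pres (PP al) (T al) (gsub F X) B e (%x. j2 (s x))"
  unfolding pres_def
 proof (intro conjI pd(1,3) Xp(2) gB' ballI)
  show "ghm (PP al) (gsub F X) e (%x. j2 (s x))" by (rule ghm_gsub_codom[OF js jX wP])
  show "j2 (s u) : B <-> u : T al" if "u : cr (PP al)" for u
  using jX[OF that] q2y[OF ghm_closed[OF s that]] cs that unfolding B_def by simp
  fix y assume "y : cr (gsub F X)"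
  then have y: "y : X" by simp
  have q: "q1 y : cr (G ds)" "q1 y : X" "q1 y : cr F" using X1(5) iX Xc(2)[OF y] Xc(1) by auto
  have "q1 y : B" unfolding B_def using q q2x[OF q(1)] c0 gsubm_zero[OF pd(3)] by simp
  moreover have "y = j2 (s (c (q2 y))) +[F] q1 y"
  using split[OF Xc(1)[OF y]] Xc(3)[OF y] F.M.a_comm[OF q(3) ghm_closed[OF j2 ghm_closed[OF q2 Xc(1)[OF y]]]] by simp
  ultimately show "EX x:cr (PP al). EX z:B. y = j2 (s x) +[gsub F X] z" using ghm_closed[OF cq Xc(1)[OF y]] by auto
 qed
 from EXT_transfer[OF this EXT_T[OF al]] have E2: "EXT (gsub F X) B" .
 \<comment> \<open>A map on \<open>K\<close> is extended first to \<open>B\<close> and then to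
   \<open>X\<close>.\<close>
 have "EXT (gsub F X) K" by (rule EXT_trans[OF gB' KB _ E2]) (use E1 in \<open>simp add: gsub_gsub[OF BX]\<close>)
 then show ?case using ps eps im gdK unfolding K_def F_def by blast
qed

end

context dihz
begin

lemma pres_cover:
 assumes F: "gmod F" and Y: "gmod Y" and eps: "ghm F Y d eps" and Z: "gsubm Y Z" and im: "eps ` cr F = Z"
 shows "pres F {x : cr F. eps x = 0[Y]} (gsub Y Z) {0[Y]} d eps"
 unfolding pres_def
proof (intro conjI F gmod_gsub[OF Y Z] ballI)
 note gZ = gmod_gsub[OF Y Z]
 interpret Z: lmod R "gsub Y Z" by (rule gmod_lmod[OF gZ])
 show "gsubm F {x : cr F. eps x = 0[Y]}" using gsubm_vimage[OF F Y eps gsubm_triv[OF Y]] by simp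
 show "gsubm (gsub Y Z) {0[Y]}" using gsubm_triv[OF gZ] by simp
 show "ghm F (gsub Y Z) d eps" by (rule ghm_onto_gsub[OF eps gmod_wgm[OF F] im])
 fix y assume y: "y : cr (gsub Y Z)"
 then obtain x where "x : cr F" "y = eps x" using im by auto
 then show "EX x:cr F. EX z:{0[Y]}. y = eps x +[gsub Y Z] z" using Z.M.r_zero[OF y] by (intro bexI[of _ x]) auto
qed auto

end

section \<open>Syzygies of arbitrary free resolutions\<close>

context tracefilt
begin

text \<open>\<open>(G ds0, K0)\<close> is up to homotopy a retract of a good pair: \<open>b a\<close> differs from the identity on \<open>K0\<close> by a
  map \<open>s\<close> that extends to \<open>G ds0\<close>.\<close>

definition okd :: "int list => (nat => A) set => int list => (nat => A) set => ((nat => A) => nat => A) => (nat => A) set =>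
  ((nat => A) => nat => A) => ((nat => A) => nat => A) => ((nat => A) => nat => A) => bool" where
 "okd ds0 K0 ds X r Z a b s <-> gsubm (G ds0) K0 & psum ds X r & Z <= X & good (G ds) Z & EXT (gsub (G ds) X) Z &
  ghm (G ds0) (gsub (G ds) X) 0 a & (ALL x:K0. a x : Z) & ghm (gsub (G ds) X) (G ds0) 0 b & (ALL z:Z. b z : K0) &
  ghm (G ds0) (G ds0) 0 s & (ALL x:cr (G ds0). s x : K0) & (ALL x:K0. s x = x -[G ds0] b (a x))"

definition ok :: "int list => (nat => A) set => bool" where
 "ok ds0 K0 <-> (EX ds X r Z a b s. okd ds0 K0 ds X r Z a b s)"

lemma okdD:
 assumes "okd ds0 K0 ds X r Z a b s"
 shows "gsubm (G ds0) K0" "psum ds X r" "Z <= X" "good (G ds) Z" "EXT (gsub (G ds) X) Z"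
  "ghm (G ds0) (gsub (G ds) X) 0 a" "ALL x:K0. a x : Z" "ghm (gsub (G ds) X) (G ds0) 0 b" "ALL z:Z. b z : K0"
  "ghm (G ds0) (G ds0) 0 s" "ALL x:cr (G ds0). s x : K0" "ALL x:K0. s x = x -[G ds0] b (a x)"
 using assms unfolding okd_def by blast+

text \<open>On \<open>K0\<close> every \<open>x\<close> is \<open>b (a x) + s x\<close>, hence
  \<open>f x = f (b (a x)) + f (s x)\<close>. The second term is defined on all of
  \<open>G ds0\<close>, and the first becomes so once \<open>f\<close> after \<open>b\<close> is
  extended from \<open>Z\<close> to \<open>X\<close>.\<close>

lemma ok_EXT:
 assumes "ok ds0 K0" shows "EXT (G ds0) K0"
 unfolding EXT_def ext_def
proof (intro ballI impI allI)
 fix mu d f assume mu: "mu : I" and T: "ALL al:I. ALL d f. ghm (gsub (PP al) (T al)) (NN mu) d f --> (EX h. ghm (PP al) (NN mu) d h & (ALL z:T al. h z = f z))"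
  and f: "ghm (gsub (G ds0) K0) (NN mu) d f"
 obtain ds X r Z a b s where "okd ds0 K0 ds X r Z a b s" using assms unfolding ok_def by blast
 note o = okdD[OF this]
 define N where "N = NN mu"
 have wN: "wgm N" unfolding N_def by (rule wgm_NN[OF mu])
 note f = f[folded N_def]
 note gF = gmod_gfree[of ds0] and X = psumD[OF o(2)]
 note wF = gmod_wgm[OF gF]
 interpret F: lmod R "G ds0" by (rule gmod_lmod[OF gF])
 have E: "ext (gsub (G ds) X) Z N" using o(5) T mu unfolding EXT_def ext_def N_def by blast
 have gZ: "gsubm (gsub (G ds) X) Z" using gsubm_gsub[OF gmod_gfree X(1) o(3)] good_gsubm[OF o(4)] by simp
 have "ghm (gsub (gsub (G ds) X) Z) (gsub (G ds0) K0) 0 b"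
  by (rule ghm_gsub_codom[OF ghm_gsub_incl[OF gZ o(8)] _ gmod_wgm[OF gmod_gsub[OF X(2) gZ]]]) (use o(9) in simp)
 from ghm_comp[OF this f] have "ghm (gsub (gsub (G ds) X) Z) N d (%z. f (b z))" by simp
 then obtain g where g: "ghm (gsub (G ds) X) N d g" "ALL z:Z. g z = f (b z)" using E unfolding ext_def by blast
 have s: "ghm (G ds0) (gsub (G ds0) K0) 0 s" by (rule ghm_gsub_codom[OF o(10) _ wF]) (use o(11) in blast)
 have h: "ghm (G ds0) N d (%x. g (a x) +[N] f (s x))"
  using ghm_plus[OF wF wN ghm_comp[OF o(6) g(1), simplified] ghm_comp[OF s f, simplified]] by simp
 have "g (a x) +[N] f (s x) = f x" if x: "x : K0" for x
 proof -
  have xc: "x : cr (G ds0)" by (rule gsubm_carrier[OF o(1) x])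
  have bk: "b (a x) : K0" using o(7,9) x by blast
  have "f (b (a x)) +[N] f (s x) = f (b (a x) +[G ds0] s x)"
  using ghm_add[OF f, of "b (a x)" "s x"] bk o(11) xc by simp
  also have "b (a x) +[G ds0] s x = x"
  unfolding bspec[OF o(12) x] using F.M.sub_add[OF xc] F.M.a_comm F.M.minus_closed gsubm_carrier[OF o(1) bk] xc by metis
  finally show ?thesis using g(2) o(7) x by simp
 qed
 then show "EX h. ghm (G ds0) (NN mu) d h & (ALL z:K0. h z = f z)" using h unfolding N_def by blast
qed

text \<open>This provides finite generation of the kernel: the same decomposition shows that
  \<open>K0\<close> is the sum of the image of \<open>s\<close> and of the image of \<open>Z\<close>
  under \<open>b\<close>, and \<open>Z\<close> has a cover by a retract of a free module of finite
  rank.\<close>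

lemma ok_cover:
 assumes "ok ds0 K0"
 obtains ds1 dt where "ghm (G ds1) (G ds0) 0 dt" "dt ` cr (G ds1) = K0"
proof -
 obtain ds X r Z a b s where "okd ds0 K0 ds X r Z a b s" using assms unfolding ok_def by blast
 note o = okdD[OF this]
 obtain ds2 X2 r2 eps where c: "psum ds2 X2 r2" "ghm (gsub (G ds2) X2) (G ds) 0 eps" "eps ` X2 = Z"
  using good_cover[OF o(4)] by blast
 note X = psumD[OF o(2)] and X2 = psumD[OF c(1)] and A = append_homs(1-4)[where ds = ds2 and es = ds0]
 note gF = gmod_gfree[of ds0] and w = gmod_wgm[OF gmod_gfree]
 interpret F: lmod R "G ds0" by (rule gmod_lmod[OF gF])
 let ?l = "length ds2" and ?D = "G (ds2 @ ds0)"
 interpret D: lmod R ?D by (rule gmod_lmod[OF gmod_gfree])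
 have e: "ghm (gsub (G ds2) X2) (gsub (G ds) X) 0 eps"
  by (rule ghm_gsub_codom[OF c(2) _ gmod_wgm[OF X2(2)]]) (use c(3) o(3) in auto)
 have h1: "ghm (G ds2) (G ds0) 0 (%x. b (eps (r2 x)))" using ghm_comp[OF ghm_comp[OF X2(3) e] o(8)] by simp
 define dt where "dt x = b (eps (r2 (p1 ?l x))) +[G ds0] s (p2 ?l x)" for x
 have dt: "ghm ?D (G ds0) 0 dt" unfolding dt_def
  using ghm_plus[OF w w ghm_comp[OF A(3) h1, simplified] ghm_comp[OF A(4) o(10), simplified]] by simp
 have "dt ` cr ?D = K0"
 proof (intro equalityI subsetI)
  fix y assume "y : dt ` cr ?D"
  then obtain x where x: "x : cr ?D" "y = dt x" by blast
  have "eps (r2 (p1 ?l x)) : Z" using c(3) X2(6)[OF ghm_closed[OF A(3) x(1)]] by blast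
  then have "b (eps (r2 (p1 ?l x))) : K0" using o(9) by blast
  moreover have "s (p2 ?l x) : K0" using o(11) ghm_closed[OF A(4) x(1)] by blast
  ultimately show "y : K0" unfolding x(2) dt_def by (rule gsubm_add[OF o(1)])
 next
  fix x assume x: "x : K0"
  have xc: "x : cr (G ds0)" by (rule gsubm_carrier[OF o(1) x])
  have "a x : eps ` X2" using o(7) x c(3) by blast
  then obtain y where y: "y : X2" "eps y = a x" by auto
  have yc: "y : cr (G ds2)" by (rule X2(5)[OF y(1)])
  note yx = ghm_closed[OF A(1) yc] ghm_closed[OF A(2) xc]
  interpret D2: lmod R "G ds2" by (rule gmod_lmod[OF gmod_gfree])
  have "p1 ?l (y +[?D] i2 ?l x) = y" using ghm_add[OF A(3) yx] append_homs(5)[OF yc] append_homs(7)[OF xc, where ds = ds2] D2.M.r_zero[OF yc] by simp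
  moreover have "p2 ?l (y +[?D] i2 ?l x) = x" using ghm_add[OF A(4) yx] append_homs(6)[OF yc, where es = ds0] append_homs(8)[OF xc, where ds = ds2] F.M.l_zero[OF xc] by simp
  moreover have "b (a x) : cr (G ds0)" by (rule ghm_closed[OF o(8) ghm_closed[OF o(6) xc]])
  ultimately have "dt (y +[?D] i2 ?l x) = x" unfolding dt_def using X2(4)[OF y(1)] y(2) bspec[OF o(12) x]
  F.M.sub_add[OF xc, of "b (a x)"] F.M.a_comm F.M.minus_closed xc by metis
  then show "x : dt ` cr ?D" using D.M.a_closed[OF yx] by force
 qed
 then show ?thesis using that dt by blast
qed

text \<open>Two covers of \<open>Y\<close>, the given free one and the filtered one, are lifted
  through each other. The composite \<open>b a\<close> covers the identity of \<open>Y\<close>, so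
  \<open>s = 1 - b a\<close> takes values in the kernel.\<close>

lemma ok_base:
 assumes Y: "gmod Y" and g: "good Y (cr Y)" and eps: "ghm (G ds0) Y 0 eps" and sj: "eps ` cr (G ds0) = cr Y"
 shows "ok ds0 {x : cr (G ds0). eps x = 0[Y]}"
proof -
 obtain ds X r eps' where c: "psum ds X r" "ghm (gsub (G ds) X) Y 0 eps'" "eps' ` X = cr Y"
  "good (G ds) {x : X. eps' x = 0[Y]}" "EXT (gsub (G ds) X) {x : X. eps' x = 0[Y]}"
  using good_cover[OF g] by blast
 note X = psumD[OF c(1)] and gF = gmod_gfree[of ds0]
 note wF = gmod_wgm[OF gF] and wY = gmod_wgm[OF Y]
 interpret Y: lmod R Y by (rule gmod_lmod[OF Y])
 have "eps x : eps' ` cr (gsub (G ds) X)" if "x : cr (G ds0)" for x using ghm_closed[OF eps that] c(3) by simp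
 then obtain a where a: "ghm (G ds0) (gsub (G ds) X) (0 - 0) a" "ALL x:cr (G ds0). eps' (a x) = eps x"
  by (rule gfree_lift[OF X(2) Y c(2) eps])
 have er: "ghm (G ds) Y 0 (%x. eps' (r x))" using ghm_comp[OF X(3) c(2)] by simp
 have "eps' (r x) : eps ` cr (G ds0)" if "x : cr (G ds)" for x using ghm_closed[OF er that] sj by simp
 then obtain b where b: "ghm (G ds) (G ds0) (0 - 0) b" "ALL x:cr (G ds). eps (b x) = eps' (r x)"
  by (rule gfree_lift[OF gF Y eps er])
 have b': "ghm (gsub (G ds) X) (G ds0) 0 b" using ghm_gsub_incl[OF X(1) b(1)] by simp
 have eb: "eps (b x) = eps' x" if "x : X" for x using b(2) X(4,5)[OF that] by simp
 have a': "ghm (G ds0) (gsub (G ds) X) 0 a" using a(1) by simp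
 have aX: "a x : X" if "x : cr (G ds0)" for x using ghm_closed[OF a' that] by simp
 have ba: "ghm (G ds0) (G ds0) 0 (%x. b (a x))" using ghm_comp[OF a' b'] by simp
 have id: "ghm (G ds0) (G ds0) 0 (%x. x)" by (rule ghmI) auto
 have s: "ghm (G ds0) (G ds0) 0 (%x. x -[G ds0] b (a x))" by (rule ghm_sub[OF wF wF id ba])
 have es: "eps (x -[G ds0] b (a x)) = 0[Y]" if x: "x : cr (G ds0)" for x
  using ghm_minus[OF wF wY eps x ghm_closed[OF ba x]] eb[OF aX[OF x]] a(2) x Y.M.sub_self[OF ghm_closed[OF eps x]] by simp
 show ?thesis unfolding ok_def okd_def
 proof (intro conjI exI)
  show "gsubm (G ds0) {x : cr (G ds0). eps x = 0[Y]}" using gsubm_vimage[OF gF Y eps gsubm_triv[OF Y]] by simp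
  show "ALL z:{x : X. eps' x = 0[Y]}. b z : {x : cr (G ds0). eps x = 0[Y]}" using eb ghm_closed[OF b'] by simp
  show "ALL x:{x : cr (G ds0). eps x = 0[Y]}. a x : {x : X. eps' x = 0[Y]}" using a(2) aX by simp
  show "ALL x:cr (G ds0). x -[G ds0] b (a x) : {x : cr (G ds0). eps x = 0[Y]}" using es ghm_closed[OF s] by simp
 qed (use c a' b' s in auto)
qed

text \<open>One step of the comparison of resolutions: \<open>a\<close>, \<open>b\<close> and the
  homotopy \<open>s\<close> are lifted to \<open>a1\<close>, \<open>b1\<close> and
  \<open>c1\<close>.\<close>

lemma ok_ker:
 assumes ok: "ok ds0 K0" and dt: "ghm (G ds1) (G ds0) 0 dt" and im: "dt ` cr (G ds1) = K0"
 shows "ok ds1 {x : cr (G ds1). dt x = 0[G ds0]}"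
proof -
 obtain ds X r Z a b s where "okd ds0 K0 ds X r Z a b s" using ok unfolding ok_def by blast
 note o = okdD[OF this]
 obtain ds2 X2 r2 eps where c: "psum ds2 X2 r2" "ghm (gsub (G ds2) X2) (G ds) 0 eps" "eps ` X2 = Z"
  "good (G ds2) {x : X2. eps x = 0[G ds]}" "EXT (gsub (G ds2) X2) {x : X2. eps x = 0[G ds]}"
  using good_cover[OF o(4)] by blast
 note X = psumD[OF o(2)] and X2 = psumD[OF c(1)] and g = gmod_gfree and w = gmod_wgm[OF gmod_gfree]
 interpret F0: lmod R "G ds0" by (rule gmod_lmod[OF g])
 interpret F1: lmod R "G ds1" by (rule gmod_lmod[OF g])
 have eX: "ghm (gsub (G ds2) X2) (gsub (G ds) X) 0 eps"
  by (rule ghm_gsub_codom[OF c(2) _ gmod_wgm[OF X2(2)]]) (use c(3) o(3) in auto)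
 have a: "ghm (G ds0) (G ds) 0 a" by (rule ghm_codom_incl[OF o(6) X(1)])
 have dtK: "dt x : K0" if "x : cr (G ds1)" for x using im that by auto
 have ad: "ghm (G ds1) (G ds) 0 (%x. a (dt x))" using ghm_comp[OF dt a] by simp
 have "a (dt x) : eps ` cr (gsub (G ds2) X2)" if "x : cr (G ds1)" for x using c(3) o(7) dtK[OF that] by simp
 then obtain a1 where a1: "ghm (G ds1) (gsub (G ds2) X2) (0 - 0) a1" "ALL x:cr (G ds1). eps (a1 x) = a (dt x)"
  by (rule gfree_lift[OF X2(2) g c(2) ad])
 have be: "ghm (G ds2) (G ds0) 0 (%x. b (eps (r2 x)))" using ghm_comp[OF ghm_comp[OF X2(3) eX] o(8)] by simp
 have "b (eps (r2 x)) : dt ` cr (G ds1)" if "x : cr (G ds2)" for x unfolding im using o(9) c(3) X2(6)[OF that] by blast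
 then obtain b1 where b1: "ghm (G ds2) (G ds1) (0 - 0) b1" "ALL x:cr (G ds2). dt (b1 x) = b (eps (r2 x))"
  by (rule gfree_lift[OF g g dt be])
 have "s x : dt ` cr (G ds1)" if "x : cr (G ds0)" for x unfolding im using o(11) that by blast
 then obtain c1 where c1: "ghm (G ds0) (G ds1) (0 - 0) c1" "ALL x:cr (G ds0). dt (c1 x) = s x"
  by (rule gfree_lift[OF g g dt o(10)])
 have a1': "ghm (G ds1) (gsub (G ds2) X2) 0 a1" using a1(1) by simp
 have b1': "ghm (gsub (G ds2) X2) (G ds1) 0 b1" using ghm_gsub_incl[OF X2(1) b1(1)] by simp
 have aX: "a1 x : X2" if "x : cr (G ds1)" for x using ghm_closed[OF a1' that] by simp
 have db: "dt (b1 x) = b (eps x)" if "x : X2" for x using b1(2) X2(4,5)[OF that] by simp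
 have ba: "ghm (G ds1) (G ds1) 0 (%x. b1 (a1 x))" using ghm_comp[OF a1' b1'] by simp
 have cd: "ghm (G ds1) (G ds1) 0 (%x. c1 (dt x))" using ghm_comp[OF dt c1(1)] by simp
 have id: "ghm (G ds1) (G ds1) 0 (%x. x)" by (rule ghmI) auto
 have s0: "ghm (G ds1) (G ds1) 0 (%x. x -[G ds1] b1 (a1 x))" by (rule ghm_sub[OF w w id ba])
 \<comment> \<open>\<open>dt\<close> sends \<open>x - b1 (a1 x)\<close> to \<open>s (dt x)\<close>,
   which is also the image of \<open>c1 (dt x)\<close>; subtracting the latter lands in the kernel
   of \<open>dt\<close>.\<close>
 let ?s = "%x. (x -[G ds1] b1 (a1 x)) -[G ds1] c1 (dt x)"
 have s: "ghm (G ds1) (G ds1) 0 ?s" by (rule ghm_sub[OF w w s0 cd])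
 have ds: "dt (?s x) = 0[G ds0]" if x: "x : cr (G ds1)" for x
 proof -
  have dx: "dt x : cr (G ds0)" by (rule ghm_closed[OF dt x])
  have "dt (x -[G ds1] b1 (a1 x)) = dt x -[G ds0] b (a (dt x))"
  using ghm_minus[OF w w dt x ghm_closed[OF ba x]] db[OF aX[OF x]] a1(2) x by simp
  also have "... = s (dt x)" using o(12) dtK[OF x] by simp
  finally show ?thesis using ghm_minus[OF w w dt ghm_closed[OF s0 x] ghm_closed[OF cd x]] c1(2) dx F0.M.sub_self[OF ghm_closed[OF o(10) dx]] by simp
 qed
 have z: "a 0[G ds0] = 0[G ds]" "b 0[G ds] = 0[G ds0]" "c1 0[G ds0] = 0[G ds1]"
  using ghm_zero[OF w w a] ghm_zero[OF gmod_wgm[OF X(2)] w o(8)] ghm_zero[OF w w c1(1)] by simp_all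
 let ?Z = "{x : X2. eps x = 0[G ds]}" and ?K = "{x : cr (G ds1). dt x = 0[G ds0]}"
 show ?thesis unfolding ok_def okd_def
 proof (intro conjI exI)
  show "gsubm (G ds1) ?K" using gsubm_vimage[OF g g dt gsubm_triv[OF g]] by simp
  show "ALL z:?Z. b1 z : ?K" using db z(2) ghm_closed[OF b1'] by simp
  show "ALL x:?K. a1 x : ?Z" using a1(2) aX z(1) by simp
  show "ALL x:cr (G ds1). ?s x : ?K" using ds ghm_closed[OF s] by simp
  \<comment> \<open>On the kernel of \<open>dt\<close> the correction \<open>c1 (dt x)\<close> is
    zero.\<close>
  show "ALL x:?K. ?s x = x -[G ds1] b1 (a1 x)"
  using z(3) F1.M.r_zero ghm_closed[OF s0] by (simp add: a_minus_def[of _ _ "0[G ds1]"])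
 qed (use c a1' b1' s in auto)
qed

lemma resolution_exists:
 assumes Y: "gmod Y" and gd: "good Y (cr Y)"
 shows "EX r. free_resolution n ze Y r"
proof -
 note w = gmod_wgm[OF gmod_gfree]
 obtain ds0 X r eps' where c: "psum ds0 X r" "ghm (gsub (G ds0) X) Y 0 eps'" "eps' ` X = cr Y"
  using good_cover[OF gd] by blast
 note X = psumD[OF c(1)]
 have eps: "ghm (G ds0) Y 0 (%x. eps' (r x))" using ghm_comp[OF X(3) c(2)] by simp
 have sj: "(%x. eps' (r x)) ` cr (G ds0) = cr Y"
 proof (intro equalityI subsetI)
  fix y assume "y : cr Y"
  then obtain x where "x : X" "y = eps' x" using c(3) by auto
  then show "y : (%x. eps' (r x)) ` cr (G ds0)" using X(4,5) by (intro image_eqI[of _ _ x]) auto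
 qed (use ghm_closed[OF eps] in auto)
 let ?K = "{x : cr (G ds0). eps' (r x) = 0[Y]}"
 have ok0: "ok ds0 ?K" by (rule ok_base[OF Y gd eps sj])
 \<comment> \<open>A state of the recursion is a list of generator degrees together with the kernel
   still to be covered. \<open>ok\<close> is the invariant, and \<open>?Q\<close> says that the next
   free module covers that kernel and has the next one.\<close>
 let ?Q = "%p q. EX dt. ghm (G (fst q)) (G (fst p)) 0 dt & dt ` cr (G (fst q)) = snd p & snd q = {x : cr (G (fst q)). dt x = 0[G (fst p)]}"
 have "EX f. ALL k. (ok (fst (f k)) (snd (f k)) & (k = 0 --> f k = (ds0, ?K))) & ?Q (f k) (f (Suc k))"
 proof (rule dependent_nat_choice)
  show "EX p. ok (fst p) (snd p) & (0 = (0::nat) --> p = (ds0, ?K))" using ok0 by (intro exI[of _ "(ds0, ?K)"]) simp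
  fix p and k :: nat assume "ok (fst p) (snd p) & (k = 0 --> p = (ds0, ?K))"
  then have ok: "ok (fst p) (snd p)" by simp
  obtain ds1 dt where dt: "ghm (G ds1) (G (fst p)) 0 dt" "dt ` cr (G ds1) = snd p" by (rule ok_cover[OF ok])
  show "EX q. (ok (fst q) (snd q) & (Suc k = 0 --> q = (ds0, ?K))) & ?Q p q"
  using ok_ker[OF ok dt] dt by (intro exI[of _ "(ds1, {x : cr (G ds1). dt x = 0[G (fst p)]})"]) auto
 qed
 then obtain f where f': "ALL k. (ok (fst (f k)) (snd (f k)) & (k = 0 --> f k = (ds0, ?K))) & ?Q (f k) (f (Suc k))" by (rule exE)
 have f: "f 0 = (ds0, ?K)" using spec[OF f', of 0] by (simp only: simp_thms)
 have "ALL k. ?Q (f k) (f (Suc k))" by (intro allI conjunct2[OF spec[OF f']])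
 then obtain dt where dt': "ALL k. ghm (G (fst (f (Suc k)))) (G (fst (f k))) 0 (dt k) & dt k ` cr (G (fst (f (Suc k)))) = snd (f k) &
  snd (f (Suc k)) = {x : cr (G (fst (f (Suc k)))). dt k x = 0[G (fst (f k))]}" by (rule choice[THEN exE])
 note dt = conjunct1[OF spec[OF dt']] conjunct1[OF conjunct2[OF spec[OF dt']]] conjunct2[OF conjunct2[OF spec[OF dt']]]
 have "free_resolution n ze Y (%k. fst (f k), %k. restrict (dt k) (cr (G (fst (f (Suc k))))), restrict (%x. eps' (r x)) (cr (G ds0)))"
  unfolding free_resolution_def Let_def prod.case
 proof (intro conjI allI)
  show "restrict (dt i) (cr (G (fst (f (Suc i))))) : ghom R (G (fst (f (Suc i)))) (G (fst (f i))) 0" for i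
  by (rule ghm_restrict[OF w dt(1)])
  show "restrict (dt (Suc i)) (cr (G (fst (f (Suc (Suc i)))))) ` cr (G (fst (f (Suc (Suc i))))) =
  {x : cr (G (fst (f (Suc i)))). restrict (dt i) (cr (G (fst (f (Suc i))))) x = 0[G (fst (f i))]}" for i
  using dt(2)[of "Suc i"] dt(3)[of i] by (simp cong: conj_cong)
 qed (use f ghm_restrict[OF w eps] sj dt(2)[of 0] in \<open>simp_all cong: conj_cong\<close>)
 then show ?thesis by blast
qed

end

section \<open>Ext groups\<close>

lemma zero_space_quot:
 assumes "abelian_group V" "B <= cr V" "0[V] : B"
 shows "zero_space (quot V B) <-> cr V <= B"
proof -
 interpret V: abelian_group V by fact
 have z: "zero_space (quot V B) <-> (\<Union>x\<in>cr V. {B +>[V] x}) = {B}"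
  unfolding zero_space_def quot_def A_RCOSETS_def' by simp
 show ?thesis unfolding z
 proof
  assume e: "(\<Union>x\<in>cr V. {B +>[V] x}) = {B}"
  show "cr V <= B"
  proof
  fix x assume x: "x : cr V"
  then have "B +>[V] x = B" using e by auto
  moreover have "x : B +>[V] x" unfolding a_r_coset_def' using assms(3) x V.l_zero[OF x] by force
  ultimately show "x : B" by simp
  qed
 next
  assume "cr V <= B"
  then have B: "B = cr V" using assms(2) by auto
  have "cr V +>[V] x = cr V" if x: "x : cr V" for x
  proof (intro equalityI subsetI)
  fix y assume y: "y : cr V"
  have "y = (y -[V] x) +[V] x" using V.sub_add[OF y x] by simp
  then show "y : cr V +>[V] x" unfolding a_r_coset_def' using V.minus_closed[OF y x] by blast
  qed (use x in \<open>auto simp: a_r_coset_def'\<close>)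
  then show "(\<Union>x\<in>cr V. {B +>[V] x}) = {B}" unfolding B using V.zero_closed by auto
 qed
qed

lemma vdim_vecs: "vdim (vecs k) k"
 unfolding vdim_def clin_def by (intro exI[of _ "%x. x"]) (auto simp: bij_betw_def)

text \<open>Cosets of the zero subspace are singletons, so the quotient that defines
  \<open>Ext\<close> in cohomological degree 0 is \<open>V\<close> up to renaming its
  elements.\<close>

lemma line_quot_zero:
 assumes V: "cvs V"
 shows "iso_complex_line (quot V {0[V]}) <-> vdim V 1"
proof -
 interpret V: lmod complex_ring V by (rule V)
 have sm: "c *[V] x : cr V" if "x : cr V" for c x using V.smult_closed[of c x] that by simp
 have co: "{0[V]} +>[V] x = {x}" if "x : cr V" for x unfolding a_r_coset_def' using that by simp
 have c: "cr (quot V {0[V]}) = (%x. {x}) ` cr V"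
  unfolding quot_def A_RCOSETS_def' using co by auto
 have a: "{x} \<oplus>\<^bsub>quot V {0[V]}\<^esub> {y} = {x +[V] y}" for x y unfolding quot_def set_add_def' by simp
 have s: "k \<odot>\<^bsub>quot V {0[V]}\<^esub> {x} = {k *[V] x}" if "x : cr V" for k x unfolding quot_def using co[OF sm[OF that]] by simp
 show ?thesis
 proof
  assume "iso_complex_line (quot V {0[V]})"
  then obtain fy where fy: "bij_betw fy ((%x. {x}) ` cr V) UNIV"
  "ALL x:cr V. ALL y:cr V. fy {x +[V] y} = fy {x} + fy {y}" "ALL k. ALL x:cr V. fy {k *[V] x} = k * fy {x}"
  unfolding iso_complex_line_def c ball_simps using a s by (auto simp: Ball_def)
  let ?r = "%x. vec 1 (%_. fy {x})"
  have "clin V (vecs 1) ?r" unfolding clin_def using fy(2,3) by (auto intro!: eq_vecI)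
  moreover have "bij_betw ?r (cr V) (cr (vecs 1))" unfolding bij_betw_def
  proof (intro conjI equalityI subsetI inj_onI)
  fix x y assume xy: "x : cr V" "y : cr V" "?r x = ?r y"
  have "fy {x} = fy {y}" using arg_cong[OF xy(3), of "%v. v $ 0"] by simp
  then show "x = y" using fy(1) xy(1,2) unfolding bij_betw_def inj_on_def by auto
  next
  fix u assume u: "u : cr (vecs 1)"
  have "u $ 0 : fy ` (%x. {x}) ` cr V" using fy(1) unfolding bij_betw_def by simp
  then obtain x where "x : cr V" "u $ 0 = fy {x}" by auto
  then show "u : ?r ` cr V" using u by (intro image_eqI[of _ _ x] eq_vecI) auto
  qed auto
  ultimately show "vdim V 1" by (rule vdim_iso_rev[OF vdim_vecs _ _ V])
 next
  assume "vdim V 1"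
  then obtain fy where fy: "clin (vecs 1) V fy" "bij_betw fy (cV 1) (cr V)" unfolding vdim_def by auto
  define g where "g = inv_into (cV 1) fy"
  have gc: "g x : cV 1" and fyg: "fy (g x) = x" if "x : cr V" for x
  using that fy(2) bij_betw_inv_into_right[OF fy(2) that] inv_into_into[of x fy "cV 1"] unfolding g_def bij_betw_def by auto
  have gp: "g (fy u) = u" if "u : cV 1" for u unfolding g_def by (rule bij_betw_inv_into_left[OF fy(2) that])
  have ga: "g (x +[V] y) = g x + g y" if "x : cr V" "y : cr V" for x y
  using gp[of "g x + g y"] clin_add[OF fy(1), of "g x" "g y"] gc fyg that by simp
  have gs: "g (k *[V] x) = k *s g x" if "x : cr V" for k x
  using gp[of "k *s g x"] clin_smult[OF fy(1), of "g x" k] gc fyg that by simp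
  let ?si = "%C. g (the_elem C) $ 0"
  have "bij_betw ?si ((%x. {x}) ` cr V) UNIV" unfolding bij_betw_def
  proof (rule conjI[OF inj_onI], goal_cases)
  fix C D assume "C : (%x. {x}) ` cr V" "D : (%x. {x}) ` cr V" and e: "?si C = ?si D"
  then obtain x y where xy: "x : cr V" "y : cr V" "C = {x}" "D = {y}" by auto
  have "g x = g y" using e gc[OF xy(1)] gc[OF xy(2)] xy(3,4) by (intro eq_vecI) auto
  then show "C = D" using fyg xy by metis
  next
  case 2
  have "z : ?si ` (%x. {x}) ` cr V" for z :: complex
  proof -
  let ?u = "vec 1 (%_. z)"
  have "fy ?u : cr V" using clin_closed[OF fy(1), of ?u] by simp
  moreover have "?si {fy ?u} = z" using gp[of ?u] by simp
  ultimately show ?thesis by force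
  qed
  then show ?case by blast
  qed
  then show "iso_complex_line (quot V {0[V]})"
  unfolding iso_complex_line_def c using a s ga gs carrier_vecD[OF gc] by (intro exI[of _ ?si]) auto
 qed
qed

context dihz
begin

text \<open>A cocycle is a homomorphism that kills the image of \<open>dt i\<close>, so the cocycles
  form an \<open>HS\<close> space, and the shift of \<open>N\<close> becomes the degree
  \<open>d\<close>.\<close>

lemma Ext_quot:
 assumes "some_resolution n ze Y = (ds, dt, eps)"
 shows "Ext n ze i Y N d = quot (HS (G (ds i)) (dt i ` cr (G (ds (Suc i)))) N d)
  (case i of 0 => {\<lambda>x\<in>cr (G (ds 0)). 0[N]} | Suc j => (%f. compose (cr (G (ds (Suc j)))) f (dt j)) ` ghom R (G (ds j)) N d)"
proof -
 have g: "ghom R (G es) (shift (- d) N) 0 = ghom R (G es) N d" for es by (auto simp: ghom_iff ghm_shift_codom)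
 have c: "cscale (shift (- d) N) = cscale N" by (intro ext) (simp add: cscale_def)
 show ?thesis unfolding Ext_def Ext_gmod_def assms Let_def prod.case hom_space_def HS_def
  by (cases i) (simp_all add: g c)
qed

text \<open>By exactness the cocycles are the maps that factor through the image \<open>Z\<close> of
  \<open>dt k\<close>; the coboundaries are those whose factor on \<open>Z\<close> extends to the
  whole free module.\<close>

lemma Ext_Suc_zero:
 fixes k :: nat
 assumes r: "some_resolution n ze Y = (ds, dt, eps)" "free_resolution n ze Y (ds, dt, eps)" and N: "wgm N"
 defines "Z == dt k ` cr (G (ds (Suc k)))"
 shows "zero_space (Ext n ze (Suc k) Y N d) <->
  (ALL f. ghm (gsub (G (ds k)) Z) N d f --> (EX h. ghm (G (ds k)) N d h & (ALL z:Z. h z = f z)))"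
proof -
 let ?F = "G (ds k)" and ?F' = "G (ds (Suc k))"
 note fr = r(2)[unfolded free_resolution_def Let_def prod.case]
 note fr2 = conjunct2[OF fr]
 have dt: "ghm ?F' ?F 0 (dt k)" using spec[OF conjunct1[OF fr2], of k] unfolding ghom_iff by (rule conjunct1)
 have im: "dt (Suc k) ` cr (G (ds (Suc (Suc k)))) = {x : cr ?F'. dt k x = 0[?F]}"
  by (rule spec[OF conjunct2[OF conjunct2[OF conjunct2[OF fr2]]]])
 note g = gmod_gfree and w = gmod_wgm[OF gmod_gfree]
 have gZ: "gsubm ?F Z" unfolding Z_def by (rule gsubm_image[OF g g dt gsubm_all[OF g]])
 let ?V = "HS ?F' {x : cr ?F'. dt k x = 0[?F]} N d" and ?c = "%f. compose (cr ?F') f (dt k)"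
 have cV: "cvs ?V" by (rule cvs_HS[OF w N]) auto
 have cin: "?c f : cr ?V" if "ghm ?F N d f" for f
  using ghm_restrict[OF w ghm_comp[OF dt that]] ghm_zero[OF w N that] unfolding compose_def by auto
 have B: "?c ` ghom R ?F N d <= cr ?V" using cin by (auto simp only: ghom_iff)
 have "0[?V] = ?c (\<lambda>x\<in>cr ?F. 0[N])" using ghm_closed[OF dt] by (auto simp: compose_def fun_eq_iff restrict_def)
 then have z: "0[?V] : ?c ` ghom R ?F N d" using ghm_restrict[OF w ghm_null[OF w N]] by blast
 have "zero_space (Ext n ze (Suc k) Y N d) <-> cr ?V <= ?c ` ghom R ?F N d"
  unfolding Ext_quot[OF r(1)] im nat.case by (rule zero_space_quot[OF lmod.axioms(2)[OF cV] B z])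
 also have "... <-> (ALL f. ghm (gsub ?F Z) N d f --> (EX h. ghm ?F N d h & (ALL z:Z. h z = f z)))"
 proof
  assume e: "cr ?V <= ?c ` ghom R ?F N d"
  show "ALL f. ghm (gsub ?F Z) N d f --> (EX h. ghm ?F N d h & (ALL z:Z. h z = f z))"
  proof (intro allI impI)
  fix f assume f: "ghm (gsub ?F Z) N d f"
  have dZ: "ghm ?F' (gsub ?F Z) 0 (dt k)" by (rule ghm_onto_gsub[OF dt w]) (simp add: Z_def)
  have "f 0[?F] = 0[N]" using ghm_zero[OF gmod_wgm[OF gmod_gsub[OF g gZ]] N f] by simp
  then have "restrict (%x. f (dt k x)) (cr ?F') : cr ?V" using ghm_restrict[OF w ghm_comp[OF dZ f]] by simp
  then obtain h where h: "h : ghom R ?F N d" "restrict (%x. f (dt k x)) (cr ?F') = ?c h" using e by blast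
  have "h (dt k x) = f (dt k x)" if "x : cr ?F'" for x using fun_cong[OF h(2), of x] that by (simp add: compose_def)
  then show "EX h. ghm ?F N d h & (ALL z:Z. h z = f z)" using h(1) unfolding Z_def ghom_iff by blast
  qed
 next
  assume e: "ALL f. ghm (gsub ?F Z) N d f --> (EX h. ghm ?F N d h & (ALL z:Z. h z = f z))"
  show "cr ?V <= ?c ` ghom R ?F N d"
  proof
  fix q assume q: "q : cr ?V"
  then have qq: "ghm ?F' N d q" "q : extensional (cr ?F')" "!!x. x : cr ?F' ==> dt k x = 0[?F] ==> q x = 0[N]"
  by (auto simp: ghom_iff)
  note p = pres_cover[OF g g dt gZ meta_eq_to_obj_eq[OF Z_def, symmetric]]
  have "ghm (gsub (gsub ?F Z) {0[?F]}) N d (%x. 0[N])" by (rule ghm_null[OF gmod_wgm[OF gmod_gsub[OF presD(2,4)[OF p]]] N])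
  from glue[OF p N _ this, of q] obtain f where f: "ghm (gsub ?F Z) N d f" "ALL x:cr ?F'. f (dt k x) = q x"
  using qq(1,3) by auto
  obtain h where h: "ghm ?F N d h" "ALL z:Z. h z = f z" using e f(1) by blast
  have "q = ?c (restrict h (cr ?F))"
  proof (rule extensionalityI[OF qq(2)])
  show "q x = ?c (restrict h (cr ?F)) x" if "x : cr ?F'" for x
  using that h(2) f(2) ghm_closed[OF dt that] unfolding Z_def by (simp add: compose_def)
  qed (simp add: compose_def)
  then show "q : ?c ` ghom R ?F N d" using ghm_restrict[OF w h(1)] by blast
  qed
 qed
 finally show ?thesis .
qed

end

context tracefilt
begin

text \<open>The resolution is whichever one choice returns. Its augmentation reduces cohomological
  degrees 0 and 1 to the pair of \<open>P_al\<close> and \<open>T al\<close>; the \<open>ok\<close>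
  property of all its syzygies handles the remaining degrees.\<close>

lemma Ext_Ktilde:
 assumes al: "al : I" and nu: "nu : I"
 defines "E == %i. Ext n ze i (KT al) (NN nu)"
 shows "iso_complex_line (E 0 d) <-> vdim (HS (PP al) (T al) (NN nu) d) 1"
  and "zero_space (E 0 d) <-> vdim (HS (PP al) (T al) (NN nu) d) 0"
  and "(!!d. zero_space (E 1 d)) ==> ext (PP al) (T al) (NN nu)"
  and "ALL al:I. ext (PP al) (T al) (NN nu) ==> zero_space (E (Suc k) d)"
proof -
 define Y where "Y = KT al"
 have Ye: "Y = QQ (up al) al" unfolding Y_def Ktilde_def ..
 note Q = QQ_facts[OF up_sub(1)[of al] al, folded Ye]
 note g = gmod_gfree and w = gmod_wgm[OF gmod_gfree]
 have gd: "good Y (cr Y)" unfolding Ye by (rule good_Ktilde[OF al])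
 obtain ds dt eps where r: "some_resolution n ze Y = (ds, dt, eps)" by (metis prod_cases3)
 have fr0: "free_resolution n ze Y (ds, dt, eps)"
  using someI_ex[OF resolution_exists[OF Q(1) gd]] unfolding r[symmetric] some_resolution_def .
 note fr = fr0[unfolded free_resolution_def Let_def prod.case]
 define N where "N = NN nu"
 have wN: "wgm N" unfolding N_def by (rule wgm_NN[OF nu])
 have EE: "E i = Ext n ze i Y N" for i unfolding E_def Y_def N_def ..
 note fr2 = conjunct2[OF fr]
 note fr3 = conjunct2[OF fr2]
 note fr4 = conjunct2[OF fr3]
 have eps: "ghm (G (ds 0)) Y 0 eps" using conjunct1[OF fr] unfolding ghom_iff by (rule conjunct1)
 note epss = conjunct1[OF fr3]
 have im0: "dt 0 ` cr (G (ds (Suc 0))) = {x : cr (G (ds 0)). eps x = 0[Y]}" using conjunct1[OF fr4] unfolding One_nat_def .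
 have dt: "ghm (G (ds (Suc j))) (G (ds j)) 0 (dt j)" for j using spec[OF conjunct1[OF fr2], of j] unfolding ghom_iff by (rule conjunct1)
 let ?K = "{x : cr (G (ds 0)). eps x = 0[Y]}"
 \<comment> \<open>\<open>ok_ker\<close> holds for any free cover of the syzygy, hence for the
   differentials of the given resolution.\<close>
 have okk: "ok (ds j) (dt j ` cr (G (ds (Suc j))))" for j
 proof (induction j)
  case 0
  show ?case unfolding im0 by (rule ok_base[OF Q(1) gd eps epss])
 next
  case (Suc j)
  have "dt (Suc j) ` cr (G (ds (Suc (Suc j)))) = {x : cr (G (ds (Suc j))). dt j x = 0[G (ds j)]}" by (rule spec[OF conjunct2[OF fr4]])
  then show ?case using ok_ker[OF Suc dt refl] by simp
 qed
 have gT: "gsubm (PP al) (T al)" by (rule gsubm_trace[OF up_sub(1) al])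
 have p1: "pres (G (ds 0)) ?K Y {0[Y]} 0 eps"
  using pres_cover[OF g Q(1) eps gsubm_all[OF Q(1)] epss] unfolding gsub_all[OF gmod_wgm[OF Q(1)]] .
 have p2: "pres (PP al) (T al) Y {0[Y]} 0 (proj (PP al) (T al))" unfolding Ye by (rule pres_proj[OF gmod_Pmod[OF al] gT])
 have "eps x : proj (PP al) (T al) ` cr (PP al)" if "x : cr (G (ds 0))" for x unfolding Q(4) by (rule ghm_closed[OF eps that])
 then obtain te where "ghm (G (ds 0)) (PP al) (0 - 0) te" "ALL x:cr (G (ds 0)). proj (PP al) (T al) (te x) = eps x"
  by (rule gfree_lift[OF gmod_Pmod[OF al] Q(1) Q(2) eps])
 \<comment> \<open>Both modules cover the same \<open>Ktilde\<close>. Lifting the augmentation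
   through \<open>P_al\<close> transports maps that kill the kernel, and the extension property, to
   \<open>P_al\<close> and \<open>T al\<close>.\<close>
 then have p: "pres (G (ds 0)) ?K (PP al) (T al) 0 te" using pres_compare[OF p1 p2, of te] by simp
 let ?V = "HS (G (ds 0)) ?K N d"
 have cV: "cvs ?V" by (rule cvs_HS[OF w wN]) auto
 have E0: "E 0 d = quot ?V {0[?V]}" unfolding EE Ext_quot[OF r] im0 by simp
 have vd: "vdim ?V k <-> vdim (HS (PP al) (T al) (NN nu) d) k" for k using vdim_HS_pres[OF p wN, of d k] unfolding N_def by simp
 show "iso_complex_line (E 0 d) <-> vdim (HS (PP al) (T al) (NN nu) d) 1" unfolding E0 line_quot_zero[OF cV] vd ..
 have zc: "0[?V] : cr ?V" using lmod.axioms(2)[OF cV] by (meson abelian_group.axioms(1) abelian_monoid.zero_closed)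
 then show "zero_space (E 0 d) <-> vdim (HS (PP al) (T al) (NN nu) d) 0"
  unfolding E0 vd[symmetric] vdim_zero[OF cV] by (subst zero_space_quot[OF lmod.axioms(2)[OF cV]]) auto
 show "ext (PP al) (T al) (NN nu)" if "!!d. zero_space (E 1 d)"
 proof -
  have "ext (G (ds 0)) ?K N" unfolding ext_def
  using that Ext_Suc_zero[OF r fr0 wN, of 0] unfolding EE im0 by simp
  then show ?thesis using ext_transfer[OF p wN] unfolding N_def by blast
 qed
 show "zero_space (E (Suc k) d)" if "ALL al:I. ext (PP al) (T al) (NN nu)"
 proof -
  have "ext (G (ds k)) (dt k ` cr (G (ds (Suc k)))) N" using ok_EXT[OF okk] that nu unfolding EXT_def N_def by blast
  then show ?thesis unfolding EE Ext_Suc_zero[OF r fr0 wN] ext_def by blast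
 qed
qed

text \<open>\<open>hyp0\<close> is the case \<open>i = 0\<close> and the \<open>ext\<close>
  condition the case \<open>i = 1\<close>; all higher cases follow from the \<open>ext\<close>
  condition by \<open>Ext_Ktilde\<close>.\<close>

lemma orthogonality_iff:
 "(ALL nu : I. ALL mu : I. ALL (i::nat) (d::int).
  if nu = mu & i = 0 & d = 0 then iso_complex_line (Ext n ze i (KT nu) (NN mu) d)
  else zero_space (Ext n ze i (KT nu) (NN mu) d))
 <-> (ALL nu:I. hyp0 nu & (ALL al:I. ext (PP al) (T al) (NN nu)))"
 (is "?L <-> ?R")
proof
 assume a: ?L
 show ?R
 proof (intro ballI conjI)
  fix nu assume nu: "nu : I"
  show "hyp0 nu" unfolding hyp0_def
  proof (intro ballI allI)
  fix al c assume al: "al : I"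
  show "vdim (HS (PP al) (T al) (NN nu) c) (if al = nu & c = 0 then 1 else 0)"
  proof (cases "al = nu & c = 0")
  case True
  show ?thesis unfolding if_P[OF True] using a[rule_format, OF al nu, of 0 c] True Ext_Ktilde(1)[OF al nu, of c] by auto
  next
  case False
  show ?thesis unfolding if_not_P[OF False] using a[rule_format, OF al nu, of 0 c] False Ext_Ktilde(2)[OF al nu, of c] by auto
  qed
  qed
  fix al assume al: "al : I"
  show "ext (PP al) (T al) (NN nu)"
  by (rule Ext_Ktilde(3)[OF al nu]) (use a[rule_format, OF al nu, of 1] in simp)
 qed
next
 assume a: ?R
 show ?L
 proof (intro ballI allI)
  fix al nu and i :: nat and d :: int assume al: "al : I" and nu: "nu : I"
  have h: "vdim (HS (PP al) (T al) (NN nu) d) (if al = nu & d = 0 then 1 else 0)" using a al nu unfolding hyp0_def by blast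
  have e: "ALL al:I. ext (PP al) (T al) (NN nu)" using a nu by blast
  show "if al = nu & i = 0 & d = 0 then iso_complex_line (Ext n ze i (KT al) (NN nu) d)
  else zero_space (Ext n ze i (KT al) (NN nu) d)"
  proof (cases i)
  case 0
  show ?thesis
  proof (cases "al = nu & d = 0")
  case True
  show ?thesis using h[unfolded if_P[OF True]] True 0 Ext_Ktilde(1)[OF al nu, of d] by auto
  next
  case False
  show ?thesis using h[unfolded if_not_P[OF False]] False 0 Ext_Ktilde(2)[OF al nu, of d] by auto
  qed
  next
  case (Suc k)
  then show ?thesis using Ext_Ktilde(4)[OF al nu e, of k d] by simp
  qed
 qed
qed

end

theorem proposition1p1:
  fixes n :: nat and \<zeta> :: complex and R :: "irr rel"
    and len :: "irr \<Rightarrow> nat" and Fil :: "irr \<Rightarrow> nat \<Rightarrow> S vec set"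
  assumes "n \<ge> 3" and "odd n" and "primitive_root_of_unity n \<zeta>"
    and "preorder_on (Irr n) R"
    and "\<And>\<mu>. \<mu> \<in> Irr n \<Longrightarrow>
      shift_filtration (skew n \<zeta>) (Pmod n \<zeta> \<mu>) (Irr n) (Ktilde n \<zeta> R) (len \<mu>) (Fil \<mu>)"
  shows
    "(\<forall>\<nu> \<in> Irr n. \<forall>\<mu> \<in> Irr n. \<forall>(i::nat) (d::int).
        if \<nu> = \<mu> \<and> i = 0 \<and> d = 0
        then iso_complex_line (Ext n \<zeta> i (Ktilde n \<zeta> R \<nu>) (dual n \<zeta> (Kmod n \<zeta> R \<mu>)) d)
        else zero_space (Ext n \<zeta> i (Ktilde n \<zeta> R \<nu>) (dual n \<zeta> (Kmod n \<zeta> R \<mu>)) d))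
     \<longleftrightarrow>
     (\<forall>\<nu> \<in> Irr n. \<forall>\<mu> \<in> Irr n.
        filtration_mult (skew n \<zeta>) (Pmod n \<zeta> \<mu>) (len \<mu>) (Fil \<mu>) (Ktilde n \<zeta> R \<nu>)
        = graded_mult n (Kmod n \<zeta> R \<nu>) \<mu>)"
proof -
  interpret tracefilt n \<zeta> R len Fil
    by unfold_locales (use assms in \<open>auto simp: primitive_root_of_unity_def\<close>)
  show ?thesis using orthogonality_iff mult_eq_iff_ext unfolding Kmod_def by simp
qed

end
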